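(* Let $f\in H^\infty(\mathbb{B})$, $f\not\equiv0$. The following are equivalent: (i) $f$ is cyclic in $H^2(\mathbb{B})$; (ii) $f$ is outer in $H^2(\mathbb{B})$; (iii) $f^s$ is cyclic in $H^2(\mathbb{B})$; (iv) $f^s$ is outer in $H^2(\mathbb{B})$; (v) $f^s_I$ is cyclic in $H^2(\mathbb{B}_I)$ for all $I\in\mathbb{S}$; (vi) there exists $I\in\mathbb{S}$ such that $f^s_I$ is cyclic in $H^2(\mathbb{B}_I)$; (vii) $f^s_I$ is outer in $H^2(\mathbb{B}_I)$ for all $I\in\mathbb{S}$; (viii) there exists $I\in\mathbb{S}$ such that $f^s_I$ is outer in $H^2(\mathbb{B}_I)$.
   Context: $\mathbb{H}$ is the skew field of quaternions, $\mathbb{B}=\{q\in\mathbb{H}:|q|<1\}$, $\mathbb{S}=\{q\in\mathbb{H}:q^2=-1\}$; for $I\in\mathbb{S}$, $L_I=\mathbb{R}+\mathbb{R}I\cong\mathbb{C}$, $\mathbb{B}_I=\mathbb{B}\cap L_I$, and a subscript $I$ denotes restriction to $\mathbb{B}_I$. A function $f:\mathbb{B}\to\mathbb{H}$ is slice regular if, for every $I\in\mathbb{S}$, $f_I$ has continuous partial derivatives and $\frac12(\partial_x+I\partial_y)f_I(x+yI)=0$; equivalently $f(q)=\sum_{n\ge0}q^na_n$ on $\mathbb{B}$ with $a_n\in\mathbb{H}$. $H^2(\mathbb{B})$ is the space of slice regular functions $f(q)=\sum_{n\ge0}q^na_n$ with $\|f\|_{H^2}^2=\sum_{n\ge0}|a_n|^2<\infty$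 (a right quaternionic Hilbert space); $H^\infty(\mathbb{B})\subseteq H^2(\mathbb{B})$ is the space of bounded slice regular functions on $\mathbb{B}$. The boundary $\partial\mathbb{B}=\{e^{tI}=\cos t+\sin t\,I:I\in\mathbb{S},t\in\mathbb{R}\}$ carries the measure $d\Sigma(e^{tI})=d\sigma(I)\,dt$, with $dt$ Lebesgue measure on $[0,2\pi)$ and $d\sigma$ the standard area element of $\mathbb{S}$, normalized so that $\Sigma(\partial\mathbb{B})=1$. Every $f\in H^2(\mathbb{B})$ has boundary values $\Sigma$-a.e. on $\partial\mathbb{B}$, given by radial limits and still denoted $f$. The $\ast$-product of $f=\sum q^na_n$ and $g=\sum q^nb_n$ is $f\ast g(q)=\sum_{n\ge0}q^n\sum_{k=0}^na_kb_{n-k}$. The conjugate of $f$ is $f^c(q)=\sum q^n\overline{a_n}$ and its symmetrization is $f^s=f\ast f^c=f^c\ast f$; it has real power series coefficients, so $f^s(\mathbb{B}_I)\subseteq L_I$ for all $I$, and $f^s\in H^\infty(\mathbb{B})$ if $f\in H^\infty(\mathbb{B})$. $g\in H^2(\mathbb{B})$ is outer (in $H^2(\mathbb{B})$) if for every $h\in H^2(\mathbb{B})$ with $|g(q)|=|h(q)|$ for $\Sigma$-a.e. $q\in\partial\mathbb{B}$ one has $|g(q)|\ge|h(q)|$ for all $q\in\mathbb{B}$. $g\in H^2(\mathbb{B})$ is cyclic (in $H^2(\mathbb{B})$) if the closure in $H^2(\mathbb{B})$ of the right $\mathbb{H}$-linear span of $\{q^n\ast g:n\ge0\}$, i.e.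 of $\{g\ast p: p \text{ a polynomial } \sum_{k=0}^mq^ka_k,\ a_k\in\mathbb{H}\}$, is all of $H^2(\mathbb{B})$. For $I\in\mathbb{S}$, $H^2(\mathbb{B}_I)$ is the space of functions $h:\mathbb{B}_I\to L_I$, $h(z)=\sum_{n\ge0}z^n\alpha_n$ with $(\alpha_n)\in\ell^2(\mathbb{N},L_I)$, i.e. the classical Hardy space $H^2(\mathbb{D})$ under $L_I\cong\mathbb{C}$. Cyclic and outer in $H^2(\mathbb{B}_I)$ have the classical meaning: $h$ is cyclic if the polynomial multiples of $h$ (polynomials with coefficients in $L_I$) are dense in $H^2(\mathbb{B}_I)$; $h\not\equiv0$ is outer if $h(z)=\alpha\exp\left\{\frac1{2\pi}\int_0^{2\pi}\log|h(e^{I\theta})|\frac{e^{I\theta}+z}{e^{I\theta}-z}\,d\theta\right\}$ for all $z\in\mathbb{B}_I$, for some $\alpha\in L_I$ with $|\alpha|=1$. *)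

theory Defs
  imports "HOL-Analysis.Analysis"
begin

section \<open>Quaternions\<close>

text \<open>The four coordinates of \<open>Quat a b c d\<close> are those with respect to \<open>1, i, j, k\<close>.\<close>

datatype quat = Quat (qre: real) (qi: real) (qj: real) (qk: real)

lemma quat_eq_iff: "p = q \<longleftrightarrow> qre p = qre q \<and> qi p = qi q \<and> qj p = qj q \<and> qk p = qk q"
  by (cases p; cases q) simp

instantiation quat :: ring_1
begin

definition "0 = Quat 0 0 0 0"
definition "1 = Quat 1 0 0 0"
definition "p + q = Quat (qre p + qre q) (qi p + qi q) (qj p + qj q) (qk p + qk q)"
definition "p - q = Quat (qre p - qre q) (qi p - qi q) (qj p - qj q) (qk p - qk q)"
definition "- q = Quat (- qre q) (- qi q) (- qj q) (- qk q)"
definition "p * q = Quat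
  (qre p * qre q - qi p * qi q - qj p * qj q - qk p * qk q)
  (qre p * qi q + qi p * qre q + qj p * qk q - qk p * qj q)
  (qre p * qj q - qi p * qk q + qj p * qre q + qk p * qi q)
  (qre p * qk q + qi p * qj q - qj p * qi q + qk p * qre q)"

instance
  apply standard
  apply (simp_all only: zero_quat_def one_quat_def plus_quat_def minus_quat_def
      uminus_quat_def times_quat_def quat_eq_iff quat.sel)
  apply (simp_all add: algebra_simps)
  done

end

lemma quat_sel [simp]:
  "qre 0 = 0" "qi 0 = 0" "qj 0 = 0" "qk 0 = 0"
  "qre 1 = 1" "qi 1 = 0" "qj 1 = 0" "qk 1 = 0"
  "qre (p + q) = qre p + qre q" "qi (p + q) = qi p + qi q"
  "qj (p + q) = qj p + qj q" "qk (p + q) = qk p + qk q"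
  "qre (p - q) = qre p - qre q" "qi (p - q) = qi p - qi q"
  "qj (p - q) = qj p - qj q" "qk (p - q) = qk p - qk q"
  "qre (- q) = - qre q" "qi (- q) = - qi q" "qj (- q) = - qj q" "qk (- q) = - qk q"
  "qre (p * q) = qre p * qre q - qi p * qi q - qj p * qj q - qk p * qk q"
  "qi (p * q) = qre p * qi q + qi p * qre q + qj p * qk q - qk p * qj q"
  "qj (p * q) = qre p * qj q - qi p * qk q + qj p * qre q + qk p * qi q"
  "qk (p * q) = qre p * qk q + qi p * qj q - qj p * qi q + qk p * qre q"
  by (simp_all add: zero_quat_def one_quat_def plus_quat_def minus_quat_def
      uminus_quat_def times_quat_def)

definition qcnj :: "quat \<Rightarrow> quat" where
  "qcnj q = Quat (qre q) (- qi q) (- qj q) (- qk q)"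

instantiation quat :: real_vector
begin

definition "r *\<^sub>R q = Quat (r * qre q) (r * qi q) (r * qj q) (r * qk q)"

instance
  by standard (simp_all add: quat_eq_iff scaleR_quat_def algebra_simps)

end

lemma scaleR_quat_sel [simp]:
  "qre (r *\<^sub>R q) = r * qre q" "qi (r *\<^sub>R q) = r * qi q"
  "qj (r *\<^sub>R q) = r * qj q" "qk (r *\<^sub>R q) = r * qk q"
  by (simp_all add: scaleR_quat_def)

instantiation quat :: real_inner
begin

definition "inner p q = qre p * qre q + qi p * qi q + qj p * qj q + qk p * qk q"
definition "norm q = sqrt ((qre q)\<^sup>2 + (qi q)\<^sup>2 + (qj q)\<^sup>2 + (qk q)\<^sup>2)"
definition "sgn (q::quat) = q /\<^sub>R norm q"
definition "dist p q = norm (p - q :: quat)"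
definition [code del]: "(uniformity :: (quat \<times> quat) filter) =
  (INF e\<in>{0 <..}. principal {(x, y). dist x y < e})"
definition [code del]: "open (U :: quat set) \<longleftrightarrow>
  (\<forall>x\<in>U. eventually (\<lambda>(x', y). x' = x \<longrightarrow> y \<in> U) uniformity)"

instance
proof
  fix r s :: real and p q u :: quat and U :: "quat set"
  show "dist p q = norm (p - q)" by (rule dist_quat_def)
  show "sgn p = p /\<^sub>R norm p" by (rule sgn_quat_def)
  show "(uniformity :: (quat \<times> quat) filter) = (INF e\<in>{0 <..}. principal {(x, y). dist x y < e})"
    by (rule uniformity_quat_def)
  show "open U \<longleftrightarrow> (\<forall>x\<in>U. eventually (\<lambda>(x', y). x' = x \<longrightarrow> y \<in> U) uniformity)"
    by (rule open_quat_def)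
  show "0 \<le> inner p p" by (simp add: inner_quat_def)
  show "inner p p = 0 \<longleftrightarrow> p = 0"
    by (simp add: inner_quat_def quat_eq_iff add_nonneg_eq_0_iff)
  show "norm p = sqrt (inner p p)"
    by (simp add: norm_quat_def inner_quat_def power2_eq_square)
qed (simp_all add: inner_quat_def algebra_simps)

end

instantiation quat :: real_normed_div_algebra
begin

definition "inverse q = qcnj q /\<^sub>R (norm q)\<^sup>2"
definition "p div q = p * inverse (q :: quat)"

instance
proof
  fix r :: real and p q :: quat
  have n2: "(norm q)\<^sup>2 = (qre q)\<^sup>2 + (qi q)\<^sup>2 + (qj q)\<^sup>2 + (qk q)\<^sup>2" for q :: quat
    by (simp add: norm_quat_def)
  have scaleR_mult: "r *\<^sub>R p * q = r *\<^sub>R (p * q)" "p * r *\<^sub>R q = r *\<^sub>R (p * q)"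
    for r and p q :: quat
    by (simp_all add: quat_eq_iff algebra_simps)
  show "r *\<^sub>R p * q = r *\<^sub>R (p * q)" by (rule scaleR_mult)
  show "p * r *\<^sub>R q = r *\<^sub>R (p * q)" by (rule scaleR_mult)
  show "p div q = p * inverse q" by (rule divide_quat_def)
  show "inverse (0::quat) = 0" by (simp add: inverse_quat_def)
  show "norm (p * q) = norm p * norm q"
    unfolding norm_quat_def real_sqrt_mult [symmetric]
    by (rule arg_cong [where f = sqrt], unfold quat_sel, algebra)
  have cnj: "qcnj q * q = (norm q)\<^sup>2 *\<^sub>R 1" "q * qcnj q = (norm q)\<^sup>2 *\<^sub>R 1"
    unfolding n2 by (simp_all add: quat_eq_iff qcnj_def power2_eq_square)
  show "inverse q * q = 1" "q * inverse q = 1" if "q \<noteq> 0"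
    using that by (simp_all only: inverse_quat_def scaleR_mult cnj) simp_all
qed

end

instantiation quat :: euclidean_space
begin

definition "Basis = {Quat 1 0 0 0, Quat 0 1 0 0, Quat 0 0 1 0, Quat 0 0 0 1}"

instance
proof
  fix u v :: quat
  show "(Basis :: quat set) \<noteq> {}" "finite (Basis :: quat set)"
    by (simp_all add: Basis_quat_def)
  show "inner u v = (if u = v then 1 else 0)" if "u \<in> Basis" "v \<in> Basis"
    using that unfolding Basis_quat_def
    by (elim insertE emptyE) (simp_all add: inner_quat_def)
  show "(\<forall>v\<in>Basis. inner u v = 0) \<longleftrightarrow> u = 0"
    unfolding Basis_quat_def ball_simps by (simp add: inner_quat_def) (simp add: quat_eq_iff)
qed

end

definition imag_units :: "quat set"  ("\<S>") where
  "\<S> = {q. q\<^sup>2 = -1}"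

abbreviation quat_ball :: "quat set"  ("\<B>") where
  "\<B> \<equiv> ball 0 1"

definition slice_plane :: "quat \<Rightarrow> quat set" where
  "slice_plane I = {of_real x + of_real y * I | x y. True}"

definition slice_ball :: "quat \<Rightarrow> quat set" where
  "slice_ball I = \<B> \<inter> slice_plane I"

definition qcis :: "quat \<Rightarrow> real \<Rightarrow> quat" where
  "qcis I t = of_real (cos t) + of_real (sin t) * I"


section \<open>Slice regular functions\<close>

text \<open>
  A function on \<open>\<B>\<close> is represented by a total function on \<^typ>\<open>quat\<close>; all notions below depend
  only on its values on \<open>\<B>\<close> (boundary values being radial limits from inside). Likewise for
  functions on \<^term>\<open>slice_ball I\<close>.
\<close>

definition slice_regular :: "(quat \<Rightarrow> quat) \<Rightarrow> bool" where
  "slice_regular f \<longleftrightarrow> (\<forall>I\<in>\<S>. \<exists>fx fy :: real \<times> real \<Rightarrow> quat.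
     let D = {(x, y). of_real x + of_real y * I \<in> \<B>} in
     continuous_on D fx \<and> continuous_on D fy \<and>
     (\<forall>(x, y)\<in>D.
        ((\<lambda>s. f (of_real s + of_real y * I)) has_vector_derivative fx (x, y)) (at x) \<and>
        ((\<lambda>t. f (of_real x + of_real t * I)) has_vector_derivative fy (x, y)) (at y) \<and>
        (1/2) *\<^sub>R (fx (x, y) + I * fy (x, y)) = 0))"

definition has_expansion_on :: "(quat \<Rightarrow> quat) \<Rightarrow> (nat \<Rightarrow> quat) \<Rightarrow> quat set \<Rightarrow> bool" where
  "has_expansion_on f a A \<longleftrightarrow> (\<forall>q\<in>A. (\<lambda>n. q ^ n * a n) sums f q)"

text \<open>
  On \<open>\<B>\<close> and on each \<^term>\<open>slice_ball I\<close> the coefficients are unique, both sets containing the real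
  interval \<open>(-1, 1)\<close>.
\<close>

definition coeffs_on :: "quat set \<Rightarrow> (quat \<Rightarrow> quat) \<Rightarrow> nat \<Rightarrow> quat" where
  "coeffs_on A f = (THE a. has_expansion_on f a A)"

definition star_prod :: "(quat \<Rightarrow> quat) \<Rightarrow> (quat \<Rightarrow> quat) \<Rightarrow> quat \<Rightarrow> quat"  (infixl "\<star>" 70) where
  "f \<star> g = (\<lambda>q. \<Sum>n. q ^ n * (\<Sum>k\<le>n. coeffs_on \<B> f k * coeffs_on \<B> g (n - k)))"

definition regular_conj :: "(quat \<Rightarrow> quat) \<Rightarrow> quat \<Rightarrow> quat" where
  "regular_conj f = (\<lambda>q. \<Sum>n. q ^ n * qcnj (coeffs_on \<B> f n))"

definition symmetrization :: "(quat \<Rightarrow> quat) \<Rightarrow> quat \<Rightarrow> quat" where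
  "symmetrization f = f \<star> regular_conj f"

definition slice_restrict :: "(quat \<Rightarrow> quat) \<Rightarrow> quat \<Rightarrow> quat \<Rightarrow> quat" where
  "slice_restrict f I = restrict f (slice_ball I)"


section \<open>Hardy spaces of the quaternionic ball\<close>

definition H2 :: "(quat \<Rightarrow> quat) set" where
  "H2 = {f. slice_regular f \<and>
        (\<exists>a. has_expansion_on f a \<B> \<and> summable (\<lambda>n. (norm (a n))\<^sup>2))}"

definition Hinf :: "(quat \<Rightarrow> quat) set" where
  "Hinf = {f. slice_regular f \<and> bounded (f ` \<B>)}"

definition norm_H2 :: "(quat \<Rightarrow> quat) \<Rightarrow> real" where
  "norm_H2 f = sqrt (\<Sum>n. (norm (coeffs_on \<B> f n))\<^sup>2)"

definition closure_H2 :: "(quat \<Rightarrow> quat) set \<Rightarrow> (quat \<Rightarrow> quat) set" where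
  "closure_H2 A = {h \<in> H2. \<forall>e>0. \<exists>k\<in>A. norm_H2 (\<lambda>q. h q - k q) < e}"

text \<open>The right \<open>\<H>\<close>-linear span of the functions \<open>q\<^sup>n \<star> g\<close>.\<close>

definition shift_span :: "(quat \<Rightarrow> quat) \<Rightarrow> (quat \<Rightarrow> quat) set" where
  "shift_span g = {(\<lambda>q. \<Sum>k\<le>m. ((\<lambda>q. q ^ k) \<star> g) q * a k) | (m :: nat) (a :: nat \<Rightarrow> quat). True}"

definition cyclic_H2 :: "(quat \<Rightarrow> quat) \<Rightarrow> bool" where
  "cyclic_H2 g \<longleftrightarrow> g \<in> H2 \<and> closure_H2 (shift_span g) = H2"

text \<open>
  The area element of \<open>\<S>\<close>, in spherical coordinates
  \<open>I = sin \<phi> cos \<theta> i + sin \<phi> sin \<theta> j + cos \<phi> k\<close>, is \<open>d\<sigma> = sin \<phi> d\<phi> d\<theta>\<close> (total mass \<open>4\<pi>\<close>).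
\<close>

definition sphere_area :: "quat measure" where
  "sphere_area = distr
     (density lborel (\<lambda>(\<phi>, \<theta>). ennreal (sin \<phi>) * indicator ({0..pi} \<times> {0..<2*pi}) (\<phi>, \<theta>)))
     borel
     (\<lambda>(\<phi>, \<theta>). Quat 0 (sin \<phi> * cos \<theta>) (sin \<phi> * sin \<theta>) (cos \<phi>))"

text \<open>
  \<open>d\<Sigma>(e\<^sup>t\<^sup>I) = d\<sigma>(I) dt\<close>: the image of \<open>\<sigma> \<otimes> dt\<close> under \<open>(I, t) \<mapsto> e\<^sup>t\<^sup>I\<close>, divided by its total
  mass \<open>4\<pi> \<sqdot> 2\<pi>\<close>. Every non-real boundary point is covered twice, by \<open>(I, t)\<close> and \<open>(-I, 2\<pi> - t)\<close>,
  which the normalization absorbs.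
\<close>

definition boundary_measure :: "quat measure" where
  "boundary_measure = scale_measure (ennreal (1 / (8 * pi\<^sup>2)))
     (distr (sphere_area \<Otimes>\<^sub>M density lborel (indicator {0..<2*pi})) borel
       (\<lambda>(I, t). qcis I t))"

lemma emeasure_sphere_area: "emeasure sphere_area UNIV = ennreal (4 * pi)"
proof -
  have [measurable]: "(\<lambda>x::real \<times> real. case x of (\<phi>, \<theta>) \<Rightarrow> Quat 0 (sin \<phi> * cos \<theta>) (sin \<phi> * sin \<theta>) (cos \<phi>)) \<in> borel_measurable borel"
  proof (rule borel_measurable_continuous_onI)
    have eq: "Quat a b c d = a *\<^sub>R Quat 1 0 0 0 + b *\<^sub>R Quat 0 1 0 0 + c *\<^sub>R Quat 0 0 1 0 + d *\<^sub>R Quat 0 0 0 1" for a b c d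
      by (simp add: quat_eq_iff)
    show "continuous_on UNIV (\<lambda>x::real \<times> real. case x of (\<phi>, \<theta>) \<Rightarrow> Quat 0 (sin \<phi> * cos \<theta>) (sin \<phi> * sin \<theta>) (cos \<phi>))"
      unfolding case_prod_beta by (subst eq) (intro continuous_intros)
  qed
  have "emeasure sphere_area UNIV = (\<integral>\<^sup>+ x. (case x of (\<phi>, \<theta>) \<Rightarrow> ennreal (sin \<phi>) * indicator ({0..pi} \<times> {0..<2*pi}) (\<phi>, \<theta>)) \<partial>(lborel :: (real \<times> real) measure))"
    unfolding sphere_area_def
    apply (subst emeasure_distr)
    apply simp
    apply simp
    apply (subst emeasure_density)
    apply (simp_all add: borel_prod[symmetric] lborel_prod[symmetric])
    done
  also have "\<dots> = (\<integral>\<^sup>+ \<phi>. \<integral>\<^sup>+ \<theta>. ennreal (sin \<phi>) * indicator {0..pi} \<phi> * indicator {0..<2*pi} \<theta> \<partial>lborel \<partial>lborel)"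
    unfolding lborel_prod[symmetric]
    apply (subst lborel.nn_integral_fst[symmetric])
    apply (simp_all add: indicator_times mult.assoc)
    done
  also have "\<dots> = (\<integral>\<^sup>+ \<phi>. ennreal (sin \<phi>) * indicator {0..pi} \<phi> * ennreal (2*pi) \<partial>lborel)"
    by (subst nn_integral_cmult) auto
  also have "\<dots> = (\<integral>\<^sup>+ \<phi>. ennreal (sin \<phi>) * indicator {0..pi} \<phi> \<partial>lborel) * ennreal (2*pi)"
    by (subst nn_integral_multc) auto
  also have "(\<integral>\<^sup>+ \<phi>. ennreal (sin \<phi>) * indicator {0..pi} \<phi> \<partial>lborel) = ennreal ((- cos pi) - (- cos 0))"
    by (rule nn_integral_FTC_Icc) (auto intro!: derivative_eq_intros sin_ge_zero)
  finally show ?thesis by (simp flip: ennreal_mult' ennreal_numeral)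
qed

lemma emeasure_boundary_measure: "emeasure boundary_measure UNIV = 1"
proof -
  have [measurable_cong]: "sets sphere_area = sets borel" by (simp add: sphere_area_def)
  have [measurable]: "(\<lambda>(I, t). qcis I t) \<in> borel_measurable (borel \<Otimes>\<^sub>M borel)"
    unfolding borel_prod
    by (rule borel_measurable_continuous_onI)
      (auto simp: qcis_def case_prod_beta of_real_def intro!: continuous_intros)
  interpret T: sigma_finite_measure "density lborel (indicator {0..<2*pi::real})"
    by (rule finite_measure.axioms) (rule finite_measureI, simp add: emeasure_density)
  have sp: "space sphere_area = UNIV" by (simp add: sphere_area_def)
  have "emeasure (sphere_area \<Otimes>\<^sub>M density lborel (indicator {0..<2*pi})) (UNIV \<times> UNIV) = ennreal (4*pi) * ennreal (2*pi)"
    by (subst T.emeasure_pair_measure_Times) (simp_all add: emeasure_sphere_area emeasure_density \<open>sets sphere_area = _\<close>)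
  then show ?thesis
    unfolding boundary_measure_def
    by (simp add: emeasure_distr space_pair_measure sp power2_eq_square flip: ennreal_mult' ennreal_mult)
qed

definition radial_limit :: "(quat \<Rightarrow> quat) \<Rightarrow> quat \<Rightarrow> quat" where
  "radial_limit f q = Lim (at_left 1) (\<lambda>r. f (r *\<^sub>R q))"

definition outer_H2 :: "(quat \<Rightarrow> quat) \<Rightarrow> bool" where
  "outer_H2 g \<longleftrightarrow> g \<in> H2 \<and>
     (\<forall>h\<in>H2. (AE q in boundary_measure. norm (radial_limit g q) = norm (radial_limit h q)) \<longrightarrow>
       (\<forall>q\<in>\<B>. norm (g q) \<ge> norm (h q)))"


section \<open>Hardy spaces of the slices\<close>

definition H2_slice :: "quat \<Rightarrow> (quat \<Rightarrow> quat) set" where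
  "H2_slice I = {h. \<exists>\<alpha>. (\<forall>n. \<alpha> n \<in> slice_plane I) \<and> has_expansion_on h \<alpha> (slice_ball I) \<and>
     summable (\<lambda>n. (norm (\<alpha> n))\<^sup>2)}"

definition norm_H2_slice :: "quat \<Rightarrow> (quat \<Rightarrow> quat) \<Rightarrow> real" where
  "norm_H2_slice I h = sqrt (\<Sum>n. (norm (coeffs_on (slice_ball I) h n))\<^sup>2)"

definition closure_H2_slice :: "quat \<Rightarrow> (quat \<Rightarrow> quat) set \<Rightarrow> (quat \<Rightarrow> quat) set" where
  "closure_H2_slice I A = {h \<in> H2_slice I. \<forall>e>0. \<exists>k\<in>A. norm_H2_slice I (\<lambda>z. h z - k z) < e}"

definition slice_multiples :: "quat \<Rightarrow> (quat \<Rightarrow> quat) \<Rightarrow> (quat \<Rightarrow> quat) set" where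
  "slice_multiples I h = {(\<lambda>z. (\<Sum>k\<le>m. z ^ k * c k) * h z) | (m :: nat) (c :: nat \<Rightarrow> quat).
     \<forall>k. c k \<in> slice_plane I}"

definition cyclic_H2_slice :: "quat \<Rightarrow> (quat \<Rightarrow> quat) \<Rightarrow> bool" where
  "cyclic_H2_slice I h \<longleftrightarrow>
     h \<in> H2_slice I \<and> closure_H2_slice I (slice_multiples I h) = H2_slice I"

text \<open>
  All values below lie in the commutative field \<^term>\<open>slice_plane I\<close>, so the quotient and the
  exponential are the complex ones.
\<close>

definition outer_H2_slice :: "quat \<Rightarrow> (quat \<Rightarrow> quat) \<Rightarrow> bool" where
  "outer_H2_slice I h \<longleftrightarrow> h \<in> H2_slice I \<and> (\<exists>z\<in>slice_ball I. h z \<noteq> 0) \<and>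
     (\<exists>\<alpha>\<in>slice_plane I. norm \<alpha> = 1 \<and>
       (\<forall>z\<in>slice_ball I.
          h z = \<alpha> * exp ((1 / (2 * pi)) *\<^sub>R
            (LINT \<theta>:{0..2*pi}|lebesgue. ln (norm (radial_limit h (qcis I \<theta>))) *\<^sub>R
               ((qcis I \<theta> + z) / (qcis I \<theta> - z))))))"

end

theory Submission imports Defs "HOL-Complex_Analysis.Complex_Analysis" begin

text \<open>
  All notions are translated to coefficient sequences. The symmetrization has real coefficients, so
  on every slice it is one and the same classical bounded power series \<open>s\<close>, and cyclicity and
  outerness on a slice are both equivalent to equality in Jensen's inequality at \<open>0\<close> (Szego's
  theorem), hence independent of the slice.

  If \<open>f\<close> is cyclic, then \<open>f * p\<close> is close to \<open>1\<close>, so \<open>f\<^sup>s p\<^sup>s\<close> is bounded by a function with small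
  logarithmic mean and \<open>s\<close> is cyclic; conversely \<open>f\<^sup>s = f * f\<^sup>c\<close> lets approximants of \<open>1\<close> for \<open>s\<close>
  give approximants for \<open>f\<close> and \<open>f\<^sup>c\<close>.

  Outerness of \<open>f\<close> is equivalent to cyclicity of \<open>f\<^sup>c\<close>, that is, to density of the products \<open>p * f\<close>. In
  one direction, \<open>|p * h| = |p * f|\<close> in norm whenever \<open>|h| = |f|\<close> on the boundary, and choosing \<open>p * f\<close>
  close to a multiple of the reproducing kernel bounds \<open>|h|\<close> by \<open>|f|\<close> pointwise. In the other, the
  closure of the products \<open>p * f\<close> is \<open>H\<^sup>2 * \<theta>\<close> with \<open>|\<theta>| = 1\<close> on the boundary, so \<open>f = h * \<theta>\<close> with
  \<open>|h| = |f|\<close> there; outerness gives \<open>|h(0)| \<le> |f(0)|\<close>, which forces \<open>\<theta>\<close> to be constant.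
\<close>

section \<open>The Poisson kernel\<close>

text \<open>The star product is not a pointwise product, so boundary arguments cannot be run on the
  values of f. They are run on the stem pair (A, B) with f (x + y I) = A + I B: its eight real
  entries are the real and imaginary parts of four complex power series, and the star product
  becomes the complex product of A + iB and A' + iB' with quaternion entries. What is needed from
  the disc is therefore scalar: Fatou, Parseval and Jensen for arbitrary square summable or bounded
  series. Jensen's inequality is obtained without dividing out zeros: |b (z)|^2 is a lower bound for
  the weighted means of |b e^g|^2 over all polynomials g with g (z) = 0, and the infimum of such
  means is the exponential of a mean logarithm. Left and right matter: cyclicity concerns f * p, but
  the moduli on the boundary determine the norm of p * f and not that of f * p. This is why
  outerness meets the conjugate f^c first; the two sides are joined by f and f^c having the same
  symmetrization.\<close>

definition PK :: "complex \<Rightarrow> real \<Rightarrow> real" where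
  "PK z t = (1 - (cmod z)\<^sup>2) / (cmod (cis t - z))\<^sup>2"

lemma cis_minus_nz: "cmod z < 1 \<Longrightarrow> cis t - z \<noteq> 0"
  by (metis eq_iff_diff_eq_0 less_irrefl norm_cis)

lemma PK_pos: "cmod z < 1 \<Longrightarrow> PK z t > 0"
  unfolding PK_def using cis_minus_nz[of z t]
  by (intro divide_pos_pos) (auto simp: abs_square_less_1)

lemma PK_continuous [continuous_intros]: "cmod z < 1 \<Longrightarrow> continuous_on A (PK z)"
  unfolding PK_def using cis_minus_nz[of z]
  by (auto intro!: continuous_intros simp: cis_conv_exp)

lemma PK_le:
  assumes "cmod z < 1"
  shows "PK z t \<le> (1 + cmod z) / (1 - cmod z)"
proof -
  let ?r = "cmod z"
  have "1 - ?r \<le> cmod (cis t - z)" using norm_triangle_ineq2[of "cis t" z] by simp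
  hence "(1 - ?r)\<^sup>2 \<le> (cmod (cis t - z))\<^sup>2" using assms by (intro power_mono) auto
  hence "PK z t \<le> (1 - ?r\<^sup>2) / (1 - ?r)\<^sup>2" unfolding PK_def
    using assms by (intro divide_left_mono) (auto simp: cis_minus_nz abs_square_less_1 intro!: mult_pos_pos less_imp_le)
  also have "\<dots> = (1 + ?r) / (1 - ?r)" using assms by (simp add: power2_eq_square divide_simps) algebra
  finally show ?thesis .
qed

text \<open>With \<open>w = cis t\<close> and dw = i w dt, the Poisson kernel is the Cauchy kernel
  plus a term holomorphic past the closed disc. The first reproduces f (z), the second integrates to
  0.\<close>

lemma PK_split:
  assumes "cmod z < 1"
  shows "complex_of_real (PK z t) = (1 / (cis t - z) + cnj z / (1 - cnj z * cis t)) * cis t"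
proof -
  define w where "w = cis t"
  have w1: "w * cnj w = 1" by (simp add: w_def cis_cnj cis_mult)
  have nz: "w - z \<noteq> 0" using cis_minus_nz[OF assms] by (simp add: w_def)
  have nz2: "1 - cnj z * w \<noteq> 0"
  proof
    assume "1 - cnj z * w = 0"
    hence "cmod (cnj z * w) = 1" by simp
    thus False using assms by (simp add: norm_mult w_def)
  qed
  have e: "1 - cnj z * w = w * cnj (w - z)" using w1 by (simp add: algebra_simps)
  have "complex_of_real (PK z t) = (1 - z * cnj z) / ((w - z) * cnj (w - z))"
    by (simp only: PK_def w_def of_real_divide of_real_diff complex_norm_square of_real_1)
  also have "\<dots> = (1 / (w - z) + cnj z / (1 - cnj z * w)) * w"
  proof -
    have wnz: "w \<noteq> 0" by (simp add: w_def)
    have "cnj (w - z) \<noteq> 0" using nz by (metis complex_cnj_zero_iff)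
    then show ?thesis unfolding e using nz wnz w1
      by (simp add: divide_simps) (simp add: algebra_simps)
  qed
  finally show ?thesis by (simp add: w_def)
qed

lemma poisson_has_integral:
  fixes f :: "complex \<Rightarrow> complex"
  assumes f: "f holomorphic_on UNIV" and z: "cmod z < 1"
  shows "((\<lambda>t. complex_of_real (PK z t) * f (cis t)) has_integral (2 * pi * f z)) {0..2*pi}"
proof -
  have c1: "((\<lambda>w. f w / (w - z)) has_contour_integral (2 * of_real pi * \<i> * f z)) (circlepath 0 1)"
    by (rule Cauchy_integral_circlepath_simple) (use z f holomorphic_on_subset in \<open>auto simp: dist_norm\<close>)
  \<comment> \<open>The pole 1 / cnj z lies outside the closed disc, so this ball contains the
    circle; for z = 0 there is no pole and 2 is an arbitrary radius above 1.\<close>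
  have nz: "1 - cnj z * w \<noteq> 0" if "w \<in> ball 0 (if z = 0 then 2 else 1 / cmod z)" for w
  proof
    assume "1 - cnj z * w = 0"
    hence "cmod (cnj z * w) = 1" by simp
    moreover have "cmod (cnj z * w) < 1"
      using that by (auto simp: norm_mult divide_simps mult.commute split: if_splits)
    ultimately show False by simp
  qed
  have c2: "((\<lambda>w. f w * cnj z / (1 - cnj z * w)) has_contour_integral 0) (circlepath 0 1)"
    by (rule Cauchy_theorem_convex_simple[where S = "ball 0 (if z = 0 then 2 else 1 / cmod z)"])
      (use nz z f in \<open>auto intro!: holomorphic_intros holomorphic_on_subset[OF f] simp: divide_simps\<close>)
  have "((\<lambda>w. f w / (w - z) + f w * cnj z / (1 - cnj z * w)) has_contour_integral (2 * of_real pi * \<i> * f z + 0)) (circlepath 0 1)"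
    by (rule has_contour_integral_add[OF c1 c2])
  hence "((\<lambda>t. (f (cis t) / (cis t - z) + f (cis t) * cnj z / (1 - cnj z * cis t)) * \<i> * cis t) has_integral 2 * of_real pi * \<i> * f z) {0..2*pi}"
    unfolding circlepath_def by (subst (asm) has_contour_integral_part_circlepath_iff) auto
  from has_integral_mult_right[OF this, of "-\<i>"]
  show ?thesis
    by (rule has_integral_eq_rhs[OF has_integral_eq[rotated]]) (simp_all add: PK_split[OF z] algebra_simps)
qed

lemma cis_add_pi: "cis (x + pi) = - cis x"
  by (simp add: cis_mult[symmetric])

lemma PK_shift: "PK (- z) (x + pi) = PK z x"
  by (simp add: PK_def cis_add_pi norm_minus_commute)

text \<open>\<open>PK / (2 pi)\<close> is a probability density under which f (cis (t + s)) has mean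
  f (r cis t), so this is the expansion of a variance. Its nonnegativity puts |f|^2 at r cis t below
  the Poisson mean of |f|^2 over a window symmetric about t.\<close>

lemma poisson_centered:
  fixes f :: "complex \<Rightarrow> complex"
  assumes f: "f holomorphic_on UNIV" and r: "0 \<le> r" "r < 1"
  shows "((\<lambda>s. PK (of_real r) s * (cmod (f (cis (t + s)) - f (of_real r * cis t)))\<^sup>2) has_integral
           (integral {-pi..pi} (\<lambda>s. PK (of_real r) s * (cmod (f (cis (t + s))))\<^sup>2) - 2 * pi * (cmod (f (of_real r * cis t)))\<^sup>2)) {-pi..pi}"
proof -
  let ?c = "f (of_real r * cis t)"
  \<comment> \<open>Shifting by pi moves the interval to [-pi, pi] and turns \<open>cis\<close> into
    \<open>- cis\<close>; the sign here and the point \<open>- of_real r\<close> undo this.\<close>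
  have "(\<lambda>w. f (- (w * cis t))) holomorphic_on UNIV"
    by (rule holomorphic_on_compose_gen[OF _ f, unfolded o_def]) (auto intro!: holomorphic_intros)
  from poisson_has_integral[OF this, of "- of_real r"]
  have "((\<lambda>u. complex_of_real (PK (- of_real r) u) * f (- (cis u * cis t))) has_integral 2 * pi * ?c) {0..2*pi}"
    using r by simp
  from has_integral_shift_real_ivl[OF this, of pi]
  have "((\<lambda>s. complex_of_real (PK (of_real r) s) * f (cis (t + s))) has_integral 2 * pi * ?c) {-pi..pi}"
    by (simp add: PK_shift cis_add_pi cis_mult mult.commute add.commute)
  note I = this
  have "(\<lambda>w. 1) holomorphic_on UNIV" by auto
  from poisson_has_integral[OF this, of "- of_real r"]
  have "((\<lambda>u. complex_of_real (PK (- of_real r) u)) has_integral 2 * pi) {0..2*pi}"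
    using r by simp
  from has_integral_shift_real_ivl[OF this, of pi]
  have "((\<lambda>s. complex_of_real (PK (of_real r) s)) has_integral 2 * pi) {-pi..pi}"
    by (simp add: PK_shift)
  from has_integral_Re[OF this] have I1: "((\<lambda>s. PK (of_real r) s) has_integral 2 * pi) {-pi..pi}" by simp
  have cf: "continuous_on UNIV f" using f by (rule holomorphic_on_imp_continuous_on)
  have cfc: "continuous_on A (\<lambda>s. f (cis (t + s)))" for A
    by (rule continuous_on_compose2[OF cf]) (auto intro!: continuous_intros)
  have I2: "((\<lambda>s. PK (of_real r) s * (cmod (f (cis (t + s))))\<^sup>2) has_integral
      integral {-pi..pi} (\<lambda>s. PK (of_real r) s * (cmod (f (cis (t + s))))\<^sup>2)) {-pi..pi}"
    by (intro integrable_integral integrable_continuous_interval continuous_intros cfc) (use r in auto)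
  from has_integral_Re[OF has_integral_mult_right[OF I, of "cnj ?c"]]
  have I3: "((\<lambda>s. PK (of_real r) s * Re (cnj ?c * f (cis (t + s)))) has_integral 2 * pi * (cmod ?c)\<^sup>2) {-pi..pi}"
    by (rule has_integral_eq_rhs[OF has_integral_eq[rotated]])
      (simp_all add: cmod_power2, simp_all add: algebra_simps power2_eq_square)
  have "((\<lambda>s. PK (of_real r) s * (cmod (f (cis (t + s))))\<^sup>2 - 2 * (PK (of_real r) s * Re (cnj ?c * f (cis (t + s)))) +
        (cmod ?c)\<^sup>2 * PK (of_real r) s) has_integral
      (integral {-pi..pi} (\<lambda>s. PK (of_real r) s * (cmod (f (cis (t + s))))\<^sup>2) - 2 * (2 * pi * (cmod ?c)\<^sup>2) + (cmod ?c)\<^sup>2 * (2 * pi))) {-pi..pi}"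
    by (intro has_integral_add has_integral_diff has_integral_mult_right I1 I2 I3)
  thus ?thesis
    by (rule has_integral_eq_rhs[OF has_integral_eq[rotated]])
      (simp_all add: cmod_power2, simp_all add: algebra_simps power2_eq_square)
qed

section \<open>Radial maximal functions, the weak type estimate and Parseval for polynomials\<close>

lemma PK_real: "PK (of_real r) s = (1 - r\<^sup>2) / (1 - 2 * r * cos s + r\<^sup>2)"
proof -
  have "(cmod (cis s - of_real r))\<^sup>2 = (cos s - r)\<^sup>2 + (sin s)\<^sup>2" by (simp add: cmod_power2)
  also have "\<dots> = (sin s)\<^sup>2 + (cos s)\<^sup>2 - 2 * r * cos s + r\<^sup>2" by (simp add: power2_eq_square algebra_simps)
  finally show ?thesis by (simp add: PK_def)
qed

text \<open>The Poisson integral is dominated by the maximal function: with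
  \<open>D s = 2Ls - \<integral>\<^bsub>t-s\<^esub>\<^bsup>t+s\<^esup> w \<ge> 0\<close>, integrate \<open>PK \<sqdot> D'\<close> by parts.\<close>

lemma poisson_maximal:
  fixes w :: "real \<Rightarrow> real"
  assumes w: "continuous_on UNIV w" and r: "0 \<le> r" "r < 1"
    and m: "\<And>s. 0 < s \<Longrightarrow> s \<le> pi \<Longrightarrow> integral {t-s..t+s} w \<le> 2 * L * s"
  shows "integral {-pi..pi} (\<lambda>s. PK (of_real r) s * w (t + s)) \<le> 2 * pi * L"
proof -
  let ?P = "PK (of_real r)"
  define W where "W u = integral {t-pi..u} w" for u
  have wc: "continuous_on A w" for A using w continuous_on_subset by blast
  have dW: "(W has_real_derivative w u) (at u)" if "t - pi < u" for u
  proof -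
    have "((\<lambda>u. integral {t-pi..u} w) has_vector_derivative w u) (at u within {t-pi..u+1})"
      by (rule integral_has_vector_derivative) (use that wc in auto)
    hence "(W has_real_derivative w u) (at u within {t-pi..u+1})"
      unfolding W_def has_real_derivative_iff_has_vector_derivative .
    moreover have "at u within {t-pi..u+1} = at u" by (rule at_within_interior) (use that in auto)
    ultimately show ?thesis by simp
  qed
  have Wd: "integral {t-s..t+s} w = W (t+s) - W (t-s)" if "0 \<le> s" "s \<le> pi" for s
    using Henstock_Kurzweil_Integration.integral_combine[of "t-pi" "t-s" "t+s" w] that unfolding W_def
    by (simp add: integrable_continuous_interval wc)
  define D where "D s = 2 * L * s - (W (t+s) - W (t-s))" for s
  have D0: "D s \<ge> 0" if "0 \<le> s" "s \<le> pi" for s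
    using m[of s] Wd[OF that] that by (cases "s = 0") (auto simp: D_def)
  define P' where "P' s = - (1 - r\<^sup>2) * (2 * r * sin s) / (1 - 2 * r * cos s + r\<^sup>2)\<^sup>2" for s
  have den: "1 - 2 * r * cos s + r\<^sup>2 > 0" for s
  proof -
    have "1 - 2 * r * cos s + r\<^sup>2 \<ge> 1 - 2 * r * 1 + r\<^sup>2"
      using r by (intro add_mono diff_mono mult_left_mono) auto
    also have "1 - 2 * r * 1 + r\<^sup>2 = (1 - r)\<^sup>2" by (simp add: power2_eq_square algebra_simps)
    finally show ?thesis using r by (smt (verit) zero_less_power)
  qed
  have dP: "(?P has_real_derivative P' s) (at s)" for s
    unfolding PK_real[abs_def] P'_def using den[of s]
    by (auto intro!: derivative_eq_intros simp: power2_eq_square minus_divide_left algebra_simps)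
  have P'0: "P' s \<le> 0" if "0 \<le> s" "s \<le> pi" for s
    unfolding P'_def using r that
    by (intro divide_nonpos_nonneg mult_nonpos_nonneg) (auto simp: sin_ge_zero abs_square_le_1)
  have dD: "(D has_real_derivative (2 * L - (w (t+s) + w (t-s)))) (at s)" if "s < pi" "s > -pi" for s
  proof -
    have "((\<lambda>s. W (t+s)) has_real_derivative w (t+s) * 1) (at s)"
      by (rule DERIV_chain2[OF dW]) (use that in \<open>auto intro!: derivative_eq_intros\<close>)
    moreover have "((\<lambda>s. W (t-s)) has_real_derivative w (t-s) * (-1)) (at s)"
      by (rule DERIV_chain2[OF dW]) (use that in \<open>auto intro!: derivative_eq_intros\<close>)
    ultimately show ?thesis unfolding D_def
      by (auto intro!: derivative_eq_intros)
  qed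
  have cW: "continuous_on {t-pi..t+pi} W" unfolding W_def
    by (intro indefinite_integral_continuous_1 integrable_continuous_interval wc)
  have cD: "continuous_on {0..pi} D" unfolding D_def
    by (intro continuous_intros continuous_on_compose2[OF cW]) auto
  have Pc: "continuous_on A ?P" for A using r by (intro continuous_intros) auto
  have "((\<lambda>s. P' s * D s + ?P s * (2 * L - (w (t+s) + w (t-s)))) has_integral (?P pi * D pi - ?P 0 * D 0)) {0..pi}"
  proof (rule fundamental_theorem_of_calculus_interior)
    show "continuous_on {0..pi} (\<lambda>s. ?P s * D s)" by (intro continuous_intros cD Pc)
    fix s assume "s \<in> {0<..<pi}"
    hence "((\<lambda>s. ?P s * D s) has_real_derivative (P' s * D s + ?P s * (2 * L - (w (t+s) + w (t-s))))) (at s)"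
      using DERIV_mult[OF dP[of s] dD[of s]] by (simp add: mult.commute)
    thus "((\<lambda>s. ?P s * D s) has_vector_derivative (P' s * D s + ?P s * (2 * L - (w (t+s) + w (t-s))))) (at s)"
      by (simp add: has_real_derivative_iff_has_vector_derivative)
  qed simp
  moreover have "D 0 = 0" by (simp add: D_def)
  ultimately have 1: "((\<lambda>s. P' s * D s + ?P s * (2 * L - (w (t+s) + w (t-s)))) has_integral (?P pi * D pi)) {0..pi}" by simp
  define h where "h s = ?P s * (2 * L - (w (t+s) + w (t-s)))" for s
  have wts: "continuous_on A (\<lambda>s. w (t+s))" "continuous_on A (\<lambda>s. w (t-s))" for A
    by (rule continuous_on_compose2[OF w]; auto intro!: continuous_intros)+
  have hi: "h integrable_on {0..pi}" unfolding h_def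
    by (intro integrable_continuous_interval continuous_intros wts Pc)
  have "0 \<le> ?P pi * D pi" using PK_pos[of "of_real r" pi] D0[of pi] r by simp
  \<comment> \<open>\<open>PK\<close> decreases on [0, pi], so the term \<open>P' s * D s\<close> is
    nonpositive and may be dropped.\<close>
  also have "\<dots> \<le> integral {0..pi} h"
  proof (rule has_integral_le[OF 1 integrable_integral[OF hi]])
    fix s assume "s \<in> {0..pi}"
    thus "P' s * D s + ?P s * (2 * L - (w (t+s) + w (t-s))) \<le> h s"
      using P'0[of s] D0[of s] by (simp add: h_def mult_nonpos_nonneg)
  qed
  finally have 2: "0 \<le> integral {0..pi} h" .
  define I where "I g = integral {0..pi} (\<lambda>s. ?P s * g s)" for g :: "real \<Rightarrow> real"
  have fold: "integral {-pi..pi} (\<lambda>s. ?P s * g s) = I g + I (\<lambda>s. g (-s))" if g: "continuous_on UNIV g" for g :: "real \<Rightarrow> real"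
  proof -
    have gi: "(\<lambda>s. ?P s * g s) integrable_on {a..b}" for a b
      by (intro integrable_continuous_interval continuous_intros Pc continuous_on_subset[OF g]) auto
    have "integral {-pi..pi} (\<lambda>s. ?P s * g s) = integral {-pi..0} (\<lambda>s. ?P s * g s) + I g"
      unfolding I_def by (rule Henstock_Kurzweil_Integration.integral_combine[symmetric]) (auto intro: gi)
    also have "integral {-pi..0} (\<lambda>s. ?P s * g s) = integral {-0..pi} (\<lambda>s. ?P (-s) * g (-s))"
      using Henstock_Kurzweil_Integration.integral_reflect_real[of pi "-0" "\<lambda>s. ?P (-s) * g (-s)"] by simp
    finally show ?thesis by (simp add: I_def PK_real)
  qed
  have e1: "integral {-pi..pi} (\<lambda>s. ?P s * w (t + s)) = integral {0..pi} (\<lambda>s. ?P s * w (t+s) + ?P s * w (t-s))"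
    by (subst fold) (auto simp: I_def intro!: wts integral_add[symmetric] integrable_continuous_interval continuous_intros Pc)
  have "2 * pi = integral {-pi..pi} (\<lambda>s. ?P s * 1)"
  proof -
    from poisson_centered[of "\<lambda>z. 1" r 0] r
    have "((\<lambda>s. 0::real) has_integral (integral {-pi..pi} (\<lambda>s. ?P s) - 2 * pi)) {-pi..pi}" by simp
    from has_integral_unique[OF this has_integral_0] show ?thesis by simp
  qed
  also have "\<dots> = 2 * integral {0..pi} ?P" by (subst fold) (auto simp: I_def)
  finally have e2: "integral {0..pi} ?P = pi" by simp
  have "integral {0..pi} h = integral {0..pi} (\<lambda>s. 2 * L * ?P s - (?P s * w (t+s) + ?P s * w (t-s)))"
    by (rule integral_cong) (simp add: h_def algebra_simps)
  also have "\<dots> = 2 * L * pi - integral {0..pi} (\<lambda>s. ?P s * w (t+s) + ?P s * w (t-s))"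
    by (subst integral_diff) (auto simp: e2 intro!: integrable_continuous_interval continuous_intros wts Pc)
  finally show ?thesis using 2 e1 by (simp add: algebra_simps)
qed


text \<open>If the radial maximal function exceeds L at t, then by \<open>poisson_maximal\<close>
  some interval about t of half-width at most pi has a mean of |f|^2 above L^2. A Vitali subfamily
  costs the factor 5, and the intervals lie in [-pi, 3 pi], which is two periods: together
  10.\<close>

lemma weak_type:
  fixes f :: "complex \<Rightarrow> complex"
  assumes f: "f holomorphic_on UNIV" and L: "L > 0"
  defines "E \<equiv> {t\<in>{0..2*pi}. \<exists>r. 0 \<le> r \<and> r < 1 \<and> L < cmod (f (of_real r * cis t))}"
  shows "E \<in> sets borel"
    and "emeasure lborel E \<le> ennreal (10 / L\<^sup>2 * integral {0..2*pi} (\<lambda>t. (cmod (f (cis t)))\<^sup>2))"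
proof -
  have cf: "continuous_on UNIV f" using f by (rule holomorphic_on_imp_continuous_on)
  \<comment> \<open>Openness for each radius makes the uncountable union over all radii
    Borel.\<close>
  have "open {t. L < cmod (f (of_real r * cis t))}" for r
    by (intro open_Collect_less continuous_intros continuous_on_compose2[OF cf]) auto
  moreover have "E = {0..2*pi} \<inter> (\<Union>r\<in>{0..<1}. {t. L < cmod (f (of_real r * cis t))})"
    by (auto simp: E_def)
  ultimately show Es: "E \<in> sets borel" by (metis (no_types, lifting) atLeastAtMost_borel borel_open open_UN sets.Int)
  define w where "w u = (cmod (f (cis u)))\<^sup>2" for u
  have wc: "continuous_on A w" for A unfolding w_def
    by (intro continuous_intros continuous_on_compose2[OF cf]) auto
  have "\<exists>s. 0 < s \<and> s \<le> pi \<and> integral {t-s..t+s} w > 2 * L\<^sup>2 * s" if tE: "t \<in> E" for t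
  proof (rule ccontr)
    assume "\<not> ?thesis"
    hence m: "integral {t-s..t+s} w \<le> 2 * L\<^sup>2 * s" if "0 < s" "s \<le> pi" for s
      using that by force
    from tE obtain r where r: "0 \<le> r" "r < 1" "L < cmod (f (of_real r * cis t))" by (auto simp: E_def)
    have 1: "integral {-pi..pi} (\<lambda>s. PK (of_real r) s * w (t + s)) \<le> 2 * pi * L\<^sup>2"
      by (rule poisson_maximal[OF wc r(1,2) m])
    have "0 \<le> integral {-pi..pi} (\<lambda>s. PK (of_real r) s * (cmod (f (cis (t + s))))\<^sup>2) - 2 * pi * (cmod (f (of_real r * cis t)))\<^sup>2"
      by (rule has_integral_nonneg[OF poisson_centered[OF f r(1,2)]])
        (use PK_pos[of "of_real r"] r in \<open>simp add: less_imp_le\<close>)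
    hence "2 * pi * (cmod (f (of_real r * cis t)))\<^sup>2 \<le> 2 * pi * L\<^sup>2" using 1 unfolding w_def by linarith
    hence "(cmod (f (of_real r * cis t)))\<^sup>2 \<le> L\<^sup>2" by (rule mult_left_le_imp_le) simp
    thus False using r L by (auto dest: power2_le_imp_le)
  qed
  then obtain s where s: "\<And>t. t \<in> E \<Longrightarrow> 0 < s t \<and> s t \<le> pi \<and> integral {t-s t..t+s t} w > 2 * L\<^sup>2 * s t"
    by metis
  have cover: "E \<subseteq> (\<Union>t\<in>E. ball t (s t))" using s by auto
  have sB: "0 < s t \<and> s t \<le> pi" if "t \<in> E" for t using s[OF that] by blast
  obtain C where C: "countable C" "C \<subseteq> E"
     "pairwise (\<lambda>i j. disjnt (ball i (s i)) (ball j (s j))) C"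
     "E \<subseteq> (\<Union>i\<in>C. ball i (5 * s i))"
    by (rule Vitali_covering_lemma_balls[OF cover sB])
  define J where "J = integral {0..2*pi} w"
  have wper: "w (u + 2 * pi) = w u" for u by (simp add: w_def cis_mult[symmetric])
  have J1: "integral {-pi..3*pi} w = 2 * J"
  proof -
    have i: "w integrable_on {a..b}" for a b by (rule integrable_continuous_interval[OF wc])
    have sh: "integral {a..b} w = integral {a + 2*pi..b + 2*pi} w" for a b
      using integral_shift_cbox_plus[of a b w "2*pi"] by (simp add: o_def wper add.commute)
    have "integral {-pi..3*pi} w = integral {-pi..0} w + (integral {0..2*pi} w + integral {2*pi..3*pi} w)"
      by (simp add: Henstock_Kurzweil_Integration.integral_combine i)
    also have "integral {-pi..0} w = integral {pi..2*pi} w" using sh[of "-pi" 0] by simp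
    also have "integral {2*pi..3*pi} w = integral {0..pi} w" using sh[of 0 pi] by simp
    also have "integral {pi..2*pi} w + (integral {0..2*pi} w + integral {0..pi} w) = 2 * J"
      using Henstock_Kurzweil_Integration.integral_combine[of 0 pi "2*pi" w] by (simp add: i J_def)
    finally show ?thesis .
  qed
  have LI: "(LINT x|lborel. indicator A x * w x) = integral A w" "integrable lborel (\<lambda>x. indicator A x * w x)"
    if A: "A \<in> sets borel" "bounded A" for A
  proof -
    obtain a b where ab: "A \<subseteq> {a..b}" using bounded_subset_cbox_symmetric[OF A(2)] by (metis cbox_interval)
    have "set_integrable lborel A w"
      by (rule set_integrable_subset[OF borel_integrable_atLeastAtMost'[OF wc]]) (use ab A in auto)
    thus "(LINT x|lborel. indicator A x * w x) = integral A w" "integrable lborel (\<lambda>x. indicator A x * w x)"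
      using set_borel_integral_eq_integral[of A w] by (simp_all add: set_lebesgue_integral_def set_integrable_def)
  qed
  have fin: "measure lborel (\<Union>i\<in>I. ball i (5 * s i)) \<le> 10 / L\<^sup>2 * J" if I: "I \<subseteq> C" "finite I" for I
  proof -
    have IE: "i \<in> E" if "i \<in> I" for i using that I C by auto
    have "measure lborel (\<Union>i\<in>I. ball i (5 * s i)) \<le> (\<Sum>i\<in>I. measure lborel (ball i (5 * s i)))"
      by (rule measure_UNION_le) (use I in auto)
    also have "\<dots> = (\<Sum>i\<in>I. 10 * s i)"
    proof (rule sum.cong)
      fix i assume "i \<in> I"
      hence "s i > 0" using s IE by auto
      thus "measure lborel (ball i (5 * s i)) = 10 * s i" by (simp add: ball_eq_greaterThanLessThan)
    qed simp
    also have "\<dots> \<le> (\<Sum>i\<in>I. 5 / L\<^sup>2 * (LINT x|lborel. indicator (ball i (s i)) x * w x))"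
    proof (rule sum_mono)
      fix i assume iI: "i \<in> I"
      have "integral {i-s i..i+s i} w \<ge> 2 * L\<^sup>2 * s i" using s[OF IE[OF iI]] by simp
      hence "2 * s i * L\<^sup>2 \<le> integral (ball i (s i)) w"
        by (simp add: ball_eq_greaterThanLessThan integral_open_interval_real algebra_simps)
      thus "10 * s i \<le> 5 / L\<^sup>2 * (LINT x|lborel. indicator (ball i (s i)) x * w x)"
        using L by (subst LI) (auto simp: field_simps)
    qed
    also have "\<dots> = 5 / L\<^sup>2 * (LINT x|lborel. (\<Sum>i\<in>I. indicator (ball i (s i)) x * w x))"
      by (subst Bochner_Integration.integral_sum) (auto simp: sum_distrib_left intro!: LI)
    also have "\<dots> \<le> 5 / L\<^sup>2 * (LINT x|lborel. indicator {-pi..3*pi} x * w x)"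
    proof (intro mult_left_mono integral_mono Bochner_Integration.integrable_sum LI)
      fix x :: real
      have dj: "disjoint_family_on (\<lambda>i. ball i (s i)) I"
        using C(3) I(1) unfolding disjoint_family_on_def pairwise_def disjnt_def by blast
      have "(\<Sum>i\<in>I. indicator (ball i (s i)) x * w x) = (indicator (\<Union>i\<in>I. ball i (s i)) x :: real) * w x"
        by (subst indicator_UN_disjoint[OF I(2) dj]) (simp add: sum_distrib_right)
      also have "\<dots> \<le> indicator {-pi..3*pi} x * w x"
      proof -
        have "(\<Union>i\<in>I. ball i (s i)) \<subseteq> {-pi..3*pi}"
        proof safe
          fix i x assume iI: "i \<in> I" and "x \<in> ball i (s i)"
          thus "x \<in> {-pi..3*pi}" using s[OF IE[OF iI]] IE[OF iI] unfolding E_def by (auto simp: dist_real_def)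
        qed
        moreover have "w x \<ge> 0" by (simp add: w_def)
        ultimately show ?thesis by (intro mult_right_mono indicator_leI) blast+
      qed
      finally show "(\<Sum>i\<in>I. indicator (ball i (s i)) x * w x) \<le> indicator {-pi..3*pi} x * w x" .
    qed auto
    also have "\<dots> = 10 / L\<^sup>2 * J" by (subst LI) (auto simp: J1)
    finally show ?thesis .
  qed
  have bs: "ball i (5 * s i) \<in> fmeasurable lborel" for i using emeasure_lborel_ball_finite[of i "5 * s i"] by (auto simp: fmeasurable_def)
  have U: "(\<Union>i\<in>C. ball i (5 * s i)) \<in> fmeasurable lborel" "measure lborel (\<Union>i\<in>C. ball i (5 * s i)) \<le> 10 / L\<^sup>2 * J"
    using fmeasurable_UN_bound[OF C(1) bs fin] measure_UN_bound[OF C(1) bs fin] by blast+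
  have "emeasure lborel E \<le> emeasure lborel (\<Union>i\<in>C. ball i (5 * s i))"
    using C(4) U(1) by (intro emeasure_mono) (auto simp del: UN_iff dest: fmeasurableD)
  also have "\<dots> = ennreal (measure lborel (\<Union>i\<in>C. ball i (5 * s i)))"
    using U(1) by (simp add: emeasure_eq_measure2)
  also have "\<dots> \<le> ennreal (10 / L\<^sup>2 * J)" using U(2) by (rule ennreal_leI)
  finally show "emeasure lborel E \<le> ennreal (10 / L\<^sup>2 * integral {0..2*pi} (\<lambda>t. (cmod (f (cis t)))\<^sup>2))"
    unfolding J_def w_def[abs_def] .
qed

lemma parseval_poly:
  "((\<lambda>t. (cmod (\<Sum>n<N. a n * cis t ^ n))\<^sup>2) has_integral 2 * pi * (\<Sum>n<N. (cmod (a n))\<^sup>2)) {0..2*pi}"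
proof (induction N)
  case (Suc N)
  \<comment> \<open>On the circle the conjugate of z^n is z^(-n), so \<open>q\<close> equals
    \<open>a N * z ^ N\<close> times the conjugate of the partial sum. It is a polynomial vanishing
    at 0, hence has mean 0, which removes the cross term.\<close>
  define q where "q z = a N * (\<Sum>n<N. cnj (a n) * z ^ (N - n))" for z
  have "((\<lambda>t. complex_of_real (PK 0 t) * q (cis t)) has_integral (2 * pi * q 0)) {0..2*pi}"
    by (rule poisson_has_integral) (auto simp: q_def intro!: holomorphic_intros)
  moreover have "q 0 = 0" by (auto simp: q_def intro!: sum.neutral)
  ultimately have "((\<lambda>t. q (cis t)) has_integral 0) {0..2*pi}" by (simp add: PK_def)
  from has_integral_Re[OF this] have "((\<lambda>t. Re (q (cis t))) has_integral 0) {0..2*pi}" by simp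
  from has_integral_add[OF has_integral_add[OF Suc.IH has_integral_mult_right[OF this, of 2]] has_integral_const_real[of "(cmod (a N))\<^sup>2" 0 "2*pi"]]
  have "((\<lambda>t. (cmod (\<Sum>n<N. a n * cis t ^ n))\<^sup>2 + 2 * Re (q (cis t)) + (cmod (a N))\<^sup>2) has_integral
     2 * pi * (\<Sum>n<Suc N. (cmod (a n))\<^sup>2)) {0..2*pi}" by (simp add: algebra_simps)
  moreover have "(cmod (\<Sum>n<Suc N. a n * cis t ^ n))\<^sup>2 = (cmod (\<Sum>n<N. a n * cis t ^ n))\<^sup>2 + 2 * Re (q (cis t)) + (cmod (a N))\<^sup>2" for t
  proof -
    define S where "S = (\<Sum>n<N. a n * cis t ^ n)"
    have "q (cis t) = (\<Sum>n<N. a N * cnj (a n) * (cis t ^ N * cnj (cis t ^ n)))"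
      unfolding q_def sum_distrib_left
    proof (rule sum.cong)
      fix n assume "n \<in> {..<N}"
      hence "cis t ^ N = cis t ^ (N - n) * cis t ^ n" by (simp flip: power_add)
      moreover have "cis t ^ n * cnj (cis t ^ n) = 1" 
        by (metis complex_norm_square norm_cis norm_power of_real_1 power_one)
      ultimately show "a N * (cnj (a n) * cis t ^ (N - n)) = a N * cnj (a n) * (cis t ^ N * cnj (cis t ^ n))"
        by (simp add: mult.assoc)
    qed simp
    hence q: "q (cis t) = a N * cis t ^ N * cnj S" by (simp add: S_def sum_distrib_left mult_ac)
    have "(cmod (S + a N * cis t ^ N))\<^sup>2 = (cmod S)\<^sup>2 + 2 * Re (a N * cis t ^ N * cnj S) + (cmod (a N * cis t ^ N))\<^sup>2"
      unfolding cmod_power2 by (simp add: power2_eq_square algebra_simps)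
    thus ?thesis unfolding q by (simp add: S_def norm_mult norm_power)
  qed
  ultimately show ?case by simp
qed simp

section \<open>Boundary values of square summable power series\<close>

definition l2 :: "(nat \<Rightarrow> 'a::real_normed_vector) \<Rightarrow> bool" where
  "l2 a \<longleftrightarrow> summable (\<lambda>n. (norm (a n))\<^sup>2)"

definition l2sq :: "(nat \<Rightarrow> 'a::real_normed_vector) \<Rightarrow> real" where
  "l2sq a = (\<Sum>n. (norm (a n))\<^sup>2)"

definition pser :: "(nat \<Rightarrow> complex) \<Rightarrow> complex \<Rightarrow> complex" where
  "pser a z = (\<Sum>n. a n * z ^ n)"

definition tail :: "(nat \<Rightarrow> 'a::zero) \<Rightarrow> nat \<Rightarrow> nat \<Rightarrow> 'a" where
  "tail a N n = (if n < N then 0 else a n)"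

lemma l2sq_nonneg: "l2 a \<Longrightarrow> l2sq a \<ge> 0"
  unfolding l2_def l2sq_def by (rule suminf_nonneg) auto

lemma l2_sum_le: "l2 a \<Longrightarrow> (\<Sum>n<N. (norm (a n))\<^sup>2) \<le> l2sq a"
  unfolding l2_def l2sq_def by (rule sum_le_suminf) auto

lemma l2_norm_le: "l2 a \<Longrightarrow> (norm (a n))\<^sup>2 \<le> l2sq a"
  using sum_le_suminf[of "\<lambda>n. (norm (a n))\<^sup>2" "{n}"] unfolding l2_def l2sq_def by auto

lemma l2_powser_summable:
  fixes a :: "nat \<Rightarrow> complex"
  assumes "l2 a" "cmod z < 1"
  shows "summable (\<lambda>n. cmod (a n * z ^ n))"
proof (rule summable_comparison_test'[where N=0])
  show "summable (\<lambda>n. (cmod (a n))\<^sup>2 + ((cmod z)\<^sup>2) ^ n)"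
    using assms unfolding l2_def by (intro summable_add summable_geometric) (auto simp: abs_square_less_1)
  fix n
  have "2 * (cmod (a n) * cmod z ^ n) \<le> (cmod (a n))\<^sup>2 + (cmod z ^ n)\<^sup>2"
    using sum_squares_bound[of "cmod (a n)" "cmod z ^ n"] by simp
  moreover have "0 \<le> cmod (a n) * cmod z ^ n" by simp
  moreover have "(cmod z ^ n)\<^sup>2 = ((cmod z)\<^sup>2) ^ n" by (simp flip: power_mult add: mult.commute)
  moreover have "norm (cmod (a n * z ^ n)) = cmod (a n) * cmod z ^ n" by (simp add: norm_mult norm_power)
  ultimately show "norm (cmod (a n * z ^ n)) \<le> (cmod (a n))\<^sup>2 + ((cmod z)\<^sup>2) ^ n" by linarith
qed

lemma pser_sums: "l2 a \<Longrightarrow> cmod z < 1 \<Longrightarrow> (\<lambda>n. a n * z ^ n) sums pser a z"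
  unfolding pser_def by (rule summable_sums[OF summable_norm_cancel[OF l2_powser_summable]])

lemma pser_holomorphic: "l2 a \<Longrightarrow> pser a holomorphic_on ball 0 1"
  by (rule power_series_holomorphic[where a = a]) (simp add: pser_sums)

lemma l2_tail: "l2 a \<Longrightarrow> l2 (tail a N)"
  unfolding l2_def by (erule summable_comparison_test'[where N=0]) (simp add: tail_def)

lemma l2sq_tail: "l2 a \<Longrightarrow> l2sq (tail a N) = l2sq a - (\<Sum>n<N. (norm (a n))\<^sup>2)"
proof -
  assume a: "l2 a"
  have "(\<Sum>n. (norm (tail a N n))\<^sup>2) = (\<Sum>n. (norm (tail a N (n+N)))\<^sup>2) + (\<Sum>n<N. (norm (tail a N n))\<^sup>2)"
    using l2_tail[OF a] unfolding l2_def by (rule suminf_split_initial_segment)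
  moreover have "(\<Sum>n. (norm (a n))\<^sup>2) = (\<Sum>n. (norm (a (n+N)))\<^sup>2) + (\<Sum>n<N. (norm (a n))\<^sup>2)"
    using a unfolding l2_def by (rule suminf_split_initial_segment)
  ultimately show ?thesis by (simp add: tail_def l2sq_def)
qed

lemma l2sq_tail_tendsto: "l2 a \<Longrightarrow> (\<lambda>N. l2sq (tail a N)) \<longlonglongrightarrow> 0"
proof -
  assume a: "l2 a"
  hence "(\<lambda>N. (\<Sum>n<N. (norm (a n))\<^sup>2)) \<longlonglongrightarrow> l2sq a"
    unfolding l2_def l2sq_def by (rule summable_LIMSEQ)
  from tendsto_diff[OF tendsto_const[of "l2sq a"] this] show ?thesis by (simp add: l2sq_tail[OF a])
qed

lemma pser_tail:
  assumes "l2 a" "cmod z < 1"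
  shows "pser (tail a N) z = pser a z - (\<Sum>n<N. a n * z ^ n)"
proof -
  have "(\<lambda>n. tail a N n * z ^ n) sums pser (tail a N) z" by (intro pser_sums l2_tail assms)
  moreover have "(\<lambda>n. a n * z ^ n - (if n \<in> {..<N} then a n * z ^ n else 0)) sums (pser a z - (\<Sum>n<N. a n * z ^ n))"
    by (intro sums_diff pser_sums assms) (rule sums_If_finite_set, simp)
  moreover have "(\<lambda>n. a n * z ^ n - (if n \<in> {..<N} then a n * z ^ n else 0)) = (\<lambda>n. tail a N n * z ^ n)"
    by (auto simp: tail_def)
  ultimately show ?thesis by (metis sums_unique2)
qed

lemma pser_trunc_tendsto:
  "l2 a \<Longrightarrow> cmod z < 1 \<Longrightarrow> (\<lambda>N. \<Sum>n<N. a n * z ^ n) \<longlonglongrightarrow> pser a z"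
  using pser_sums unfolding sums_def .

text \<open>The superlevel set of the radial maximal function, within one period.\<close>

definition expset :: "(nat \<Rightarrow> complex) \<Rightarrow> real \<Rightarrow> real set" where
  "expset a L = {t\<in>{0..2*pi}. \<exists>r. 0 \<le> r \<and> r < 1 \<and> L < cmod (pser a (of_real r * cis t))}"

text \<open>At a fixed interior point the truncations converge, so each point of
  \<open>expset a L\<close> lies in the superlevel sets of all sufficiently late truncations; the
  bound for polynomials passes to the increasing union of these intersections. The constant is 10
  times the 2 pi of Parseval.\<close>

lemma weak_type_pser:
  assumes a: "l2 a" and L: "L > 0"
  shows "expset a L \<in> sets borel"
    and "emeasure lborel (expset a L) \<le> ennreal (20 * pi / L\<^sup>2 * l2sq a)"
proof -
  define S where "S N z = (\<Sum>n<N. a n * z ^ n)" for N z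
  define E where "E N = {t\<in>{0..2*pi}. \<exists>r. 0 \<le> r \<and> r < 1 \<and> L < cmod (S N (of_real r * cis t))}" for N
  have hol: "S N holomorphic_on UNIV" for N unfolding S_def[abs_def] by (intro holomorphic_intros)
  have EN: "E N \<in> sets borel" "emeasure lborel (E N) \<le> ennreal (20 * pi / L\<^sup>2 * l2sq a)" for N
  proof -
    show "E N \<in> sets borel" unfolding E_def using weak_type(1)[OF hol L] .
    have "emeasure lborel (E N) \<le> ennreal (10 / L\<^sup>2 * integral {0..2*pi} (\<lambda>t. (cmod (S N (cis t)))\<^sup>2))"
      unfolding E_def using weak_type(2)[OF hol L] .
    also have "integral {0..2*pi} (\<lambda>t. (cmod (S N (cis t)))\<^sup>2) = 2 * pi * (\<Sum>n<N. (cmod (a n))\<^sup>2)"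
      unfolding S_def by (rule integral_unique[OF parseval_poly])
    also have "ennreal (10 / L\<^sup>2 * (2 * pi * (\<Sum>n<N. (cmod (a n))\<^sup>2))) \<le> ennreal (10 / L\<^sup>2 * (2 * pi * l2sq a))"
      by (intro ennreal_leI mult_left_mono l2_sum_le a) (use L in auto)
    finally show "emeasure lborel (E N) \<le> ennreal (20 * pi / L\<^sup>2 * l2sq a)" by (simp add: mult_ac)
  qed
  have cont: "continuous_on (ball 0 1) (pser a)" using pser_holomorphic[OF a] by (rule holomorphic_on_imp_continuous_on)
  have "open {t. L < cmod (pser a (of_real r * cis t))}" if "r \<in> {0..<1}" for r
  proof (rule open_Collect_less[OF continuous_on_const continuous_on_norm[OF continuous_on_compose2[OF cont]]])
    show "continuous_on UNIV (\<lambda>t. of_real r * cis t)" by (intro continuous_intros)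
  qed (use that in \<open>auto simp: norm_mult\<close>)
  moreover have "expset a L = {0..2*pi} \<inter> (\<Union>r\<in>{0..<1}. {t. L < cmod (pser a (of_real r * cis t))})"
    by (auto simp: expset_def)
  ultimately show "expset a L \<in> sets borel" by (metis (no_types, lifting) atLeastAtMost_borel borel_open open_UN sets.Int)
  define A where "A N = (\<Inter>n\<in>{N..}. E n)" for N
  have As: "A N \<in> sets borel" for N unfolding A_def by (intro sets.countable_INT') (use EN in auto)
  have "expset a L \<subseteq> (\<Union>N. A N)"
  proof
    fix t assume "t \<in> expset a L"
    then obtain r where r: "0 \<le> r" "r < 1" "L < cmod (pser a (of_real r * cis t))" and t: "t \<in> {0..2*pi}" by (auto simp: expset_def)
    have "(\<lambda>N. cmod (S N (of_real r * cis t))) \<longlonglongrightarrow> cmod (pser a (of_real r * cis t))"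
      unfolding S_def by (intro tendsto_norm pser_trunc_tendsto a) (use r in \<open>simp add: norm_mult\<close>)
    from order_tendstoD(1)[OF this r(3)] obtain N where "\<forall>n\<ge>N. L < cmod (S n (of_real r * cis t))"
      unfolding eventually_sequentially by auto
    hence "t \<in> A N" unfolding A_def E_def using r t by auto
    thus "t \<in> (\<Union>N. A N)" by auto
  qed
  hence "emeasure lborel (expset a L) \<le> emeasure lborel (\<Union>N. A N)"
    using As by (intro emeasure_mono) auto
  also have "\<dots> = (SUP N. emeasure lborel (A N))"
    by (rule SUP_emeasure_incseq[symmetric]) (use As in \<open>auto simp: incseq_def A_def\<close>)
  also have "\<dots> \<le> ennreal (20 * pi / L\<^sup>2 * l2sq a)"
  proof (rule SUP_least)
    fix N
    have "emeasure lborel (A N) \<le> emeasure lborel (E N)"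
      using EN by (intro emeasure_mono) (auto simp: A_def)
    thus "emeasure lborel (A N) \<le> ennreal (20 * pi / L\<^sup>2 * l2sq a)" using EN(2)[of N] by (rule order_trans)
  qed
  finally show "emeasure lborel (expset a L) \<le> ennreal (20 * pi / L\<^sup>2 * l2sq a)" .
qed

lemma at_left_1_ge: "eventually (\<lambda>r. 0 \<le> r \<and> r < (1::real)) (at_left 1)"
  using eventually_at_left_real[of 0 "1::real"] by (auto elim: eventually_mono)

lemma trunc_radial_tendsto:
  "((\<lambda>r. \<Sum>n<N. a n * (of_real r * cis t) ^ n) \<longlongrightarrow> (\<Sum>n<N. a n * cis t ^ n)) (at_left 1)"
proof -
  have "((\<lambda>r. \<Sum>n<N. a n * (of_real r * cis t) ^ n) \<longlongrightarrow> (\<Sum>n<N. a n * (of_real 1 * cis t) ^ n)) (at_left 1)"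
    by (intro tendsto_intros)
  thus ?thesis by simp
qed

text \<open>The weak type estimate for the tails, whose norms tend to 0, shows that almost every
  radius carries, for each k, a truncation within 1 / (k + 1) of f along the whole radius.
  Truncations extend continuously to the circle, which makes f Cauchy along the radius.\<close>

theorem fatou_radial:
  assumes a: "l2 a"
  shows "AE t in lborel. t \<in> {0..2*pi} \<longrightarrow> (\<exists>l. ((\<lambda>r. pser a (of_real r * cis t)) \<longlongrightarrow> l) (at_left 1))"
proof -
  define B where "B k = (\<Inter>N. expset (tail a N) (1 / Suc k))" for k :: nat
  have Es: "expset (tail a N) (1 / Suc k) \<in> sets borel" for N k by (rule weak_type_pser(1)[OF l2_tail[OF a]]) simp
  have Bs: "B k \<in> sets borel" for k unfolding B_def by (intro sets.countable_INT') (use Es in auto)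
  have "emeasure lborel (B k) = 0" for k
  proof -
    have le: "emeasure lborel (B k) \<le> ennreal (20 * pi / (1 / Suc k)\<^sup>2 * l2sq (tail a N))" for N
    proof -
      have "emeasure lborel (B k) \<le> emeasure lborel (expset (tail a N) (1 / Suc k))"
        by (intro emeasure_mono) (use Es in \<open>auto simp: B_def\<close>)
      also have "\<dots> \<le> ennreal (20 * pi / (1 / Suc k)\<^sup>2 * l2sq (tail a N))"
        by (rule weak_type_pser(2)[OF l2_tail[OF a]]) simp
      finally show ?thesis .
    qed
    have "(\<lambda>N. ennreal (20 * pi / (1 / Suc k)\<^sup>2 * l2sq (tail a N))) \<longlonglongrightarrow> ennreal (20 * pi / (1 / Suc k)\<^sup>2 * 0)"
      by (intro tendsto_ennrealI tendsto_mult tendsto_const l2sq_tail_tendsto a)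
    from LIMSEQ_le_const[OF this] le have "emeasure lborel (B k) \<le> ennreal (20 * pi / (1 / Suc k)\<^sup>2 * 0)" by blast
    thus ?thesis by simp
  qed
  hence "B k \<in> null_sets lborel" for k using Bs by auto
  hence "AE t in lborel. \<forall>k. t \<notin> B k" by (simp add: AE_all_countable AE_not_in)
  thus ?thesis
  proof (rule AE_mp, intro AE_I2 impI)
    fix t assume tB: "\<forall>k. t \<notin> B k" and t: "t \<in> {0..2*pi}"
    define h where "h r = pser a (of_real r * cis t)" for r
    define S where "S N r = (\<Sum>n<N. a n * (of_real r * cis t) ^ n)" for N r
    have "\<exists>N. \<forall>r. 0 \<le> r \<and> r < 1 \<longrightarrow> cmod (h r - S N r) \<le> 1 / Suc k" for k
    proof -
      obtain N where N: "t \<notin> expset (tail a N) (1 / Suc k)" using tB unfolding B_def by auto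
      have "cmod (h r - S N r) \<le> 1 / Suc k" if r: "0 \<le> r" "r < 1" for r
      proof -
        have "\<not> 1 / Suc k < cmod (pser (tail a N) (of_real r * cis t))"
          using N t r unfolding expset_def by blast
        moreover have "cmod (of_real r * cis t) < 1" using r by (simp add: norm_mult)
        ultimately show ?thesis using pser_tail[OF a, of "of_real r * cis t" N]
          by (simp add: h_def S_def)
      qed
      thus ?thesis by blast
    qed
    then obtain N where N: "\<And>k r. 0 \<le> r \<Longrightarrow> r < 1 \<Longrightarrow> cmod (h r - S (N k) r) \<le> 1 / Suc k" by metis
    define l where "l k = (\<Sum>n<N k. a n * cis t ^ n)" for k
    have lim: "(S (N k) \<longlongrightarrow> l k) (at_left 1)" for k unfolding S_def l_def by (rule trunc_radial_tendsto)
    have dl: "cmod (l j - l k) \<le> 1 / Suc j + 1 / Suc k" for j k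
    proof (rule tendsto_upperbound)
      show "((\<lambda>r. cmod (S (N j) r - S (N k) r)) \<longlongrightarrow> cmod (l j - l k)) (at_left 1)"
        by (intro tendsto_intros lim)
      show "\<forall>\<^sub>F r in at_left 1. cmod (S (N j) r - S (N k) r) \<le> 1 / Suc j + 1 / Suc k"
        using at_left_1_ge
      proof eventually_elim
        case (elim r)
        have "S (N j) r - S (N k) r = (h r - S (N k) r) - (h r - S (N j) r)" by simp
        also have "cmod \<dots> \<le> 1 / Suc k + 1 / Suc j"
          by (rule order_trans[OF norm_triangle_ineq4 add_mono]) (use N elim in auto)
        finally show ?case by (simp add: add.commute)
      qed
    qed simp
    have z: "(\<lambda>k. 1 / real (Suc k)) \<longlonglongrightarrow> 0" by (rule LIMSEQ_Suc[OF lim_1_over_n])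
    have "Cauchy l"
    proof (rule metric_CauchyI)
      fix e :: real assume "e > 0"
      hence "\<forall>\<^sub>F k in sequentially. 1 / real (Suc k) < e / 2" using order_tendstoD(2)[OF z, of "e/2"] by simp
      then obtain M where M: "\<And>k. k \<ge> M \<Longrightarrow> 1 / real (Suc k) < e / 2" by (auto simp: eventually_sequentially)
      show "\<exists>M. \<forall>m\<ge>M. \<forall>n\<ge>M. dist (l m) (l n) < e"
      proof (intro exI allI impI)
        fix m n assume "m \<ge> M" "n \<ge> M"
        thus "dist (l m) (l n) < e" using M[of m] M[of n] dl[of m n] unfolding dist_norm by linarith
      qed
    qed
    then obtain x where x: "l \<longlonglongrightarrow> x" using Cauchy_convergent convergent_def by blast
    have lx: "cmod (l k - x) \<le> 1 / Suc k" for k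
    proof (rule LIMSEQ_le[of "\<lambda>j. cmod (l k - l j)" _ "\<lambda>j. 1 / Suc k + 1 / real (Suc j)"])
      show "(\<lambda>j. cmod (l k - l j)) \<longlonglongrightarrow> cmod (l k - x)" by (intro tendsto_intros x)
      have "(\<lambda>j. 1 / Suc k + 1 / real (Suc j)) \<longlonglongrightarrow> 1 / Suc k + 0" by (intro tendsto_intros z)
      thus "(\<lambda>j. 1 / Suc k + 1 / real (Suc j)) \<longlonglongrightarrow> 1 / Suc k" by simp
    qed (use dl in auto)
    have "(h \<longlongrightarrow> x) (at_left 1)"
    proof (rule tendstoI)
      fix e :: real assume "e > 0"
      hence "\<forall>\<^sub>F k in sequentially. 1 / real (Suc k) < e / 3" using order_tendstoD(2)[OF z, of "e/3"] by simp
      then obtain k where k: "1 / real (Suc k) < e / 3" by (auto simp: eventually_sequentially)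
      have "\<forall>\<^sub>F r in at_left 1. dist (S (N k) r) (l k) < e / 3"
        using tendstoD[OF lim[of k], of "e/3"] \<open>e > 0\<close> by simp
      thus "\<forall>\<^sub>F r in at_left 1. dist (h r) x < e" using at_left_1_ge
      proof eventually_elim
        case (elim r)
        have "h r - x = (h r - S (N k) r) + (S (N k) r - l k) + (l k - x)" by simp
        also have "cmod \<dots> \<le> cmod (h r - S (N k) r) + cmod (S (N k) r - l k) + cmod (l k - x)"
          by (intro order_trans[OF norm_triangle_ineq add_mono] norm_triangle_ineq order_refl)
        also have "\<dots> < e" using N[of r k] elim lx[of k] k unfolding dist_norm by linarith
        finally show ?case by (simp add: dist_norm)
      qed
    qed
    thus "\<exists>l. ((\<lambda>r. pser a (of_real r * cis t)) \<longlongrightarrow> l) (at_left 1)" unfolding h_def by blast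
  qed
qed

section \<open>Normalized Lebesgue measure on one period\<close>

definition circ :: "real measure" where
  "circ = density lborel (\<lambda>t. ennreal (indicator {0..2*pi} t / (2*pi)))"

lemma sets_circ [simp, measurable_cong]: "sets circ = sets borel"
  by (simp add: circ_def)

lemma space_circ [simp]: "space circ = UNIV"
  by (simp add: circ_def)

lemma emeasure_circ: "emeasure circ UNIV = 1"
proof -
  have "(\<lambda>t. ennreal (indicator {0..2*pi} t / (2*pi))) = (\<lambda>t. ennreal (1 / (2*pi)) * indicator {0..2*pi} t)"
    by (auto simp: indicator_def)
  hence "emeasure circ UNIV = (\<integral>\<^sup>+ t. ennreal (1 / (2*pi)) * indicator {0..2*pi} t \<partial>lborel)"
    by (simp add: circ_def emeasure_density)
  also have "\<dots> = ennreal (1 / (2*pi)) * ennreal (2 * pi)"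
    by (subst nn_integral_cmult_indicator) auto
  also have "\<dots> = 1" by (simp flip: ennreal_mult')
  finally show ?thesis .
qed

lemma finite_measure_circ: "finite_measure circ"
  by (rule finite_measureI) (simp add: emeasure_circ)

lemma measure_circ: "measure circ UNIV = 1"
  by (simp add: measure_def emeasure_circ)

lemma AE_circ: "(AE t in circ. P t) \<longleftrightarrow> (AE t in lborel. t \<in> {0..2*pi} \<longrightarrow> P t)"
  unfolding circ_def by (subst AE_density) (auto intro!: AE_cong simp: indicator_def)

lemma integral_circ:
  fixes f :: "real \<Rightarrow> 'a::euclidean_space"
  assumes [measurable]: "f \<in> borel_measurable borel"
  shows "integral\<^sup>L circ f = (1 / (2*pi)) *\<^sub>R (LINT t:{0..2*pi}|lborel. f t)"
    and "integrable circ f \<longleftrightarrow> set_integrable lborel {0..2*pi} f"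
proof -
  have "integral\<^sup>L circ f = (LINT t|lborel. (indicator {0..2*pi} t / (2*pi)) *\<^sub>R f t)"
    unfolding circ_def by (rule integral_density) auto
  also have "(\<lambda>t. (indicator {0..2*pi} t / (2*pi)) *\<^sub>R f t) = (\<lambda>t. (1 / (2*pi)) *\<^sub>R (indicator {0..2*pi} t *\<^sub>R f t))"
    by (simp add: mult.commute)
  finally show "integral\<^sup>L circ f = (1 / (2*pi)) *\<^sub>R (LINT t:{0..2*pi}|lborel. f t)"
    unfolding set_lebesgue_integral_def by (simp only: integral_scaleR_right)
  have "integrable circ f \<longleftrightarrow> integrable lborel (\<lambda>t. (indicator {0..2*pi} t / (2*pi)) *\<^sub>R f t)"
    unfolding circ_def by (rule integrable_density) auto
  also have "(\<lambda>t. (indicator {0..2*pi} t / (2*pi)) *\<^sub>R f t) = (\<lambda>t. (1 / (2*pi)) *\<^sub>R (indicator {0..2*pi} t *\<^sub>R f t))"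
    by (simp add: mult.commute)
  also have "integrable lborel (\<lambda>t. (1 / (2*pi)) *\<^sub>R g t) \<longleftrightarrow> integrable lborel g" for g :: "real \<Rightarrow> 'a"
  proof
    assume "integrable lborel (\<lambda>t. (1 / (2*pi)) *\<^sub>R g t)"
    from integrable_scaleR_right[OF this, of "2*pi"]
    have "integrable lborel (\<lambda>t. (2*pi) *\<^sub>R ((1 / (2*pi)) *\<^sub>R g t))" .
    thus "integrable lborel g" by simp
  qed (rule integrable_scaleR_right)
  finally show "integrable circ f \<longleftrightarrow> set_integrable lborel {0..2*pi} f"
    unfolding set_integrable_def .
qed

lemma circ_continuous:
  fixes f :: "real \<Rightarrow> 'a::euclidean_space"
  assumes f: "continuous_on UNIV f"
  shows "integrable circ f" and "integral\<^sup>L circ f = (1 / (2*pi)) *\<^sub>R integral {0..2*pi} f"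
proof -
  have [measurable]: "f \<in> borel_measurable borel" by (rule borel_measurable_continuous_onI[OF f])
  have s: "set_integrable lborel {0..2*pi} f"
    by (intro borel_integrable_atLeastAtMost' continuous_on_subset[OF f]) auto
  thus "integrable circ f" by (simp add: integral_circ(2))
  show "integral\<^sup>L circ f = (1 / (2*pi)) *\<^sub>R integral {0..2*pi} f"
    using set_borel_integral_eq_integral(2)[OF s] by (simp add: integral_circ(1))
qed

lemma integrable_circ_bounded:
  fixes f :: "real \<Rightarrow> 'a::{banach, second_countable_topology}"
  assumes "f \<in> borel_measurable borel" "AE t in circ. norm (f t) \<le> B"
  shows "integrable circ f"
  by (rule finite_measure.integrable_const_bound[OF finite_measure_circ]) (use assms in auto)

lemma continuous_cis [continuous_intros]: "continuous_on A (\<lambda>t. cis t)"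
  by (intro continuous_intros)

lemma poisson_circ:
  assumes f: "f holomorphic_on UNIV" and z: "cmod z < 1"
  shows "integrable circ (\<lambda>t. complex_of_real (PK z t) * f (cis t))"
    and "integral\<^sup>L circ (\<lambda>t. complex_of_real (PK z t) * f (cis t)) = f z"
proof -
  have cf: "continuous_on UNIV f" using f by (rule holomorphic_on_imp_continuous_on)
  have c: "continuous_on UNIV (\<lambda>t. complex_of_real (PK z t) * f (cis t))"
    by (intro continuous_intros z continuous_on_compose2[OF cf]) auto
  show "integrable circ (\<lambda>t. complex_of_real (PK z t) * f (cis t))" by (rule circ_continuous[OF c])
  show "integral\<^sup>L circ (\<lambda>t. complex_of_real (PK z t) * f (cis t)) = f z"
    unfolding circ_continuous(2)[OF c] integral_unique[OF poisson_has_integral[OF f z]]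
    by (simp add: scaleR_conv_of_real)
qed

lemma PK_integral:
  assumes z: "cmod z < 1"
  shows "integrable circ (PK z)" "integral\<^sup>L circ (PK z) = 1"
proof -
  have "(\<lambda>_. 1) holomorphic_on UNIV" by auto
  from poisson_circ[OF this z] have "integrable circ (\<lambda>t. complex_of_real (PK z t))" 
    "integral\<^sup>L circ (\<lambda>t. complex_of_real (PK z t)) = 1" by simp_all
  thus "integrable circ (PK z)" "integral\<^sup>L circ (PK z) = 1"
    by (simp_all add: complex_of_real_integrable_eq)
qed

text \<open>The variance argument of \<open>poisson_centered\<close>, at an arbitrary point z of the
  disc.\<close>

lemma poisson_jensen:
  assumes f: "f holomorphic_on UNIV" and z: "cmod z < 1"
  shows "(cmod (f z))\<^sup>2 \<le> integral\<^sup>L circ (\<lambda>t. PK z t * (cmod (f (cis t)))\<^sup>2)"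
proof -
  have cf: "continuous_on UNIV f" using f by (rule holomorphic_on_imp_continuous_on)
  have i2: "integrable circ (\<lambda>t. PK z t * (cmod (f (cis t)))\<^sup>2)"
    by (intro circ_continuous continuous_intros z continuous_on_compose2[OF cf]) auto
  define X where "X t = cnj (f z) * (complex_of_real (PK z t) * f (cis t))" for t
  have i1: "integrable circ X" unfolding X_def[abs_def]
    by (intro integrable_mult_right poisson_circ f z)
  have e1: "integral\<^sup>L circ X = cnj (f z) * f z"
    unfolding X_def[abs_def] using poisson_circ[OF f z] by simp
  have "0 \<le> integral\<^sup>L circ (\<lambda>t. PK z t * (cmod (f (cis t) - f z))\<^sup>2)"
    by (intro integral_nonneg_AE AE_I2 mult_nonneg_nonneg) (use PK_pos[OF z] in \<open>auto simp: less_imp_le\<close>)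
  also have "(\<lambda>t. PK z t * (cmod (f (cis t) - f z))\<^sup>2) = (\<lambda>t. PK z t * (cmod (f (cis t)))\<^sup>2
      - 2 * Re (X t) + PK z t * (cmod (f z))\<^sup>2)"
    unfolding cmod_power2 X_def by (rule ext) (simp add: power2_eq_square algebra_simps)
  also have "integral\<^sup>L circ \<dots> = integral\<^sup>L circ (\<lambda>t. PK z t * (cmod (f (cis t)))\<^sup>2) 
      - 2 * Re (cnj (f z) * f z) + (cmod (f z))\<^sup>2"
    using PK_integral[OF z] integrable_Re[OF i1] i2 integral_Re[OF i1] unfolding e1 by simp
  also have "Re (cnj (f z) * f z) = (cmod (f z))\<^sup>2" unfolding cmod_power2 by (simp add: power2_eq_square)
  finally show ?thesis by simp
qed

text \<open>The limit is taken along a sequence of radii so that \<open>bd a\<close> is measurable.\<close>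

definition bd :: "(nat \<Rightarrow> complex) \<Rightarrow> real \<Rightarrow> complex" where
  "bd a t = lim (\<lambda>k. pser a (of_real (1 - 1 / real (Suc k)) * cis t))"

lemma rseq: "filterlim (\<lambda>k. 1 - 1 / real (Suc k)) (at_left 1) sequentially"
proof -
  have "(\<lambda>k. 1 - 1 / real (Suc k)) \<longlonglongrightarrow> 1 - 0" by (intro tendsto_intros LIMSEQ_Suc[OF lim_1_over_n])
  thus ?thesis unfolding filterlim_at by auto
qed

lemma pser_radial_continuous:
  assumes "l2 a" "0 \<le> r" "r < 1"
  shows "continuous_on A (\<lambda>t. pser a (of_real r * cis t))"
proof (rule continuous_on_compose2[OF holomorphic_on_imp_continuous_on[OF pser_holomorphic[OF assms(1)]]])
  show "continuous_on A (\<lambda>t. of_real r * cis t)" by (intro continuous_intros)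
qed (use assms in \<open>auto simp: norm_mult\<close>)

lemma bd_measurable:
  assumes "l2 a" shows "bd a \<in> borel_measurable borel"
  unfolding bd_def
  by (intro borel_measurable_lim_metric borel_measurable_continuous_onI pser_radial_continuous assms) auto

lemma bd_eqI: "((\<lambda>r. pser a (of_real r * cis t)) \<longlongrightarrow> l) (at_left 1) \<Longrightarrow> bd a t = l"
  unfolding bd_def by (rule limI) (rule filterlim_compose[OF _ rseq])

lemma bd_AE:
  assumes "l2 a"
  shows "AE t in circ. ((\<lambda>r. pser a (of_real r * cis t)) \<longlongrightarrow> bd a t) (at_left 1)"
  unfolding AE_circ using fatou_radial[OF assms] by (rule AE_mp) (auto intro!: AE_I2 dest: bd_eqI)

section \<open>Parseval's identity for boundary functions\<close>

lemma parseval_trunc: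
  "integral\<^sup>L circ (\<lambda>t. (cmod (\<Sum>n<N. a n * cis t ^ n))\<^sup>2) = (\<Sum>n<N. (cmod (a n))\<^sup>2)"
  "integrable circ (\<lambda>t. (cmod (\<Sum>n<N. a n * cis t ^ n))\<^sup>2)"
proof -
  have c: "continuous_on UNIV (\<lambda>t. (cmod (\<Sum>n<N. a n * cis t ^ n))\<^sup>2)"
    by (intro continuous_intros)
  show "integral\<^sup>L circ (\<lambda>t. (cmod (\<Sum>n<N. a n * cis t ^ n))\<^sup>2) = (\<Sum>n<N. (cmod (a n))\<^sup>2)"
    unfolding circ_continuous(2)[OF c] integral_unique[OF parseval_poly] by simp
  show "integrable circ (\<lambda>t. (cmod (\<Sum>n<N. a n * cis t ^ n))\<^sup>2)" by (rule circ_continuous[OF c])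
qed

text \<open>Meant for the dilations \<open>a n * r ^ n\<close> with r < 1: they are absolutely
  summable, so the partial sums are uniformly bounded on the circle and dominated convergence
  applies.\<close>

lemma parseval_l1:
  assumes d: "summable (\<lambda>n. cmod (d n))"
  shows "(\<lambda>n. (cmod (d n))\<^sup>2) sums integral\<^sup>L circ (\<lambda>t. (cmod (\<Sum>n. d n * cis t ^ n))\<^sup>2)"
    and "integrable circ (\<lambda>t. (cmod (\<Sum>n. d n * cis t ^ n))\<^sup>2)"
proof -
  have s: "summable (\<lambda>n. cmod (d n * cis t ^ n))" for t using d by (simp add: norm_mult norm_power)
  have lim: "(\<lambda>N. \<Sum>n<N. d n * cis t ^ n) \<longlonglongrightarrow> (\<Sum>n. d n * cis t ^ n)" for t
    by (rule summable_LIMSEQ[OF summable_norm_cancel[OF s]])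
  have bnd: "(cmod (\<Sum>n<N. d n * cis t ^ n))\<^sup>2 \<le> (\<Sum>n. cmod (d n))\<^sup>2" for N t
  proof (rule power_mono)
    have "cmod (\<Sum>n<N. d n * cis t ^ n) \<le> (\<Sum>n<N. cmod (d n))"
      by (rule order_trans[OF norm_sum]) (simp add: norm_mult norm_power)
    also have "\<dots> \<le> (\<Sum>n. cmod (d n))" by (rule sum_le_suminf[OF d]) auto
    finally show "cmod (\<Sum>n<N. d n * cis t ^ n) \<le> (\<Sum>n. cmod (d n))" .
  qed simp
  have [measurable]: "(\<lambda>t. \<Sum>n<N. d n * cis t ^ n) \<in> borel_measurable borel" for N
    by (intro borel_measurable_continuous_onI continuous_intros)
  have [measurable]: "(\<lambda>t. \<Sum>n. d n * cis t ^ n) \<in> borel_measurable borel"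
    by (rule borel_measurable_LIMSEQ_metric[OF _ lim]) measurable
  have dom: "integrable circ (\<lambda>t. (\<Sum>n. cmod (d n))\<^sup>2)"
    by (rule integrable_circ_bounded) auto
  note D = integral_dominated_convergence[where M = circ and s = "\<lambda>N t. (cmod (\<Sum>n<N. d n * cis t ^ n))\<^sup>2" 
     and f = "\<lambda>t. (cmod (\<Sum>n. d n * cis t ^ n))\<^sup>2" and w = "\<lambda>t. (\<Sum>n. cmod (d n))\<^sup>2"]
  have "(\<lambda>N. integral\<^sup>L circ (\<lambda>t. (cmod (\<Sum>n<N. d n * cis t ^ n))\<^sup>2)) \<longlonglongrightarrow> integral\<^sup>L circ (\<lambda>t. (cmod (\<Sum>n. d n * cis t ^ n))\<^sup>2)"
    by (rule D) (use dom bnd lim in \<open>auto intro!: AE_I2 tendsto_intros\<close>)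
  thus "(\<lambda>n. (cmod (d n))\<^sup>2) sums integral\<^sup>L circ (\<lambda>t. (cmod (\<Sum>n. d n * cis t ^ n))\<^sup>2)"
    unfolding sums_def parseval_trunc .
  show "integrable circ (\<lambda>t. (cmod (\<Sum>n. d n * cis t ^ n))\<^sup>2)"
  proof (rule integrable_circ_bounded)
    show "AE t in circ. norm ((cmod (\<Sum>n. d n * cis t ^ n))\<^sup>2) \<le> (\<Sum>n. cmod (d n))\<^sup>2"
      using LIMSEQ_le_const2[OF tendsto_power[OF tendsto_norm[OF lim]]] bnd by (intro AE_I2) auto
  qed auto
qed

lemma radial_mean_le:
  assumes a: "l2 a" and r: "0 \<le> r" "r < 1"
  shows "(\<integral>\<^sup>+ t. ennreal ((cmod (pser a (of_real r * cis t)))\<^sup>2) \<partial>circ) \<le> ennreal (l2sq a)"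
proof -
  define d where "d n = a n * of_real r ^ n" for n
  have d1: "summable (\<lambda>n. cmod (d n))" using l2_powser_summable[OF a, of "of_real r"] r by (simp add: d_def)
  have eq: "pser a (of_real r * cis t) = (\<Sum>n. d n * cis t ^ n)" for t
    by (simp add: pser_def d_def power_mult_distrib mult.assoc)
  have "(\<integral>\<^sup>+ t. ennreal ((cmod (pser a (of_real r * cis t)))\<^sup>2) \<partial>circ) = ennreal (integral\<^sup>L circ (\<lambda>t. (cmod (\<Sum>n. d n * cis t ^ n))\<^sup>2))"
    unfolding eq by (rule nn_integral_eq_integral[OF parseval_l1(2)[OF d1]]) auto
  also have "integral\<^sup>L circ (\<lambda>t. (cmod (\<Sum>n. d n * cis t ^ n))\<^sup>2) = (\<Sum>n. (cmod (d n))\<^sup>2)"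
    using parseval_l1(1)[OF d1] by (simp add: sums_iff)
  also have "\<dots> \<le> l2sq a" unfolding l2sq_def
  proof (rule suminf_le)
    show "summable (\<lambda>n. (cmod (d n))\<^sup>2)" using parseval_l1(1)[OF d1] by (simp add: sums_iff)
    show "summable (\<lambda>n. (cmod (a n))\<^sup>2)" using a by (simp add: l2_def)
    fix n
    have "cmod (d n) \<le> cmod (a n)" unfolding d_def norm_mult norm_power using r
      by (simp add: mult_left_le power_le_one)
    thus "(cmod (d n))\<^sup>2 \<le> (cmod (a n))\<^sup>2" by (rule power_mono) simp
  qed
  finally show ?thesis by (simp add: ennreal_leI)
qed

text \<open>Fatou's lemma along the radii that define \<open>bd\<close>. Applied to tails, the
  inequality controls the distance to the truncations, from which \<open>parseval_bd\<close>
  recovers equality.\<close>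

lemma bd_nn_integral_le:
  assumes a: "l2 a"
  shows "(\<integral>\<^sup>+ t. ennreal ((cmod (bd a t))\<^sup>2) \<partial>circ) \<le> ennreal (l2sq a)"
proof -
  define u where "u k t = ennreal ((cmod (pser a (of_real (1 - 1 / real (Suc k)) * cis t)))\<^sup>2)" for k t
  have um: "u k \<in> borel_measurable circ" for k
  proof -
    have "(\<lambda>t. pser a (of_real (1 - 1 / real (Suc k)) * cis t)) \<in> borel_measurable borel"
      by (intro borel_measurable_continuous_onI pser_radial_continuous a) auto
    thus ?thesis unfolding u_def[abs_def] by measurable
  qed
  have "AE t in circ. ennreal ((cmod (bd a t))\<^sup>2) = liminf (\<lambda>k. u k t)"
    using bd_AE[OF a]
  proof eventually_elim
    case (elim t)
    have "(\<lambda>k. u k t) \<longlonglongrightarrow> ennreal ((cmod (bd a t))\<^sup>2)" unfolding u_def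
      by (intro tendsto_ennrealI tendsto_power tendsto_norm filterlim_compose[OF elim rseq])
    thus ?case by (simp add: lim_imp_Liminf)
  qed
  hence "(\<integral>\<^sup>+ t. ennreal ((cmod (bd a t))\<^sup>2) \<partial>circ) = (\<integral>\<^sup>+ t. liminf (\<lambda>k. u k t) \<partial>circ)"
    by (rule nn_integral_cong_AE)
  also have "\<dots> \<le> liminf (\<lambda>k. \<integral>\<^sup>+ t. u k t \<partial>circ)"
    by (rule nn_integral_liminf[OF um])
  also have "\<dots> \<le> liminf (\<lambda>k::nat. ennreal (l2sq a))"
    unfolding u_def by (rule Liminf_mono, rule always_eventually, rule allI, rule radial_mean_le[OF a]) auto
  also have "\<dots> = ennreal (l2sq a)" by (simp add: Liminf_const)
  finally show ?thesis .
qed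

lemma bd_sq_integrable:
  assumes a: "l2 a"
  shows "integrable circ (\<lambda>t. (cmod (bd a t))\<^sup>2)" "integral\<^sup>L circ (\<lambda>t. (cmod (bd a t))\<^sup>2) \<le> l2sq a"
proof -
  have [measurable]: "bd a \<in> borel_measurable borel" by (rule bd_measurable[OF a])
  have lt: "(\<integral>\<^sup>+ t. ennreal ((cmod (bd a t))\<^sup>2) \<partial>circ) < \<infinity>"
    using bd_nn_integral_le[OF a] by (auto intro: order_le_less_trans)
  show i: "integrable circ (\<lambda>t. (cmod (bd a t))\<^sup>2)"
    by (rule integrableI_bounded) (use lt in auto)
  have "ennreal (integral\<^sup>L circ (\<lambda>t. (cmod (bd a t))\<^sup>2)) \<le> ennreal (l2sq a)"
    using bd_nn_integral_le[OF a] by (subst nn_integral_eq_integral[OF i, symmetric]) auto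
  thus "integral\<^sup>L circ (\<lambda>t. (cmod (bd a t))\<^sup>2) \<le> l2sq a"
    using l2sq_nonneg[OF a] by simp
qed

lemma bd_tail:
  assumes a: "l2 a"
  shows "AE t in circ. bd (tail a N) t = bd a t - (\<Sum>n<N. a n * cis t ^ n)"
  using bd_AE[OF a]
proof eventually_elim
  case (elim t)
  show ?case
  proof (rule bd_eqI)
    have "((\<lambda>r. pser a (of_real r * cis t) - (\<Sum>n<N. a n * (of_real r * cis t) ^ n)) \<longlongrightarrow> bd a t - (\<Sum>n<N. a n * cis t ^ n)) (at_left 1)"
      by (intro tendsto_diff elim trunc_radial_tendsto)
    moreover have "\<forall>\<^sub>F r in at_left 1. pser a (of_real r * cis t) - (\<Sum>n<N. a n * (of_real r * cis t) ^ n) = pser (tail a N) (of_real r * cis t)"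
      using at_left_1_ge by eventually_elim (subst pser_tail[OF a], auto simp: norm_mult)
    ultimately show "((\<lambda>r. pser (tail a N) (of_real r * cis t)) \<longlongrightarrow> bd a t - (\<Sum>n<N. a n * cis t ^ n)) (at_left 1)"
      by (rule Lim_transform_eventually)
  qed
qed

text \<open>Young's inequality with a free weight: the coefficient of |y|^2 can be made small at the
  price of a large one at |y - x|^2, which in the application is the boundary value of a
  tail.\<close>

lemma norm_sq_diff_le:
  fixes x y :: complex
  assumes "\<delta> > 0"
  shows "\<bar>(cmod x)\<^sup>2 - (cmod y)\<^sup>2\<bar> \<le> (1 + 1 / \<delta>) * (cmod (y - x))\<^sup>2 + \<delta> * (cmod y)\<^sup>2"
proof -
  define p q d where "p = cmod x" "q = cmod y" "d = cmod (y - x)"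
  have pq: "\<bar>p - q\<bar> \<le> d" "p \<ge> 0" "q \<ge> 0" unfolding p_q_d_def
    using norm_triangle_ineq3[of x y] by (auto simp: norm_minus_commute)
  have am: "2 * d * q \<le> 1 / \<delta> * d\<^sup>2 + \<delta> * q\<^sup>2"
  proof -
    have "0 \<le> (d / sqrt \<delta> - sqrt \<delta> * q)\<^sup>2" by simp
    also have "\<dots> = 1 / \<delta> * d\<^sup>2 + \<delta> * q\<^sup>2 - 2 * d * q" using assms
      by (simp add: power2_eq_square field_simps)
    finally show ?thesis by simp
  qed
  have "\<bar>p\<^sup>2 - q\<^sup>2\<bar> = \<bar>p - q\<bar> * (p + q)" using pq by (simp add: power2_eq_square square_diff_square_factored abs_mult)
  also have "\<dots> \<le> d * (d + 2 * q)" using pq by (intro mult_mono) auto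
  also have "\<dots> = d\<^sup>2 + 2 * d * q" by (simp add: power2_eq_square algebra_simps)
  also have "\<dots> \<le> (1 + 1 / \<delta>) * d\<^sup>2 + \<delta> * q\<^sup>2" using am by (simp add: algebra_simps)
  finally show ?thesis by (simp add: p_q_d_def)
qed

lemma bd_weighted_tendsto:
  assumes a: "l2 a" and k [measurable]: "k \<in> borel_measurable borel" and kb: "\<And>t. 0 \<le> k t \<and> k t \<le> K"
  shows "(\<lambda>N. integral\<^sup>L circ (\<lambda>t. k t * (cmod (\<Sum>n<N. a n * cis t ^ n))\<^sup>2)) \<longlonglongrightarrow> integral\<^sup>L circ (\<lambda>t. k t * (cmod (bd a t))\<^sup>2)"
    and "integrable circ (\<lambda>t. k t * (cmod (bd a t))\<^sup>2)"
proof -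
  have bm [measurable]: "bd b \<in> borel_measurable borel" if "l2 b" for b using that by (rule bd_measurable)
  note a [measurable]
  have K: "K \<ge> 0" using kb[of 0] by linarith
  have int: "integrable circ (\<lambda>t. k t * u t)" if u: "integrable circ u" for u :: "real \<Rightarrow> real"
  proof (rule Bochner_Integration.integrable_bound[OF integrable_mult_right[OF u, of K]])
    show "(\<lambda>t. k t * u t) \<in> borel_measurable circ" using borel_measurable_integrable[OF u] by measurable
    show "AE t in circ. norm (k t * u t) \<le> norm (K * u t)"
      using kb K by (intro AE_I2) (auto simp: abs_mult intro!: mult_right_mono)
  qed
  show ib: "integrable circ (\<lambda>t. k t * (cmod (bd a t))\<^sup>2)" by (rule int[OF bd_sq_integrable(1)[OF a]])
  define S where "S N t = (\<Sum>n<N. a n * cis t ^ n)" for N t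
  have iS: "integrable circ (\<lambda>t. (cmod (S N t))\<^sup>2)" for N unfolding S_def by (rule parseval_trunc)
  have est: "\<bar>integral\<^sup>L circ (\<lambda>t. k t * (cmod (S N t))\<^sup>2) - integral\<^sup>L circ (\<lambda>t. k t * (cmod (bd a t))\<^sup>2)\<bar>
     \<le> K * ((1 + 1 / \<delta>) * l2sq (tail a N) + \<delta> * l2sq a)" if d: "\<delta> > 0" for N \<delta>
  proof -
    have it: "integrable circ (\<lambda>t. K * ((1 + 1 / \<delta>) * (cmod (bd (tail a N) t))\<^sup>2 + \<delta> * (cmod (bd a t))\<^sup>2))"
      by (intro integrable_mult_right Bochner_Integration.integrable_add bd_sq_integrable l2_tail a)
    have "\<bar>integral\<^sup>L circ (\<lambda>t. k t * (cmod (S N t))\<^sup>2) - integral\<^sup>L circ (\<lambda>t. k t * (cmod (bd a t))\<^sup>2)\<bar>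
       = \<bar>integral\<^sup>L circ (\<lambda>t. k t * (cmod (S N t))\<^sup>2 - k t * (cmod (bd a t))\<^sup>2)\<bar>"
      using int[OF iS] ib by simp
    also have "\<dots> \<le> integral\<^sup>L circ (\<lambda>t. \<bar>k t * (cmod (S N t))\<^sup>2 - k t * (cmod (bd a t))\<^sup>2\<bar>)"
      by (rule integral_abs_bound)
    also have "\<dots> \<le> integral\<^sup>L circ (\<lambda>t. K * ((1 + 1 / \<delta>) * (cmod (bd (tail a N) t))\<^sup>2 + \<delta> * (cmod (bd a t))\<^sup>2))"
    proof (rule integral_mono_AE[OF _ it])
      show "integrable circ (\<lambda>t. \<bar>k t * (cmod (S N t))\<^sup>2 - k t * (cmod (bd a t))\<^sup>2\<bar>)"
        using int[OF iS] ib by (intro integrable_abs Bochner_Integration.integrable_diff)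
      show "AE t in circ. \<bar>k t * (cmod (S N t))\<^sup>2 - k t * (cmod (bd a t))\<^sup>2\<bar>
         \<le> K * ((1 + 1 / \<delta>) * (cmod (bd (tail a N) t))\<^sup>2 + \<delta> * (cmod (bd a t))\<^sup>2)"
        using bd_tail[OF a, of N]
      proof eventually_elim
        case (elim t)
        have "\<bar>k t * (cmod (S N t))\<^sup>2 - k t * (cmod (bd a t))\<^sup>2\<bar> = k t * \<bar>(cmod (S N t))\<^sup>2 - (cmod (bd a t))\<^sup>2\<bar>"
          using kb[of t] by (simp add: abs_mult flip: right_diff_distrib)
        also have "\<dots> \<le> K * ((1 + 1 / \<delta>) * (cmod (bd a t - S N t))\<^sup>2 + \<delta> * (cmod (bd a t))\<^sup>2)"
          by (intro mult_mono norm_sq_diff_le d) (use kb K in auto)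
        finally show ?case unfolding elim S_def .
      qed
    qed
    also have "\<dots> = K * ((1 + 1 / \<delta>) * integral\<^sup>L circ (\<lambda>t. (cmod (bd (tail a N) t))\<^sup>2) + \<delta> * integral\<^sup>L circ (\<lambda>t. (cmod (bd a t))\<^sup>2))"
      using bd_sq_integrable(1)[OF a] bd_sq_integrable(1)[OF l2_tail[OF a, of N]] by simp
    also have "\<dots> \<le> K * ((1 + 1 / \<delta>) * l2sq (tail a N) + \<delta> * l2sq a)"
      by (intro mult_left_mono add_mono bd_sq_integrable(2) l2_tail a) (use d K in auto)
    finally show ?thesis .
  qed
  have "(\<lambda>N. integral\<^sup>L circ (\<lambda>t. k t * (cmod (S N t))\<^sup>2)) \<longlonglongrightarrow> integral\<^sup>L circ (\<lambda>t. k t * (cmod (bd a t))\<^sup>2)"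
  proof (rule tendstoI)
    fix e :: real assume e: "e > 0"
    \<comment> \<open>Makes the part of the error that does not shrink with N at most e / 2; adding
      1 avoids division by zero.\<close>
    define \<delta> where "\<delta> = e / (2 * (K * l2sq a + 1))"
    have d: "\<delta> > 0" unfolding \<delta>_def using e K l2sq_nonneg[OF a] by (intro divide_pos_pos) (auto intro: add_nonneg_pos)
    have d2: "K * (\<delta> * l2sq a) < e"
    proof -
      have p: "K * l2sq a + 1 > 0" using K l2sq_nonneg[OF a] by (auto intro: add_nonneg_pos)
      have "K * (\<delta> * l2sq a) = (e / 2) * (K * l2sq a / (K * l2sq a + 1))" by (simp add: \<delta>_def)
      also have "\<dots> \<le> (e / 2) * 1" using e p by (intro mult_left_mono) auto
      finally show ?thesis using e by simp
    qed
    have "(\<lambda>N. K * ((1 + 1 / \<delta>) * l2sq (tail a N) + \<delta> * l2sq a)) \<longlonglongrightarrow> K * ((1 + 1 / \<delta>) * 0 + \<delta> * l2sq a)"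
      by (intro tendsto_intros l2sq_tail_tendsto a)
    from order_tendstoD(2)[OF this, of e] d2
    have "\<forall>\<^sub>F N in sequentially. K * ((1 + 1 / \<delta>) * l2sq (tail a N) + \<delta> * l2sq a) < e" by simp
    thus "\<forall>\<^sub>F N in sequentially. dist (integral\<^sup>L circ (\<lambda>t. k t * (cmod (S N t))\<^sup>2)) (integral\<^sup>L circ (\<lambda>t. k t * (cmod (bd a t))\<^sup>2)) < e"
      by eventually_elim (use est[OF d] in \<open>auto simp: dist_real_def intro: order_le_less_trans\<close>)
  qed
  thus "(\<lambda>N. integral\<^sup>L circ (\<lambda>t. k t * (cmod (\<Sum>n<N. a n * cis t ^ n))\<^sup>2)) \<longlonglongrightarrow> integral\<^sup>L circ (\<lambda>t. k t * (cmod (bd a t))\<^sup>2)"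
    by (simp add: S_def)
qed

lemma parseval_bd:
  assumes a: "l2 a"
  shows "integral\<^sup>L circ (\<lambda>t. (cmod (bd a t))\<^sup>2) = l2sq a"
proof -
  have "(\<lambda>N. integral\<^sup>L circ (\<lambda>t. 1 * (cmod (\<Sum>n<N. a n * cis t ^ n))\<^sup>2)) \<longlonglongrightarrow> integral\<^sup>L circ (\<lambda>t. 1 * (cmod (bd a t))\<^sup>2)"
    by (rule bd_weighted_tendsto[OF a, where K=1]) auto
  hence "(\<lambda>N. \<Sum>n<N. (cmod (a n))\<^sup>2) \<longlonglongrightarrow> integral\<^sup>L circ (\<lambda>t. (cmod (bd a t))\<^sup>2)"
    by (simp add: parseval_trunc)
  moreover have "(\<lambda>N. \<Sum>n<N. (cmod (a n))\<^sup>2) \<longlonglongrightarrow> l2sq a"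
    using a unfolding l2_def l2sq_def by (rule summable_LIMSEQ)
  ultimately show ?thesis by (rule LIMSEQ_unique)
qed

lemma PK_bounded_measurable:
  assumes "cmod z < 1"
  shows "PK z \<in> borel_measurable borel" "0 \<le> PK z t \<and> PK z t \<le> (1 + cmod z) / (1 - cmod z)"
  using PK_le[OF assms] PK_pos[OF assms, of t] PK_continuous[OF assms, of UNIV]
  by (auto intro: borel_measurable_continuous_onI)

lemma poisson_jensen_bd:
  assumes a: "l2 a" and z: "cmod z < 1"
  shows "(cmod (pser a z))\<^sup>2 \<le> integral\<^sup>L circ (\<lambda>t. PK z t * (cmod (bd a t))\<^sup>2)"
proof (rule LIMSEQ_le)
  show "(\<lambda>N. (cmod (\<Sum>n<N. a n * z ^ n))\<^sup>2) \<longlonglongrightarrow> (cmod (pser a z))\<^sup>2"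
    by (intro tendsto_intros pser_trunc_tendsto a z)
  show "(\<lambda>N. integral\<^sup>L circ (\<lambda>t. PK z t * (cmod (\<Sum>n<N. a n * cis t ^ n))\<^sup>2)) \<longlonglongrightarrow> integral\<^sup>L circ (\<lambda>t. PK z t * (cmod (bd a t))\<^sup>2)"
    by (rule bd_weighted_tendsto[OF a PK_bounded_measurable[OF z]])
  have "(\<lambda>z. \<Sum>n<N. a n * z ^ n) holomorphic_on UNIV" for N by (intro holomorphic_intros)
  from poisson_jensen[OF this z]
  show "\<exists>N. \<forall>n\<ge>N. (cmod (\<Sum>n<n. a n * z ^ n))\<^sup>2 \<le> integral\<^sup>L circ (\<lambda>t. PK z t * (cmod (\<Sum>n<n. a n * cis t ^ n))\<^sup>2)"
    by blast
qed

section \<open>Lower bounds for logarithmic means\<close>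

lemma circ_dct:
  fixes f :: "real \<Rightarrow> 'a::{banach, second_countable_topology}"
  assumes [measurable]: "\<And>n::nat. s n \<in> borel_measurable borel" "f \<in> borel_measurable borel"
    and b: "\<And>n. AE t in circ. norm (s n t) \<le> B" and lim: "AE t in circ. (\<lambda>n. s n t) \<longlonglongrightarrow> f t"
  shows "(\<lambda>n. integral\<^sup>L circ (s n)) \<longlonglongrightarrow> integral\<^sup>L circ f"
  by (rule integral_dominated_convergence[where w = "\<lambda>_. B"])
    (use b lim in \<open>auto intro!: finite_measure.integrable_const[OF finite_measure_circ]\<close>)

section \<open>Approximation by real parts of polynomials on the circle\<close>

definition repoly :: "(complex \<Rightarrow> real) \<Rightarrow> bool" where
  "repoly f \<longleftrightarrow> continuous_on (sphere 0 1) f \<and> (\<exists>p. \<forall>z\<in>sphere 0 1. f z = Re (poly p z))"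

text \<open>Peeling off the constant coefficients of p and q leaves the product of the shorter
  polynomials multiplied by z * cnj z = 1, plus terms whose real parts come from polynomials. This
  makes the real parts of polynomials an algebra, as Stone-Weierstrass requires.\<close>

lemma repoly_product:
  fixes p q :: "complex poly"
  shows "\<exists>s. \<forall>z\<in>sphere 0 1. Re (poly p z * cnj (poly q z)) = Re (poly s z)"
proof (induction p q rule: poly_induct2)
  case (pCons a p b q)
  then obtain s where s: "\<And>z. z \<in> sphere 0 1 \<Longrightarrow> Re (poly p z * cnj (poly q z)) = Re (poly s z)" by auto
  show ?case
  proof (intro exI ballI)
    fix z :: complex assume z: "z \<in> sphere 0 1"
    hence zz: "z * cnj z = 1" using complex_norm_square[of z] by simp
    have "poly (pCons a p) z * cnj (poly (pCons b q) z) =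
       a * cnj b + cnj (cnj a * z * poly q z) + cnj b * z * poly p z + (z * cnj z) * (poly p z * cnj (poly q z))"
      by (simp add: algebra_simps)
    also have "Re \<dots> = Re (poly ([:a * cnj b:] + smult (cnj a) (pCons 0 q) + smult (cnj b) (pCons 0 p) + s) z)"
      unfolding zz using s[OF z] by (simp add: algebra_simps)
    finally show "Re (poly (pCons a p) z * cnj (poly (pCons b q) z)) = \<dots>" .
  qed
qed (rule exI[of _ 0], simp)

lemma repoly_approx:
  assumes "continuous_on (sphere 0 1) f" "e > 0"
  shows "\<exists>p. \<forall>z\<in>sphere 0 1. \<bar>f z - Re (poly p z)\<bar> < e"
proof -
  have "\<exists>g. repoly g \<and> (\<forall>z\<in>sphere 0 1. \<bar>f z - g z\<bar> < e)"
  proof (rule Stone_Weierstrass_HOL[where P = repoly])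
    show "repoly (\<lambda>x. c)" for c unfolding repoly_def by (auto intro!: exI[of _ "[:of_real c:]"])
    show "repoly f \<Longrightarrow> continuous_on (sphere 0 1) f" for f by (simp add: repoly_def)
    show "repoly f \<and> repoly g \<Longrightarrow> repoly (\<lambda>x. f x + g x)" for f g
      unfolding repoly_def by (auto intro!: continuous_intros) (metis poly_add plus_complex.sel(1))
    show "repoly f \<and> repoly g \<Longrightarrow> repoly (\<lambda>x. f x * g x)" for f g
    proof -
      assume fg: "repoly f \<and> repoly g"
      then obtain p q where pq: "\<And>z. z \<in> sphere 0 1 \<Longrightarrow> f z = Re (poly p z)" "\<And>z. z \<in> sphere 0 1 \<Longrightarrow> g z = Re (poly q z)"
        by (auto simp: repoly_def)
      obtain s where s: "\<And>z. z \<in> sphere 0 1 \<Longrightarrow> Re (poly p z * cnj (poly q z)) = Re (poly s z)"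
        using repoly_product by blast
      have "f z * g z = Re (poly (smult (1/2) (p * q + s)) z)" if z: "z \<in> sphere 0 1" for z
      proof -
        have "Re x * Re y = (Re (x * y) + Re (x * cnj y)) / 2" for x y by simp
        hence "f z * g z = (Re (poly p z * poly q z) + Re (poly p z * cnj (poly q z))) / 2"
          unfolding pq[OF z] .
        thus ?thesis unfolding s[OF z] by simp
      qed
      thus ?thesis using fg unfolding repoly_def by (blast intro: continuous_intros)
    qed
    show "\<exists>f. repoly f \<and> f x \<noteq> f y" if "x \<in> sphere 0 1 \<and> y \<in> sphere 0 1 \<and> x \<noteq> y" for x y :: complex
    proof (cases "Re x = Re y")
      case True
      hence "Im x \<noteq> Im y" using that complex_eqI by blast
      moreover have "repoly Im" unfolding repoly_def
        by (auto intro!: continuous_intros exI[of _ "[:0, -\<i>:]"])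
      ultimately show ?thesis by blast
    next
      case False
      moreover have "repoly Re" unfolding repoly_def
        by (auto intro!: continuous_intros exI[of _ "[:0, 1:]"])
      ultimately show ?thesis by blast
    qed
  qed (use assms in auto)
  thus ?thesis unfolding repoly_def by metis
qed

text \<open>\<open>Arg2pi\<close> jumps at 1; a function that vanishes near both ends of the period
  does not notice the jump.\<close>

lemma continuous_on_Arg2pi_cutoff:
  fixes y :: "real \<Rightarrow> real"
  assumes y: "continuous_on UNIV y" and d: "0 < d" "d < pi" and 0: "\<And>t. t \<le> d \<or> t \<ge> 2*pi - d \<Longrightarrow> y t = 0"
  shows "continuous_on (sphere 0 1) (\<lambda>z. y (Arg2pi z))"
  unfolding continuous_on_eq_continuous_within
proof
  fix z :: complex assume z: "z \<in> sphere 0 1"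
  show "continuous (at z within sphere 0 1) (\<lambda>z. y (Arg2pi z))"
  proof (cases "z \<in> \<real>\<^sub>\<ge>\<^sub>0")
    case False
    have "continuous (at (Arg2pi z)) y" using y by (simp add: continuous_on_eq_continuous_at)
    from continuous_at_compose[OF continuous_at_Arg2pi[OF False] this] show ?thesis
      by (simp add: o_def continuous_at_imp_continuous_at_within)
  next
    case True
    then obtain x where x: "z = of_real x" "x \<ge> 0" by (auto elim: nonneg_Reals_cases)
    hence z1: "z = 1" using z by simp
    have van: "y (Arg2pi w) = 0" if "w \<in> sphere 0 1" "Re w > cos d" for w
    proof (rule 0, rule ccontr)
      assume "\<not> (Arg2pi w \<le> d \<or> 2 * pi - d \<le> Arg2pi w)"
      hence a: "d < Arg2pi w" "Arg2pi w < 2*pi - d" by auto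
      have c: "Re w = cos (Arg2pi w)" using cos_Arg2pi[of w] that by simp
      have "cos (Arg2pi w) \<le> cos d"
      proof (cases "Arg2pi w \<le> pi")
        case True thus ?thesis using a d by (intro cos_monotone_0_pi_le) auto
      next
        case False
        have "cos (2*pi - Arg2pi w) \<le> cos d" using False a d by (intro cos_monotone_0_pi_le) auto
        thus ?thesis by simp
      qed
      thus False using c that by simp
    qed
    have cd: "cos d < 1" using cos_monotone_0_pi[of 0 d] d by simp
    have "open {w. Re w > cos d}" by (intro open_Collect_less continuous_intros)
    hence "eventually (\<lambda>w. Re w > cos d) (at z within sphere 0 1)"
      using cd z1 unfolding eventually_at_topological by (intro exI[of _ "{w. Re w > cos d}"]) auto
    hence "eventually (\<lambda>w. 0 = y (Arg2pi w)) (at z within sphere 0 1)"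
      using eventually_at_topological[of "\<lambda>w. w \<in> sphere 0 1" z "sphere 0 1"]
      by (auto simp: eventually_at_filter van elim!: eventually_mono)
    hence "((\<lambda>w. y (Arg2pi w)) \<longlongrightarrow> 0) (at z within sphere 0 1)"
      by (rule Lim_transform_eventually[OF tendsto_const])
    moreover have "y (Arg2pi z) = 0" using z1 cd by (intro van) auto
    ultimately show ?thesis by (simp add: continuous_within)
  qed
qed

text \<open>Measurable functions are almost everywhere limits of continuous ones; these are clamped
  to [-K, K], cut off near the ends of the period so as to descend to the circle, and then
  approximated uniformly. The uniform approximation costs the extra 1 in the bound.\<close>

lemma bounded_approx_repoly:
  assumes u [measurable]: "u \<in> borel_measurable borel" and K: "\<And>t. \<bar>u t\<bar> \<le> K"
  shows "\<exists>G :: nat \<Rightarrow> complex poly. (\<forall>n t. \<bar>Re (poly (G n) (cis t))\<bar> \<le> K + 1) \<and>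
    (AE t in circ. (\<lambda>n. Re (poly (G n) (cis t))) \<longlonglongrightarrow> u t)"
proof -
  have "u \<in> borel_measurable (lebesgue_on UNIV)"
    using measurable_completion[of u lborel borel] by (simp add: lebesgue_on_UNIV_eq)
  hence "u measurable_on UNIV" by (subst measurable_on_iff_borel_measurable) auto
  then obtain N v where N: "negligible N" and v: "\<And>n. continuous_on UNIV (v n)"
     and lim: "\<And>x. x \<notin> N \<Longrightarrow> (\<lambda>n. v n x) \<longlonglongrightarrow> u x"
    unfolding measurable_on_def by auto
  have K0: "K \<ge> 0" using K[of 0] by linarith
  \<comment> \<open>For n > 0, zero within 1 / n of the ends 0 and 2 pi, and 1 at distance at least
    2 / n from both.\<close>
  define ct where "ct n t = min 1 (max 0 (real n * t - 1)) * min 1 (max 0 (real n * (2*pi - t) - 1))" for n t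
  have ct01: "0 \<le> ct n t \<and> ct n t \<le> 1" for n t unfolding ct_def by (auto intro!: mult_nonneg_nonneg mult_le_one)
  have ctlim: "(\<lambda>n. ct n t) \<longlonglongrightarrow> 1" if t: "0 < t" "t < 2*pi" for t
  proof -
    have "filterlim (\<lambda>n. real n * c) at_top sequentially" if "c > 0" for c
      using filterlim_tendsto_pos_mult_at_top[OF tendsto_const[of c] that filterlim_real_sequentially] by (simp add: mult.commute)
    hence ev: "eventually (\<lambda>n. real n * c \<ge> 2) sequentially" if "c > 0" for c using that by (auto simp: filterlim_at_top)
    have "eventually (\<lambda>n. 1 = ct n t) sequentially"
      using eventually_conj[OF ev[of t] ev[of "2*pi - t"]] t by (auto elim!: eventually_mono simp: ct_def)
    thus ?thesis by (rule Lim_transform_eventually[OF tendsto_const])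
  qed
  define y where "y n t = ct (Suc n) t * max (-K) (min K (v n t))" for n t
  have yc: "continuous_on UNIV (y n)" for n
    unfolding y_def ct_def by (intro continuous_intros v)
  have yK: "\<bar>y n t\<bar> \<le> K" for n t
  proof -
    have "\<bar>y n t\<bar> \<le> 1 * K" unfolding y_def abs_mult using ct01 K0 by (intro mult_mono) auto
    thus ?thesis by simp
  qed
  have y0: "y n t = 0" if "t \<le> 1 / Suc n \<or> t \<ge> 2*pi - 1 / Suc n" for n t
  proof -
    have "real (Suc n) * t \<le> 1 \<or> real (Suc n) * (2*pi - t) \<le> 1"
      using that by (auto simp: field_simps)
    thus ?thesis unfolding y_def ct_def by auto
  qed
  have "\<exists>p. \<forall>z\<in>sphere 0 1. \<bar>y n (Arg2pi z) - Re (poly p z)\<bar> < 1 / Suc n" for n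
  proof (rule repoly_approx[OF continuous_on_Arg2pi_cutoff[OF yc]])
    have "1 / real (Suc n) \<le> 1" by simp
    thus "1 / real (Suc n) < pi" using pi_gt3 by linarith
  qed (use y0 in auto)
  then obtain G where G: "\<And>n z. z \<in> sphere 0 1 \<Longrightarrow> \<bar>y n (Arg2pi z) - Re (poly (G n) z)\<bar> < 1 / Suc n" by metis
  have G': "\<bar>y n (Arg2pi (cis t)) - Re (poly (G n) (cis t))\<bar> < 1 / Suc n" for n t by (rule G) simp
  have 1: "\<bar>Re (poly (G n) (cis t))\<bar> \<le> K + 1" for n t
  proof -
    have "1 / real (Suc n) \<le> 1" by simp
    thus ?thesis using G'[of n t] yK[of n "Arg2pi (cis t)"] by linarith
  qed
  have "N \<union> {0, 2*pi} \<in> null_sets lebesgue" using N by (simp add: negligible_iff_null_sets null_sets.Un)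
  hence "AE t in lebesgue. t \<notin> N \<union> {0, 2*pi}" by (rule AE_not_in)
  hence ae: "AE t in lborel. t \<notin> N \<union> {0, 2*pi}" by (simp add: AE_completion_iff)
  have 2: "AE t in circ. (\<lambda>n. Re (poly (G n) (cis t))) \<longlonglongrightarrow> u t"
    unfolding AE_circ using ae
  proof eventually_elim
    case (elim t)
    show ?case
    proof
      assume "t \<in> {0..2*pi}"
      with elim have t: "0 < t" "t < 2*pi" "t \<notin> N" by auto
      have A: "Arg2pi (cis t) = t" using Arg2pi_unique[of 1 t "cis t"] t by (simp add: cis_conv_exp)
      have "(\<lambda>n. y n t) \<longlonglongrightarrow> 1 * max (-K) (min K (u t))" unfolding y_def
        by (intro tendsto_intros lim t LIMSEQ_Suc[OF ctlim])
      also have "1 * max (-K) (min K (u t)) = u t" using K[of t] by auto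
      finally have yl: "(\<lambda>n. y n t) \<longlonglongrightarrow> u t" .
      have "(\<lambda>n. Re (poly (G n) (cis t)) - y n t) \<longlonglongrightarrow> 0"
      proof (rule Lim_null_comparison[OF _ LIMSEQ_Suc[OF lim_1_over_n]])
        show "\<forall>\<^sub>F n in sequentially. norm (Re (poly (G n) (cis t)) - y n t) \<le> 1 / real (Suc n)"
          using G'[of _ t] by (intro always_eventually) (auto simp: A abs_minus_commute intro: less_imp_le)
      qed
      from tendsto_add[OF this yl] show "(\<lambda>n. Re (poly (G n) (cis t))) \<longlonglongrightarrow> u t" by simp
    qed
  qed
  from 1 2 show ?thesis by blast
qed

lemma poly_cis_continuous [continuous_intros]: "continuous_on A (\<lambda>t. poly p (cis t))"
  by (intro continuous_intros)

lemma poly_cis_measurable [measurable]: "(\<lambda>t. poly p (cis t)) \<in> borel_measurable borel"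
  by (intro borel_measurable_continuous_onI continuous_intros)

text \<open>Adding \<open>e\<close> keeps the logarithm bounded, so it has uniformly bounded
  approximants \<open>G n\<close>, and both passages to the limit are covered by dominated
  convergence with constant bounds.\<close>

lemma poisson_log_eps:
  assumes w [measurable]: "w \<in> borel_measurable borel" and wB: "\<And>t. 0 \<le> w t \<and> w t \<le> B"
    and z: "cmod z < 1" and c: "c > 0"
    and H: "\<And>g :: complex poly. poly g z = 0 \<Longrightarrow> c \<le> integral\<^sup>L circ (\<lambda>t. PK z t * (w t * exp (2 * Re (poly g (cis t)))))"
    and e: "0 < e" "e \<le> 1"
  shows "ln c \<le> integral\<^sup>L circ (\<lambda>t. PK z t * ln (w t + e))"
proof -
  note [measurable] = PK_bounded_measurable(1)[OF z]
  define P where "P = (1 + cmod z) / (1 - cmod z)"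
  have PK: "0 \<le> PK z t" "PK z t \<le> P" for t using PK_bounded_measurable(2)[OF z, of t] by (auto simp: P_def)
  have P0: "P \<ge> 0" using PK[of 0] by linarith
  define K where "K = \<bar>ln e\<bar> + \<bar>ln (B + 1)\<bar>"
  define u where "u t = ln (w t + e)" for t
  have um [measurable]: "u \<in> borel_measurable borel" unfolding u_def by measurable
  have uK: "\<bar>u t\<bar> \<le> K" for t
  proof -
    have "ln e \<le> u t" "u t \<le> ln (B + 1)" unfolding u_def using wB[of t] e by (intro ln_mono; simp)+
    thus ?thesis unfolding K_def by linarith
  qed
  obtain G :: "nat \<Rightarrow> complex poly" where GK: "\<And>n t. \<bar>Re (poly (G n) (cis t))\<bar> \<le> K + 1"
    and Gl: "AE t in circ. (\<lambda>n. Re (poly (G n) (cis t))) \<longlonglongrightarrow> u t"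
    using bounded_approx_repoly[OF um uK] by auto
  define m where "m = integral\<^sup>L circ (\<lambda>t. PK z t * u t)"
  have GI: "integral\<^sup>L circ (\<lambda>t. PK z t * Re (poly (G n) (cis t))) = Re (poly (G n) z)" for n
  proof -
    have hol: "poly (G n) holomorphic_on UNIV" by (intro holomorphic_intros)
    have "Re (integral\<^sup>L circ (\<lambda>t. complex_of_real (PK z t) * poly (G n) (cis t))) = integral\<^sup>L circ (\<lambda>t. Re (complex_of_real (PK z t) * poly (G n) (cis t)))"
      by (rule integral_Re[OF poisson_circ(1)[OF hol z], symmetric])
    thus ?thesis using poisson_circ(2)[OF hol z] by simp
  qed
  have Glim: "(\<lambda>n. Re (poly (G n) z)) \<longlonglongrightarrow> m"
    unfolding GI[symmetric] m_def
  proof (rule circ_dct)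
    show "AE t in circ. norm (PK z t * Re (poly (G n) (cis t))) \<le> P * (K + 1)" for n
      using PK GK[of n] P0 by (intro AE_I2) (auto simp: abs_mult intro!: mult_mono)
    show "AE t in circ. (\<lambda>n. PK z t * Re (poly (G n) (cis t))) \<longlonglongrightarrow> PK z t * u t"
      using Gl by eventually_elim (intro tendsto_intros)
  qed measurable
  have ReGz: "\<bar>Re (poly (G n) z)\<bar> \<le> K + 1" for n
  proof -
    have hol: "(\<lambda>w. poly (G n) w) holomorphic_on UNIV" by (intro holomorphic_intros)
    have "\<bar>integral\<^sup>L circ (\<lambda>t. PK z t * Re (poly (G n) (cis t)))\<bar> \<le> integral\<^sup>L circ (\<lambda>t. \<bar>PK z t * Re (poly (G n) (cis t))\<bar>)"
      by (rule integral_abs_bound)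
    also have "\<dots> \<le> integral\<^sup>L circ (\<lambda>t. PK z t * (K + 1))"
    proof (rule integral_mono)
      have "continuous_on UNIV (\<lambda>t. \<bar>PK z t * Re (poly (G n) (cis t))\<bar>)" by (intro continuous_intros z)
      thus "integrable circ (\<lambda>t. \<bar>PK z t * Re (poly (G n) (cis t))\<bar>)" by (rule circ_continuous)
      show "integrable circ (\<lambda>t. PK z t * (K + 1))" using PK_integral(1)[OF z] by simp
      show "\<bar>PK z t * Re (poly (G n) (cis t))\<bar> \<le> PK z t * (K + 1)" for t
        unfolding abs_mult using PK GK by (intro mult_mono) auto
    qed
    also have "\<dots> = K + 1" using PK_integral[OF z] by simp
    finally show ?thesis unfolding GI .
  qed
  \<comment> \<open>Subtracting the value at z makes \<open>g n\<close> admissible in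
    \<open>H\<close>; the factor 1/2 cancels the 2 in \<open>exp (2 * Re g)\<close>, so that this
    exponential tends to exp m / (w + e).\<close>
  define g where "g n = smult (1/2) ([:poly (G n) z:] - G n)" for n
  have gz: "poly (g n) z = 0" for n by (simp add: g_def)
  have g2: "2 * Re (poly (g n) (cis t)) = Re (poly (G n) z) - Re (poly (G n) (cis t))" for n t
    by (simp add: g_def)
  define F where "F t = PK z t * (w t * exp (m - u t))" for t
  have "(\<lambda>n. integral\<^sup>L circ (\<lambda>t. PK z t * (w t * exp (2 * Re (poly (g n) (cis t)))))) \<longlonglongrightarrow> integral\<^sup>L circ F"
    unfolding g2 F_def[abs_def]
  proof (rule circ_dct)
    show "AE t in circ. norm (PK z t * (w t * exp (Re (poly (G n) z) - Re (poly (G n) (cis t))))) \<le> P * (B * exp (2 * (K + 1)))" for n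
    proof (intro AE_I2)
      fix t
      have "exp (Re (poly (G n) z) - Re (poly (G n) (cis t))) \<le> exp (2 * (K + 1))"
        using ReGz[of n] GK[of n t] by simp
      thus "norm (PK z t * (w t * exp (Re (poly (G n) z) - Re (poly (G n) (cis t))))) \<le> P * (B * exp (2 * (K + 1)))"
        unfolding real_norm_def abs_mult using PK[of t] P0 wB[of t] by (intro mult_mono) auto
    qed
    show "AE t in circ. (\<lambda>n. PK z t * (w t * exp (Re (poly (G n) z) - Re (poly (G n) (cis t))))) \<longlonglongrightarrow> PK z t * (w t * exp (m - u t))"
      using Gl by eventually_elim (intro tendsto_intros Glim)
  qed measurable
  hence cF: "c \<le> integral\<^sup>L circ F" by (rule LIMSEQ_le_const) (use H[OF gz] in blast)
  also have "\<dots> \<le> integral\<^sup>L circ (\<lambda>t. PK z t * exp m)"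
  proof (rule integral_mono)
    have Fle: "F t \<le> PK z t * exp m" "0 \<le> F t" for t
    proof -
      have pos: "w t + e > 0" using wB[of t] e by auto
      have "F t = PK z t * (exp m * (w t / (w t + e)))" unfolding F_def u_def using pos by (simp add: exp_diff)
      moreover have "exp m * (w t / (w t + e)) \<le> exp m * 1" using wB[of t] e pos by (intro mult_left_mono) auto
      ultimately show "F t \<le> PK z t * exp m" using PK(1)[of t] by (metis mult.right_neutral mult_left_mono)
      show "0 \<le> F t" unfolding F_def using PK wB by simp
    qed
    show "F t \<le> PK z t * exp m" for t by (rule Fle)
    show i: "integrable circ (\<lambda>t. PK z t * exp m)" using PK_integral(1)[OF z] by simp
    have Fm: "F \<in> borel_measurable circ" unfolding F_def[abs_def] by measurable
    show "integrable circ F"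
      by (rule Bochner_Integration.integrable_bound[OF i Fm]) (use Fle PK in \<open>auto intro!: AE_I2 simp: abs_of_nonneg\<close>)
  qed
  also have "\<dots> = exp m" using PK_integral[OF z] by simp
  finally have "ln c \<le> m" using c by (simp add: ln_le_cancel_iff[symmetric] del: ln_le_cancel_iff)
  thus ?thesis by (simp add: m_def u_def)
qed

text \<open>The hypothesis \<open>H\<close> says \<open>c \<le> \<integral> w |e\<^sup>g|\<^sup>2\<close> for all polynomials \<open>g\<close> vanishing at \<open>z\<close>; choosing
  \<open>2 Re g\<close> close to \<open>- ln (w + \<epsilon>)\<close> up to a constant gives the reverse of the inequality between
  arithmetic and geometric means.\<close>

lemma poisson_log_lower:
  assumes w [measurable]: "w \<in> borel_measurable borel" and wB: "\<And>t. 0 \<le> w t \<and> w t \<le> B"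
    and z: "cmod z < 1" and c: "c > 0"
    and H: "\<And>g :: complex poly. poly g z = 0 \<Longrightarrow> c \<le> integral\<^sup>L circ (\<lambda>t. PK z t * (w t * exp (2 * Re (poly g (cis t)))))"
  shows "AE t in circ. w t > 0" and "integrable circ (\<lambda>t. ln (w t))"
    and "ln c \<le> integral\<^sup>L circ (\<lambda>t. PK z t * ln (w t))"
proof -
  note [measurable] = PK_bounded_measurable(1)[OF z]
  have PK: "PK z t > 0" for t by (rule PK_pos[OF z])
  define e where "e k = 1 / real (Suc k)" for k
  have e: "0 < e k" "e k \<le> 1" for k by (auto simp: e_def)
  have el: "e \<longlonglongrightarrow> 0" unfolding e_def by (rule LIMSEQ_Suc[OF lim_1_over_n])
  define L where "L = ln (B + 1)"
  \<comment> \<open>\<open>L\<close> dominates all the regularized logarithms because w <= B and e k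
    <= 1, so these gaps are nonnegative and Fatou's lemma applies as e k tends to 0.\<close>
  define h where "h k t = PK z t * (L - ln (w t + e k))" for k t
  have h0: "0 \<le> h k t" for k t
  proof -
    have "ln (w t + e k) \<le> L" unfolding L_def using wB[of t] e[of k] by (intro ln_mono) auto
    thus ?thesis using PK[of t] by (simp add: h_def)
  qed
  have hm [measurable]: "h k \<in> borel_measurable borel" for k unfolding h_def by measurable
  define Q where "Q = L - ln c"
  have hI: "integrable circ (h k)" "integral\<^sup>L circ (h k) \<le> Q" for k
  proof -
    have i2: "integrable circ (\<lambda>t. PK z t * ln (w t + e k))"
    proof (rule Bochner_Integration.integrable_bound)
      show "integrable circ (\<lambda>t. PK z t * (\<bar>ln (e k)\<bar> + \<bar>L\<bar>))" using PK_integral(1)[OF z] by simp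
      show "AE t in circ. norm (PK z t * ln (w t + e k)) \<le> norm (PK z t * (\<bar>ln (e k)\<bar> + \<bar>L\<bar>))"
      proof (intro AE_I2)
        fix t
        have "ln (e k) \<le> ln (w t + e k)" "ln (w t + e k) \<le> L" unfolding L_def using wB[of t] e[of k]
          by (intro ln_mono; simp)+
        hence "\<bar>ln (w t + e k)\<bar> \<le> \<bar>ln (e k)\<bar> + \<bar>L\<bar>" by linarith
        thus "norm (PK z t * ln (w t + e k)) \<le> norm (PK z t * (\<bar>ln (e k)\<bar> + \<bar>L\<bar>))"
          unfolding real_norm_def abs_mult by (intro mult_left_mono) auto
      qed
    qed measurable
    have i1: "integrable circ (\<lambda>t. PK z t * L)" using PK_integral(1)[OF z] by simp
    have eq: "h k = (\<lambda>t. PK z t * L - PK z t * ln (w t + e k))" by (auto simp: h_def algebra_simps)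
    show "integrable circ (h k)" unfolding eq using i1 i2 by simp
    have "integral\<^sup>L circ (h k) = L - integral\<^sup>L circ (\<lambda>t. PK z t * ln (w t + e k))"
      unfolding eq using i1 i2 PK_integral[OF z] by simp
    thus "integral\<^sup>L circ (h k) \<le> Q" unfolding Q_def
      using poisson_log_eps[OF w wB z c H e] by simp
  qed
  have "0 \<le> integral\<^sup>L circ (h 0)" by (rule Bochner_Integration.integral_nonneg) (rule h0)
  hence Q0: "Q \<ge> 0" using hI(2)[of 0] by linarith
  define X where "X t = liminf (\<lambda>k. ennreal (h k t))" for t
  have Xm [measurable]: "X \<in> borel_measurable borel" unfolding X_def by measurable
  have XQ: "(\<integral>\<^sup>+t. X t \<partial>circ) \<le> ennreal Q"
  proof -
    have "(\<integral>\<^sup>+t. X t \<partial>circ) \<le> liminf (\<lambda>k. \<integral>\<^sup>+t. ennreal (h k t) \<partial>circ)"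
      unfolding X_def by (rule nn_integral_liminf) measurable
    also have "\<dots> \<le> liminf (\<lambda>k::nat. ennreal Q)"
    proof (rule Liminf_mono, rule always_eventually, rule allI)
      fix k
      have "(\<integral>\<^sup>+t. ennreal (h k t) \<partial>circ) = ennreal (integral\<^sup>L circ (h k))"
        by (rule nn_integral_eq_integral[OF hI(1)]) (use h0 in auto)
      thus "(\<integral>\<^sup>+t. ennreal (h k t) \<partial>circ) \<le> ennreal Q" using hI(2)[of k] by (simp add: ennreal_leI)
    qed
    finally show ?thesis by (simp add: Liminf_const)
  qed
  have Xfin: "AE t in circ. X t \<noteq> \<infinity>"
    by (rule nn_integral_PInf_AE) (use XQ in \<open>auto simp: top_unique\<close>)
  \<comment> \<open>Where w vanishes \<open>ln (w t)\<close> is only a default value, so these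
    points must be shown to form a null set before the limit of \<open>h k\<close> can be
    identified.\<close>
  have Xinf: "X t = \<infinity>" if "w t = 0" for t
  proof -
    have "filterlim (\<lambda>k. h k t) at_top sequentially"
    proof -
      have "filterlim e (at_right 0) sequentially"
        using el e by (auto simp: filterlim_at intro!: always_eventually) (metis less_irrefl)
      hence "filterlim (\<lambda>k. ln (e k)) at_bot sequentially" by (rule filterlim_compose[OF ln_at_0])
      hence "filterlim (\<lambda>k. L + - ln (e k)) at_top sequentially"
        by (intro filterlim_tendsto_add_at_top[OF tendsto_const]) (simp add: filterlim_uminus_at_bot)
      hence "filterlim (\<lambda>k. PK z t * (L + - ln (e k))) at_top sequentially"
        by (rule filterlim_tendsto_pos_mult_at_top[OF tendsto_const PK])
      thus ?thesis by (simp add: h_def that)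
    qed
    hence "(\<lambda>k. ennreal (h k t)) \<longlonglongrightarrow> \<infinity>" by (simp add: ennreal_tendsto_top_eq_at_top)
    thus ?thesis unfolding X_def by (simp add: lim_imp_Liminf)
  qed
  show pos: "AE t in circ. w t > 0" using Xfin
    by eventually_elim (use wB Xinf in \<open>auto simp: less_le\<close>)
  define f where "f t = PK z t * (L - ln (w t))" for t
  have Xeq: "AE t in circ. X t = ennreal (f t)"
    using pos
  proof eventually_elim
    case (elim t)
    have "(\<lambda>k. ennreal (h k t)) \<longlonglongrightarrow> ennreal (PK z t * (L - ln (w t + 0)))"
      unfolding h_def using elim by (intro tendsto_ennrealI tendsto_intros el) auto
    thus ?case unfolding X_def f_def by (simp add: lim_imp_Liminf)
  qed
  have f0: "AE t in circ. 0 \<le> f t" using pos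
  proof eventually_elim
    case (elim t)
    have "ln (w t) \<le> L" unfolding L_def using wB[of t] elim by (intro ln_mono) auto
    thus ?case using PK[of t] by (simp add: f_def)
  qed
  have fn: "(\<integral>\<^sup>+t. ennreal (f t) \<partial>circ) \<le> ennreal Q"
    using XQ nn_integral_cong_AE[OF Xeq] by simp
  have fm [measurable]: "f \<in> borel_measurable borel" unfolding f_def[abs_def] by measurable
  have fI: "integrable circ f" by (rule integrableI_nonneg) (use f0 fn in \<open>auto intro: order_le_less_trans\<close>)
  have "ennreal (integral\<^sup>L circ f) \<le> ennreal Q"
    using fn nn_integral_eq_integral[OF fI f0] by simp
  hence fQ: "integral\<^sup>L circ f \<le> Q" using Q0 by simp
  have i1: "integrable circ (\<lambda>t. PK z t * L)" using PK_integral(1)[OF z] by simp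
  have lnP: "integrable circ (\<lambda>t. PK z t * L - f t)" using i1 fI by (rule Bochner_Integration.integrable_diff)
  have eqP: "(\<lambda>t. PK z t * L - f t) = (\<lambda>t. PK z t * ln (w t))" by (auto simp: f_def algebra_simps)
  have "integral\<^sup>L circ (\<lambda>t. PK z t * ln (w t)) = L - integral\<^sup>L circ f"
    unfolding eqP[symmetric] using i1 fI PK_integral[OF z] by simp
  thus "ln c \<le> integral\<^sup>L circ (\<lambda>t. PK z t * ln (w t))" using fQ by (simp add: Q_def)
  \<comment> \<open>\<open>PK z\<close> is bounded away from 0, so integrability of the logarithm
    against it gives plain integrability.\<close>
  have low: "(1 - cmod z) / 2 * \<bar>x\<bar> \<le> \<bar>PK z t * x\<bar>" for t x
  proof -
    have "cmod (cis t - z) \<le> 1 + cmod z" using norm_triangle_ineq4[of "cis t" z] by simp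
    hence "(cmod (cis t - z))\<^sup>2 \<le> (1 + cmod z)\<^sup>2" by (intro power_mono) auto
    hence "(1 - (cmod z)\<^sup>2) / (1 + cmod z)\<^sup>2 \<le> PK z t" unfolding PK_def
      using z cis_minus_nz[OF z] by (intro divide_left_mono) (auto simp: abs_square_le_1 add_pos_nonneg intro!: mult_pos_pos)
    moreover have "(1 - (cmod z)\<^sup>2) / (1 + cmod z)\<^sup>2 = (1 - cmod z) / (1 + cmod z)"
    proof -
      have "1 + cmod z \<noteq> 0" using norm_ge_zero[of z] by linarith
      thus ?thesis by (simp add: power2_eq_square divide_simps) algebra
    qed
    moreover have "(1 - cmod z) / 2 \<le> (1 - cmod z) / (1 + cmod z)" using z by (intro divide_left_mono) (auto simp: add_pos_nonneg)
    ultimately have "(1 - cmod z) / 2 \<le> PK z t" by linarith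
    thus ?thesis unfolding abs_mult using PK[of t] by (intro mult_mono) auto
  qed
  have "integrable circ (\<lambda>t. (1 - cmod z) / 2 * ln (w t))"
  proof (rule Bochner_Integration.integrable_bound[OF lnP[unfolded eqP]])
    show "AE t in circ. norm ((1 - cmod z) / 2 * ln (w t)) \<le> norm (PK z t * ln (w t))"
      using low z by (intro AE_I2) (simp add: abs_mult)
  qed measurable
  from integrable_mult_right[OF this, of "2 / (1 - cmod z)"]
  show "integrable circ (\<lambda>t. ln (w t))" using z by simp
qed

section \<open>Convolutions of square summable sequences\<close>

definition l2n :: "(nat \<Rightarrow> 'a::real_normed_vector) \<Rightarrow> real" where
  "l2n a = sqrt (l2sq a)"

lemma l2n_nonneg: "l2 a \<Longrightarrow> l2n a \<ge> 0"
  by (simp add: l2n_def l2sq_nonneg)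

lemma l2n_sq: "l2 a \<Longrightarrow> (l2n a)\<^sup>2 = l2sq a"
  by (simp add: l2n_def l2sq_nonneg)

lemma l2n_bound:
  assumes "\<And>N. sqrt (\<Sum>n<N. (norm (a n))\<^sup>2) \<le> C"
  shows "l2 a" "l2n a \<le> C"
proof -
  have C: "0 \<le> C" using assms[of 0] by simp
  have b: "(\<Sum>n<N. (norm (a n))\<^sup>2) \<le> C\<^sup>2" for N
    using assms[of N] C by (metis real_le_lsqrt real_sqrt_le_iff real_sqrt_abs abs_of_nonneg)
  show l: "l2 a" unfolding l2_def by (rule summableI_nonneg_bounded[OF _ b]) simp
  have "l2sq a \<le> C\<^sup>2" unfolding l2sq_def by (rule suminf_le_const) (use l b in \<open>auto simp: l2_def\<close>)
  thus "l2n a \<le> C" unfolding l2n_def using C real_le_lsqrt l2sq_nonneg[OF l] by blast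
qed

lemma sqrt_sum_le_l2n: "l2 a \<Longrightarrow> sqrt (\<Sum>n<N. (norm (a n))\<^sup>2) \<le> l2n a"
  unfolding l2n_def by (intro real_sqrt_le_mono l2_sum_le)

lemma l2_add:
  assumes "l2 a" "l2 b"
  shows "l2 (\<lambda>n. a n + b n)" "l2n (\<lambda>n. a n + b n) \<le> l2n a + l2n b"
proof -
  have "sqrt (\<Sum>n<N. (norm (a n + b n))\<^sup>2) \<le> l2n a + l2n b" for N
  proof -
    have "sqrt (\<Sum>n<N. (norm (a n + b n))\<^sup>2) \<le> sqrt (\<Sum>n<N. (norm (a n) + norm (b n))\<^sup>2)"
      by (intro real_sqrt_le_mono sum_mono power_mono norm_triangle_ineq) auto
    also have "\<dots> \<le> sqrt (\<Sum>n<N. (norm (a n))\<^sup>2) + sqrt (\<Sum>n<N. (norm (b n))\<^sup>2)"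
      using L2_set_triangle_ineq[of "\<lambda>n. norm (a n)" "\<lambda>n. norm (b n)" "{..<N}"] by (simp add: L2_set_def)
    also have "\<dots> \<le> l2n a + l2n b" by (intro add_mono sqrt_sum_le_l2n assms)
    finally show ?thesis .
  qed
  from l2n_bound[OF this] show "l2 (\<lambda>n. a n + b n)" "l2n (\<lambda>n. a n + b n) \<le> l2n a + l2n b" .
qed

lemma l2_norm_cong: "(\<And>n. norm (a n) = norm (b n)) \<Longrightarrow> l2 a \<longleftrightarrow> l2 b" "(\<And>n. norm (a n) = norm (b n)) \<Longrightarrow> l2n a = l2n b"
  by (simp_all add: l2_def l2n_def l2sq_def)

lemma l2_mono:
  assumes "l2 b" "\<And>n. norm (a n) \<le> norm (b n)"
  shows "l2 a" "l2n a \<le> l2n b"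
proof -
  have "sqrt (\<Sum>n<N. (norm (a n))\<^sup>2) \<le> l2n b" for N
    by (rule order_trans[OF _ sqrt_sum_le_l2n[OF assms(1), of N]]) (intro real_sqrt_le_mono sum_mono power_mono assms(2) norm_ge_zero)
  from l2n_bound[OF this] show "l2 a" "l2n a \<le> l2n b" .
qed

lemma l2_scaleR:
  assumes "l2 a"
  shows "l2 (\<lambda>n. c *\<^sub>R a n)" "l2n (\<lambda>n. c *\<^sub>R a n) = \<bar>c\<bar> * l2n a"
  using assms by (simp_all add: l2_def l2n_def l2sq_def power_mult_distrib suminf_mult real_sqrt_mult)

lemma l2_mult:
  fixes a :: "nat \<Rightarrow> 'a::real_normed_div_algebra"
  assumes "l2 a"
  shows "l2 (\<lambda>n. c * a n)" "l2n (\<lambda>n. c * a n) = norm c * l2n a"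
    "l2 (\<lambda>n. a n * c)" "l2n (\<lambda>n. a n * c) = norm c * l2n a"
proof -
  have *: "l2 (\<lambda>n. norm c *\<^sub>R a n)" "l2n (\<lambda>n. norm c *\<^sub>R a n) = norm c * l2n a" using l2_scaleR[OF assms, of "norm c"] by simp_all
  show "l2 (\<lambda>n. c * a n)" "l2n (\<lambda>n. c * a n) = norm c * l2n a" "l2 (\<lambda>n. a n * c)" "l2n (\<lambda>n. a n * c) = norm c * l2n a"
    unfolding *(2)[symmetric] using *(1)
    by (subst l2_norm_cong; auto simp: norm_mult)+
qed

lemma l2_minus: "l2 a \<Longrightarrow> l2 (\<lambda>n. - a n)" "l2n (\<lambda>n. - a n) = l2n a"
  by (subst l2_norm_cong[of "\<lambda>n. - a n" a]; auto)+

lemma l2_diff: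
  assumes "l2 a" "l2 b"
  shows "l2 (\<lambda>n. a n - b n)" "l2n (\<lambda>n. a n - b n) \<le> l2n a + l2n b"
  using l2_add[OF assms(1) l2_minus(1)[OF assms(2)]] by (simp_all add: l2_minus(2))

lemma l2n_minus_commute: "l2n (\<lambda>n. a n - b n) = l2n (\<lambda>n. b n - a n)"
  by (rule l2_norm_cong) (simp add: norm_minus_commute)

lemma l2n_triangle_sub:
  assumes "l2 b" "l2 (\<lambda>n. a n - b n)"
  shows "l2 a" "l2n a \<le> l2n (\<lambda>n. a n - b n) + l2n b"
  using l2_add[OF assms(2,1)] by simp_all

lemma l2_sum:
  assumes "\<And>k. k \<in> A \<Longrightarrow> l2 (a k)"
  shows "l2 (\<lambda>n. \<Sum>k\<in>A. a k n) \<and> l2n (\<lambda>n. \<Sum>k\<in>A. a k n) \<le> (\<Sum>k\<in>A. l2n (a k))"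
  using assms
proof (induction A rule: infinite_finite_induct)
  case (insert x F)
  hence 1: "l2 (\<lambda>n. \<Sum>k\<in>F. a k n)" "l2n (\<lambda>n. \<Sum>k\<in>F. a k n) \<le> (\<Sum>k\<in>F. l2n (a k))" by auto
  have "l2 (a x)" using insert by auto
  from l2_add[OF this 1(1)] 1(2) show ?case using insert(1,2) by auto
qed (auto simp: l2_def l2n_def l2sq_def)

definition shiftr :: "nat \<Rightarrow> (nat \<Rightarrow> 'a::zero) \<Rightarrow> nat \<Rightarrow> 'a" where
  "shiftr k a n = (if k \<le> n then a (n - k) else 0)"

lemma l2_shiftr:
  assumes "l2 a" shows "l2 (shiftr k a)" "l2n (shiftr k a) = l2n a"
proof -
  have s: "(\<lambda>n. (norm (a n))\<^sup>2) sums l2sq a" using assms by (simp add: l2_def l2sq_def summable_sums)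
  have "(\<lambda>n. (norm (shiftr k a (n + k)))\<^sup>2) sums l2sq a" using s by (simp add: shiftr_def)
  from sums_iff_shift[THEN iffD1, OF this[unfolded sums_iff_shift]] 
  have "(\<lambda>n. (norm (shiftr k a n))\<^sup>2) sums (l2sq a + (\<Sum>n<k. (norm (shiftr k a n))\<^sup>2))"
    using sums_iff_shift[of "\<lambda>n. (norm (shiftr k a n))\<^sup>2" k "l2sq a"] \<open>(\<lambda>n. (norm (shiftr k a (n + k)))\<^sup>2) sums l2sq a\<close> by blast
  moreover have "(\<Sum>n<k. (norm (shiftr k a n))\<^sup>2) = 0" by (intro sum.neutral) (auto simp: shiftr_def)
  ultimately have "(\<lambda>n. (norm (shiftr k a n))\<^sup>2) sums l2sq a" by simp
  thus "l2 (shiftr k a)" "l2n (shiftr k a) = l2n a"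
    by (auto simp: l2_def l2n_def l2sq_def sums_iff)
qed

definition conv :: "(nat \<Rightarrow> 'a::semiring_0) \<Rightarrow> (nat \<Rightarrow> 'a) \<Rightarrow> nat \<Rightarrow> 'a" where
  "conv a b n = (\<Sum>k\<le>n. a k * b (n - k))"

definition delta0 :: "nat \<Rightarrow> 'a::zero_neq_one" where
  "delta0 n = (if n = 0 then 1 else 0)"

definition fins :: "(nat \<Rightarrow> 'a::zero) \<Rightarrow> bool" where
  "fins p \<longleftrightarrow> (\<exists>N. \<forall>n\<ge>N. p n = 0)"

text \<open>Convolution is the product of formal power series, from which associativity and the unit
  are inherited.\<close>

lemma conv_fps: "conv a b = fps_nth (Abs_fps a * Abs_fps b)"
  by (rule ext) (simp add: conv_def fps_mult_nth atLeast0AtMost)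

lemma conv_assoc: "conv (conv a b) c = conv a (conv b c)"
  by (simp add: conv_fps fps_nth_inverse mult.assoc)

lemma conv_delta0 [simp]:
  fixes a :: "nat \<Rightarrow> 'a::ring_1" shows "conv a delta0 = a" "conv delta0 a = a"
proof -
  have "Abs_fps delta0 = (1 :: 'a fps)" by (rule fps_ext) (simp add: delta0_def)
  thus "conv a delta0 = a" "conv delta0 a = a" by (simp_all add: conv_fps fun_eq_iff)
qed

lemma conv_diff_left: "conv (\<lambda>n. a n - b n) c n = conv a c n - conv (b :: nat \<Rightarrow> 'a::ring) c n"
  and conv_diff_right: "conv c (\<lambda>n. a n - b n) n = conv c a n - conv c (b :: nat \<Rightarrow> 'a::ring) n"
  and conv_add_left: "conv (\<lambda>n. a n + b n) c n = conv a c n + conv b c n"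
  by (simp_all add: conv_def algebra_simps sum_subtractf sum.distrib)

lemma conv_0: "conv a b 0 = a 0 * b 0" by (simp add: conv_def)

lemma conv_fins_right:
  assumes "\<forall>n\<ge>N. p n = 0"
  shows "conv a p = (\<lambda>n. \<Sum>k<N. shiftr k a n * p k)"
proof
  fix n
  have "conv a p n = (\<Sum>k\<le>n. a (n - k) * p k)"
    unfolding conv_def by (rule sum.reindex_bij_witness[of _ "\<lambda>k. n - k" "\<lambda>k. n - k"]) auto
  also have "\<dots> = (\<Sum>k\<in>{..n} \<union> {..<N}. shiftr k a n * p k)"
    by (rule sum.mono_neutral_cong_left) (auto simp: shiftr_def)
  also have "\<dots> = (\<Sum>k<N. shiftr k a n * p k)"
    by (rule sum.mono_neutral_right) (use assms in auto)
  finally show "conv a p n = (\<Sum>k<N. shiftr k a n * p k)" .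
qed

lemma conv_fins_left:
  assumes "\<forall>n\<ge>N. p n = 0"
  shows "conv p a = (\<lambda>n. \<Sum>k<N. p k * shiftr k a n)"
proof
  fix n
  have "conv p a n = (\<Sum>k\<in>{..n} \<union> {..<N}. p k * shiftr k a n)"
    unfolding conv_def by (rule sum.mono_neutral_cong_left) (auto simp: shiftr_def)
  also have "\<dots> = (\<Sum>k<N. p k * shiftr k a n)"
    by (rule sum.mono_neutral_right) (use assms in auto)
  finally show "conv p a n = (\<Sum>k<N. p k * shiftr k a n)" .
qed

lemma l2_conv_fins:
  fixes a :: "nat \<Rightarrow> 'a::real_normed_div_algebra"
  assumes a: "l2 a" and p: "\<forall>n\<ge>N. p n = 0"
  shows "l2 (conv a p)" "l2n (conv a p) \<le> (\<Sum>k<N. norm (p k)) * l2n a"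
    "l2 (conv p a)" "l2n (conv p a) \<le> (\<Sum>k<N. norm (p k)) * l2n a"
proof -
  have "l2 (\<lambda>n. shiftr k a n * p k)" "l2n (\<lambda>n. shiftr k a n * p k) = norm (p k) * l2n a"
    "l2 (\<lambda>n. p k * shiftr k a n)" "l2n (\<lambda>n. p k * shiftr k a n) = norm (p k) * l2n a" for k
    using l2_mult[OF l2_shiftr(1)[OF a, of k], of "p k"] l2_shiftr(2)[OF a, of k] by simp_all
  thus "l2 (conv a p)" "l2n (conv a p) \<le> (\<Sum>k<N. norm (p k)) * l2n a"
    "l2 (conv p a)" "l2n (conv p a) \<le> (\<Sum>k<N. norm (p k)) * l2n a"
    using l2_sum[of "{..<N}" "\<lambda>k n. shiftr k a n * p k"] l2_sum[of "{..<N}" "\<lambda>k n. p k * shiftr k a n"]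
    unfolding conv_fins_right[OF p] conv_fins_left[OF p] by (auto simp: sum_distrib_right)
qed

lemma fins_l2: "fins p \<Longrightarrow> l2 (p :: nat \<Rightarrow> 'a::real_normed_vector)"
proof -
  assume "fins p"
  then obtain N where "\<forall>n\<ge>N. p n = 0" by (auto simp: fins_def)
  thus "l2 p" unfolding l2_def by (intro summable_finite[of "{..<N}"]) (auto simp: not_less)
qed

lemma fins_delta0: "fins delta0" by (auto simp: fins_def delta0_def intro!: exI[of _ 1])

lemma fins_conv:
  assumes "fins p" "fins q" shows "fins (conv p q)"
proof -
  obtain N M where "\<forall>n\<ge>N. p n = 0" "\<forall>n\<ge>M. q n = 0" using assms by (auto simp: fins_def)
  hence "p k * q (n - k) = 0" if "n \<ge> N + M" "k \<le> n" for n k using that by (cases "k \<ge> N") auto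
  hence "\<forall>n\<ge>N+M. conv p q n = 0" unfolding conv_def by (intro allI impI sum.neutral) auto
  thus ?thesis unfolding fins_def by blast
qed

lemma fins_add: "fins p \<Longrightarrow> fins q \<Longrightarrow> fins (\<lambda>n. p n + q n :: 'a::monoid_add)"
  unfolding fins_def by (metis add_0 le_trans nat_le_linear)

text \<open>Only the constant 1 has to be approximated; multiplying the approximants on the right by
  polynomials gives density in everything (\<open>cyc_dense_gen\<close>). The polynomial stands on
  the right of \<open>a\<close>. Summability is a separate conjunct since \<open>l2n\<close> of a
  sequence that is not square summable is a meaningless value.\<close>

definition cyc :: "(nat \<Rightarrow> 'a::real_normed_div_algebra) \<Rightarrow> bool" where
  "cyc a \<longleftrightarrow> (\<forall>e>0. \<exists>p. fins p \<and> l2 (\<lambda>n. conv a p n - delta0 n) \<and> l2n (\<lambda>n. conv a p n - delta0 n) < e)"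

section \<open>Bounded power series\<close>

definition dsum :: "(nat \<Rightarrow> complex) \<Rightarrow> bool" where
  "dsum b \<longleftrightarrow> (\<forall>z. cmod z < 1 \<longrightarrow> summable (\<lambda>n. cmod (b n * z ^ n)))"

definition bser :: "(nat \<Rightarrow> complex) \<Rightarrow> real \<Rightarrow> bool" where
  "bser b M \<longleftrightarrow> dsum b \<and> (\<forall>z. cmod z < 1 \<longrightarrow> cmod (pser b z) \<le> M)"

lemma l2_dsum: "l2 a \<Longrightarrow> dsum a"
  by (simp add: dsum_def l2_powser_summable)

lemma pser_conv:
  assumes "dsum a" "dsum b"
  shows "dsum (conv a b)" "cmod z < 1 \<Longrightarrow> pser (conv a b) z = pser a z * pser b z"
proof -
  have eq: "conv a b n * z ^ n = (\<Sum>i\<le>n. (a i * z ^ i) * (b (n - i) * z ^ (n - i)))" for n z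
    unfolding conv_def sum_distrib_right
  proof (rule sum.cong)
    fix i assume "i \<in> {..n}"
    hence "z ^ n = z ^ i * z ^ (n - i)" by (simp flip: power_add)
    thus "a i * b (n - i) * z ^ n = a i * z ^ i * (b (n - i) * z ^ (n - i))" by simp
  qed simp
  show "dsum (conv a b)" unfolding dsum_def
  proof (intro allI impI)
    fix z :: complex assume z: "cmod z < 1"
    have sa: "summable (\<lambda>k. norm (cmod (a k * z ^ k)))" "summable (\<lambda>k. norm (cmod (b k * z ^ k)))"
      using assms z by (auto simp: dsum_def)
    show "summable (\<lambda>n. cmod (conv a b n * z ^ n))"
    proof (rule summable_comparison_test'[OF summable_Cauchy_product[OF sa], where N=0])
      show "norm (cmod (conv a b n * z ^ n)) \<le> (\<Sum>i\<le>n. cmod (a i * z ^ i) * cmod (b (n - i) * z ^ (n - i)))" for n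
        unfolding eq real_norm_def abs_norm_cancel by (rule order_trans[OF norm_sum]) (simp add: norm_mult)
    qed
  qed
  assume z: "cmod z < 1"
  show "pser (conv a b) z = pser a z * pser b z"
    unfolding pser_def eq by (rule Cauchy_product[symmetric]) (use assms z in \<open>auto simp: dsum_def\<close>)
qed

text \<open>On circles of radius r < 1 Parseval's identity is available for the product series and
  |b| <= M holds pointwise; bounds for finite sums of coefficients then survive r -> 1. With a = 1
  this shows that a bounded series is square summable.\<close>

lemma l2_conv_bounded:
  assumes b: "bser b M" and a: "l2 a"
  shows "l2 (conv b a)" "l2n (conv b a) \<le> M * l2n a"
proof -
  have M0: "M \<ge> 0" using b norm_ge_zero[of "pser b 0"] unfolding bser_def by (metis norm_zero order_trans zero_less_one)
  have db: "dsum b" using b by (simp add: bser_def)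
  define c where "c = conv b a"
  have dc: "dsum c" and pc: "cmod z < 1 \<Longrightarrow> pser c z = pser b z * pser a z" for z
    unfolding c_def using pser_conv[OF db l2_dsum[OF a]] by auto
  have r: "(\<Sum>n<N. (cmod (c n * of_real r ^ n))\<^sup>2) \<le> M\<^sup>2 * l2sq a" if r: "0 \<le> r" "r < 1" for r :: real and N
  proof -
    define d where "d n = c n * of_real r ^ n" for n
    have d1: "summable (\<lambda>n. cmod (d n))" using dc r unfolding dsum_def d_def by (auto dest: spec[of _ "of_real r"])
    have eq: "pser c (of_real r * cis t) = (\<Sum>n. d n * cis t ^ n)" for t
      by (simp add: pser_def d_def power_mult_distrib mult.assoc)
    have rz: "cmod (of_real r * cis t) < 1" for t using r by (simp add: norm_mult)
    have ia: "integrable circ (\<lambda>t. (cmod (pser a (of_real r * cis t)))\<^sup>2)"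
      by (intro circ_continuous continuous_intros pser_radial_continuous a r)
    have "(\<Sum>n<N. (cmod (d n))\<^sup>2) \<le> integral\<^sup>L circ (\<lambda>t. (cmod (pser c (of_real r * cis t)))\<^sup>2)"
      unfolding eq using parseval_l1(1)[OF d1] by (intro order_trans[OF sum_le_suminf eq_refl[OF sums_unique[symmetric]]]) (auto simp: sums_iff)
    also have "\<dots> \<le> integral\<^sup>L circ (\<lambda>t. M\<^sup>2 * (cmod (pser a (of_real r * cis t)))\<^sup>2)"
    proof (rule integral_mono)
      show "integrable circ (\<lambda>t. (cmod (pser c (of_real r * cis t)))\<^sup>2)" unfolding eq by (rule parseval_l1(2)[OF d1])
      show "integrable circ (\<lambda>t. M\<^sup>2 * (cmod (pser a (of_real r * cis t)))\<^sup>2)" using ia by simp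
      fix t
      have "cmod (pser b (of_real r * cis t)) \<le> M" using b rz by (simp add: bser_def)
      thus "(cmod (pser c (of_real r * cis t)))\<^sup>2 \<le> M\<^sup>2 * (cmod (pser a (of_real r * cis t)))\<^sup>2"
        unfolding pc[OF rz] norm_mult power_mult_distrib by (intro mult_right_mono power_mono) auto
    qed
    also have "\<dots> = M\<^sup>2 * integral\<^sup>L circ (\<lambda>t. (cmod (pser a (of_real r * cis t)))\<^sup>2)" by simp
    also have "\<dots> \<le> M\<^sup>2 * l2sq a"
    proof (rule mult_left_mono)
      have "ennreal (integral\<^sup>L circ (\<lambda>t. (cmod (pser a (of_real r * cis t)))\<^sup>2)) \<le> ennreal (l2sq a)"
        using radial_mean_le[OF a r] nn_integral_eq_integral[OF ia] by simp
      thus "integral\<^sup>L circ (\<lambda>t. (cmod (pser a (of_real r * cis t)))\<^sup>2) \<le> l2sq a"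
        using l2sq_nonneg[OF a] by simp
    qed simp
    finally show ?thesis by (simp add: d_def)
  qed
  have fin: "(\<Sum>n<N. (cmod (c n))\<^sup>2) \<le> M\<^sup>2 * l2sq a" for N
  proof (rule tendsto_upperbound)
    have "((\<lambda>r. \<Sum>n<N. (cmod (c n * of_real r ^ n))\<^sup>2) \<longlongrightarrow> (\<Sum>n<N. (cmod (c n * of_real 1 ^ n))\<^sup>2)) (at_left (1::real))"
      by (intro tendsto_intros)
    thus "((\<lambda>r. \<Sum>n<N. (cmod (c n * of_real r ^ n))\<^sup>2) \<longlongrightarrow> (\<Sum>n<N. (cmod (c n))\<^sup>2)) (at_left (1::real))" by simp
    show "\<forall>\<^sub>F r in at_left 1. (\<Sum>n<N. (cmod (c n * of_real r ^ n))\<^sup>2) \<le> M\<^sup>2 * l2sq a"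
      using at_left_1_ge by eventually_elim (auto intro: r)
  qed simp
  have "sqrt (\<Sum>n<N. (norm (c n))\<^sup>2) \<le> M * l2n a" for N
  proof -
    have "sqrt (\<Sum>n<N. (norm (c n))\<^sup>2) \<le> sqrt (M\<^sup>2 * l2sq a)" using fin by simp
    also have "\<dots> = M * l2n a" using M0 by (simp add: real_sqrt_mult l2n_def)
    finally show ?thesis .
  qed
  from l2n_bound[OF this] show "l2 (conv b a)" "l2n (conv b a) \<le> M * l2n a" by (simp_all add: c_def)
qed

lemma bser_l2: "bser b M \<Longrightarrow> l2 b"
  using l2_conv_bounded(1)[of b M delta0] fins_l2[OF fins_delta0] by simp

lemma bd_conv:
  assumes "l2 a" "l2 b"
  shows "AE t in circ. bd (conv a b) t = bd a t * bd b t"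
  using bd_AE[OF assms(1)] bd_AE[OF assms(2)]
proof eventually_elim
  case (elim t)
  have "((\<lambda>r. pser a (of_real r * cis t) * pser b (of_real r * cis t)) \<longlongrightarrow> bd a t * bd b t) (at_left 1)"
    by (intro tendsto_mult elim)
  moreover have "\<forall>\<^sub>F r in at_left 1. pser a (of_real r * cis t) * pser b (of_real r * cis t) = pser (conv a b) (of_real r * cis t)"
    using at_left_1_ge by eventually_elim (subst pser_conv, auto simp: norm_mult l2_dsum assms)
  ultimately show ?case by (intro bd_eqI) (rule Lim_transform_eventually)
qed

lemma bd_bounded:
  assumes b: "bser b M" shows "AE t in circ. cmod (bd b t) \<le> M"
  using bd_AE[OF bser_l2[OF b]]
proof eventually_elim
  case (elim t)
  show ?case
  proof (rule tendsto_upperbound[OF tendsto_norm[OF elim]])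
    show "\<forall>\<^sub>F r in at_left 1. cmod (pser b (of_real r * cis t)) \<le> M"
      using at_left_1_ge by eventually_elim (use b in \<open>auto simp: bser_def norm_mult\<close>)
  qed simp
qed

lemma fins_poly: "fins p \<Longrightarrow> \<exists>P. coeff P = p"
proof -
  assume "fins p"
  then obtain N where N: "\<forall>n\<ge>N. p n = 0" by (auto simp: fins_def)
  have "coeff (Poly (map p [0..<N])) = p"
    by (rule ext) (use N in \<open>auto simp: coeff_Poly_eq nth_default_def\<close>)
  thus ?thesis by blast
qed

lemma fins_coeff: "fins (coeff P)"
  unfolding fins_def using coeff_eq_0[of P] by (metis Suc_le_lessD)

lemma pser_coeff: "pser (coeff P) z = poly P z"
proof -
  have "pser (coeff P) z = (\<Sum>n\<le>degree P. coeff P n * z ^ n)" unfolding pser_def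
    by (rule suminf_finite) (auto simp: coeff_eq_0 not_le)
  thus ?thesis by (simp add: poly_altdef)
qed

lemma dsum_coeff: "dsum (coeff P)" by (intro l2_dsum fins_l2 fins_coeff)

lemma bd_coeff: "bd (coeff P) t = poly P (cis t)"
proof (rule bd_eqI, unfold pser_coeff)
  have "((\<lambda>r. poly P (of_real r * cis t)) \<longlongrightarrow> poly P (of_real 1 * cis t)) (at_left 1)"
    by (intro tendsto_intros)
  thus "((\<lambda>r. poly P (of_real r * cis t)) \<longlongrightarrow> poly P (cis t)) (at_left 1)" by simp
qed

lemma poly_bound:
  "cmod z \<le> 1 \<Longrightarrow> cmod (poly P z) \<le> (\<Sum>i\<le>degree P. cmod (coeff P i))"
  unfolding poly_altdef by (rule order_trans[OF norm_sum]) (auto simp: norm_mult norm_power intro!: sum_mono mult_left_le power_le_one)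

lemma bser_coeff: "bser (coeff P) (\<Sum>i\<le>degree P. cmod (coeff P i))"
  unfolding bser_def by (auto simp: dsum_coeff pser_coeff intro!: poly_bound)

section \<open>Jensen's inequality and cyclic power series\<close>

text \<open>Taylor polynomials of e^g, since in \<open>conv b p\<close> only polynomial factors are
  allowed. If g vanishes at z and K > 0, the value at z is exactly 1, so multiplying b by them keeps
  its value at z.\<close>

definition exp_poly :: "complex poly \<Rightarrow> nat \<Rightarrow> complex poly" where
  "exp_poly g K = (\<Sum>k<K. smult (1 / fact k) (g ^ k))"

lemma poly_exp_poly: "poly (exp_poly g K) z = (\<Sum>k<K. poly g z ^ k /\<^sub>R fact k)"
  by (simp add: exp_poly_def poly_sum poly_power scaleR_conv_of_real divide_inverse)

lemma poly_exp_poly_root: "poly g z = 0 \<Longrightarrow> K > 0 \<Longrightarrow> poly (exp_poly g K) z = 1"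
  unfolding poly_exp_poly by (subst sum.remove[of _ 0]) (auto intro!: sum.neutral simp: power_0_left)

lemma exp_poly_tendsto: "(\<lambda>K. poly (exp_poly g K) z) \<longlonglongrightarrow> exp (poly g z)"
  unfolding poly_exp_poly using exp_converges[of "poly g z"] by (simp add: sums_def)

lemma exp_poly_bound:
  assumes "cmod z \<le> 1"
  shows "cmod (poly (exp_poly g K) z) \<le> exp (\<Sum>i\<le>degree g. cmod (coeff g i))"
proof -
  let ?C = "\<Sum>i\<le>degree g. cmod (coeff g i)"
  have C0: "?C \<ge> 0" by (intro sum_nonneg) auto
  have "cmod (poly (exp_poly g K) z) \<le> (\<Sum>k<K. ?C ^ k /\<^sub>R fact k)"
    unfolding poly_exp_poly
    by (rule order_trans[OF norm_sum])
      (auto simp: norm_power intro!: sum_mono power_mono poly_bound assms divide_right_mono mult_left_mono)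
  also have "\<dots> \<le> exp ?C"
    using sum_le_suminf[OF sums_summable[OF exp_converges[of ?C]], of "{..<K}"] C0
    by (simp add: exp_def)
  finally show ?thesis .
qed

lemma exp_poly_integral:
  assumes b: "bser b M" and z: "cmod z < 1"
  shows "(\<lambda>K. integral\<^sup>L circ (\<lambda>t. PK z t * (cmod (bd (conv b (coeff (exp_poly g K))) t))\<^sup>2))
     \<longlonglongrightarrow> integral\<^sup>L circ (\<lambda>t. PK z t * ((cmod (bd b t))\<^sup>2 * exp (2 * Re (poly g (cis t)))))"
proof -
  have bl: "l2 b" by (rule bser_l2[OF b])
  note [measurable] = bd_measurable[OF bl] PK_bounded_measurable(1)[OF z]
  define P where "P = (1 + cmod z) / (1 - cmod z)"
  have PK: "0 \<le> PK z t" "PK z t \<le> P" for t using PK_bounded_measurable(2)[OF z, of t] by (auto simp: P_def)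
  define C where "C = exp (\<Sum>i\<le>degree g. cmod (coeff g i))"
  have e2: "exp (2 * Re x) = (cmod (exp x))\<^sup>2" for x by (simp add: norm_exp_eq_Re flip: exp_double)
  have "(\<lambda>K. integral\<^sup>L circ (\<lambda>t. PK z t * ((cmod (bd b t))\<^sup>2 * (cmod (poly (exp_poly g K) (cis t)))\<^sup>2)))
     \<longlonglongrightarrow> integral\<^sup>L circ (\<lambda>t. PK z t * ((cmod (bd b t))\<^sup>2 * exp (2 * Re (poly g (cis t)))))"
    unfolding e2
  proof (rule circ_dct)
    show "AE t in circ. norm (PK z t * ((cmod (bd b t))\<^sup>2 * (cmod (poly (exp_poly g K) (cis t)))\<^sup>2)) \<le> P * (M\<^sup>2 * C\<^sup>2)" for K
      using bd_bounded[OF b]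
    proof eventually_elim
      case (elim t)
      have "cmod (poly (exp_poly g K) (cis t)) \<le> C" unfolding C_def by (rule exp_poly_bound) simp
      thus ?case unfolding real_norm_def abs_mult using PK[of t] elim by (intro mult_mono) (auto intro!: power_mono)
    qed
    show "AE t in circ. (\<lambda>K. PK z t * ((cmod (bd b t))\<^sup>2 * (cmod (poly (exp_poly g K) (cis t)))\<^sup>2))
       \<longlonglongrightarrow> PK z t * ((cmod (bd b t))\<^sup>2 * (cmod (exp (poly g (cis t))))\<^sup>2)"
      by (intro AE_I2 tendsto_intros exp_poly_tendsto)
  qed measurable
  moreover have "integral\<^sup>L circ (\<lambda>t. PK z t * (cmod (bd (conv b (coeff (exp_poly g K))) t))\<^sup>2)
     = integral\<^sup>L circ (\<lambda>t. PK z t * ((cmod (bd b t))\<^sup>2 * (cmod (poly (exp_poly g K) (cis t)))\<^sup>2))" for K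
  proof (rule integral_cong_AE)
    have l: "l2 (coeff (exp_poly g K))" "l2 (conv b (coeff (exp_poly g K)))"
      using l2_conv_bounded(1)[OF b fins_l2[OF fins_coeff]] fins_l2[OF fins_coeff] by auto
    note [measurable] = bd_measurable[OF l(2)]
    show "(\<lambda>t. PK z t * (cmod (bd (conv b (coeff (exp_poly g K))) t))\<^sup>2) \<in> borel_measurable circ" by measurable
    show "(\<lambda>t. PK z t * ((cmod (bd b t))\<^sup>2 * (cmod (poly (exp_poly g K) (cis t)))\<^sup>2)) \<in> borel_measurable circ" by measurable
    show "AE t in circ. PK z t * (cmod (bd (conv b (coeff (exp_poly g K))) t))\<^sup>2 = PK z t * ((cmod (bd b t))\<^sup>2 * (cmod (poly (exp_poly g K) (cis t)))\<^sup>2)"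
      using bd_conv[OF bl l(1)] by eventually_elim (simp add: norm_mult power_mult_distrib bd_coeff)
  qed
  ultimately show ?thesis by simp
qed

lemma truncated_weight:
  assumes b: "bser b M"
  shows "AE t in circ. min ((cmod (bd b t))\<^sup>2) (M\<^sup>2) = (cmod (bd b t))\<^sup>2"
  using bd_bounded[OF b] by eventually_elim (simp add: min_def power_mono)

lemma poisson_log_lower_bser:
  assumes b: "bser b M" and z: "cmod z < 1" and c: "c > 0"
    and H: "\<And>g :: complex poly. poly g z = 0 \<Longrightarrow> c \<le> integral\<^sup>L circ (\<lambda>t. PK z t * ((cmod (bd b t))\<^sup>2 * exp (2 * Re (poly g (cis t)))))"
  shows "AE t in circ. bd b t \<noteq> 0" "integrable circ (\<lambda>t. ln (cmod (bd b t)))"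
    "ln c \<le> 2 * integral\<^sup>L circ (\<lambda>t. PK z t * ln (cmod (bd b t)))"
proof -
  \<comment> \<open>\<open>bd b\<close> is bounded by M only almost everywhere; the truncation makes
    the bound hold everywhere, as \<open>poisson_log_lower\<close> asks.\<close>
  define w where "w t = min ((cmod (bd b t))\<^sup>2) (M\<^sup>2)" for t
  note [measurable] = bd_measurable[OF bser_l2[OF b]] PK_bounded_measurable(1)[OF z]
  have wm [measurable]: "w \<in> borel_measurable borel" unfolding w_def by measurable
  have wB: "0 \<le> w t \<and> w t \<le> M\<^sup>2" for t by (simp add: w_def)
  have weq: "AE t in circ. w t = (cmod (bd b t))\<^sup>2" unfolding w_def by (rule truncated_weight[OF b])
  have H': "c \<le> integral\<^sup>L circ (\<lambda>t. PK z t * (w t * exp (2 * Re (poly g (cis t)))))" if "poly g z = 0" for g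
  proof -
    have "integral\<^sup>L circ (\<lambda>t. PK z t * (w t * exp (2 * Re (poly g (cis t))))) = integral\<^sup>L circ (\<lambda>t. PK z t * ((cmod (bd b t))\<^sup>2 * exp (2 * Re (poly g (cis t)))))"
      by (rule integral_cong_AE) (measurable, use weq in \<open>eventually_elim, simp\<close>)
    thus ?thesis using H[OF that] by simp
  qed
  have R: "AE t in circ. w t > 0" "integrable circ (\<lambda>t. ln (w t))" "ln c \<le> integral\<^sup>L circ (\<lambda>t. PK z t * ln (w t))"
    using poisson_log_lower[OF wm wB z c] H' by blast+
  show pos: "AE t in circ. bd b t \<noteq> 0" using R(1) weq by eventually_elim auto
  have lneq: "AE t in circ. ln (w t) = 2 * ln (cmod (bd b t))" using pos weq
    by eventually_elim (simp add: ln_realpow)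
  have "integrable circ (\<lambda>t. 2 * ln (cmod (bd b t)))"
    by (rule integrable_cong_AE_imp[OF R(2)]) (measurable, use lneq in \<open>eventually_elim, simp\<close>)
  thus "integrable circ (\<lambda>t. ln (cmod (bd b t)))" by simp
  have "integral\<^sup>L circ (\<lambda>t. PK z t * ln (w t)) = integral\<^sup>L circ (\<lambda>t. 2 * (PK z t * ln (cmod (bd b t))))"
    by (rule integral_cong_AE) (measurable, use lneq in \<open>eventually_elim, simp\<close>)
  thus "ln c \<le> 2 * integral\<^sup>L circ (\<lambda>t. PK z t * ln (cmod (bd b t)))" using R(3) by simp
qed

text \<open>b e^g has the value of b at z whenever g (z) = 0, so the quadratic inequality
  \<open>poisson_jensen_bd\<close> makes |b (z)|^2 a lower bound as in
  \<open>poisson_log_lower_bser\<close>. Zeros of b elsewhere in the disc never enter.\<close>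

theorem poisson_log_jensen:
  assumes b: "bser b M" and z: "cmod z < 1" and nz: "pser b z \<noteq> 0"
  shows "AE t in circ. bd b t \<noteq> 0" "integrable circ (\<lambda>t. ln (cmod (bd b t)))"
    "ln (cmod (pser b z)) \<le> integral\<^sup>L circ (\<lambda>t. PK z t * ln (cmod (bd b t)))"
proof -
  have H: "(cmod (pser b z))\<^sup>2 \<le> integral\<^sup>L circ (\<lambda>t. PK z t * ((cmod (bd b t))\<^sup>2 * exp (2 * Re (poly g (cis t)))))"
    if g: "poly g z = 0" for g :: "complex poly"
  proof (rule LIMSEQ_le_const[OF exp_poly_integral[OF b z]], intro exI allI impI)
    fix K :: nat assume K: "1 \<le> K"
    let ?p = "coeff (exp_poly g K)"
    have l: "l2 (conv b ?p)" by (rule l2_conv_bounded(1)[OF b fins_l2[OF fins_coeff]])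
    have "pser (conv b ?p) z = pser b z * poly (exp_poly g K) z"
      using pser_conv(2)[OF l2_dsum[OF bser_l2[OF b]] dsum_coeff z] by (simp add: pser_coeff)
    also have "poly (exp_poly g K) z = 1" using poly_exp_poly_root[OF g] K by simp
    finally show "(cmod (pser b z))\<^sup>2 \<le> integral\<^sup>L circ (\<lambda>t. PK z t * (cmod (bd (conv b ?p) t))\<^sup>2)"
      using poisson_jensen_bd[OF l z] by simp
  qed
  have c: "(cmod (pser b z))\<^sup>2 > 0" using nz by simp
  from poisson_log_lower_bser[OF b z c H]
  show "AE t in circ. bd b t \<noteq> 0" "integrable circ (\<lambda>t. ln (cmod (bd b t)))"
    "ln (cmod (pser b z)) \<le> integral\<^sup>L circ (\<lambda>t. PK z t * ln (cmod (bd b t)))"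
    using nz by (auto simp: ln_realpow)
qed

lemma PK_0 [simp]: "PK 0 t = 1"
  by (simp add: PK_def)

lemma pser_0 [simp]: "pser b 0 = b 0"
  by (simp add: pser_def powser_zero)

lemma ln_mean_le:
  fixes v :: "real \<Rightarrow> real"
  assumes v: "AE t in circ. v t > 0" "integrable circ v" "integrable circ (\<lambda>t. ln (v t))"
  shows "integral\<^sup>L circ v > 0" "integral\<^sup>L circ (\<lambda>t. ln (v t)) \<le> ln (integral\<^sup>L circ v)"
proof -
  define m where "m = integral\<^sup>L circ v"
  have m0: "m \<ge> 0" unfolding m_def by (rule Bochner_Integration.integral_nonneg_AE) (use v(1) in \<open>eventually_elim, simp\<close>)
  have "m \<noteq> 0"
  proof
    assume "m = 0"
    hence "AE t in circ. v t = 0" unfolding m_def using v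
      by (subst (asm) integral_nonneg_eq_0_iff_AE) (auto elim: eventually_mono)
    with v(1) have "AE t in circ. False" by eventually_elim auto
    thus False using emeasure_circ by (simp add: AE_iff_measurable[of UNIV])
  qed
  hence mp: "m > 0" using m0 by simp
  thus "integral\<^sup>L circ v > 0" by (simp add: m_def)
  have ic: "integrable circ (\<lambda>t. c)" for c :: real by (rule finite_measure.integrable_const[OF finite_measure_circ])
  have "integral\<^sup>L circ (\<lambda>t. ln (v t)) \<le> integral\<^sup>L circ (\<lambda>t. v t / m + (ln m - 1))"
  proof (rule integral_mono_AE[OF v(3)])
    show "integrable circ (\<lambda>t. v t / m + (ln m - 1))" using v(2) ic by simp
    show "AE t in circ. ln (v t) \<le> v t / m + (ln m - 1)" using v(1)
    proof eventually_elim
      case (elim t)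
      have "ln (v t / m) \<le> v t / m - 1" using elim mp by (intro ln_le_minus_one) simp
      thus ?case using elim mp by (simp add: ln_div)
    qed
  qed
  also have "\<dots> = ln m" using v(2) ic mp by (simp add: measure_circ flip: m_def)
  finally show "integral\<^sup>L circ (\<lambda>t. ln (v t)) \<le> ln (integral\<^sup>L circ v)" by (simp add: m_def)
qed

lemma l2sq_remove_0:
  assumes "l2 (a :: nat \<Rightarrow> 'a::real_normed_algebra_1)"
  shows "l2 (\<lambda>n. a n - a 0 * delta0 n)" "l2sq (\<lambda>n. a n - a 0 * delta0 n) = l2sq a - (norm (a 0))\<^sup>2"
proof -
  have "(\<lambda>n. a n - a 0 * delta0 n) = tail a 1" by (auto simp: tail_def delta0_def)
  thus "l2 (\<lambda>n. a n - a 0 * delta0 n)" "l2sq (\<lambda>n. a n - a 0 * delta0 n) = l2sq a - (norm (a 0))\<^sup>2"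
    using l2_tail[OF assms, of 1] l2sq_tail[OF assms, of 1] by simp_all
qed

lemma l2n_delta0: "l2n (delta0 :: nat \<Rightarrow> 'a::real_normed_algebra_1) = 1"
proof -
  have "(\<lambda>n. (norm (delta0 n :: 'a))\<^sup>2) = (\<lambda>n. if n = 0 then 1 else 0)" by (auto simp: delta0_def)
  thus ?thesis by (simp add: l2n_def l2sq_def sums_unique[OF sums_single, symmetric])
qed

lemma l2n_ge_0th: "l2 a \<Longrightarrow> norm (a n) \<le> l2n a"
  unfolding l2n_def using l2_norm_le[of a n] by (simp add: real_le_rsqrt)

lemma cyc_approx:
  fixes a :: "nat \<Rightarrow> 'a::real_normed_div_algebra"
  assumes p: "l2 (\<lambda>n. conv a p n - delta0 n)" "l2n (\<lambda>n. conv a p n - delta0 n) < e"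
  shows "l2 (conv a p)" "l2n (conv a p) \<le> 1 + e" "1 - e \<le> norm (a 0) * norm (p 0)"
proof -
  from l2n_triangle_sub[OF fins_l2[OF fins_delta0] p(1)] p(2)
  show "l2 (conv a p)" "l2n (conv a p) \<le> 1 + e" by (auto simp: l2n_delta0)
  have "norm (conv a p 0 - delta0 0) < e" using l2n_ge_0th[OF p(1), of 0] p(2) by simp
  hence "norm (a 0 * p 0 - 1) < e" by (simp add: conv_0 delta0_def)
  moreover have "norm (1::'a) - norm (a 0 * p 0) \<le> norm (a 0 * p 0 - 1)" by (metis norm_minus_commute norm_triangle_ineq2)
  ultimately show "1 - e \<le> norm (a 0) * norm (p 0)" by (simp add: norm_mult)
qed

text \<open>Szego's theorem in the form: \<open>b\<close> is cyclic iff equality holds in Jensen's inequality at \<open>0\<close>.\<close>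

theorem cyc_iff_log_mean:
  assumes b: "bser b M"
  shows "cyc b \<longleftrightarrow> b 0 \<noteq> 0 \<and> integral\<^sup>L circ (\<lambda>t. ln (cmod (bd b t))) = ln (cmod (b 0))"
proof
  have bl: "l2 b" by (rule bser_l2[OF b])
  note [measurable] = bd_measurable[OF bl]
  {
    assume cyc: "cyc b"
    have b0: "b 0 \<noteq> 0"
    proof
      assume "b 0 = 0"
      obtain p where "l2 (\<lambda>n. conv b p n - delta0 n)" "l2n (\<lambda>n. conv b p n - delta0 n) < 1/2"
        using cyc unfolding cyc_def by (metis half_gt_zero zero_less_one)
      from cyc_approx(3)[OF this] \<open>b 0 = 0\<close> show False by simp
    qed
    note J = poisson_log_jensen[OF b, of 0, simplified, OF b0]
    have "integral\<^sup>L circ (\<lambda>t. ln (cmod (bd b t))) \<le> ln (cmod (b 0)) + (ln (1 + e) - ln (1 - e))" if e: "0 < e" "e < 1" for e :: real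
    proof -
      \<comment> \<open>The mean logarithm of |b p|^2 is at most the logarithm of its mean, hence at
        most 2 ln (1 + e). Jensen for p bounds the share of p below by 2 ln |p 0|, and |b 0| |p 0|
        >= 1 - e. What remains is ln |b 0| and an error vanishing with e.\<close>
      obtain p where p: "fins p" "l2 (\<lambda>n. conv b p n - delta0 n)" "l2n (\<lambda>n. conv b p n - delta0 n) < e"
        using cyc e unfolding cyc_def by blast
      note q = cyc_approx[OF p(2,3)]
      obtain P where P: "coeff P = p" using fins_poly[OF p(1)] by blast
      have p0: "p 0 \<noteq> 0" using q(3) e by auto
      have Jp: "AE t in circ. bd p t \<noteq> 0" "integrable circ (\<lambda>t. ln (cmod (bd p t)))"
        "ln (cmod (p 0)) \<le> integral\<^sup>L circ (\<lambda>t. ln (cmod (bd p t)))"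
        using poisson_log_jensen[OF bser_coeff[of P], of 0] p0 unfolding P by auto
      define v where "v t = (cmod (bd (conv b p) t))\<^sup>2" for t
      have veq: "AE t in circ. v t > 0 \<and> ln (v t) = 2 * ln (cmod (bd b t)) + 2 * ln (cmod (bd p t))"
        using bd_conv[OF bl fins_l2[OF p(1)]] J(1) Jp(1)
        by eventually_elim (simp add: v_def norm_mult ln_mult ln_realpow)
      note [measurable] = bd_measurable[OF q(1)]
      have i2: "integrable circ (\<lambda>t. 2 * ln (cmod (bd b t)) + 2 * ln (cmod (bd p t)))" using J(2) Jp(2) by simp
      have vm: "(\<lambda>t. ln (v t)) \<in> borel_measurable circ" unfolding v_def by measurable
      have iv: "integrable circ (\<lambda>t. ln (v t))"
        by (rule integrable_cong_AE_imp[OF i2 vm]) (use veq in \<open>eventually_elim, simp\<close>)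
      have v1: "AE t in circ. v t > 0" using veq by eventually_elim simp
      have v2: "integrable circ v" unfolding v_def[abs_def] by (rule bd_sq_integrable[OF q(1)])
      have pv: "integral\<^sup>L circ v = l2sq (conv b p)" unfolding v_def[abs_def] by (rule parseval_bd[OF q(1)])
      have "2 * integral\<^sup>L circ (\<lambda>t. ln (cmod (bd b t))) + 2 * integral\<^sup>L circ (\<lambda>t. ln (cmod (bd p t))) = integral\<^sup>L circ (\<lambda>t. ln (v t))"
      proof -
        have "integral\<^sup>L circ (\<lambda>t. ln (v t)) = integral\<^sup>L circ (\<lambda>t. 2 * ln (cmod (bd b t)) + 2 * ln (cmod (bd p t)))"
          by (rule integral_cong_AE[OF vm borel_measurable_integrable[OF i2]]) (use veq in \<open>eventually_elim, simp\<close>)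
        thus ?thesis using J(2) Jp(2) by simp
      qed
      also have "\<dots> \<le> ln (integral\<^sup>L circ v)" by (rule ln_mean_le[OF v1 v2 iv])
      also have "\<dots> = ln ((l2n (conv b p))\<^sup>2)" unfolding pv l2n_sq[OF q(1)] ..
      also have "\<dots> \<le> ln ((1 + e)\<^sup>2)"
      proof (rule ln_mono)
        show "0 < (l2n (conv b p))\<^sup>2" using ln_mean_le(1)[OF v1 v2 iv] unfolding pv l2n_sq[OF q(1)] .
        show "(l2n (conv b p))\<^sup>2 \<le> (1 + e)\<^sup>2" by (intro power_mono q(2) l2n_nonneg q(1))
      qed
      also have "\<dots> = 2 * ln (1 + e)" using e by (simp add: ln_realpow)
      finally have "integral\<^sup>L circ (\<lambda>t. ln (cmod (bd b t))) + ln (cmod (p 0)) \<le> ln (1 + e)" using Jp(3) by linarith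
      moreover have "ln (1 - e) \<le> ln (cmod (b 0)) + ln (cmod (p 0))"
        using q(3) e b0 p0 by (subst ln_mult_pos[symmetric]) (auto intro: ln_mono)
      ultimately show ?thesis by linarith
    qed
    moreover have "((\<lambda>e. ln (cmod (b 0)) + (ln (1 + e) - ln (1 - e))) \<longlongrightarrow> ln (cmod (b 0)) + (ln (1 + 0) - ln (1 - 0))) (at_right (0::real))"
      by (intro tendsto_intros) auto
    ultimately have "integral\<^sup>L circ (\<lambda>t. ln (cmod (bd b t))) \<le> ln (cmod (b 0))"
      by (intro tendsto_lowerbound[where F = "at_right (0::real)"])
        (auto intro!: eventually_mono[OF eventually_at_right_real[of 0 1]])
    with J(3) b0 show "b 0 \<noteq> 0 \<and> integral\<^sup>L circ (\<lambda>t. ln (cmod (bd b t))) = ln (cmod (b 0))" by simp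
  }
  assume A: "b 0 \<noteq> 0 \<and> integral\<^sup>L circ (\<lambda>t. ln (cmod (bd b t))) = ln (cmod (b 0))"
  show "cyc b" unfolding cyc_def
  proof (intro allI impI)
    fix e :: real assume e: "e > 0"
    \<comment> \<open>The excess over |b 0|^2 is the square of the error allowed before division by
      b 0. Equality in Jensen prevents c from being a lower bound for the weighted means.\<close>
    define c where "c = (cmod (b 0))\<^sup>2 + (e * cmod (b 0))\<^sup>2"
    have b2: "(cmod (b 0))\<^sup>2 > 0" "(e * cmod (b 0))\<^sup>2 > 0" using A e by auto
    hence cp: "c > 0" unfolding c_def by linarith
    have "\<exists>g :: complex poly. poly g 0 = 0 \<and> integral\<^sup>L circ (\<lambda>t. PK 0 t * ((cmod (bd b t))\<^sup>2 * exp (2 * Re (poly g (cis t))))) < c"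
    proof (rule ccontr)
      assume "\<not> ?thesis"
      hence "\<And>g :: complex poly. poly g 0 = 0 \<Longrightarrow> c \<le> integral\<^sup>L circ (\<lambda>t. PK 0 t * ((cmod (bd b t))\<^sup>2 * exp (2 * Re (poly g (cis t)))))"
        by (meson not_le)
      from poisson_log_lower_bser(3)[OF b _ cp this] have "ln c \<le> 2 * ln (cmod (b 0))" using A by simp
      also have "\<dots> = ln ((cmod (b 0))\<^sup>2)" using A by (simp add: ln_realpow)
      finally have "c \<le> (cmod (b 0))\<^sup>2" using cp b2(1) ln_le_cancel_iff by blast
      thus False using b2 by (simp add: c_def)
    qed
    then obtain g :: "complex poly" where g: "poly g 0 = 0"
      "integral\<^sup>L circ (\<lambda>t. PK 0 t * ((cmod (bd b t))\<^sup>2 * exp (2 * Re (poly g (cis t))))) < c" by blast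
    have "cmod (0::complex) < 1" by simp
    from order_tendstoD(2)[OF exp_poly_integral[OF b this] g(2)]
    obtain K where K: "integral\<^sup>L circ (\<lambda>t. PK 0 t * (cmod (bd (conv b (coeff (exp_poly g K))) t))\<^sup>2) < c" "K > 0"
      unfolding eventually_sequentially by (metis le_add1 le_add2 less_add_one add_pos_nonneg less_numeral_extra(1) zero_le)
    define p where "p = coeff (exp_poly g K)"
    have p0: "p 0 = 1" using poly_exp_poly_root[OF g(1) K(2)] by (simp add: p_def poly_0_coeff_0)
    have pf: "fins p" unfolding p_def by (rule fins_coeff)
    define q where "q = conv b p"
    have ql: "l2 q" unfolding q_def by (rule l2_conv_bounded(1)[OF b fins_l2[OF pf]])
    have qc: "l2sq q < c" using K(1) parseval_bd[OF ql] by (simp add: q_def p_def)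
    have q0: "q 0 = b 0" by (simp add: q_def conv_0 p0)
    \<comment> \<open>q has the constant term of b because p 0 = 1, so removing it lowers the
      squared norm by exactly |b 0|^2.\<close>
    define r where "r n = q n - q 0 * delta0 n" for n
    have r: "l2 r" "l2sq r < (e * cmod (b 0))\<^sup>2" using l2sq_remove_0[OF ql] qc by (simp_all add: r_def[abs_def] c_def q0)
    have rn: "l2n r < e * cmod (b 0)" unfolding l2n_def using r(2) e A by (intro real_less_lsqrt) auto
    define p' where "p' n = p n * inverse (b 0)" for n
    have "fins p'" using pf by (auto simp: fins_def p'_def)
    moreover have eq: "(\<lambda>n. conv b p' n - delta0 n) = (\<lambda>n. inverse (b 0) * r n)"
    proof
      fix n
      have "conv b p' n = inverse (b 0) * q n" unfolding q_def conv_def p'_def sum_distrib_left by (simp add: mult_ac)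
      thus "conv b p' n - delta0 n = inverse (b 0) * r n" using A by (simp add: r_def q0 algebra_simps)
    qed
    moreover have "l2 (\<lambda>n. inverse (b 0) * r n)" by (rule l2_mult(1)[OF r(1)])
    moreover have "l2n (\<lambda>n. inverse (b 0) * r n) < e"
    proof -
      have "l2n (\<lambda>n. inverse (b 0) * r n) = norm (inverse (b 0)) * l2n r" by (rule l2_mult(2)[OF r(1)])
      also have "\<dots> < norm (inverse (b 0)) * (e * cmod (b 0))" using A by (intro mult_strict_left_mono rn) auto
      also have "\<dots> = e" using A by (simp add: norm_inverse)
      finally show ?thesis .
    qed
    ultimately show "\<exists>p. fins p \<and> l2 (\<lambda>n. conv b p n - delta0 n) \<and> l2n (\<lambda>n. conv b p n - delta0 n) < e"
      by metis
  qed
qed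

section \<open>The outer function with given boundary modulus\<close>

text \<open>The real part of the kernel is \<open>PK z\<close>, so |exp (herglotz u z)| is the
  exponential of the Poisson integral of u.\<close>

definition herglotz :: "(real \<Rightarrow> real) \<Rightarrow> complex \<Rightarrow> complex" where
  "herglotz u z = integral\<^sup>L circ (\<lambda>t. u t *\<^sub>R ((cis t + z) / (cis t - z)))"

lemma herglotz_kernel_Re: "cmod z < 1 \<Longrightarrow> Re ((cis t + z) / (cis t - z)) = PK z t"
proof -
  assume z: "cmod z < 1"
  have "(cmod (cis t))\<^sup>2 = 1" by simp
  hence c: "(cos t)\<^sup>2 + (sin t)\<^sup>2 = 1" by simp
  have "(cos t + Re z) * (cos t - Re z) + (sin t + Im z) * (sin t - Im z) = 1 - (cmod z)\<^sup>2"
    using c unfolding cmod_power2 by (simp add: power2_eq_square algebra_simps)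
  thus ?thesis by (simp add: PK_def Re_divide cmod_power2)
qed

lemma herglotz_kernel_cont: "cmod z < 1 \<Longrightarrow> continuous_on UNIV (\<lambda>t. (cis t + z) / (cis t - z))"
  using cis_minus_nz[of z] by (intro continuous_intros) auto

lemma herglotz_kernel_bound: "cmod z < 1 \<Longrightarrow> cmod ((cis t + z) / (cis t - z)) \<le> 2 / (1 - cmod z)"
proof -
  assume z: "cmod z < 1"
  have "1 - cmod z \<le> cmod (cis t - z)" using norm_triangle_ineq2[of "cis t" z] by simp
  moreover have "cmod (cis t + z) \<le> 2" using norm_triangle_ineq[of "cis t" z] z by simp
  ultimately show ?thesis unfolding norm_divide using z by (intro frac_le) auto
qed

lemma herglotz_integrable:
  assumes u: "integrable circ u" and z: "cmod z < 1"
  shows "integrable circ (\<lambda>t. u t *\<^sub>R ((cis t + z) / (cis t - z)))"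
proof (rule Bochner_Integration.integrable_bound[OF integrable_mult_left[OF u, of "2 / (1 - cmod z)"]])
  have [measurable]: "(\<lambda>t. (cis t + z) / (cis t - z)) \<in> borel_measurable borel"
    by (intro borel_measurable_continuous_onI herglotz_kernel_cont z)
  have [measurable]: "u \<in> borel_measurable borel" using borel_measurable_integrable[OF u] by simp
  show "(\<lambda>t. u t *\<^sub>R ((cis t + z) / (cis t - z))) \<in> borel_measurable circ" by measurable
  show "AE t in circ. norm (u t *\<^sub>R ((cis t + z) / (cis t - z))) \<le> norm (u t * (2 / (1 - cmod z)))"
    unfolding norm_scaleR real_norm_def abs_mult using order_trans[OF herglotz_kernel_bound[OF z] abs_ge_self]
    by (intro AE_I2 mult_left_mono) auto
qed

lemma herglotz_Re:
  assumes u: "integrable circ u" and z: "cmod z < 1"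
  shows "Re (herglotz u z) = integral\<^sup>L circ (\<lambda>t. PK z t * u t)"
  unfolding herglotz_def using integral_Re[OF herglotz_integrable[OF assms]]
  by (simp add: herglotz_kernel_Re[OF z] mult.commute del: Re_divide)

lemma herglotz_holomorphic:
  assumes u: "integrable circ u"
  shows "herglotz u holomorphic_on ball 0 1"
proof (rule power_series_holomorphic)
  fix z :: complex assume "z \<in> ball 0 1"
  hence z: "cmod z < 1" by simp
  \<comment> \<open>Coefficients of (1 + x) / (1 - x) = 1 + 2 x + 2 x^2 + ... at x = z
    e^(-it).\<close>
  define k where "k n t = (if n = 0 then 1 else 2) * cis (- t) ^ n" for n :: nat and t
  have [measurable]: "u \<in> borel_measurable borel" using borel_measurable_integrable[OF u] by simp
  have [measurable]: "k n \<in> borel_measurable borel" for n unfolding k_def[abs_def]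
    by (intro borel_measurable_continuous_onI continuous_intros)
  have kn: "cmod (k n t) \<le> 2" for n t by (simp add: k_def norm_mult norm_power)
  have iuk: "integrable circ (\<lambda>t. u t *\<^sub>R k n t)" for n
    by (rule Bochner_Integration.integrable_bound[OF integrable_mult_left[OF u, of 2]])
      (use kn in \<open>auto intro!: AE_I2 simp: abs_mult intro: mult_left_mono\<close>)
  have ks: "(\<lambda>n. k n t * z ^ n) sums ((cis t + z) / (cis t - z))" for t
  proof -
    define x where "x = z * cis (- t)"
    have x: "cmod x < 1" using z by (simp add: x_def norm_mult)
    hence x1: "1 - x \<noteq> 0" by auto
    have "(\<lambda>n. 2 * x ^ n - (if n = 0 then 1 else 0)) sums (2 * (1 / (1 - x)) - 1)"
      by (intro sums_diff sums_mult geometric_sums x sums_single)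
    moreover have "2 * x ^ n - (if n = 0 then 1 else 0) = k n t * z ^ n" for n
      by (simp add: k_def x_def power_mult_distrib)
    moreover have "2 * (1 / (1 - x)) - 1 = (cis t + z) / (cis t - z)"
    proof -
      have c: "cis t * cis (- t) = 1" by (simp add: cis_mult)
      have "2 * (1 / (1 - x)) - 1 = (1 + x) / (1 - x)" using x1 by (simp add: divide_simps)
      also have "\<dots> = (cis t * (1 + x)) / (cis t * (1 - x))" by simp
      also have "cis t * (1 + x) = cis t + z * (cis t * cis (-t))" by (simp add: x_def algebra_simps)
      also have "cis t * (1 - x) = cis t - z * (cis t * cis (-t))" by (simp add: x_def algebra_simps)
      finally show ?thesis unfolding c by simp
    qed
    ultimately show ?thesis by simp
  qed
  have bnd: "norm (u t *\<^sub>R (k n t * z ^ n)) \<le> \<bar>u t\<bar> * (2 * cmod z ^ n)" for n t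
    unfolding norm_scaleR norm_mult norm_power using kn[of n t] by (intro mult_left_mono mult_right_mono) auto
  have iu: "integrable circ (\<lambda>t. u t *\<^sub>R (k n t * z ^ n))" for n
    using integrable_mult_left[OF iuk[of n], of "z ^ n"] by (simp add: scaleR_conv_of_real mult.assoc)
  have "(\<lambda>n. integral\<^sup>L circ (\<lambda>t. u t *\<^sub>R (k n t * z ^ n))) sums integral\<^sup>L circ (\<lambda>t. \<Sum>n. u t *\<^sub>R (k n t * z ^ n))"
  proof (rule sums_integral[OF iu])
    have sg: "summable (\<lambda>n. c * (2 * cmod z ^ n))" for c using z by (intro summable_mult summable_geometric) simp
    show "AE t in circ. summable (\<lambda>n. norm (u t *\<^sub>R (k n t * z ^ n)))"
      by (intro AE_I2 summable_comparison_test'[OF sg, where N=0]) (use bnd in simp)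
    show "summable (\<lambda>n. integral\<^sup>L circ (\<lambda>t. norm (u t *\<^sub>R (k n t * z ^ n))))"
    proof (rule summable_comparison_test'[OF sg[of "integral\<^sup>L circ (\<lambda>t. \<bar>u t\<bar>)"], where N=0])
      fix n
      have "integral\<^sup>L circ (\<lambda>t. norm (u t *\<^sub>R (k n t * z ^ n))) \<le> integral\<^sup>L circ (\<lambda>t. \<bar>u t\<bar> * (2 * cmod z ^ n))"
        by (intro integral_mono integrable_norm iu integrable_mult_left integrable_abs u bnd)
      moreover have "0 \<le> integral\<^sup>L circ (\<lambda>t. norm (u t *\<^sub>R (k n t * z ^ n)))"
        by (rule Bochner_Integration.integral_nonneg) simp
      ultimately show "norm (integral\<^sup>L circ (\<lambda>t. norm (u t *\<^sub>R (k n t * z ^ n)))) \<le> integral\<^sup>L circ (\<lambda>t. \<bar>u t\<bar>) * (2 * cmod z ^ n)"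
        by simp
    qed
  qed
  moreover have "(\<Sum>n. u t *\<^sub>R (k n t * z ^ n)) = u t *\<^sub>R ((cis t + z) / (cis t - z))" for t
    by (rule sums_unique[OF sums_scaleR_right[OF ks], symmetric])
  moreover have "integral\<^sup>L circ (\<lambda>t. u t *\<^sub>R (k n t * z ^ n)) = integral\<^sup>L circ (\<lambda>t. u t *\<^sub>R k n t) * z ^ n" for n
  proof -
    have "(\<lambda>t. u t *\<^sub>R (k n t * z ^ n)) = (\<lambda>t. (u t *\<^sub>R k n t) * z ^ n)" by simp
    thus ?thesis by (simp only: integral_mult_left_zero)
  qed
  ultimately show "(\<lambda>n. integral\<^sup>L circ (\<lambda>t. u t *\<^sub>R k n t) * (z - 0) ^ n) sums herglotz u z"
    by (simp add: herglotz_def)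
qed

text \<open>Jensen's inequality at every z says that b divided by the exponential of the Herglotz
  integral has modulus at most 1; equality at 0 makes it 1 there, and the maximum principle makes
  the quotient constant.\<close>

theorem outer_formula:
  assumes b: "bser b M" and b0: "b 0 \<noteq> 0"
    and eq: "integral\<^sup>L circ (\<lambda>t. ln (cmod (bd b t))) = ln (cmod (b 0))"
  shows "\<exists>\<alpha>. cmod \<alpha> = 1 \<and> (\<forall>z. cmod z < 1 \<longrightarrow> pser b z = \<alpha> * exp (herglotz (\<lambda>t. ln (cmod (bd b t))) z))"
proof -
  let ?u = "\<lambda>t. ln (cmod (bd b t))"
  have u: "integrable circ ?u" using poisson_log_jensen(2)[OF b, of 0] b0 by simp
  define F where "F z = pser b z * exp (- herglotz ?u z)" for z
  have holF: "F holomorphic_on ball 0 1" unfolding F_def[abs_def]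
    by (intro holomorphic_intros pser_holomorphic herglotz_holomorphic u bser_l2[OF b])
  have le1: "cmod (F z) \<le> 1" if z: "cmod z < 1" for z
  proof (cases "pser b z = 0")
    case False
    have "cmod (F z) = cmod (pser b z) * exp (- integral\<^sup>L circ (\<lambda>t. PK z t * ?u t))"
      by (simp add: F_def norm_mult norm_exp_eq_Re herglotz_Re[OF u z])
    also have "\<dots> \<le> cmod (pser b z) * exp (- ln (cmod (pser b z)))"
      using poisson_log_jensen(3)[OF b z False] by (intro mult_left_mono) auto
    also have "\<dots> = 1" using False by (simp add: exp_minus)
    finally show ?thesis .
  qed (simp add: F_def)
  have F0: "cmod (F 0) = 1" using herglotz_Re[OF u, of 0] b0
    by (simp add: F_def norm_mult norm_exp_eq_Re eq) (simp add: exp_minus)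
  have "F constant_on ball 0 1"
    by (rule maximum_modulus_principle[OF holF open_ball _ open_ball order_refl, of 0]) (use le1 F0 in auto)
  then obtain \<alpha> where \<alpha>: "\<And>z. cmod z < 1 \<Longrightarrow> F z = \<alpha>" unfolding constant_on_def by auto
  have "cmod \<alpha> = 1" using \<alpha>[of 0] F0 by simp
  moreover have "pser b z = \<alpha> * exp (herglotz ?u z)" if "cmod z < 1" for z
    using \<alpha>[OF that] by (auto simp: F_def exp_minus field_simps)
  ultimately show ?thesis by blast
qed

text \<open>\<open>outer_H2_slice\<close> integrates over \<open>lebesgue\<close> a function built
  from \<open>radial_limit\<close>, which is known only up to null sets; completeness of the measure
  supplies its measurability.\<close>

lemma lebesgue_integral_circ:
  fixes f g :: "real \<Rightarrow> 'a::euclidean_space"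
  assumes g: "g \<in> borel_measurable borel" and eq: "AE t in circ. f t = g t"
  shows "(1 / (2*pi)) *\<^sub>R (LINT t:{0..2*pi}|lebesgue. f t) = integral\<^sup>L circ g"
proof -
  let ?i = "\<lambda>f t. indicator {0..2*pi} t *\<^sub>R f t :: 'a"
  have ae: "AE t in lebesgue. ?i g t = ?i f t"
    using AE_completion[OF eq[unfolded AE_circ]] by eventually_elim (auto simp: indicator_def)
  have gm: "?i g \<in> borel_measurable lborel" using g by measurable
  have gm': "?i g \<in> borel_measurable lebesgue" by (rule measurable_completion[OF gm])
  have fm: "?i f \<in> borel_measurable lebesgue"
  proof (rule measurableI)
    fix A :: "'a set" assume A: "A \<in> sets borel"
    show "?i f -` A \<inter> space lebesgue \<in> sets lebesgue"
    proof (rule complete_measure.in_sets_AE[of lebesgue])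
      show "complete_measure (lebesgue :: real measure)" by (rule completion.complete_measure_axioms)
      show "AE t in lebesgue. t \<in> ?i g -` A \<inter> space lebesgue \<longleftrightarrow> t \<in> ?i f -` A \<inter> space lebesgue"
        using ae by eventually_elim auto
      show "?i g -` A \<inter> space lebesgue \<in> sets lebesgue" by (rule measurable_sets[OF gm' A])
    qed auto
  qed auto
  have "(LINT t:{0..2*pi}|lebesgue. f t) = integral\<^sup>L lebesgue (?i g)"
    unfolding set_lebesgue_integral_def using ae by (intro integral_cong_AE fm gm') (auto elim: eventually_mono)
  also have "\<dots> = (LINT t:{0..2*pi}|lborel. g t)" unfolding set_lebesgue_integral_def by (rule integral_completion[OF gm])
  finally show ?thesis using integral_circ(1)[OF g] by simp
qed

section \<open>Slices\<close>

lemma imag_units_iff: "I \<in> \<S> \<longleftrightarrow> qre I = 0 \<and> (qi I)\<^sup>2 + (qj I)\<^sup>2 + (qk I)\<^sup>2 = 1"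
proof
  assume "I \<in> \<S>"
  hence h: "qre I * qre I - qi I * qi I - qj I * qj I - qk I * qk I = -1"
    "qre I * qi I = 0" "qre I * qj I = 0" "qre I * qk I = 0"
    by (auto simp: imag_units_def quat_eq_iff power2_eq_square)
  have "qre I = 0"
  proof (rule ccontr)
    assume "qre I \<noteq> 0"
    hence "qi I = 0" "qj I = 0" "qk I = 0" using h by auto
    hence "qre I * qre I = -1" using h(1) by simp
    moreover have "qre I * qre I \<ge> 0" by simp
    ultimately show False by linarith
  qed
  thus "qre I = 0 \<and> (qi I)\<^sup>2 + (qj I)\<^sup>2 + (qk I)\<^sup>2 = 1" using h(1) by (simp add: power2_eq_square)
next
  assume "qre I = 0 \<and> (qi I)\<^sup>2 + (qj I)\<^sup>2 + (qk I)\<^sup>2 = 1"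
  thus "I \<in> \<S>" by (simp add: imag_units_def quat_eq_iff power2_eq_square)
qed

lemma imag_unit_sq: "I \<in> \<S> \<Longrightarrow> I * I = -1"
  by (simp add: imag_units_def power2_eq_square)

lemma of_real_quat: "of_real r = Quat r 0 0 0"
  by (simp add: of_real_def quat_eq_iff)

lemma of_real_quat_sel [simp]: "qre (of_real r) = r" "qi (of_real r) = 0" "qj (of_real r) = 0" "qk (of_real r) = 0"
  by (simp_all add: of_real_quat)

lemma norm_quat_sq: "(norm (q::quat))\<^sup>2 = (qre q)\<^sup>2 + (qi q)\<^sup>2 + (qj q)\<^sup>2 + (qk q)\<^sup>2"
  by (simp add: norm_quat_def)

definition emb :: "quat \<Rightarrow> complex \<Rightarrow> quat" where
  "emb I z = of_real (Re z) + of_real (Im z) * I"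

lemma emb_add: "emb I (x + y) = emb I x + emb I y"
  and emb_diff: "emb I (x - y) = emb I x - emb I y"
  and emb_of_real [simp]: "emb I (of_real r) = of_real r"
  by (simp_all add: emb_def algebra_simps)

lemma emb_0 [simp]: "emb I 0 = 0" and emb_1 [simp]: "emb I 1 = 1" by (simp_all add: emb_def)

lemma emb_mult: "I \<in> \<S> \<Longrightarrow> emb I (x * y) = emb I x * emb I y"
  by (simp add: imag_units_iff emb_def quat_eq_iff power2_eq_square) (algebra)

lemma norm_emb: "I \<in> \<S> \<Longrightarrow> norm (emb I z) = cmod z"
proof -
  assume I: "I \<in> \<S>"
  have "(norm (emb I z))\<^sup>2 = (Re z)\<^sup>2 + (Im z)\<^sup>2 * ((qi I)\<^sup>2 + (qj I)\<^sup>2 + (qk I)\<^sup>2)"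
    using imag_units_iff[THEN iffD1, OF I, THEN conjunct1] by (simp add: norm_quat_sq emb_def power_mult_distrib algebra_simps)
  also have "(qi I)\<^sup>2 + (qj I)\<^sup>2 + (qk I)\<^sup>2 = 1" using I by (simp add: imag_units_iff)
  also have "(Re z)\<^sup>2 + (Im z)\<^sup>2 * 1 = (cmod z)\<^sup>2" by (simp add: cmod_power2)
  finally show ?thesis by simp
qed

lemma emb_power: "I \<in> \<S> \<Longrightarrow> emb I (x ^ n) = emb I x ^ n"
  by (induction n) (simp_all add: emb_mult)

lemma emb_scaleR: "emb I (r *\<^sub>R x) = r *\<^sub>R emb I x"
  by (simp add: emb_def quat_eq_iff algebra_simps)

lemma bounded_linear_emb: "I \<in> \<S> \<Longrightarrow> bounded_linear (emb I)"
  by (rule bounded_linear_intro[where K=1]) (auto simp: emb_add emb_scaleR norm_emb)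

lemma emb_inverse: "I \<in> \<S> \<Longrightarrow> emb I (inverse x) = inverse (emb I x)"
proof (cases "x = 0")
  case False
  assume I: "I \<in> \<S>"
  have "emb I x * emb I (inverse x) = 1" using False by (simp flip: emb_mult[OF I])
  thus ?thesis by (rule inverse_unique[symmetric])
qed simp

lemma emb_divide: "I \<in> \<S> \<Longrightarrow> emb I (x / y) = emb I x / emb I y"
  by (simp add: divide_inverse emb_mult emb_inverse)

lemma emb_exp: "I \<in> \<S> \<Longrightarrow> emb I (exp x) = exp (emb I x)"
proof -
  assume I: "I \<in> \<S>"
  have "(\<lambda>n. emb I (x ^ n /\<^sub>R fact n)) sums emb I (exp x)"
    by (rule bounded_linear.sums[OF bounded_linear_emb[OF I] exp_converges])
  moreover have "(\<lambda>n. emb I (x ^ n /\<^sub>R fact n)) = (\<lambda>n. emb I x ^ n /\<^sub>R fact n)"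
    using I by (simp add: emb_scaleR emb_power)
  ultimately show ?thesis using exp_converges[of "emb I x"] by (simp add: sums_unique2)
qed

lemma emb_cis: "emb I (cis t) = qcis I t"
  by (simp add: emb_def qcis_def)

lemma scaleR_emb: "r *\<^sub>R emb I z = emb I (of_real r * z)"
  by (simp add: emb_def quat_eq_iff algebra_simps)

lemma slice_plane_emb: "slice_plane I = range (emb I)"
proof -
  have "of_real x + of_real y * I = emb I (Complex x y)" for x y by (simp add: emb_def)
  thus ?thesis unfolding slice_plane_def by (auto simp: image_iff emb_def) (metis complex.sel)
qed

lemma slice_ball_emb: "I \<in> \<S> \<Longrightarrow> slice_ball I = emb I ` ball 0 1"
  unfolding slice_ball_def slice_plane_emb by (auto simp: norm_emb)

definition qim_unit :: quat where "qim_unit = Quat 0 1 0 0"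

lemma qim_unit_imag: "qim_unit \<in> \<S>" by (simp add: imag_units_iff qim_unit_def)

lemma quat_emb_cases:
  obtains I z where "I \<in> \<S>" "q = emb I z"
proof -
  define n where "n = sqrt ((qi q)\<^sup>2 + (qj q)\<^sup>2 + (qk q)\<^sup>2)"
  show thesis
  proof (cases "n = 0")
    case True
    hence "(qi q)\<^sup>2 + (qj q)\<^sup>2 + (qk q)\<^sup>2 = 0" by (simp add: n_def)
    hence "qi q = 0" "qj q = 0" "qk q = 0" by (smt (verit) zero_le_power2 zero_eq_power2)+
    hence "q = emb qim_unit (of_real (qre q))" by (simp add: quat_eq_iff)
    thus thesis using that qim_unit_imag by blast
  next
    case False
    define I where "I = Quat 0 (qi q / n) (qj q / n) (qk q / n)"
    have n2: "n\<^sup>2 = (qi q)\<^sup>2 + (qj q)\<^sup>2 + (qk q)\<^sup>2" by (simp add: n_def)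
    have "I \<in> \<S>" using False by (simp add: imag_units_iff I_def power_divide n2[symmetric] flip: add_divide_distrib)
    moreover have "q = emb I (Complex (qre q) n)" using False by (simp add: quat_eq_iff emb_def I_def)
    ultimately show thesis using that by blast
  qed
qed

section \<open>Component series and stem functions\<close>

definition pc :: "(quat \<Rightarrow> real) \<Rightarrow> (nat \<Rightarrow> quat) \<Rightarrow> nat \<Rightarrow> complex" where
  "pc m a n = of_real (m (a n))"

definition reQ :: "complex \<Rightarrow> complex \<Rightarrow> complex \<Rightarrow> complex \<Rightarrow> quat" where
  "reQ w0 w1 w2 w3 = Quat (Re w0) (Re w1) (Re w2) (Re w3)"

definition imQ :: "complex \<Rightarrow> complex \<Rightarrow> complex \<Rightarrow> complex \<Rightarrow> quat" where
  "imQ w0 w1 w2 w3 = Quat (Im w0) (Im w1) (Im w2) (Im w3)"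

text \<open>The real and imaginary parts of the stem function: \<open>f (x + y I) = sA a z + I sB a z\<close> for
  \<open>z = x + y \<i>\<close>; \<open>bA\<close> and \<open>bB\<close> are their boundary values.\<close>

definition sA :: "(nat \<Rightarrow> quat) \<Rightarrow> complex \<Rightarrow> quat" where
  "sA a z = reQ (pser (pc qre a) z) (pser (pc qi a) z) (pser (pc qj a) z) (pser (pc qk a) z)"

definition sB :: "(nat \<Rightarrow> quat) \<Rightarrow> complex \<Rightarrow> quat" where
  "sB a z = imQ (pser (pc qre a) z) (pser (pc qi a) z) (pser (pc qj a) z) (pser (pc qk a) z)"

definition bA :: "(nat \<Rightarrow> quat) \<Rightarrow> real \<Rightarrow> quat" where
  "bA a t = reQ (bd (pc qre a) t) (bd (pc qi a) t) (bd (pc qj a) t) (bd (pc qk a) t)"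

definition bB :: "(nat \<Rightarrow> quat) \<Rightarrow> real \<Rightarrow> quat" where
  "bB a t = imQ (bd (pc qre a) t) (bd (pc qi a) t) (bd (pc qj a) t) (bd (pc qk a) t)"

definition qds :: "(nat \<Rightarrow> quat) \<Rightarrow> bool" where
  "qds a \<longleftrightarrow> dsum (pc qre a) \<and> dsum (pc qi a) \<and> dsum (pc qj a) \<and> dsum (pc qk a)"

lemma qdsD: "qds a \<Longrightarrow> m \<in> {qre, qi, qj, qk} \<Longrightarrow> dsum (pc m a)" by (auto simp: qds_def)

lemma quat_decomp: "q = qre q *\<^sub>R Quat 1 0 0 0 + qi q *\<^sub>R Quat 0 1 0 0 + qj q *\<^sub>R Quat 0 0 1 0 + qk q *\<^sub>R Quat 0 0 0 1"
  by (simp add: quat_eq_iff)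

lemma tendsto_Quat:
  assumes "(f0 \<longlongrightarrow> k0) F" "(f1 \<longlongrightarrow> k1) F" "(f2 \<longlongrightarrow> k2) F" "(f3 \<longlongrightarrow> k3) F"
  shows "((\<lambda>x. Quat (f0 x) (f1 x) (f2 x) (f3 x)) \<longlongrightarrow> Quat k0 k1 k2 k3) F"
  by (subst (1 2) quat_decomp) (simp, intro tendsto_intros assms)

lemma abs_comp_le: "m \<in> {qre, qi, qj, qk} \<Longrightarrow> \<bar>m q\<bar> \<le> norm q"
  unfolding norm_quat_def by (auto intro!: real_le_rsqrt)

lemma tendsto_comp: "m \<in> {qre, qi, qj, qk} \<Longrightarrow> (f \<longlongrightarrow> l) F \<Longrightarrow> ((\<lambda>x. m (f x)) \<longlongrightarrow> m l) F"
proof -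
  assume m: "m \<in> {qre, qi, qj, qk}" and f: "(f \<longlongrightarrow> l) F"
  have "bounded_linear m"
    by (rule bounded_linear_intro[where K=1]) (use m abs_comp_le[OF m] in auto)
  from bounded_linear.tendsto[OF this f] show ?thesis .
qed

lemma comp_sum: "m \<in> {qre, qi, qj, qk} \<Longrightarrow> m (sum f A) = (\<Sum>x\<in>A. m (f x))"
  by (induction A rule: infinite_finite_induct) auto

lemma sums_quat_iff:
  "f sums s \<longleftrightarrow> (\<lambda>n. qre (f n)) sums qre s \<and> (\<lambda>n. qi (f n)) sums qi s \<and> (\<lambda>n. qj (f n)) sums qj s \<and> (\<lambda>n. qk (f n)) sums qk s"
proof
  assume "f sums s"
  thus "(\<lambda>n. qre (f n)) sums qre s \<and> (\<lambda>n. qi (f n)) sums qi s \<and> (\<lambda>n. qj (f n)) sums qj s \<and> (\<lambda>n. qk (f n)) sums qk s"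
    unfolding sums_def using tendsto_comp[of _ "\<lambda>n. \<Sum>i<n. f i" s] by (simp add: comp_sum)
next
  assume A: "(\<lambda>n. qre (f n)) sums qre s \<and> (\<lambda>n. qi (f n)) sums qi s \<and> (\<lambda>n. qj (f n)) sums qj s \<and> (\<lambda>n. qk (f n)) sums qk s"
  have "(\<lambda>N. Quat (\<Sum>n<N. qre (f n)) (\<Sum>n<N. qi (f n)) (\<Sum>n<N. qj (f n)) (\<Sum>n<N. qk (f n))) \<longlonglongrightarrow> Quat (qre s) (qi s) (qj s) (qk s)"
    by (intro tendsto_Quat) (use A in \<open>auto simp: sums_def\<close>)
  moreover have "Quat (\<Sum>n<N. qre (f n)) (\<Sum>n<N. qi (f n)) (\<Sum>n<N. qj (f n)) (\<Sum>n<N. qk (f n)) = (\<Sum>n<N. f n)" for N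
    by (simp add: quat_eq_iff comp_sum)
  ultimately show "f sums s" by (simp add: sums_def)
qed

lemma dsum_sums: "dsum a \<Longrightarrow> cmod z < 1 \<Longrightarrow> (\<lambda>n. a n * z ^ n) sums pser a z"
  unfolding pser_def dsum_def by (intro summable_sums) (rule summable_norm_cancel, blast)

lemma stem_sums:
  assumes a: "qds a" and z: "cmod z < 1"
  shows "(\<lambda>n. Re (z ^ n) *\<^sub>R a n) sums sA a z" "(\<lambda>n. Im (z ^ n) *\<^sub>R a n) sums sB a z"
proof -
  have "(\<lambda>n. pc m a n * z ^ n) sums pser (pc m a) z" if "m \<in> {qre, qi, qj, qk}" for m
    by (rule dsum_sums[OF qdsD[OF a that] z])
  from sums_Re[OF this] sums_Im[OF this]
  have "(\<lambda>n. Re (z ^ n) * m (a n)) sums Re (pser (pc m a) z)" "(\<lambda>n. Im (z ^ n) * m (a n)) sums Im (pser (pc m a) z)"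
    if "m \<in> {qre, qi, qj, qk}" for m using that by (simp_all add: pc_def mult.commute)
  thus "(\<lambda>n. Re (z ^ n) *\<^sub>R a n) sums sA a z" "(\<lambda>n. Im (z ^ n) *\<^sub>R a n) sums sB a z"
    unfolding sums_quat_iff sA_def sB_def by (simp_all add: reQ_def imQ_def)
qed

lemma emb_times: "emb I w * q = Re w *\<^sub>R q + I * (Im w *\<^sub>R q)"
  by (simp add: emb_def quat_eq_iff algebra_simps)

lemma quat_eval_sums:
  assumes a: "qds a" and z: "cmod z < 1" and I: "I \<in> \<S>"
  shows "(\<lambda>n. emb I z ^ n * a n) sums (sA a z + I * sB a z)"
  unfolding emb_power[OF I, symmetric] emb_times
  by (intro sums_add sums_mult stem_sums a z)

lemma l2_pc:
  assumes "l2 a" "m \<in> {qre, qi, qj, qk}"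
  shows "l2 (pc m a)" "l2n (pc m a) \<le> l2n a"
proof -
  have "norm (pc m a n) \<le> norm (a n)" for n using abs_comp_le[OF assms(2)] by (simp add: pc_def)
  from l2_mono[OF assms(1) this] show "l2 (pc m a)" "l2n (pc m a) \<le> l2n a" .
qed

lemma l2_qds: "l2 a \<Longrightarrow> qds a"
  by (simp add: qds_def l2_dsum l2_pc)

lemma l2_from_pc:
  assumes "l2 (pc qre a)" "l2 (pc qi a)" "l2 (pc qj a)" "l2 (pc qk a)"
  shows "l2 a" "l2sq a = l2sq (pc qre a) + l2sq (pc qi a) + l2sq (pc qj a) + l2sq (pc qk a)"
proof -
  have "(\<lambda>n. (norm (a n))\<^sup>2) = (\<lambda>n. (norm (pc qre a n))\<^sup>2 + (norm (pc qi a n))\<^sup>2 + (norm (pc qj a n))\<^sup>2 + (norm (pc qk a n))\<^sup>2)"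
    by (simp add: norm_quat_sq pc_def)
  moreover have "\<dots> sums (l2sq (pc qre a) + l2sq (pc qi a) + l2sq (pc qj a) + l2sq (pc qk a))"
    unfolding l2sq_def by (intro sums_add summable_sums) (use assms in \<open>auto simp: l2_def\<close>)
  ultimately have "(\<lambda>n. (norm (a n))\<^sup>2) sums (l2sq (pc qre a) + l2sq (pc qi a) + l2sq (pc qj a) + l2sq (pc qk a))" by simp
  thus "l2 a" "l2sq a = l2sq (pc qre a) + l2sq (pc qi a) + l2sq (pc qj a) + l2sq (pc qk a)"
    by (auto simp: l2_def l2sq_def[of a] sums_iff)
qed

lemma stem_radial:
  assumes a: "l2 a"
  shows "AE t in circ. ((\<lambda>r. sA a (of_real r * cis t)) \<longlongrightarrow> bA a t) (at_left 1) \<and> ((\<lambda>r. sB a (of_real r * cis t)) \<longlongrightarrow> bB a t) (at_left 1)"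
proof -
  have m: "AE t in circ. ((\<lambda>r. pser (pc m a) (of_real r * cis t)) \<longlongrightarrow> bd (pc m a) t) (at_left 1)" if "m \<in> {qre, qi, qj, qk}" for m
    by (rule bd_AE[OF l2_pc(1)[OF a that]])
  show ?thesis using m[of qre, simplified] m[of qi, simplified] m[of qj, simplified] m[of qk, simplified]
    by eventually_elim (auto simp: sA_def sB_def bA_def bB_def reQ_def imQ_def intro!: tendsto_Quat tendsto_Re tendsto_Im)
qed

lemma stem_parseval:
  assumes a: "l2 a"
  shows "integrable circ (\<lambda>t. (norm (bA a t))\<^sup>2 + (norm (bB a t))\<^sup>2)"
    "integral\<^sup>L circ (\<lambda>t. (norm (bA a t))\<^sup>2 + (norm (bB a t))\<^sup>2) = l2sq a"
proof -
  have eq: "(\<lambda>t. (norm (bA a t))\<^sup>2 + (norm (bB a t))\<^sup>2) = (\<lambda>t. (cmod (bd (pc qre a) t))\<^sup>2 + (cmod (bd (pc qi a) t))\<^sup>2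
    + (cmod (bd (pc qj a) t))\<^sup>2 + (cmod (bd (pc qk a) t))\<^sup>2)"
    by (rule ext) (simp add: norm_quat_sq bA_def bB_def reQ_def imQ_def cmod_power2)
  have l: "l2 (pc qre a)" "l2 (pc qi a)" "l2 (pc qj a)" "l2 (pc qk a)" using l2_pc(1)[OF a] by auto
  show "integrable circ (\<lambda>t. (norm (bA a t))\<^sup>2 + (norm (bB a t))\<^sup>2)"
    unfolding eq by (intro Bochner_Integration.integrable_add bd_sq_integrable l)
  show "integral\<^sup>L circ (\<lambda>t. (norm (bA a t))\<^sup>2 + (norm (bB a t))\<^sup>2) = l2sq a"
    unfolding eq using bd_sq_integrable(1)[OF l(1)] bd_sq_integrable(1)[OF l(2)] bd_sq_integrable(1)[OF l(3)] bd_sq_integrable(1)[OF l(4)]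
    by (simp add: parseval_bd l l2_from_pc(2))
qed

lemma bA_bB_measurable:
  assumes a: "l2 a"
  shows "bA a \<in> borel_measurable borel" "bB a \<in> borel_measurable borel"
proof -
  have [measurable]: "bd (pc m a) \<in> borel_measurable borel" if "m \<in> {qre, qi, qj, qk}" for m
    by (rule bd_measurable[OF l2_pc(1)[OF a that]])
  show "bA a \<in> borel_measurable borel" "bB a \<in> borel_measurable borel"
    unfolding bA_def[abs_def] bB_def[abs_def] reQ_def imQ_def
    by (subst quat_decomp; simp only: quat.sel; measurable)+
qed

lemma pser_lin4:
  assumes c: "dsum c1" "dsum c2" "dsum c3" "dsum c4"
  shows "dsum (\<lambda>n. c1 n + s2 * c2 n + s3 * c3 n + s4 * c4 n)"
    "cmod z < 1 \<Longrightarrow> pser (\<lambda>n. c1 n + s2 * c2 n + s3 * c3 n + s4 * c4 n) z = pser c1 z + s2 * pser c2 z + s3 * pser c3 z + s4 * pser c4 z"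
proof -
  show "dsum (\<lambda>n. c1 n + s2 * c2 n + s3 * c3 n + s4 * c4 n)" unfolding dsum_def
  proof (intro allI impI)
    fix z :: complex assume z: "cmod z < 1"
    have "summable (\<lambda>n. cmod (c1 n * z ^ n) + cmod s2 * cmod (c2 n * z ^ n) + cmod s3 * cmod (c3 n * z ^ n) + cmod s4 * cmod (c4 n * z ^ n))"
      using c z by (intro summable_add summable_mult) (auto simp: dsum_def)
    thus "summable (\<lambda>n. cmod ((c1 n + s2 * c2 n + s3 * c3 n + s4 * c4 n) * z ^ n))"
    proof (rule summable_comparison_test'[where N=0])
      fix n
      have "cmod ((c1 n + s2 * c2 n + s3 * c3 n + s4 * c4 n) * z ^ n) = cmod (c1 n * z ^ n + s2 * (c2 n * z ^ n) + s3 * (c3 n * z ^ n) + s4 * (c4 n * z ^ n))"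
        by (simp add: algebra_simps)
      also have "\<dots> \<le> cmod (c1 n * z ^ n) + cmod (s2 * (c2 n * z ^ n)) + cmod (s3 * (c3 n * z ^ n)) + cmod (s4 * (c4 n * z ^ n))"
        by (intro order_trans[OF norm_triangle_ineq] add_right_mono order_refl)
      finally show "norm (cmod ((c1 n + s2 * c2 n + s3 * c3 n + s4 * c4 n) * z ^ n)) \<le> cmod (c1 n * z ^ n) + cmod s2 * cmod (c2 n * z ^ n) + cmod s3 * cmod (c3 n * z ^ n) + cmod s4 * cmod (c4 n * z ^ n)"
        by (simp add: norm_mult)
    qed
  qed
  assume z: "cmod z < 1"
  have "(\<lambda>n. c1 n * z ^ n + s2 * (c2 n * z ^ n) + s3 * (c3 n * z ^ n) + s4 * (c4 n * z ^ n)) sums (pser c1 z + s2 * pser c2 z + s3 * pser c3 z + s4 * pser c4 z)"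
    by (intro sums_add sums_mult dsum_sums c z)
  thus "pser (\<lambda>n. c1 n + s2 * c2 n + s3 * c3 n + s4 * c4 n) z = pser c1 z + s2 * pser c2 z + s3 * pser c3 z + s4 * pser c4 z"
    unfolding pser_def by (simp add: sums_iff algebra_simps)
qed

lemma pc_conv:
  "pc qre (conv a b) = (\<lambda>n. conv (pc qre a) (pc qre b) n + (-1) * conv (pc qi a) (pc qi b) n + (-1) * conv (pc qj a) (pc qj b) n + (-1) * conv (pc qk a) (pc qk b) n)"
  "pc qi (conv a b) = (\<lambda>n. conv (pc qre a) (pc qi b) n + 1 * conv (pc qi a) (pc qre b) n + 1 * conv (pc qj a) (pc qk b) n + (-1) * conv (pc qk a) (pc qj b) n)"
  "pc qj (conv a b) = (\<lambda>n. conv (pc qre a) (pc qj b) n + (-1) * conv (pc qi a) (pc qk b) n + 1 * conv (pc qj a) (pc qre b) n + 1 * conv (pc qk a) (pc qi b) n)"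
  "pc qk (conv a b) = (\<lambda>n. conv (pc qre a) (pc qk b) n + 1 * conv (pc qi a) (pc qj b) n + (-1) * conv (pc qj a) (pc qi b) n + 1 * conv (pc qk a) (pc qre b) n)"
  unfolding pc_def conv_def by (auto simp: comp_sum sum.distrib sum_subtractf)

text \<open>On stems the star product is pointwise: A + iB is multiplied as an element of the
  quaternions tensored with the complex numbers. Each component of the product is a signed sum of
  four scalar convolutions (\<open>pc_conv\<close>), and these are products of complex power
  series.\<close>

lemma pser_pc_conv:
  assumes a: "qds a" and b: "qds b"
  shows "qds (conv a b)"
    and "cmod z < 1 \<Longrightarrow> sA (conv a b) z = sA a z * sA b z - sB a z * sB b z"
    and "cmod z < 1 \<Longrightarrow> sB (conv a b) z = sA a z * sB b z + sB a z * sA b z"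
proof -
  have d: "dsum (conv (pc m a) (pc m' b))" if "m \<in> {qre, qi, qj, qk}" "m' \<in> {qre, qi, qj, qk}" for m m'
    by (rule pser_conv(1)[OF qdsD[OF a that(1)] qdsD[OF b that(2)]])
  show "qds (conv a b)" unfolding qds_def pc_conv by (intro conjI pser_lin4(1) d) auto
  assume z: "cmod z < 1"
  have p: "pser (conv (pc m a) (pc m' b)) z = pser (pc m a) z * pser (pc m' b) z" if "m \<in> {qre, qi, qj, qk}" "m' \<in> {qre, qi, qj, qk}" for m m'
    by (rule pser_conv(2)[OF qdsD[OF a that(1)] qdsD[OF b that(2)] z])
  let ?P = "\<lambda>m m'. pser (pc m a) z * pser (pc m' b) z"
  have "pser (pc qre (conv a b)) z = ?P qre qre - ?P qi qi - ?P qj qj - ?P qk qk"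
    "pser (pc qi (conv a b)) z = ?P qre qi + ?P qi qre + ?P qj qk - ?P qk qj"
    "pser (pc qj (conv a b)) z = ?P qre qj - ?P qi qk + ?P qj qre + ?P qk qi"
    "pser (pc qk (conv a b)) z = ?P qre qk + ?P qi qj - ?P qj qi + ?P qk qre"
    unfolding pc_conv by (subst pser_lin4(2)[OF d d d d z]; simp add: p)+
  thus "sA (conv a b) z = sA a z * sA b z - sB a z * sB b z" "sB (conv a b) z = sA a z * sB b z + sB a z * sA b z"
    unfolding sA_def sB_def by (simp_all add: reQ_def imQ_def quat_eq_iff)
qed

lemma boundary_conv:
  assumes a: "l2 a" and b: "l2 b" and c: "l2 (conv a b)"
  shows "AE t in circ. bA (conv a b) t = bA a t * bA b t - bB a t * bB b t \<and> bB (conv a b) t = bA a t * bB b t + bB a t * bA b t"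
  using stem_radial[OF a] stem_radial[OF b] stem_radial[OF c]
proof eventually_elim
  case (elim t)
  have "((\<lambda>r. sA a (of_real r * cis t) * sA b (of_real r * cis t) - sB a (of_real r * cis t) * sB b (of_real r * cis t)) \<longlongrightarrow> bA a t * bA b t - bB a t * bB b t) (at_left 1)"
    using elim by (intro tendsto_intros) auto
  moreover have "\<forall>\<^sub>F r in at_left 1. sA a (of_real r * cis t) * sA b (of_real r * cis t) - sB a (of_real r * cis t) * sB b (of_real r * cis t) = sA (conv a b) (of_real r * cis t)"
    using at_left_1_ge by eventually_elim (subst pser_pc_conv(2)[OF l2_qds[OF a] l2_qds[OF b]], auto simp: norm_mult)
  ultimately have "((\<lambda>r. sA (conv a b) (of_real r * cis t)) \<longlongrightarrow> bA a t * bA b t - bB a t * bB b t) (at_left 1)"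
    by (rule Lim_transform_eventually)
  hence 1: "bA (conv a b) t = bA a t * bA b t - bB a t * bB b t" using elim
    by (intro tendsto_unique[of "at_left (1::real)"]) auto
  have "((\<lambda>r. sA a (of_real r * cis t) * sB b (of_real r * cis t) + sB a (of_real r * cis t) * sA b (of_real r * cis t)) \<longlongrightarrow> bA a t * bB b t + bB a t * bA b t) (at_left 1)"
    using elim by (intro tendsto_intros) auto
  moreover have "\<forall>\<^sub>F r in at_left 1. sA a (of_real r * cis t) * sB b (of_real r * cis t) + sB a (of_real r * cis t) * sA b (of_real r * cis t) = sB (conv a b) (of_real r * cis t)"
    using at_left_1_ge by eventually_elim (subst pser_pc_conv(3)[OF l2_qds[OF a] l2_qds[OF b]], auto simp: norm_mult)
  ultimately have "((\<lambda>r. sB (conv a b) (of_real r * cis t)) \<longlongrightarrow> bA a t * bB b t + bB a t * bA b t) (at_left 1)"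
    by (rule Lim_transform_eventually)
  hence "bB (conv a b) t = bA a t * bB b t + bB a t * bA b t" using elim
    by (intro tendsto_unique[of "at_left (1::real)"]) auto
  with 1 show ?case by blast
qed

section \<open>Slice regular functions and power series\<close>

lemma real_powser_0:
  fixes d :: "nat \<Rightarrow> real"
  assumes "\<And>x. \<bar>x\<bar> < 1 \<Longrightarrow> (\<lambda>n. d n * x ^ n) sums 0"
  shows "d n = 0"
proof (rule ccontr)
  assume nz: "d n \<noteq> 0"
  have "d 0 = 0" using assms[of 0] sums_unique2[OF powser_sums_zero] by fastforce
  hence n: "n > 0" using nz by (cases n) auto
  obtain s where "0 < s" "\<And>z::real. z \<in> cball 0 s - {0} \<Longrightarrow> (\<lambda>x. 0::real) z \<noteq> 0"
    by (rule powser_0_nonzero[of 1 0 d "\<lambda>x. 0" n]) (use assms nz n in auto)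
  from this(2)[of s] this(1) show False by simp
qed

lemma expansion_unique:
  assumes "\<And>x. \<bar>x\<bar> < 1 \<Longrightarrow> (\<lambda>n. of_real x ^ n * a n) sums f x" "\<And>x. \<bar>x\<bar> < 1 \<Longrightarrow> (\<lambda>n. of_real x ^ n * b n) sums f x"
  shows "a = (b :: nat \<Rightarrow> quat)"
proof
  fix n
  have m: "m (a n) - m (b n) = 0" if m: "m \<in> {qre, qi, qj, qk}" for m
  proof (rule real_powser_0[of "\<lambda>n. m (a n) - m (b n)"])
    fix x :: real assume "\<bar>x\<bar> < 1"
    from sums_diff[OF assms(1)[OF this] assms(2)[OF this]]
    have "(\<lambda>n. x ^ n *\<^sub>R (a n - b n)) sums 0" by (simp add: scaleR_conv_of_real algebra_simps)
    hence "(\<lambda>n. x ^ n * m (a n - b n)) sums 0" unfolding sums_quat_iff using m by auto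
    moreover have "m (a n - b n) = m (a n) - m (b n)" for n using m by auto
    ultimately show "(\<lambda>n. (m (a n) - m (b n)) * x ^ n) sums 0" by (simp add: mult.commute)
  qed
  show "a n = b n" using m[of qre] m[of qi] m[of qj] m[of qk] by (simp add: quat_eq_iff)
qed

lemma coeffs_on_eq:
  assumes a: "has_expansion_on f a A" and A: "\<And>x. \<bar>x\<bar> < 1 \<Longrightarrow> of_real x \<in> A"
  shows "coeffs_on A f = a"
  unfolding coeffs_on_def
proof (rule the_equality)
  show "has_expansion_on f a A" by (rule a)
  fix b assume "has_expansion_on f b A"
  thus "b = a" using a A by (intro expansion_unique[of b "\<lambda>x. f (of_real x)"]) (auto simp: has_expansion_on_def)
qed

lemma real_in_ball: "\<bar>x\<bar> < 1 \<Longrightarrow> of_real x \<in> \<B>" by simp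

lemma real_in_slice_ball: "\<bar>x\<bar> < 1 \<Longrightarrow> of_real x \<in> slice_ball I"
  unfolding slice_ball_def slice_plane_emb by (auto intro!: image_eqI[of _ _ "of_real x"])

lemmas coeffs_ball = coeffs_on_eq[OF _ real_in_ball]
lemmas coeffs_slice = coeffs_on_eq[OF _ real_in_slice_ball]

lemma expansion_qds:
  assumes "\<And>x. \<bar>x\<bar> < 1 \<Longrightarrow> summable (\<lambda>n. of_real x ^ n * a n)"
  shows "qds a"
proof -
  have "dsum (pc m a)" if m: "m \<in> {qre, qi, qj, qk}" for m unfolding dsum_def
  proof (intro allI impI)
    fix z :: complex assume z: "cmod z < 1"
    then obtain x where x: "cmod z < x" "x < 1" using dense by blast
    hence "\<bar>x\<bar> < 1" using norm_ge_zero[of z] by linarith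
    from summable_sums[OF assms[OF this]] m
    have "summable (\<lambda>n. m (of_real x ^ n * a n))" unfolding sums_quat_iff by (auto simp: sums_iff)
    moreover have "m (of_real x ^ n * a n) = m (a n) * x ^ n" for n
    proof -
      have "of_real x ^ n * a n = x ^ n *\<^sub>R a n" by (simp add: scaleR_conv_of_real)
      thus ?thesis using m by auto
    qed
    ultimately have "summable (\<lambda>n. m (a n) * x ^ n)" by simp
    hence "summable (\<lambda>n. norm (m (a n) * cmod z ^ n))" by (rule powser_insidea) (use x in auto)
    thus "summable (\<lambda>n. cmod (pc m a n * z ^ n))" by (simp add: pc_def norm_mult norm_power abs_mult)
  qed
  thus ?thesis by (simp add: qds_def)
qed

lemma has_expansion_qds: "has_expansion_on f a \<B> \<Longrightarrow> qds a"
  by (rule expansion_qds) (auto simp: has_expansion_on_def sums_iff)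

definition qeval :: "(nat \<Rightarrow> quat) \<Rightarrow> quat \<Rightarrow> quat" where
  "qeval a q = (\<Sum>n. q ^ n * a n)"

lemma qeval_emb:
  "qds a \<Longrightarrow> cmod z < 1 \<Longrightarrow> I \<in> \<S> \<Longrightarrow> qeval a (emb I z) = sA a z + I * sB a z"
  unfolding qeval_def by (rule sums_unique[OF quat_eval_sums, symmetric])

lemma qds_has_expansion: "qds a \<Longrightarrow> has_expansion_on (qeval a) a \<B>"
  unfolding has_expansion_on_def
proof
  fix q assume a: "qds a" and q: "q \<in> \<B>"
  obtain I z where Iz: "I \<in> \<S>" "q = emb I z" by (rule quat_emb_cases)
  hence z: "cmod z < 1" using q by (simp add: norm_emb)
  show "(\<lambda>n. q ^ n * a n) sums qeval a q"
    using quat_eval_sums[OF a z Iz(1)] qeval_emb[OF a z Iz(1)] Iz(2) by simp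
qed

lemma has_expansion_eq: "has_expansion_on f a \<B> \<Longrightarrow> q \<in> \<B> \<Longrightarrow> f q = qeval a q"
  unfolding has_expansion_on_def qeval_def by (simp add: sums_iff)

text \<open>The \<^term>\<open>slice_plane I\<close>-linear functional with real part the inner product with \<open>v\<close>.\<close>

definition lfun :: "quat \<Rightarrow> quat \<Rightarrow> quat \<Rightarrow> complex" where
  "lfun I v q = Complex (inner q v) (inner q (I * v))"

lemma lfun_emb: "I \<in> \<S> \<Longrightarrow> lfun I v (emb I w * q) = w * lfun I v q"
proof -
  assume "I \<in> \<S>"
  hence I: "qre I = 0" "(qi I)\<^sup>2 + (qj I)\<^sup>2 + (qk I)\<^sup>2 = 1" by (auto simp: imag_units_iff)
  have Iv: "inner (I * q) v = - inner q (I * v)"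
    using I(1) by (simp add: inner_quat_def algebra_simps)
  have IIv: "inner (I * q) (I * v) = inner q v"
  proof -
    have "inner (I * q) (I * v) = ((qi I)\<^sup>2 + (qj I)\<^sup>2 + (qk I)\<^sup>2) * inner q v"
      unfolding inner_quat_def quat_sel I(1) by algebra
    thus ?thesis unfolding I(2) by simp
  qed
  show ?thesis unfolding emb_times complex_eq_iff lfun_def
    by (simp add: inner_add_left Iv IIv)
qed

lemma bounded_linear_lfun: "bounded_linear (lfun I v)"
proof -
  have "bounded_linear (\<lambda>q. inner q v *\<^sub>R (1::complex) + inner q (I * v) *\<^sub>R \<i>)"
    by (intro bounded_linear_add bounded_linear_scaleR_const bounded_linear_inner_left)
  moreover have "(\<lambda>q. inner q v *\<^sub>R (1::complex) + inner q (I * v) *\<^sub>R \<i>) = lfun I v"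
    by (rule ext) (simp add: lfun_def complex_eq_iff)
  ultimately show ?thesis by simp
qed

lemma complex_powser_0_real:
  fixes d :: "nat \<Rightarrow> complex"
  assumes "\<And>x. \<bar>x\<bar> < 1 \<Longrightarrow> (\<lambda>n. d n * of_real x ^ n) sums 0"
  shows "d n = 0"
proof -
  have "Re (d n) = 0" "Im (d n) = 0"
    using sums_Re[OF assms] sums_Im[OF assms]
    by (intro real_powser_0[of "\<lambda>n. Re (d n)"] real_powser_0[of "\<lambda>n. Im (d n)"]; simp flip: of_real_power)+
  thus ?thesis by (simp add: complex_eq_iff)
qed

text \<open>Continuous partial derivatives give a total derivative, and the slice Cauchy-Riemann
  equation reads fy = I fx, so the derivative acts as t -> \<open>emb I t * c\<close>.\<close>

lemma slice_complex_derivative: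
  assumes f: "slice_regular f" and I: "I \<in> \<S>" and z: "cmod z < 1"
  shows "\<exists>c. ((\<lambda>w. f (emb I w)) has_derivative (\<lambda>t. emb I t * c)) (at z)"
proof -
  define D where "D = {(x, y). of_real x + of_real y * I \<in> \<B>}"
  have Deq: "(x, y) \<in> D \<longleftrightarrow> cmod (Complex x y) < 1" for x y
    using norm_emb[OF I, of "Complex x y"] by (simp add: D_def emb_def)
  obtain fx fy where c: "continuous_on D fx" "continuous_on D fy"
    and d: "\<And>x y. (x, y) \<in> D \<Longrightarrow> ((\<lambda>s. f (of_real s + of_real y * I)) has_vector_derivative fx (x, y)) (at x) \<and>
        ((\<lambda>t. f (of_real x + of_real t * I)) has_vector_derivative fy (x, y)) (at y) \<and>
        (1/2) *\<^sub>R (fx (x, y) + I * fy (x, y)) = 0"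
    using f I unfolding slice_regular_def Let_def D_def by blast
  define x0 y0 where "x0 = Re z" "y0 = Im z"
  have "open D"
  proof -
    have "D = (\<lambda>p. Complex (fst p) (snd p)) -` ball 0 1" using Deq by auto
    moreover have "continuous_on UNIV (\<lambda>p. Complex (fst p) (snd p))" by (intro continuous_intros)
    ultimately show ?thesis using open_vimage[of "ball 0 1"] by auto
  qed
  have in0: "(x0, y0) \<in> D" using z Deq[of x0 y0] by (simp add: x0_y0_def)
  obtain X Y where XY: "open X" "open Y" "x0 \<in> X" "y0 \<in> Y" "X \<times> Y \<subseteq> D"
    using open_prod_elim[OF \<open>open D\<close> in0] by (metis mem_Sigma_iff)
  obtain e where e: "e > 0" "ball y0 e \<subseteq> Y" using XY openE by blast
  define Y' where "Y' = ball y0 e"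
  have Y': "open Y'" "y0 \<in> Y'" "convex Y'" "X \<times> Y' \<subseteq> D" using e XY by (auto simp: Y'_def)
  define g where "g x y = f (of_real x + of_real y * I)" for x y
  define FY where "FY x y = blinfun_scaleR_left (fy (x, y))" for x y
  have "((\<lambda>(x, y). g x y) has_derivative (\<lambda>(tx, ty). tx *\<^sub>R fx (x0, y0) + blinfun_apply (FY x0 y0) ty)) (at (x0, y0) within X \<times> Y')"
  proof (rule has_derivative_partialsI)
    show "((\<lambda>x. g x y0) has_derivative (\<lambda>tx. tx *\<^sub>R fx (x0, y0))) (at x0 within X)"
      using d[OF in0] unfolding g_def has_vector_derivative_def by (auto intro: has_derivative_at_withinI)
    show "((\<lambda>y. g x y) has_derivative blinfun_apply (FY x y)) (at y within Y')" if "x \<in> X" "y \<in> Y'" for x y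
    proof -
      have "(x, y) \<in> D" using that Y' by auto
      thus ?thesis using d[of x y] unfolding g_def FY_def has_vector_derivative_def
        by (auto intro: has_derivative_at_withinI)
    qed
    have "continuous_on (X \<times> Y') (\<lambda>p. blinfun_scaleR_left (fy p))"
      by (intro bounded_linear.continuous_on[OF bounded_linear_blinfun_scaleR_left] continuous_on_subset[OF c(2)] Y')
    thus "continuous (at (x0, y0) within X \<times> Y') (\<lambda>(x, y). FY x y)"
      using XY(3) Y'(2) unfolding continuous_on_eq_continuous_within FY_def case_prod_beta by simp
  qed (use Y' in auto)
  hence "((\<lambda>(x, y). g x y) has_derivative (\<lambda>(tx, ty). tx *\<^sub>R fx (x0, y0) + blinfun_apply (FY x0 y0) ty)) (at (x0, y0))"
    by (subst (asm) at_within_open) (use XY Y' in \<open>auto intro: open_Times\<close>)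
  hence "((\<lambda>(x, y). g x y) has_derivative (\<lambda>(tx, ty). tx *\<^sub>R fx (x0, y0) + blinfun_apply (FY x0 y0) ty)) (at (Re z, Im z))"
    by (simp add: x0_y0_def)
  moreover have "((\<lambda>w. (Re w, Im w)) has_derivative (\<lambda>w. (Re w, Im w))) (at z)"
    by (intro bounded_linear_imp_has_derivative bounded_linear_Pair bounded_linear_Re bounded_linear_Im)
  ultimately have "((\<lambda>w. (\<lambda>(x, y). g x y) (Re w, Im w)) has_derivative (\<lambda>t. (\<lambda>(tx, ty). tx *\<^sub>R fx (x0, y0) + blinfun_apply (FY x0 y0) ty) (Re t, Im t))) (at z)"
    by (rule has_derivative_compose[rotated])
  hence D1: "((\<lambda>w. f (emb I w)) has_derivative (\<lambda>t. Re t *\<^sub>R fx (x0, y0) + Im t *\<^sub>R fy (x0, y0))) (at z)"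
    by (simp add: g_def emb_def FY_def)
  have "fx (x0, y0) + I * fy (x0, y0) = 0" using d[OF in0] by simp
  hence "I * fx (x0, y0) + I * (I * fy (x0, y0)) = 0" by (metis distrib_left mult_zero_right)
  moreover have "I * (I * fy (x0, y0)) = - fy (x0, y0)" using imag_unit_sq[OF I] by (simp flip: mult.assoc)
  ultimately have "fy (x0, y0) = I * fx (x0, y0)" by simp
  hence "(\<lambda>t. Re t *\<^sub>R fx (x0, y0) + Im t *\<^sub>R fy (x0, y0)) = (\<lambda>t. emb I t * fx (x0, y0))"
    by (simp add: emb_times)
  with D1 show ?thesis by metis
qed

text \<open>The functionals \<open>lfun I v\<close> are linear over \<open>slice_plane I\<close>, so
  they turn f on the slice into ordinary holomorphic functions. That their Taylor coefficients come
  from one quaternion sequence is read off on the real axis and holds throughout by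
  uniqueness.\<close>

lemma slice_regular_slice_expansion:
  assumes f: "slice_regular f" and I: "I \<in> \<S>"
  shows "\<exists>a. \<forall>z. cmod z < 1 \<longrightarrow> (\<lambda>n. emb I z ^ n * a n) sums f (emb I z)"
proof -
  define F where "F v z = lfun I v (f (emb I z))" for v z
  have hol: "F v holomorphic_on ball 0 1" for v
    unfolding holomorphic_on_def
  proof
    fix z :: complex assume "z \<in> ball 0 1"
    then obtain c where c: "((\<lambda>w. f (emb I w)) has_derivative (\<lambda>t. emb I t * c)) (at z)"
      using slice_complex_derivative[OF f I] by auto
    have "(F v has_derivative (\<lambda>t. lfun I v (emb I t * c))) (at z)"
      unfolding F_def[abs_def] by (rule bounded_linear.has_derivative[OF bounded_linear_lfun c])
    hence "(F v has_field_derivative lfun I v c) (at z)"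
      unfolding has_field_derivative_def lfun_emb[OF I] by (simp add: mult_commute_abs)
    thus "F v field_differentiable at z within ball 0 1"
      using field_differentiable_at_within field_differentiable_def by blast
  qed
  define c where "c v n = (deriv ^^ n) (F v) 0 / fact n" for v n
  have cs: "(\<lambda>n. c v n * z ^ n) sums F v z" if "cmod z < 1" for v z
    using holomorphic_power_series[OF hol, of z] that by (simp add: c_def)
  define e where "e m = (if m = (0::nat) then Quat 1 0 0 0 else if m = 1 then Quat 0 1 0 0 else if m = 2 then Quat 0 0 1 0 else Quat 0 0 0 1)" for m
  have ReF: "Re (lfun I (e 0) q) = qre q" "Re (lfun I (e 1) q) = qi q" "Re (lfun I (e 2) q) = qj q" "Re (lfun I (e 3) q) = qk q" for q
    by (simp_all add: lfun_def e_def inner_quat_def)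
  \<comment> \<open>For v = 1, i, j, k the real part of \<open>lfun I v q\<close> is the
    corresponding component of q (\<open>ReF\<close>).\<close>
  define a where "a n = Quat (Re (c (e 0) n)) (Re (c (e 1) n)) (Re (c (e 2) n)) (Re (c (e 3) n))" for n
  have real: "(\<lambda>n. of_real x ^ n * a n) sums f (of_real x)" if x: "\<bar>x\<bar> < 1" for x
  proof -
    have "(\<lambda>n. Re (c v n) * x ^ n) sums Re (lfun I v (f (of_real x)))" for v
      using sums_Re[OF cs[of "of_real x" v]] x by (simp add: F_def flip: of_real_power)
    from this[of "e 0"] this[of "e 1"] this[of "e 2"] this[of "e 3"]
    have "(\<lambda>n. x ^ n *\<^sub>R a n) sums f (of_real x)"
      unfolding sums_quat_iff ReF by (simp add: a_def mult.commute)
    thus ?thesis by (simp add: scaleR_conv_of_real)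
  qed
  have ca: "c v n = lfun I v (a n)" for v n
  proof -
    have "c v n - lfun I v (a n) = 0"
    proof (rule complex_powser_0_real[of "\<lambda>n. c v n - lfun I v (a n)"])
      fix x :: real assume x: "\<bar>x\<bar> < 1"
      have "(\<lambda>n. lfun I v (of_real x ^ n * a n)) sums lfun I v (f (of_real x))"
        by (rule bounded_linear.sums[OF bounded_linear_lfun real[OF x]])
      moreover have "lfun I v (of_real x ^ n * a n) = lfun I v (a n) * of_real x ^ n" for n
        using lfun_emb[OF I, of v "of_real (x ^ n)" "a n"] unfolding emb_of_real by (simp add: mult.commute)
      moreover have "(\<lambda>n. c v n * of_real x ^ n) sums lfun I v (f (of_real x))"
        using cs[of "of_real x" v] x by (simp add: F_def)
      ultimately show "(\<lambda>n. (c v n - lfun I v (a n)) * of_real x ^ n) sums 0"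
        using sums_diff[of "\<lambda>n. c v n * of_real x ^ n" "lfun I v (f (of_real x))" "\<lambda>n. lfun I v (a n) * of_real x ^ n" "lfun I v (f (of_real x))"]
        by (simp add: left_diff_distrib)
    qed
    thus ?thesis by simp
  qed
  have "(\<lambda>n. emb I z ^ n * a n) sums f (emb I z)" if z: "cmod z < 1" for z
  proof -
    have "(\<lambda>n. Re (lfun I v (emb I z ^ n * a n))) sums Re (lfun I v (f (emb I z)))" for v
    proof -
      have "(\<lambda>n. lfun I v (a n) * z ^ n) sums lfun I v (f (emb I z))"
        using cs[OF z, of v] by (simp add: ca F_def)
      hence "(\<lambda>n. lfun I v (emb I z ^ n * a n)) sums lfun I v (f (emb I z))"
        by (simp add: emb_power[OF I, symmetric] lfun_emb[OF I] mult.commute)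
      thus ?thesis by (rule sums_Re)
    qed
    from this[of "e 0"] this[of "e 1"] this[of "e 2"] this[of "e 3"] show ?thesis
      unfolding sums_quat_iff ReF by blast
  qed
  thus ?thesis by blast
qed

text \<open>All slices share the interval (-1, 1), which forces their coefficient sequences to
  coincide.\<close>

theorem slice_regular_imp_expansion:
  assumes f: "slice_regular f"
  shows "\<exists>a. has_expansion_on f a \<B>"
proof -
  obtain a where a: "\<And>I z. I \<in> \<S> \<Longrightarrow> cmod z < 1 \<Longrightarrow> (\<lambda>n. emb I z ^ n * a I n) sums f (emb I z)"
    using slice_regular_slice_expansion[OF f] by metis
  have eq: "a I = a qim_unit" if I: "I \<in> \<S>" for I
    by (rule expansion_unique[of _ "\<lambda>x. f (of_real x)"]) (use a[OF I, of "of_real _"] a[OF qim_unit_imag, of "of_real _"] in simp_all)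
  have "has_expansion_on f (a qim_unit) \<B>" unfolding has_expansion_on_def
  proof
    fix q assume q: "q \<in> \<B>"
    obtain I z where Iz: "I \<in> \<S>" "q = emb I z" by (rule quat_emb_cases)
    hence "cmod z < 1" using q by (simp add: norm_emb)
    from a[OF Iz(1) this] show "(\<lambda>n. q ^ n * a qim_unit n) sums f q" unfolding Iz(2) eq[OF Iz(1)] .
  qed
  thus ?thesis by blast
qed

lemma dsum_holomorphic: "dsum a \<Longrightarrow> pser a holomorphic_on ball 0 1"
  by (rule power_series_holomorphic[where a = a]) (simp add: dsum_sums)

lemma sA_sB_emb: "sA a z + I * sB a z = emb I (pser (pc qre a) z) + emb I (pser (pc qi a) z) * Quat 0 1 0 0
   + emb I (pser (pc qj a) z) * Quat 0 0 1 0 + emb I (pser (pc qk a) z) * Quat 0 0 0 1"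
  by (simp add: sA_def sB_def reQ_def imQ_def emb_def quat_eq_iff)

theorem expansion_imp_slice_regular:
  assumes f: "has_expansion_on f a \<B>"
  shows "slice_regular f"
  unfolding slice_regular_def Let_def
proof
  fix I assume I: "I \<in> \<S>"
  have a: "qds a" by (rule has_expansion_qds[OF f])
  define W where "W m = pser (pc m a)" for m
  have hol: "W m holomorphic_on ball 0 1" if "m \<in> {qre, qi, qj, qk}" for m
    unfolding W_def by (rule dsum_holomorphic[OF qdsD[OF a that]])
  \<comment> \<open>On a slice f is a combination of four complex holomorphic functions with 1, i,
    j, k as coefficients on the right. In this combination, multiplying all arguments by the complex
    unit amounts to multiplying by I on the left (\<open>stI\<close>), which is the Cauchy-Riemann
    equation.\<close>
  define st where "st w = emb I (w qre) + emb I (w qi) * Quat 0 1 0 0 + emb I (w qj) * Quat 0 0 1 0 + emb I (w qk) * Quat 0 0 0 1" for w :: "(quat \<Rightarrow> real) \<Rightarrow> complex"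
  have fst: "f (emb I z) = st (\<lambda>m. W m z)" if "cmod z < 1" for z
    using has_expansion_eq[OF f, of "emb I z"] qeval_emb[OF a that I] that
    by (simp add: norm_emb I sA_sB_emb st_def W_def)
  define X where "X z = st (\<lambda>m. deriv (W m) z)" for z
  define fx where "fx p = X (Complex (fst p) (snd p))" for p
  define fy where "fy p = I * fx p" for p
  define D where "D = {(x, y). of_real x + of_real y * I \<in> \<B>}"
  have embC: "of_real x + of_real y * I = emb I (Complex x y)" for x y by (simp add: emb_def)
  have Deq: "(x, y) \<in> D \<longleftrightarrow> cmod (Complex x y) < 1" for x y
    by (simp add: D_def embC norm_emb I)
  have cX: "continuous_on (ball 0 1) X"
  proof -
    have "continuous_on (ball 0 1) (deriv (W m))" if "m \<in> {qre, qi, qj, qk}" for m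
      by (intro holomorphic_on_imp_continuous_on holomorphic_deriv hol that) simp
    thus ?thesis unfolding X_def[abs_def] st_def
      by (intro continuous_intros bounded_linear.continuous_on[OF bounded_linear_emb[OF I]]) auto
  qed
  have cfx: "continuous_on D fx" unfolding fx_def
    by (rule continuous_on_compose2[OF cX]) (auto intro!: continuous_intros simp: Deq)
  have dW: "((\<lambda>s. st (\<lambda>m. W m (\<gamma> s))) has_vector_derivative st (\<lambda>m. deriv (W m) (\<gamma> s) * \<gamma>')) (at s)"
    if \<gamma>: "(\<gamma> has_vector_derivative \<gamma>') (at s)" and z: "cmod (\<gamma> s) < 1" for \<gamma> \<gamma>' s
  proof -
    have "((\<lambda>s. W m (\<gamma> s)) has_vector_derivative deriv (W m) (\<gamma> s) * \<gamma>') (at s)" if m: "m \<in> {qre, qi, qj, qk}" for m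
    proof -
      have "(W m has_field_derivative deriv (W m) (\<gamma> s)) (at (\<gamma> s))"
        by (rule holomorphic_derivI[OF hol[OF m] open_ball]) (use z in simp)
      from field_vector_diff_chain_at[OF \<gamma> this] show ?thesis by (simp add: o_def mult.commute)
    qed
    from bounded_linear.has_vector_derivative[OF bounded_linear_emb[OF I] this]
    show ?thesis unfolding st_def
      by (intro has_vector_derivative_add bounded_linear.has_vector_derivative[OF bounded_linear_mult_left]) auto
  qed
  have stI: "st (\<lambda>m. w m * \<i>) = I * st w" for w
  proof -
    have "emb I (w m * \<i>) = I * emb I (w m)" for m
    proof -
      have "emb I \<i> = I" by (simp add: emb_def)
      thus ?thesis using emb_mult[OF I, of \<i> "w m"] by (simp add: mult.commute)
    qed
    thus ?thesis unfolding st_def by (simp add: distrib_left mult.assoc)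
  qed
  have der: "((\<lambda>s. f (emb I (\<gamma> s))) has_vector_derivative st (\<lambda>m. deriv (W m) (\<gamma> s) * \<gamma>')) (at s)"
    if \<gamma>: "(\<gamma> has_vector_derivative \<gamma>') (at s)" and z: "cmod (\<gamma> s) < 1" and c: "continuous_on UNIV \<gamma>" for \<gamma> \<gamma>' s
  proof (rule has_vector_derivative_transform_within_open[OF dW[OF \<gamma> z]])
    show "open {s. cmod (\<gamma> s) < 1}" by (intro open_Collect_less continuous_intros c)
  qed (use z in \<open>auto simp: fst\<close>)
  have "((\<lambda>s. f (of_real s + of_real y * I)) has_vector_derivative fx (x, y)) (at x) \<and>
        ((\<lambda>t. f (of_real x + of_real t * I)) has_vector_derivative fy (x, y)) (at y) \<and>
        (1/2) *\<^sub>R (fx (x, y) + I * fy (x, y)) = 0" if xy: "(x, y) \<in> D" for x y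
  proof (intro conjI)
    have C1: "Complex s y = of_real s + \<i> * of_real y" for s y by (simp add: complex_eq_iff)
    have "((\<lambda>s. Complex s y) has_vector_derivative 1) (at x)"
      unfolding C1 has_vector_derivative_def by (auto intro!: derivative_eq_intros simp: scaleR_conv_of_real)
    from der[OF this] xy show "((\<lambda>s. f (of_real s + of_real y * I)) has_vector_derivative fx (x, y)) (at x)"
      by (simp add: embC Deq fx_def X_def continuous_intros)
    have "((\<lambda>t. Complex x t) has_vector_derivative \<i>) (at y)"
      unfolding C1 has_vector_derivative_def by (auto intro!: derivative_eq_intros simp: scaleR_conv_of_real)
    from der[OF this] xy show "((\<lambda>t. f (of_real x + of_real t * I)) has_vector_derivative fy (x, y)) (at y)"
      by (simp add: embC Deq fx_def fy_def X_def stI continuous_intros)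
    have "I * fy (x, y) = - fx (x, y)" unfolding fy_def using imag_unit_sq[OF I] by (simp flip: mult.assoc)
    thus "(1/2) *\<^sub>R (fx (x, y) + I * fy (x, y)) = 0" by simp
  qed
  moreover have "continuous_on D fy" unfolding fy_def by (intro continuous_intros cfx)
  ultimately show "\<exists>fx fy. continuous_on {(x, y). of_real x + of_real y * I \<in> \<B>} fx \<and>
      continuous_on {(x, y). of_real x + of_real y * I \<in> \<B>} fy \<and>
      (\<forall>(x, y)\<in>{(x, y). of_real x + of_real y * I \<in> \<B>}.
        ((\<lambda>s. f (of_real s + of_real y * I)) has_vector_derivative fx (x, y)) (at x) \<and>
        ((\<lambda>t. f (of_real x + of_real t * I)) has_vector_derivative fy (x, y)) (at y) \<and>
        (1/2) *\<^sub>R (fx (x, y) + I * fy (x, y)) = 0)"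
    using cfx unfolding D_def[symmetric] by (intro exI[of _ fx] exI[of _ fy]) auto
qed

section \<open>Coefficient sequences for the notions of the Hardy space\<close>

lemma H2_iff: "f \<in> H2 \<longleftrightarrow> (\<exists>a. has_expansion_on f a \<B> \<and> l2 a)"
  unfolding H2_def l2_def using expansion_imp_slice_regular by blast

lemma qeval_H2: "l2 a \<Longrightarrow> qeval a \<in> H2"
  unfolding H2_iff using qds_has_expansion[OF l2_qds] by blast

lemma star_prod_eq:
  assumes "has_expansion_on f a \<B>" "has_expansion_on g b \<B>"
  shows "f \<star> g = qeval (conv a b)" "has_expansion_on (f \<star> g) (conv a b) \<B>"
proof -
  show "f \<star> g = qeval (conv a b)"
    by (simp add: star_prod_def qeval_def[abs_def] conv_def coeffs_ball[OF assms(1)] coeffs_ball[OF assms(2)])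
  thus "has_expansion_on (f \<star> g) (conv a b) \<B>"
    using qds_has_expansion[OF pser_pc_conv(1)[OF has_expansion_qds[OF assms(1)] has_expansion_qds[OF assms(2)]]] by simp
qed

lemma qcnj_sel [simp]: "qre (qcnj q) = qre q" "qi (qcnj q) = - qi q" "qj (qcnj q) = - qj q" "qk (qcnj q) = - qk q"
  by (simp_all add: qcnj_def)

lemma qcnj_mult: "qcnj (p * q) = qcnj q * qcnj p"
  by (simp add: quat_eq_iff)

lemma norm_qcnj [simp]: "norm (qcnj q) = norm q"
  by (simp add: norm_quat_def)

lemma qcnj_simps [simp]: "qcnj (qcnj q) = q" "qcnj 0 = 0" "qcnj 1 = 1" "qcnj (p - q) = qcnj p - qcnj q"
  "qcnj (p + q) = qcnj p + qcnj q"
  by (simp_all add: quat_eq_iff)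

lemma qcnj_sum: "qcnj (sum f A) = (\<Sum>x\<in>A. qcnj (f x))"
  by (induction A rule: infinite_finite_induct) auto

definition cnjs :: "(nat \<Rightarrow> quat) \<Rightarrow> nat \<Rightarrow> quat" where
  "cnjs a n = qcnj (a n)"

lemma cnjs_cnjs [simp]: "cnjs (cnjs a) = a"
  by (simp add: cnjs_def fun_eq_iff)

lemma cnjs_conv: "cnjs (conv a b) = conv (cnjs b) (cnjs a)"
proof
  fix n
  have "cnjs (conv a b) n = (\<Sum>k\<le>n. qcnj (b (n - k)) * qcnj (a k))"
    by (simp add: cnjs_def conv_def qcnj_sum qcnj_mult)
  also have "\<dots> = conv (cnjs b) (cnjs a) n" unfolding conv_def cnjs_def
    by (rule sum.reindex_bij_witness[of _ "\<lambda>k. n - k" "\<lambda>k. n - k"]) auto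
  finally show "cnjs (conv a b) n = conv (cnjs b) (cnjs a) n" .
qed

lemma l2_cnjs: "l2 a \<Longrightarrow> l2 (cnjs a)" "l2n (cnjs a) = l2n a"
  by (simp_all add: l2_def l2n_def l2sq_def cnjs_def)

lemma pc_cnjs: "pc qre (cnjs a) = pc qre a" "pc qi (cnjs a) = (\<lambda>n. - pc qi a n)"
  "pc qj (cnjs a) = (\<lambda>n. - pc qj a n)" "pc qk (cnjs a) = (\<lambda>n. - pc qk a n)"
  by (simp_all add: pc_def cnjs_def fun_eq_iff)

lemma dsum_minus: "dsum a \<Longrightarrow> dsum (\<lambda>n. - a n)" "dsum a \<Longrightarrow> cmod z < 1 \<Longrightarrow> pser (\<lambda>n. - a n) z = - pser a z"
  using sums_minus[OF dsum_sums[of a z]] by (simp_all add: dsum_def pser_def sums_iff)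

lemma qds_cnjs: "qds a \<Longrightarrow> qds (cnjs a)"
  by (simp add: qds_def pc_cnjs dsum_minus)

lemma stem_cnjs:
  "qds a \<Longrightarrow> cmod z < 1 \<Longrightarrow> sA (cnjs a) z = qcnj (sA a z)"
  "qds a \<Longrightarrow> cmod z < 1 \<Longrightarrow> sB (cnjs a) z = qcnj (sB a z)"
  by (simp_all add: sA_def sB_def pc_cnjs dsum_minus qds_def quat_eq_iff reQ_def imQ_def)

lemma regular_conj_eq:
  assumes "has_expansion_on f a \<B>"
  shows "has_expansion_on (regular_conj f) (cnjs a) \<B>"
proof -
  have "regular_conj f = qeval (cnjs a)"
    by (simp add: regular_conj_def qeval_def[abs_def] cnjs_def coeffs_ball[OF assms])
  thus ?thesis using qds_has_expansion[OF qds_cnjs[OF has_expansion_qds[OF assms]]] by simp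
qed

lemma symmetrization_expansion:
  assumes "has_expansion_on f a \<B>"
  shows "has_expansion_on (symmetrization f) (conv a (cnjs a)) \<B>"
  unfolding symmetrization_def by (rule star_prod_eq(2)[OF assms regular_conj_eq[OF assms]])

lemma has_expansion_diff:
  assumes "has_expansion_on f a A" "has_expansion_on g b A"
  shows "has_expansion_on (\<lambda>q. f q - g q) (\<lambda>n. a n - b n) A"
  using assms unfolding has_expansion_on_def by (auto simp: right_diff_distrib intro!: sums_diff)

lemma norm_H2_eq: "has_expansion_on f a \<B> \<Longrightarrow> norm_H2 f = l2n a"
  by (simp add: norm_H2_def coeffs_ball l2n_def l2sq_def)

lemma norm_H2_slice_eq: "has_expansion_on f a (slice_ball I) \<Longrightarrow> norm_H2_slice I f = l2n a"
  by (simp add: norm_H2_slice_def coeffs_slice l2n_def l2sq_def)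

lemma expansion_power: "has_expansion_on (\<lambda>q. q ^ k) (\<lambda>n. if n = k then 1 else 0) A"
  unfolding has_expansion_on_def
proof
  fix q :: quat
  have "(\<lambda>n. q ^ n * (if n = k then 1 else 0)) = (\<lambda>n. if n = k then q ^ n else 0)" by auto
  thus "(\<lambda>n. q ^ n * (if n = k then 1 else 0)) sums q ^ k" using sums_single[of k "\<lambda>n. q ^ n"] by simp
qed

lemma conv_shift: "conv (\<lambda>n. if n = k then 1 else 0) b = shiftr k (b :: nat \<Rightarrow> 'a::semiring_1)"
proof
  fix n
  have "conv (\<lambda>n. if n = k then 1 else 0) b n = (\<Sum>j\<le>n. if j = k then b (n - j) else 0)"
    unfolding conv_def by (intro sum.cong) auto
  thus "conv (\<lambda>n. if n = k then 1 else 0) b n = shiftr k b n" by (simp add: shiftr_def)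
qed

lemma shift_span_expansion:
  assumes g: "has_expansion_on g b \<B>"
  shows "has_expansion_on (\<lambda>q. \<Sum>k\<le>m. ((\<lambda>q. q ^ k) \<star> g) q * a k) (conv b (\<lambda>n. if n < Suc m then a n else 0)) \<B>"
proof -
  have "has_expansion_on ((\<lambda>q. q ^ k) \<star> g) (shiftr k b) \<B>" for k
    using star_prod_eq(2)[OF expansion_power g] by (simp add: conv_shift)
  hence "has_expansion_on (\<lambda>q. \<Sum>k\<le>m. ((\<lambda>q. q ^ k) \<star> g) q * a k) (\<lambda>n. \<Sum>k\<le>m. shiftr k b n * a k) \<B>"
    unfolding has_expansion_on_def by (auto simp: sum_distrib_left mult.assoc[symmetric] intro!: sums_sum sums_mult2)
  also have "(\<lambda>n. \<Sum>k\<le>m. shiftr k b n * a k) = conv b (\<lambda>n. if n < Suc m then a n else 0)"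
    by (subst conv_fins_right[where N="Suc m"]) (auto simp: lessThan_Suc_atMost intro!: ext sum.cong)
  finally show ?thesis .
qed

lemma trunc_eq: "(\<lambda>n. if n < N then c n else 0) = (\<lambda>n. c n - tail (c :: nat \<Rightarrow> 'a::ab_group_add) N n)"
  by (auto simp: tail_def)

lemma l2n_tail_small:
  assumes c: "l2 c" and e: "e > 0" shows "\<exists>N. l2n (tail c N) < e"
proof -
  have "(\<lambda>N. l2n (tail c N)) \<longlonglongrightarrow> sqrt 0" unfolding l2n_def by (intro tendsto_real_sqrt l2sq_tail_tendsto c)
  from order_tendstoD(2)[OF this, of e] e show ?thesis by (auto simp: eventually_sequentially)
qed

text \<open>The \<open>P\<close>-variant keeps track of the coefficients of the approximating polynomial.\<close>

lemma cyc_dense_gen: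
  fixes b c :: "nat \<Rightarrow> 'a::real_normed_div_algebra"
  assumes b: "\<And>e. e > 0 \<Longrightarrow> \<exists>p. fins p \<and> P p \<and> l2 (\<lambda>n. conv b p n - delta0 n) \<and> l2n (\<lambda>n. conv b p n - delta0 n) < e"
    and c: "l2 c" and e: "e > 0"
  shows "\<exists>p N. fins p \<and> P p \<and> l2 (\<lambda>n. conv b (conv p (\<lambda>n. if n < N then c n else 0)) n - c n)
     \<and> l2n (\<lambda>n. conv b (conv p (\<lambda>n. if n < N then c n else 0)) n - c n) < e"
proof -
  obtain N where N: "l2n (tail c N) < e / 2" using l2n_tail_small[OF c, of "e/2"] e by auto
  define d where "d n = (if n < N then c n else 0)" for n
  define C where "C = (\<Sum>k<N. norm (d k))"
  have C0: "C \<ge> 0" unfolding C_def by (intro sum_nonneg) auto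
  \<comment> \<open>Right multiplication by the truncation d has norm at most C, so this error grows
    to at most e / 2; the other half is left for the tail of c.\<close>
  obtain p where p: "fins p" "P p" "l2 (\<lambda>n. conv b p n - delta0 n)" "l2n (\<lambda>n. conv b p n - delta0 n) < e / (2 * (C + 1))"
    using b[of "e / (2 * (C + 1))"] e C0 by auto
  have dN: "\<forall>n\<ge>N. d n = 0" by (simp add: d_def)
  define r where "r = conv (\<lambda>n. conv b p n - delta0 n) d"
  have r: "l2 r" "l2n r \<le> C * l2n (\<lambda>n. conv b p n - delta0 n)"
    unfolding r_def C_def using l2_conv_fins(1,2)[OF p(3) dN] by auto
  have "l2n r \<le> C * (e / (2 * (C + 1)))" using r(2) p(4) C0 by (meson less_imp_le mult_left_mono order_trans)
  also have "\<dots> = (e / 2) * (C / (C + 1))" by simp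
  also have "\<dots> \<le> (e / 2) * 1" using C0 e by (intro mult_left_mono) auto
  finally have r2: "l2n r \<le> e / 2" by simp
  have eq: "(\<lambda>n. conv b (conv p d) n - c n) = (\<lambda>n. r n - tail c N n)"
  proof
    fix n
    have "r n = conv b (conv p d) n - d n" by (simp add: r_def conv_diff_left conv_assoc)
    moreover have "d n = c n - tail c N n" by (simp add: d_def tail_def)
    ultimately show "conv b (conv p d) n - c n = r n - tail c N n" by simp
  qed
  have "l2 (\<lambda>n. conv b (conv p d) n - c n)" "l2n (\<lambda>n. conv b (conv p d) n - c n) < e"
    unfolding eq using l2_diff[OF r(1) l2_tail[OF c, of N]] r2 N by auto
  thus ?thesis using p(1,2) unfolding d_def by blast
qed

lemma cyc_dense:
  fixes b c :: "nat \<Rightarrow> 'a::real_normed_div_algebra"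
  assumes "cyc b" "l2 c" "e > 0"
  shows "\<exists>p. fins p \<and> l2 (\<lambda>n. conv b p n - c n) \<and> l2n (\<lambda>n. conv b p n - c n) < e"
proof -
  obtain p N where p: "fins p" "l2 (\<lambda>n. conv b (conv p (\<lambda>n. if n < N then c n else 0)) n - c n)"
     "l2n (\<lambda>n. conv b (conv p (\<lambda>n. if n < N then c n else 0)) n - c n) < e"
    using cyc_dense_gen[of "\<lambda>p. True" b, OF _ assms(2,3)] assms(1) unfolding cyc_def by auto
  moreover have "fins (conv p (\<lambda>n. if n < N then c n else 0))"
    by (intro fins_conv p) (auto simp: fins_def intro!: exI[of _ N])
  ultimately show ?thesis by blast
qed

theorem cyclic_H2_iff:
  assumes g: "has_expansion_on g b \<B>" and b: "l2 b"
  shows "cyclic_H2 g \<longleftrightarrow> cyc b"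
proof -
  have gH: "g \<in> H2" unfolding H2_iff using assms by blast
  have "cyclic_H2 g \<longleftrightarrow> (\<forall>h\<in>H2. \<forall>e>0. \<exists>k\<in>shift_span g. norm_H2 (\<lambda>q. h q - k q) < e)"
    unfolding cyclic_H2_def closure_H2_def using gH by blast
  also have "\<dots> \<longleftrightarrow> cyc b"
  proof
    assume A: "\<forall>h\<in>H2. \<forall>e>0. \<exists>k\<in>shift_span g. norm_H2 (\<lambda>q. h q - k q) < e"
    show "cyc b" unfolding cyc_def
    proof (intro allI impI)
      fix e :: real assume e: "e > 0"
      have one: "has_expansion_on (qeval delta0) delta0 \<B>" by (intro qds_has_expansion l2_qds fins_l2 fins_delta0)
      obtain k where k: "k \<in> shift_span g" "norm_H2 (\<lambda>q. qeval delta0 q - k q) < e"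
        using A qeval_H2[OF fins_l2[OF fins_delta0]] e by blast
      then obtain m a where kd: "k = (\<lambda>q. \<Sum>k\<le>m. ((\<lambda>q. q ^ k) \<star> g) q * a k)" unfolding shift_span_def by blast
      define p where "p n = (if n < Suc m then a n else 0)" for n
      have pf: "fins p" by (auto simp: fins_def p_def intro!: exI[of _ "Suc m"])
      have "has_expansion_on k (conv b p) \<B>" using shift_span_expansion[OF g, where m=m and a=a] unfolding kd p_def .
      from norm_H2_eq[OF has_expansion_diff[OF one this]] k(2) have "l2n (\<lambda>n. delta0 n - conv b p n) < e" by simp
      moreover have "l2 (conv b p)" using pf l2_conv_fins(1)[OF b] by (auto simp: fins_def)
      ultimately show "\<exists>p. fins p \<and> l2 (\<lambda>n. conv b p n - delta0 n) \<and> l2n (\<lambda>n. conv b p n - delta0 n) < e"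
        using pf l2_diff(1)[OF _ fins_l2[OF fins_delta0]] by (metis l2n_minus_commute)
    qed
  next
    assume c: "cyc b"
    show "\<forall>h\<in>H2. \<forall>e>0. \<exists>k\<in>shift_span g. norm_H2 (\<lambda>q. h q - k q) < e"
    proof (intro ballI allI impI)
      fix h :: "quat \<Rightarrow> quat" and e :: real assume "h \<in> H2" and e: "e > 0"
      then obtain c where h: "has_expansion_on h c \<B>" "l2 c" unfolding H2_iff by blast
      obtain p where p: "fins p" "l2n (\<lambda>n. conv b p n - c n) < e" using cyc_dense[OF c h(2) e] by blast
      obtain N where N: "\<forall>n\<ge>N. p n = 0" using p(1) by (auto simp: fins_def)
      define k where "k = (\<lambda>q. \<Sum>k\<le>N. ((\<lambda>q. q ^ k) \<star> g) q * p k)"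
      have "(\<lambda>n. if n < Suc N then p n else 0) = p" using N by auto
      hence "has_expansion_on k (conv b p) \<B>" using shift_span_expansion[OF g, where m=N and a=p] unfolding k_def by simp
      from norm_H2_eq[OF has_expansion_diff[OF h(1) this]] p(2) have "norm_H2 (\<lambda>q. h q - k q) < e"
        by (simp add: l2n_minus_commute[of c])
      moreover have "k \<in> shift_span g" unfolding shift_span_def k_def by blast
      ultimately show "\<exists>k\<in>shift_span g. norm_H2 (\<lambda>q. h q - k q) < e" by blast
    qed
  qed
  finally show ?thesis .
qed

section \<open>Real coefficients\<close>

lemma conv_of_real: "conv (\<lambda>n. of_real (s n)) (\<lambda>n. of_real (p n)) n = (of_real (conv s p n) :: 'a::real_normed_div_algebra)"
  by (simp add: conv_def)

text \<open>For real s, a contractive real-linear functional with value 1 at 1 commutes with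
  convolution by s, so it makes the polynomial real without increasing the error. Hence cyclicity of
  s is the same over real, complex and quaternionic polynomials.\<close>

lemma cyc_of_real_proj:
  fixes \<pi> :: "'a::real_normed_div_algebra \<Rightarrow> real"
  assumes \<pi>: "linear \<pi>" "\<And>x. \<bar>\<pi> x\<bar> \<le> norm x" "\<pi> 1 = 1"
    and p: "fins p" "l2 (\<lambda>n. conv (\<lambda>n. of_real (s n)) p n - delta0 n)"
  shows "fins (\<lambda>n. \<pi> (p n))" "l2 (\<lambda>n. conv s (\<lambda>n. \<pi> (p n)) n - delta0 n)"
    "l2n (\<lambda>n. conv s (\<lambda>n. \<pi> (p n)) n - delta0 n) \<le> l2n (\<lambda>n. conv (\<lambda>n. of_real (s n)) p n - delta0 n)"
proof -
  interpret linear \<pi> by (rule \<pi>(1))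
  show "fins (\<lambda>n. \<pi> (p n))" using p(1) linear_0[OF \<pi>(1)] unfolding fins_def by metis
  have e: "\<pi> (conv (\<lambda>n. of_real (s n)) p n - delta0 n) = conv s (\<lambda>n. \<pi> (p n)) n - delta0 n" for n
    by (simp add: conv_def sum diff scale zero delta0_def \<pi>(3) flip: scaleR_conv_of_real)
  have "norm (conv s (\<lambda>n. \<pi> (p n)) n - delta0 n) \<le> norm (conv (\<lambda>n. of_real (s n)) p n - delta0 n)" for n
    using \<pi>(2)[of "conv (\<lambda>n. of_real (s n)) p n - delta0 n"] unfolding e by simp
  from l2_mono[OF p(2) this] show "l2 (\<lambda>n. conv s (\<lambda>n. \<pi> (p n)) n - delta0 n)"
    "l2n (\<lambda>n. conv s (\<lambda>n. \<pi> (p n)) n - delta0 n) \<le> l2n (\<lambda>n. conv (\<lambda>n. of_real (s n)) p n - delta0 n)" .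
qed

lemma cyc_real_imp:
  fixes s :: "nat \<Rightarrow> real"
  assumes "cyc s" "e > 0"
  shows "\<exists>p. fins p \<and> l2 (\<lambda>n. conv (\<lambda>n. of_real (s n)) (\<lambda>n. of_real (p n)) n - delta0 n :: 'a::real_normed_div_algebra)
     \<and> l2n (\<lambda>n. conv (\<lambda>n. of_real (s n)) (\<lambda>n. of_real (p n)) n - delta0 n :: 'a) < e"
proof -
  obtain p where p: "fins p" "l2 (\<lambda>n. conv s p n - delta0 n)" "l2n (\<lambda>n. conv s p n - delta0 n) < e"
    using assms unfolding cyc_def by blast
  have n: "norm (conv (\<lambda>n. of_real (s n)) (\<lambda>n. of_real (p n)) n - delta0 n :: 'a) = norm (conv s p n - delta0 n)" for n
  proof -
    have "conv (\<lambda>n. of_real (s n)) (\<lambda>n. of_real (p n)) n - delta0 n = (of_real (conv s p n - delta0 n) :: 'a)"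
      by (simp add: conv_of_real delta0_def)
    thus ?thesis by (simp only: norm_of_real real_norm_def)
  qed
  show ?thesis using p l2_norm_cong[OF n] by auto
qed

lemma fins_of_real: "fins p \<Longrightarrow> fins (\<lambda>n. of_real (p n) :: 'a::real_algebra_1)"
  unfolding fins_def by auto

lemma cyc_of_real_iff:
  fixes \<pi> :: "'a::real_normed_div_algebra \<Rightarrow> real"
  assumes \<pi>: "linear \<pi>" "\<And>x. \<bar>\<pi> x\<bar> \<le> norm x" "\<pi> 1 = 1"
  shows "cyc (\<lambda>n. of_real (s n) :: 'a) \<longleftrightarrow> cyc s"
proof
  assume "cyc (\<lambda>n. of_real (s n) :: 'a)"
  thus "cyc s" unfolding cyc_def using cyc_of_real_proj[OF \<pi>] by (meson order_le_less_trans)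
next
  assume "cyc s"
  from cyc_real_imp[OF this] show "cyc (\<lambda>n. of_real (s n) :: 'a)" unfolding cyc_def using fins_of_real by blast
qed

lemma linear_qre: "linear qre" by (rule linearI) auto

lemma cyc_of_real_quat: "cyc (\<lambda>n. of_real (s n) :: quat) \<longleftrightarrow> cyc s"
  by (rule cyc_of_real_iff[OF linear_qre]) (simp_all add: abs_comp_le[of qre])

lemma cyc_of_real_complex: "cyc (\<lambda>n. of_real (s n) :: complex) \<longleftrightarrow> cyc s"
  by (rule cyc_of_real_iff[of Re]) (auto intro: linearI abs_Re_le_cmod)

lemma slice_plane_closed:
  assumes I: "I \<in> \<S>"
  shows "x \<in> slice_plane I \<Longrightarrow> y \<in> slice_plane I \<Longrightarrow> x * y \<in> slice_plane I" "of_real r \<in> slice_plane I"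
    "(\<And>k. k \<in> A \<Longrightarrow> u k \<in> slice_plane I) \<Longrightarrow> sum u A \<in> slice_plane I"
proof -
  show "x \<in> slice_plane I \<Longrightarrow> y \<in> slice_plane I \<Longrightarrow> x * y \<in> slice_plane I"
    unfolding slice_plane_emb by (auto simp flip: emb_mult[OF I])
  show r: "of_real r \<in> slice_plane I" for r unfolding slice_plane_emb by (rule range_eqI[of _ _ "of_real r"]) simp
  have "x + y \<in> slice_plane I" if "x \<in> slice_plane I" "y \<in> slice_plane I" for x y
    using that unfolding slice_plane_emb by (auto simp flip: emb_add)
  note add = this
  assume u: "\<And>k. k \<in> A \<Longrightarrow> u k \<in> slice_plane I"
  show "sum u A \<in> slice_plane I" using u
    by (induction A rule: infinite_finite_induct) (use r[of 0] add in auto)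
qed

lemma slice_plane_commute: "I \<in> \<S> \<Longrightarrow> x \<in> slice_plane I \<Longrightarrow> y \<in> slice_plane I \<Longrightarrow> x * y = y * x"
  unfolding slice_plane_emb by (auto simp flip: emb_mult simp: mult.commute)

text \<open>Inside \<open>slice_plane I\<close> the coefficients c k commute with the powers of z,
  so here, unlike for general quaternion coefficients, the pointwise product has the convolution as
  its coefficient sequence.\<close>

lemma slice_multiple_expansion:
  assumes I: "I \<in> \<S>" and h: "has_expansion_on h b (slice_ball I)" and c: "\<And>k. c k \<in> slice_plane I"
  shows "has_expansion_on (\<lambda>z. (\<Sum>k\<le>m. z ^ k * c k) * h z) (conv (\<lambda>n. if n < Suc m then c n else 0) b) (slice_ball I)"
proof -
  have 1: "(\<lambda>n. z ^ n * (c k * shiftr k b n)) sums (z ^ k * c k * h z)" if z: "z \<in> slice_ball I" for z k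
  proof -
    have zp: "z \<in> slice_plane I" using z by (simp add: slice_ball_def)
    have zn: "z ^ n \<in> slice_plane I" for n
      using slice_plane_closed(1)[OF I zp] slice_plane_closed(2)[OF I, of 1] by (induction n) auto
    have "(\<lambda>n. z ^ k * c k * (z ^ n * b n)) sums (z ^ k * c k * h z)"
      using h z unfolding has_expansion_on_def by (intro sums_mult) auto
    moreover have "z ^ k * c k * (z ^ n * b n) = z ^ (n + k) * (c k * shiftr k b (n + k))" for n
    proof -
      have "z ^ k * c k * (z ^ n * b n) = z ^ k * (c k * z ^ n) * b n" by (simp only: mult.assoc)
      also have "c k * z ^ n = z ^ n * c k" by (rule slice_plane_commute[OF I c zn])
      also have "z ^ k * (z ^ n * c k) * b n = z ^ (k + n) * (c k * b n)" by (simp only: power_add mult.assoc)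
      finally show ?thesis by (simp add: shiftr_def add.commute)
    qed
    ultimately have "(\<lambda>n. z ^ (n + k) * (c k * shiftr k b (n + k))) sums (z ^ k * c k * h z)" by simp
    moreover have "(\<Sum>n<k. z ^ n * (c k * shiftr k b n)) = 0" by (intro sum.neutral) (auto simp: shiftr_def)
    ultimately show ?thesis using sums_iff_shift[of "\<lambda>n. z ^ n * (c k * shiftr k b n)" k "z ^ k * c k * h z"] by simp
  qed
  have "has_expansion_on (\<lambda>z. (\<Sum>k\<le>m. z ^ k * c k) * h z) (\<lambda>n. \<Sum>k\<le>m. c k * shiftr k b n) (slice_ball I)"
    unfolding has_expansion_on_def by (auto simp: sum_distrib_left sum_distrib_right intro!: sums_sum 1)
  also have "(\<lambda>n. \<Sum>k\<le>m. c k * shiftr k b n) = conv (\<lambda>n. if n < Suc m then c n else 0) b"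
    by (subst conv_fins_left[where N="Suc m"]) (auto simp: lessThan_Suc_atMost intro!: ext sum.cong)
  finally show ?thesis .
qed

lemma conv_of_real_commute: "conv (\<lambda>n. of_real (s n)) p = conv p (\<lambda>n. of_real (s n) :: 'a::real_normed_div_algebra)"
proof
  fix n
  have "of_real r * x = x * (of_real r :: 'a)" for r x by (simp add: of_real_def)
  hence "conv (\<lambda>n. of_real (s n)) p n = (\<Sum>k\<le>n. p (n - k) * of_real (s k))"
    unfolding conv_def by (intro sum.cong) auto
  also have "\<dots> = conv p (\<lambda>n. of_real (s n)) n" unfolding conv_def
    by (rule sum.reindex_bij_witness[of _ "\<lambda>k. n - k" "\<lambda>k. n - k"]) auto
  finally show "conv (\<lambda>n. of_real (s n)) p n = conv p (\<lambda>n. of_real (s n)) n" .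
qed

lemma expansion_one: "has_expansion_on (\<lambda>z. 1) delta0 A"
  using expansion_power[of 0 A] by (simp add: delta0_def[abs_def])

theorem cyclic_H2_slice_iff:
  assumes I: "I \<in> \<S>" and h: "has_expansion_on h (\<lambda>n. of_real (s n)) (slice_ball I)" and s: "l2 s"
  shows "cyclic_H2_slice I h \<longleftrightarrow> cyc s"
proof -
  let ?b = "\<lambda>n. of_real (s n) :: quat"
  have b: "l2 ?b" using s by (simp add: l2_def)
  have hH: "h \<in> H2_slice I" unfolding H2_slice_def
    using h b slice_plane_closed(2)[OF I] by (auto simp: l2_def intro!: exI[of _ ?b])
  have "cyclic_H2_slice I h \<longleftrightarrow> (\<forall>g\<in>H2_slice I. \<forall>e>0. \<exists>k\<in>slice_multiples I h. norm_H2_slice I (\<lambda>q. g q - k q) < e)"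
    unfolding cyclic_H2_slice_def closure_H2_slice_def using hH by blast
  also have "\<dots> \<longleftrightarrow> cyc s"
  proof
    assume A: "\<forall>g\<in>H2_slice I. \<forall>e>0. \<exists>k\<in>slice_multiples I h. norm_H2_slice I (\<lambda>q. g q - k q) < e"
    show "cyc s" unfolding cyc_def
    proof (intro allI impI)
      fix e :: real assume e: "e > 0"
      have "(\<lambda>z. 1) \<in> H2_slice I" unfolding H2_slice_def
        using expansion_one fins_l2[OF fins_delta0] slice_plane_closed(2)[OF I, of 1] slice_plane_closed(2)[OF I, of 0]
        unfolding l2_def by (intro CollectI exI[of _ delta0]) (auto simp: delta0_def)
      from A[THEN bspec, OF this, rule_format, OF e]
      obtain k where k: "k \<in> slice_multiples I h" "norm_H2_slice I (\<lambda>q. 1 - k q) < e" by (elim bexE)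
      then obtain m c where kd: "k = (\<lambda>z. (\<Sum>k\<le>m. z ^ k * c k) * h z)" "\<And>k. c k \<in> slice_plane I" unfolding slice_multiples_def by blast
      define p where "p n = (if n < Suc m then c n else 0)" for n
      have pf: "fins p" by (auto simp: fins_def p_def intro!: exI[of _ "Suc m"])
      have "has_expansion_on k (conv p ?b) (slice_ball I)" using slice_multiple_expansion[OF I h kd(2), where m=m] unfolding kd p_def .
      from norm_H2_slice_eq[OF has_expansion_diff[OF expansion_one this]] k(2) have "l2n (\<lambda>n. delta0 n - conv p ?b n) < e" by simp
      hence 1: "l2n (\<lambda>n. conv ?b p n - delta0 n) < e" by (subst l2n_minus_commute) (simp only: conv_of_real_commute)
      have "l2 (conv ?b p)" using pf l2_conv_fins(1)[OF b] by (auto simp: fins_def)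
      hence "l2 (\<lambda>n. conv ?b p n - delta0 n)" by (rule l2_diff(1)[OF _ fins_l2[OF fins_delta0]])
      from cyc_of_real_proj[OF linear_qre abs_comp_le[of qre, simplified] quat_sel(5) pf this] 1
      show "\<exists>p. fins p \<and> l2 (\<lambda>n. conv s p n - delta0 n) \<and> l2n (\<lambda>n. conv s p n - delta0 n) < e"
        by (intro exI[of _ "\<lambda>n. qre (p n)"] conjI) (auto elim: order_le_less_trans)
    qed
  next
    assume c: "cyc s"
    show "\<forall>g\<in>H2_slice I. \<forall>e>0. \<exists>k\<in>slice_multiples I h. norm_H2_slice I (\<lambda>q. g q - k q) < e"
    proof (intro ballI allI impI)
      fix g :: "quat \<Rightarrow> quat" and e :: real assume "g \<in> H2_slice I" and e: "e > 0"
      then obtain c where g: "has_expansion_on g c (slice_ball I)" "l2 c" "\<And>n. c n \<in> slice_plane I"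
        unfolding H2_slice_def l2_def by blast
      \<comment> \<open>Real approximants of 1 lie in every slice plane; multiplied by truncations
        of c they give polynomials whose coefficients stay in the plane.\<close>
      have "\<exists>p. fins p \<and> (\<forall>n. p n \<in> slice_plane I) \<and> l2 (\<lambda>n. conv ?b p n - delta0 n) \<and> l2n (\<lambda>n. conv ?b p n - delta0 n) < e" if "e > 0" for e
        using cyc_real_imp[OF \<open>cyc s\<close> that, where ?'a = quat] fins_of_real slice_plane_closed(2)[OF I] by blast
      from cyc_dense_gen[of "\<lambda>p. \<forall>n. p n \<in> slice_plane I", OF this g(2) e]
      obtain p N where p: "fins p" "\<And>n. p n \<in> slice_plane I"
        "l2n (\<lambda>n. conv ?b (conv p (\<lambda>n. if n < N then c n else 0)) n - c n) < e" by blast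
      define q where "q = conv p (\<lambda>n. if n < N then c n else 0)"
      have qf: "fins q" unfolding q_def by (intro fins_conv p) (auto simp: fins_def intro!: exI[of _ N])
      have qI: "q n \<in> slice_plane I" for n unfolding q_def conv_def
        using p(2) g(3) slice_plane_closed(2)[OF I, of 0] by (intro slice_plane_closed[OF I]) auto
      obtain M where M: "\<forall>n\<ge>M. q n = 0" using qf by (auto simp: fins_def)
      define k where "k = (\<lambda>z. (\<Sum>k\<le>M. z ^ k * q k) * h z)"
      have "(\<lambda>n. if n < Suc M then q n else 0) = q" using M by auto
      hence "has_expansion_on k (conv ?b q) (slice_ball I)"
        using slice_multiple_expansion[OF I h, where c=q and m=M, OF qI] unfolding k_def by (simp add: conv_of_real_commute)
      from norm_H2_slice_eq[OF has_expansion_diff[OF g(1) this]] p(3) have "norm_H2_slice I (\<lambda>q. g q - k q) < e"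
        by (simp add: l2n_minus_commute[of c] q_def)
      moreover have "k \<in> slice_multiples I h" unfolding slice_multiples_def k_def using qI by blast
      ultimately show "\<exists>k\<in>slice_multiples I h. norm_H2_slice I (\<lambda>q. g q - k q) < e" by blast
    qed
  qed
  finally show ?thesis .
qed

section \<open>Bounded quaternionic power series\<close>

definition qbser :: "(nat \<Rightarrow> quat) \<Rightarrow> real \<Rightarrow> bool" where
  "qbser a M \<longleftrightarrow> bser (pc qre a) M \<and> bser (pc qi a) M \<and> bser (pc qj a) M \<and> bser (pc qk a) M"

lemma qbserD: "qbser a M \<Longrightarrow> m \<in> {qre, qi, qj, qk} \<Longrightarrow> bser (pc m a) M" by (auto simp: qbser_def)

lemma qbser_l2: "qbser a M \<Longrightarrow> l2 a"
  unfolding qbser_def by (intro l2_from_pc bser_l2) auto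

lemma qbser_cnjs: "qbser a M \<Longrightarrow> qbser (cnjs a) M"
  unfolding qbser_def pc_cnjs bser_def by (auto simp: dsum_minus)

lemma stem_cnj:
  assumes a: "qds a" and z: "cmod z < 1"
  shows "sA a (cnj z) = sA a z" "sB a (cnj z) = - sB a z"
proof -
  have "(\<lambda>n. Re (z ^ n) *\<^sub>R a n) sums sA a (cnj z)" "(\<lambda>n. - (Im (z ^ n) *\<^sub>R a n)) sums sB a (cnj z)"
    using stem_sums[OF a, of "cnj z"] z by (simp_all flip: complex_cnj_power)
  with stem_sums(1)[OF a z] sums_minus[OF stem_sums(2)[OF a z]] show "sA a (cnj z) = sA a z" "sB a (cnj z) = - sB a z"
    using sums_unique2 by blast+
qed

text \<open>On one slice the values at z and at the conjugate of z are A + I B and A - I B, so a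
  bound M for f bounds both A and B by M, and each complex component series by 2 M.\<close>

lemma Hinf_expansion:
  assumes "f \<in> Hinf"
  shows "\<exists>a M. has_expansion_on f a \<B> \<and> qbser a M"
proof -
  from assms have "slice_regular f" and "bounded (f ` \<B>)" by (auto simp: Hinf_def)
  then obtain a M where f: "has_expansion_on f a \<B>" and M: "\<And>q. q \<in> \<B> \<Longrightarrow> norm (f q) \<le> M"
    using slice_regular_imp_expansion by (force simp: bounded_iff)
  have a: "qds a" by (rule has_expansion_qds[OF f])
  let ?I = qim_unit
  have I: "?I \<in> \<S>" by (rule qim_unit_imag)
  have st: "norm (sA a z) \<le> M" "norm (sB a z) \<le> M" if z: "cmod z < 1" for z
  proof -
    have e: "f (emb ?I z) = sA a z + ?I * sB a z" if "cmod z < 1" for z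
      using has_expansion_eq[OF f, of "emb ?I z"] qeval_emb[OF a that I] that by (simp add: norm_emb[OF I])
    have n: "norm (f (emb ?I z)) \<le> M" "norm (f (emb ?I (cnj z))) \<le> M"
      using z by (intro M; simp add: norm_emb[OF I])+
    have f2: "f (emb ?I (cnj z)) = sA a z - ?I * sB a z" using e[of "cnj z"] z stem_cnj[OF a z] by simp
    have A: "2 *\<^sub>R sA a z = f (emb ?I z) + f (emb ?I (cnj z))" unfolding e[OF z] f2 by (simp add: scaleR_2)
    have B: "2 *\<^sub>R (?I * sB a z) = f (emb ?I z) - f (emb ?I (cnj z))" unfolding e[OF z] f2 by (simp add: scaleR_2)
    have "2 * norm (sA a z) \<le> M + M" using norm_triangle_ineq[of "f (emb ?I z)" "f (emb ?I (cnj z))"] n unfolding A[symmetric] by simp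
    thus "norm (sA a z) \<le> M" by simp
    have "norm ?I = 1" by (simp add: norm_quat_def qim_unit_def)
    hence "2 * norm (sB a z) \<le> M + M" using norm_triangle_ineq4[of "f (emb ?I z)" "f (emb ?I (cnj z))"] n unfolding B[symmetric] by (simp add: norm_mult)
    thus "norm (sB a z) \<le> M" by simp
  qed
  have "bser (pc m a) (2 * M)" if m: "m \<in> {qre, qi, qj, qk}" for m
    unfolding bser_def
  proof (intro conjI allI impI qdsD[OF a m])
    fix z :: complex assume z: "cmod z < 1"
    have "Re (pser (pc m a) z) = m (sA a z)" "Im (pser (pc m a) z) = m (sB a z)"
      using m by (auto simp: sA_def sB_def reQ_def imQ_def)
    thus "cmod (pser (pc m a) z) \<le> 2 * M"
      using cmod_le[of "pser (pc m a) z"] abs_comp_le[OF m, of "sA a z"] abs_comp_le[OF m, of "sB a z"] st[OF z] by linarith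
  qed
  hence "qbser a (2 * M)" by (simp add: qbser_def)
  with f show ?thesis by blast
qed

text \<open>Four components, each a signed sum of four scalar products controlled by
  \<open>l2_conv_bounded\<close>, give the crude factor 16.\<close>

lemma l2_qconv_bounded:
  assumes a: "qbser a M" and k: "l2 k"
  shows "l2 (conv a k)" "l2n (conv a k) \<le> 16 * M * l2n k"
proof -
  have c: "l2 (conv (pc m a) (pc m' k))" "l2n (conv (pc m a) (pc m' k)) \<le> M * l2n k"
    if m: "m \<in> {qre, qi, qj, qk}" "m' \<in> {qre, qi, qj, qk}" for m m'
  proof -
    note l = l2_conv_bounded[OF qbserD[OF a m(1)] l2_pc(1)[OF k m(2)]]
    show "l2 (conv (pc m a) (pc m' k))" by (rule l)
    have M: "M \<ge> 0" using a norm_ge_zero[of "pser (pc qre a) 0"] unfolding qbser_def bser_def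
      by (metis norm_zero order_trans zero_less_one)
    show "l2n (conv (pc m a) (pc m' k)) \<le> M * l2n k"
      by (rule order_trans[OF l(2)]) (intro mult_left_mono l2_pc(2) k m M)
  qed
  have four: "l2 (\<lambda>n. c1 n + s2 * c2 n + s3 * c3 n + s4 * c4 n) \<and> l2n (\<lambda>n. c1 n + s2 * c2 n + s3 * c3 n + s4 * c4 n) \<le> 4 * (M * l2n k)"
    if "l2 c1" "l2n c1 \<le> M * l2n k" "l2 c2" "l2n c2 \<le> M * l2n k" "l2 c3" "l2n c3 \<le> M * l2n k" "l2 c4" "l2n c4 \<le> M * l2n k"
     "cmod s2 = 1" "cmod s3 = 1" "cmod s4 = 1" for c1 c2 c3 c4 :: "nat \<Rightarrow> complex" and s2 s3 s4
  proof -
    have m: "l2 (\<lambda>n. s2 * c2 n)" "l2 (\<lambda>n. s3 * c3 n)" "l2 (\<lambda>n. s4 * c4 n)" "l2n (\<lambda>n. s2 * c2 n) = l2n c2" "l2n (\<lambda>n. s3 * c3 n) = l2n c3" "l2n (\<lambda>n. s4 * c4 n) = l2n c4"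
      using that l2_mult(1,2)[of c2 s2] l2_mult(1,2)[of c3 s3] l2_mult(1,2)[of c4 s4] by auto
    note a1 = l2_add[OF that(1) m(1)]
    note a2 = l2_add[OF a1(1) m(2)]
    note a3 = l2_add[OF a2(1) m(3)]
    show ?thesis using a1(2) a2(2) a3 m(4-6) that by auto
  qed
  have p: "l2 (pc qre (conv a k)) \<and> l2n (pc qre (conv a k)) \<le> 4 * (M * l2n k)" "l2 (pc qi (conv a k)) \<and> l2n (pc qi (conv a k)) \<le> 4 * (M * l2n k)"
    "l2 (pc qj (conv a k)) \<and> l2n (pc qj (conv a k)) \<le> 4 * (M * l2n k)" "l2 (pc qk (conv a k)) \<and> l2n (pc qk (conv a k)) \<le> 4 * (M * l2n k)"
    unfolding pc_conv by (intro four c; simp)+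
  show "l2 (conv a k)" by (rule l2_from_pc(1)) (use p in auto)
  have s: "sqrt (x + y) \<le> sqrt x + sqrt y" if "x \<ge> 0" "y \<ge> 0" for x y by (rule sqrt_add_le_add_sqrt[OF that])
  have nn: "l2sq (pc m (conv a k)) \<ge> 0" if "m \<in> {qre, qi, qj, qk}" for m
    using that p by (auto intro: l2sq_nonneg)
  have "l2n (conv a k) \<le> l2n (pc qre (conv a k)) + l2n (pc qi (conv a k)) + l2n (pc qj (conv a k)) + l2n (pc qk (conv a k))"
    unfolding l2n_def using p nn
    by (subst l2_from_pc(2)) (auto intro!: order_trans[OF s] add_mono order_refl)
  thus "l2n (conv a k) \<le> 16 * M * l2n k" using p by linarith
qed

text \<open>If a * b * p is near 1, then so is a times a truncation of b * p, because left
  multiplication by the bounded series a is continuous. It is the right factor that is dropped in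
  this way.\<close>

lemma cyc_conv_left:
  assumes a: "qbser a M" and b: "l2 b" and c: "cyc (conv a b)" and b': "qbser b M'"
  shows "cyc a"
  unfolding cyc_def
proof (intro allI impI)
  fix e :: real assume e: "e > 0"
  define C where "C = 16 * \<bar>M\<bar> + 1"
  have C: "C > 0" by (simp add: C_def)
  obtain p where p: "fins p" "l2 (\<lambda>n. conv (conv a b) p n - delta0 n)" "l2n (\<lambda>n. conv (conv a b) p n - delta0 n) < e / 2"
    using c e unfolding cyc_def by (meson half_gt_zero)
  define k where "k = conv b p"
  have k: "l2 k" using p(1) l2_conv_fins(1)[OF b] by (auto simp: k_def fins_def)
  obtain N where N: "l2n (tail k N) < e / (2 * C)" using l2n_tail_small[OF k, of "e / (2 * C)"] e C by auto
  define q where "q n = (if n < N then k n else 0)" for n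
  have qf: "fins q" by (auto simp: fins_def q_def intro!: exI[of _ N])
  note t = l2_qconv_bounded[OF a l2_tail[OF k, of N]]
  have "16 * M * l2n (tail k N) \<le> C * l2n (tail k N)"
    using l2n_nonneg[OF l2_tail[OF k, of N]] by (intro mult_right_mono) (auto simp: C_def)
  also have "\<dots> < C * (e / (2 * C))" using N C by (intro mult_strict_left_mono)
  also have "\<dots> = e / 2" using C by simp
  finally have t2: "l2n (conv a (tail k N)) < e / 2" using t(2) by linarith
  have eq: "(\<lambda>n. conv a q n - delta0 n) = (\<lambda>n. (conv (conv a b) p n - delta0 n) - conv a (tail k N) n)"
  proof
    fix n
    have "q = (\<lambda>n. k n - tail k N n)" unfolding q_def by (rule trunc_eq)
    thus "conv a q n - delta0 n = (conv (conv a b) p n - delta0 n) - conv a (tail k N) n"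
      by (simp add: conv_diff_right k_def conv_assoc)
  qed
  have "l2 (\<lambda>n. conv a q n - delta0 n)" "l2n (\<lambda>n. conv a q n - delta0 n) < e"
    unfolding eq using l2_diff[OF p(2) t(1)] p(3) t2 by auto
  thus "\<exists>p. fins p \<and> l2 (\<lambda>n. conv a p n - delta0 n) \<and> l2n (\<lambda>n. conv a p n - delta0 n) < e"
    using qf by blast
qed

section \<open>The symmetrization\<close>

lemma norm_quat_mult: "norm q * norm q = qre q * qre q + qi q * qi q + qj q * qj q + qk q * qk q"
  using norm_quat_sq[of q] by (simp add: power2_eq_square)

definition symc :: "(nat \<Rightarrow> quat) \<Rightarrow> nat \<Rightarrow> real" where
  "symc a n = qre (conv a (cnjs a) n)"

lemma sym_of_real: "conv a (cnjs a) = (\<lambda>n. of_real (symc a n))"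
proof
  fix n
  have "cnjs (conv a (cnjs a)) = conv a (cnjs a)" by (simp add: cnjs_conv)
  hence "qcnj (conv a (cnjs a) n) = conv a (cnjs a) n" by (metis cnjs_def)
  thus "conv a (cnjs a) n = of_real (symc a n)" by (simp add: quat_eq_iff symc_def)
qed

lemma sym_pc: "pc qre (conv a (cnjs a)) = (\<lambda>n. of_real (symc a n))"
  by (simp add: pc_def symc_def fun_eq_iff)

text \<open>b * b^c has real coefficients and hence commutes with a^c, so that a * b * b^c * a^c can
  be regrouped as a * a^c * b * b^c.\<close>

lemma sym_conv: "symc (conv a b) = conv (symc a) (symc b)"
proof
  fix n
  have "conv (conv a b) (cnjs (conv a b)) = conv a (conv (conv b (cnjs b)) (cnjs a))"
    by (simp add: cnjs_conv conv_assoc)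
  also have "\<dots> = conv a (conv (cnjs a) (conv b (cnjs b)))"
    unfolding sym_of_real[of b] conv_of_real_commute ..
  also have "\<dots> = conv (\<lambda>n. of_real (symc a n)) (\<lambda>n. of_real (symc b n))"
    by (simp only: conv_assoc[symmetric] sym_of_real)
  finally have "conv (conv a b) (cnjs (conv a b)) n = of_real (conv (symc a) (symc b) n)"
    by (simp add: conv_of_real)
  thus "symc (conv a b) n = conv (symc a) (symc b) n" by (simp add: symc_def)
qed

text \<open>Both products have the stem part |A|^2 - |B|^2, and values on the real axis determine
  the coefficients.\<close>

lemma sym_cnjs: 
  assumes a: "qds a"
  shows "conv (cnjs a) a = conv a (cnjs a)"
proof -
  have r: "conv (cnjs a) a = (\<lambda>n. of_real (symc (cnjs a) n))" using sym_of_real[of "cnjs a"] by simp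
  have "sA (conv (cnjs a) a) z = sA (conv a (cnjs a)) z" if "cmod z < 1" for z
    using pser_pc_conv(2)[OF a qds_cnjs[OF a] that] pser_pc_conv(2)[OF qds_cnjs[OF a] a that]
    by (simp add: stem_cnjs[OF a that] quat_eq_iff)
  note eq = this
  have sm: "(\<lambda>n. of_real x ^ n * c n) sums sA c (of_real x)" if "\<bar>x\<bar> < 1" "qds c" for x c
    using stem_sums(1)[OF that(2), of "of_real x"] that(1) by (simp add: scaleR_conv_of_real flip: of_real_power)
  show ?thesis
  proof (rule expansion_unique)
    fix x :: real assume x: "\<bar>x\<bar> < 1"
    hence "cmod (of_real x) < 1" by simp
    from eq[OF this] show "(\<lambda>n. of_real x ^ n * conv (cnjs a) a n) sums sA (conv a (cnjs a)) (of_real x)"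
      using sm[OF x pser_pc_conv(1)[OF qds_cnjs[OF a] a]] by simp
    show "(\<lambda>n. of_real x ^ n * conv a (cnjs a) n) sums sA (conv a (cnjs a)) (of_real x)"
      by (rule sm[OF x pser_pc_conv(1)[OF a qds_cnjs[OF a]]])
  qed
qed

text \<open>The scalar function of a^s is |A|^2 - |B|^2 + 2 i <A, B>, and Cauchy-Schwarz bounds its
  modulus.\<close>

lemma sym_norm_le:
  assumes a: "qds a" and z: "cmod z < 1"
  shows "cmod (pser (\<lambda>n. of_real (symc a n)) z) \<le> (norm (sA a z))\<^sup>2 + (norm (sB a z))\<^sup>2"
proof -
  define A B where "A = sA a z" "B = sB a z"
  have "Re (pser (pc qre (conv a (cnjs a))) z) = qre (sA (conv a (cnjs a)) z)" "Im (pser (pc qre (conv a (cnjs a))) z) = qre (sB (conv a (cnjs a)) z)"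
    by (simp_all add: sA_def sB_def reQ_def imQ_def)
  hence e: "Re (pser (\<lambda>n. of_real (symc a n)) z) = (norm A)\<^sup>2 - (norm B)\<^sup>2" "Im (pser (\<lambda>n. of_real (symc a n)) z) = 2 * inner A B"
    unfolding sym_pc pser_pc_conv(2,3)[OF a qds_cnjs[OF a] z] stem_cnjs[OF a z] A_B_def
    by (simp_all add: norm_quat_mult inner_quat_def power2_eq_square)
  have "(inner A B)\<^sup>2 \<le> (norm A)\<^sup>2 * (norm B)\<^sup>2"
    using Cauchy_Schwarz_ineq[of A B] by (simp add: power2_norm_eq_inner)
  hence "(cmod (pser (\<lambda>n. of_real (symc a n)) z))\<^sup>2 \<le> ((norm A)\<^sup>2 + (norm B)\<^sup>2)\<^sup>2"
    unfolding cmod_power2 e by (simp add: power2_eq_square algebra_simps)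
  thus ?thesis unfolding A_B_def by (rule power2_le_imp_le) simp
qed

lemma sym_bser:
  assumes a: "qbser a M"
  shows "\<exists>M'. bser (\<lambda>n. of_real (symc a n)) M'"
proof -
  have q: "qds a" by (rule l2_qds[OF qbser_l2[OF a]])
  have "dsum (\<lambda>n. of_real (symc a n))" unfolding sym_pc[symmetric]
    using pser_pc_conv(1)[OF q qds_cnjs[OF q]] by (simp add: qds_def)
  moreover have "cmod (pser (\<lambda>n. of_real (symc a n)) z) \<le> 4 * M\<^sup>2" if z: "cmod z < 1" for z
  proof -
    have "(norm (sA a z))\<^sup>2 + (norm (sB a z))\<^sup>2 = (cmod (pser (pc qre a) z))\<^sup>2 + (cmod (pser (pc qi a) z))\<^sup>2 + (cmod (pser (pc qj a) z))\<^sup>2 + (cmod (pser (pc qk a) z))\<^sup>2"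
      by (simp add: norm_quat_sq sA_def sB_def reQ_def imQ_def cmod_power2)
    also have "\<dots> \<le> M\<^sup>2 + M\<^sup>2 + M\<^sup>2 + M\<^sup>2"
      using a z by (intro add_mono power_mono) (auto simp: qbser_def bser_def)
    finally show ?thesis using sym_norm_le[OF q z] by linarith
  qed
  ultimately show ?thesis unfolding bser_def by blast
qed

lemma sym_bd_le:
  assumes k: "l2 k" and s: "l2 (\<lambda>n. complex_of_real (symc k n))"
  shows "AE t in circ. cmod (bd (\<lambda>n. of_real (symc k n)) t) \<le> (norm (bA k t))\<^sup>2 + (norm (bB k t))\<^sup>2"
  using bd_AE[OF s] stem_radial[OF k]
proof eventually_elim
  case (elim t)
  show ?case
  proof (rule tendsto_le)
    show "((\<lambda>r. (norm (sA k (of_real r * cis t)))\<^sup>2 + (norm (sB k (of_real r * cis t)))\<^sup>2) \<longlongrightarrow> (norm (bA k t))\<^sup>2 + (norm (bB k t))\<^sup>2) (at_left 1)"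
      using elim by (intro tendsto_intros) auto
    show "((\<lambda>r. cmod (pser (\<lambda>n. of_real (symc k n)) (of_real r * cis t))) \<longlongrightarrow> cmod (bd (\<lambda>n. of_real (symc k n)) t)) (at_left 1)"
      using elim by (intro tendsto_intros) auto
    show "\<forall>\<^sub>F r in at_left 1. cmod (pser (\<lambda>n. of_real (symc k n)) (of_real r * cis t)) \<le> (norm (sA k (of_real r * cis t)))\<^sup>2 + (norm (sB k (of_real r * cis t)))\<^sup>2"
      using at_left_1_ge by eventually_elim (rule sym_norm_le[OF l2_qds[OF k]], simp add: norm_mult)
  qed simp
qed

lemma sym_0: "symc a 0 = (norm (a 0))\<^sup>2"
  by (simp add: symc_def conv_0 cnjs_def norm_quat_mult power2_eq_square)

text \<open>From \<open>a * p \<approx> 1\<close> one gets \<open>a\<^sup>s p\<^sup>s = (a * p)\<^sup>s\<close>, which is bounded by the square of the norm of the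
  stem of \<open>a * p\<close>, so Jensen's inequality for \<open>a\<^sup>s\<close> must be an equality.\<close>

theorem cyc_imp_cyc_sym:
  assumes a: "qbser a M" and cyc: "cyc a"
  shows "cyc (symc a)"
proof -
  let ?\<phi> = "\<lambda>n. complex_of_real (symc a n)"
  obtain M' where b: "bser ?\<phi> M'" using sym_bser[OF a] by blast
  have bl: "l2 ?\<phi>" by (rule bser_l2[OF b])
  have al: "l2 a" by (rule qbser_l2[OF a])
  have a0: "a 0 \<noteq> 0"
  proof
    assume "a 0 = 0"
    obtain p where "l2 (\<lambda>n. conv a p n - delta0 n)" "l2n (\<lambda>n. conv a p n - delta0 n) < 1/2"
      using cyc unfolding cyc_def by (metis half_gt_zero zero_less_one)
    from cyc_approx(3)[OF this] \<open>a 0 = 0\<close> show False by simp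
  qed
  have b0: "?\<phi> 0 \<noteq> 0" using a0 by (simp add: sym_0)
  have nb0: "ln (cmod (?\<phi> 0)) = 2 * ln (norm (a 0))" using a0 by (simp add: sym_0 ln_realpow norm_power)
  note J = poisson_log_jensen[OF b, of 0, unfolded pser_0 PK_0 mult_1_left, simplified norm_zero, OF zero_less_one b0]
  have "integral\<^sup>L circ (\<lambda>t. ln (cmod (bd ?\<phi> t))) \<le> ln (cmod (?\<phi> 0)) + 2 * (ln (1 + e) - ln (1 - e))" if e: "0 < e" "e < 1" for e :: real
  proof -
    obtain p where p: "fins p" "l2 (\<lambda>n. conv a p n - delta0 n)" "l2n (\<lambda>n. conv a p n - delta0 n) < e"
      using cyc e unfolding cyc_def by blast
    note q = cyc_approx[OF p(2,3)]
    define k where "k = conv a p"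
    let ?\<psi> = "\<lambda>n. complex_of_real (symc p n)"
    have "fins (cnjs p)" using p(1) unfolding fins_def cnjs_def by (metis qcnj_simps(2))
    hence "fins (conv p (cnjs p))" by (rule fins_conv[OF p(1)])
    hence pf: "fins ?\<psi>" unfolding symc_def fins_def by (metis of_real_0 quat_sel(1))
    obtain P where P: "coeff P = ?\<psi>" using fins_poly[OF pf] by blast
    have p0: "p 0 \<noteq> 0" using q(3) e by auto
    have Jp: "AE t in circ. bd ?\<psi> t \<noteq> 0" "integrable circ (\<lambda>t. ln (cmod (bd ?\<psi> t)))"
      "2 * ln (norm (p 0)) \<le> integral\<^sup>L circ (\<lambda>t. ln (cmod (bd ?\<psi> t)))"
      using poisson_log_jensen[OF bser_coeff[of P], of 0] p0 unfolding P by (auto simp: sym_0 ln_realpow norm_power)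
    have kl: "l2 k" unfolding k_def by (rule q(1))
    have sk: "(\<lambda>n. complex_of_real (symc k n)) = conv ?\<phi> ?\<psi>"
      unfolding k_def sym_conv by (simp add: conv_of_real[where ?'a = complex, symmetric])
    have skl: "l2 (\<lambda>n. complex_of_real (symc k n))" unfolding sk by (rule l2_conv_bounded(1)[OF b fins_l2[OF pf]])
    define v where "v t = cmod (bd ?\<phi> t) * cmod (bd ?\<psi> t)" for t
    define N where "N t = (norm (bA k t))\<^sup>2 + (norm (bB k t))\<^sup>2" for t
    note [measurable] = bd_measurable[OF bl] bd_measurable[OF fins_l2[OF pf]]
    \<comment> \<open>In the scalar case the mean of |b p|^2 was itself a squared norm; here |a^s
      p^s| is only dominated by the stem norm of a * p, but in the direction that an upper bound for
      the mean logarithm needs.\<close>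
    have vN: "AE t in circ. v t \<le> N t" using sym_bd_le[OF kl skl] bd_conv[OF bl fins_l2[OF pf]] unfolding sk
      by eventually_elim (simp add: v_def N_def norm_mult)
    have iN: "integrable circ N" "integral\<^sup>L circ N = l2sq k" unfolding N_def[abs_def] by (rule stem_parseval[OF kl])+
    have vm: "v \<in> borel_measurable circ" unfolding v_def[abs_def] by measurable
    have iv: "integrable circ v"
      by (rule Bochner_Integration.integrable_bound[OF iN(1) vm]) (use vN in \<open>eventually_elim, simp add: v_def N_def\<close>)
    have veq: "AE t in circ. v t > 0 \<and> ln (v t) = ln (cmod (bd ?\<phi> t)) + ln (cmod (bd ?\<psi> t))"
      using J(1) Jp(1) by eventually_elim (simp add: v_def ln_mult)
    have i2: "integrable circ (\<lambda>t. ln (cmod (bd ?\<phi> t)) + ln (cmod (bd ?\<psi> t)))" using J(2) Jp(2) by simp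
    have lvm: "(\<lambda>t. ln (v t)) \<in> borel_measurable circ" using vm by measurable
    have ilv: "integrable circ (\<lambda>t. ln (v t))"
      by (rule integrable_cong_AE_imp[OF i2 lvm]) (use veq in \<open>eventually_elim, simp\<close>)
    have v1: "AE t in circ. v t > 0" using veq by eventually_elim simp
    have "integral\<^sup>L circ (\<lambda>t. ln (cmod (bd ?\<phi> t))) + integral\<^sup>L circ (\<lambda>t. ln (cmod (bd ?\<psi> t))) = integral\<^sup>L circ (\<lambda>t. ln (v t))"
    proof -
      have "integral\<^sup>L circ (\<lambda>t. ln (v t)) = integral\<^sup>L circ (\<lambda>t. ln (cmod (bd ?\<phi> t)) + ln (cmod (bd ?\<psi> t)))"
        by (rule integral_cong_AE[OF lvm borel_measurable_integrable[OF i2]]) (use veq in \<open>eventually_elim, simp\<close>)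
      thus ?thesis using J(2) Jp(2) by simp
    qed
    also have "\<dots> \<le> ln (integral\<^sup>L circ v)" by (rule ln_mean_le[OF v1 iv ilv])
    also have "\<dots> \<le> ln ((1 + e)\<^sup>2)"
    proof (rule ln_mono)
      show "0 < integral\<^sup>L circ v" by (rule ln_mean_le(1)[OF v1 iv ilv])
      have "integral\<^sup>L circ v \<le> l2sq k" unfolding iN(2)[symmetric] by (rule integral_mono_AE[OF iv iN(1) vN])
      also have "\<dots> = (l2n k)\<^sup>2" by (rule l2n_sq[OF kl, symmetric])
      also have "\<dots> \<le> (1 + e)\<^sup>2" using q(2) l2n_nonneg[OF kl] by (intro power_mono) (auto simp: k_def)
      finally show "integral\<^sup>L circ v \<le> (1 + e)\<^sup>2" .
    qed
    also have "\<dots> = 2 * ln (1 + e)" using e by (simp add: ln_realpow)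
    finally have 1: "integral\<^sup>L circ (\<lambda>t. ln (cmod (bd ?\<phi> t))) + 2 * ln (norm (p 0)) \<le> 2 * ln (1 + e)" using Jp(3) by linarith
    have 2: "ln (1 - e) \<le> ln (norm (a 0)) + ln (norm (p 0))"
      using q(3) e a0 p0 by (subst ln_mult_pos[symmetric]) (auto intro: ln_mono)
    have arith: "x \<le> 2 * u + 2 * (v - y)" if "x + 2 * w \<le> 2 * v" "y \<le> u + w" for x u v w y :: real
      using that by (simp add: algebra_simps)
    show ?thesis unfolding nb0 by (rule arith[OF 1 2])
  qed
  moreover have "((\<lambda>e. ln (cmod (?\<phi> 0)) + 2 * (ln (1 + e) - ln (1 - e))) \<longlongrightarrow> ln (cmod (?\<phi> 0)) + 2 * (ln (1 + 0) - ln (1 - 0))) (at_right (0::real))"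
    by (intro tendsto_intros) auto
  ultimately have "integral\<^sup>L circ (\<lambda>t. ln (cmod (bd ?\<phi> t))) \<le> ln (cmod (?\<phi> 0))"
    by (intro tendsto_lowerbound[where F = "at_right (0::real)"])
      (auto intro!: eventually_mono[OF eventually_at_right_real[of 0 1]])
  with J(3) b0 have "cyc ?\<phi>" unfolding cyc_iff_log_mean[OF b] by simp
  thus ?thesis by (simp add: cyc_of_real_complex)
qed

text \<open>a^s is both a * a^c and a^c * a, so either factor can be put on the left, where
  \<open>cyc_conv_left\<close> retains it.\<close>

theorem cyc_sym_imp:
  assumes a: "qbser a M" and c: "cyc (symc a)"
  shows "cyc a" "cyc (cnjs a)"
proof -
  have "cyc (conv a (cnjs a))" unfolding sym_of_real cyc_of_real_quat by (rule c)
  thus "cyc a" by (rule cyc_conv_left[OF a qbser_l2[OF qbser_cnjs[OF a]] _ qbser_cnjs[OF a]])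
  have "cyc (conv (cnjs a) a)" unfolding sym_cnjs[OF l2_qds[OF qbser_l2[OF a]]] sym_of_real cyc_of_real_quat by (rule c)
  thus "cyc (cnjs a)" by (rule cyc_conv_left[OF qbser_cnjs[OF a] qbser_l2[OF a] _ a])
qed

section \<open>Moduli of stems over the sphere of imaginary units\<close>

lemma inner_mult_left: "inner (a * x) y = inner x (qcnj a * (y::quat))"
  by (simp add: inner_quat_def algebra_simps)

lemma inner_imag:
  "qre V = 0 \<Longrightarrow> inner x (V * y) = qi V * inner x (Quat 0 1 0 0 * y) + qj V * inner x (Quat 0 0 1 0 * y) + qk V * inner x (Quat 0 0 0 1 * y)"
  by (simp add: inner_quat_def algebra_simps)

lemma norm_sum_sq: "(norm (x + y :: quat))\<^sup>2 = (norm x)\<^sup>2 + (norm y)\<^sup>2 + 2 * inner x y"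
  by (simp add: power2_norm_eq_inner inner_add_left inner_add_right inner_commute)

lemma norm_imag_unit: "I \<in> \<S> \<Longrightarrow> norm I = 1"
  by (simp add: imag_units_iff norm_quat_def)

text \<open>For a stem \<open>(x, y)\<close>, the function \<open>I \<mapsto> |x + I y|\<close> on the sphere determines and is determined
  by \<open>|x|\<^sup>2 + |y|\<^sup>2\<close> and the three numbers \<open>\<langle>x, e y\<rangle>\<close>.\<close>

definition same_mod :: "quat \<Rightarrow> quat \<Rightarrow> quat \<Rightarrow> quat \<Rightarrow> bool" where
  "same_mod x y x' y' \<longleftrightarrow> (norm x)\<^sup>2 + (norm y)\<^sup>2 = (norm x')\<^sup>2 + (norm y')\<^sup>2 \<and>
     (\<forall>V. qre V = 0 \<longrightarrow> inner x (V * y) = inner x' (V * y'))"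

lemma norm_slice_sq: "I \<in> \<S> \<Longrightarrow> (norm (x + I * y))\<^sup>2 = (norm x)\<^sup>2 + (norm y)\<^sup>2 + 2 * inner x (I * y)"
  by (simp add: norm_sum_sq norm_mult norm_imag_unit)

lemma same_modD: "same_mod x y x' y' \<Longrightarrow> I \<in> \<S> \<Longrightarrow> norm (x + I * y) = norm (x' + I * y')"
proof -
  assume s: "same_mod x y x' y'" and I: "I \<in> \<S>"
  have "qre I = 0" using I by (simp add: imag_units_iff)
  hence "(norm (x + I * y))\<^sup>2 = (norm (x' + I * y'))\<^sup>2"
    using s unfolding norm_slice_sq[OF I] same_mod_def by auto
  thus ?thesis by simp
qed

text \<open>The squared moduli differ by an affine function of I, and these four points are affinely
  independent. They are chosen in the interior of the rectangle of spherical coordinates, which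
  excludes i (azimuth 0) and k (polar angle 0).\<close>

lemma same_modI:
  assumes "\<And>I. I \<in> {Quat 0 (-1) 0 0, Quat 0 0 1 0, Quat 0 0 (-1) 0, Quat 0 0 (sqrt (1/2)) (sqrt (1/2))} \<Longrightarrow> norm (x + I * y) = norm (x' + I * y')"
  shows "same_mod x y x' y'"
proof -
  let ?e1 = "Quat 0 1 0 0" and ?e2 = "Quat 0 0 1 0" and ?e3 = "Quat 0 0 0 1"
  define d where "d = (norm x)\<^sup>2 + (norm y)\<^sup>2 - ((norm x')\<^sup>2 + (norm y')\<^sup>2)"
  define w where "w e = inner x (e * y) - inner x' (e * y')" for e
  have eq: "d + 2 * (qi I * w ?e1 + qj I * w ?e2 + qk I * w ?e3) = 0"
    if I: "I \<in> {Quat 0 (-1) 0 0, Quat 0 0 1 0, Quat 0 0 (-1) 0, Quat 0 0 (sqrt (1/2)) (sqrt (1/2))}" for I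
  proof -
    have IS: "I \<in> \<S>" using I by (auto simp: imag_units_iff)
    hence "qre I = 0" by (simp add: imag_units_iff)
    with assms[OF I] norm_slice_sq[OF IS, of x y] norm_slice_sq[OF IS, of x' y'] show ?thesis
      unfolding d_def w_def by (simp add: inner_imag[of I] algebra_simps)
  qed
  from eq[of "Quat 0 (-1) 0 0"] eq[of "Quat 0 0 1 0"] eq[of "Quat 0 0 (-1) 0"] eq[of "Quat 0 0 (sqrt (1/2)) (sqrt (1/2))"]
  have "d = 0" "w ?e1 = 0" "w ?e2 = 0" "w ?e3 = 0" by auto
  hence "inner x (V * y) = inner x' (V * y')" if "qre V = 0" for V
    unfolding inner_imag[OF that] w_def by simp
  thus ?thesis using \<open>d = 0\<close> unfolding same_mod_def d_def by simp
qed

text \<open>\<open>qcnj a * b - qcnj b * a\<close> is purely imaginary, so the norm of a stem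
  multiplied on the left depends on (x, y) only through the quantities in \<open>same_mod\<close>.
  This ties the boundary modulus to left multiples.\<close>

lemma stem_mult_norm:
  fixes a b x y :: quat
  shows "(norm (a * x - b * y))\<^sup>2 + (norm (a * y + b * x))\<^sup>2 =
    ((norm a)\<^sup>2 + (norm b)\<^sup>2) * ((norm x)\<^sup>2 + (norm y)\<^sup>2) - 2 * inner x ((qcnj a * b - qcnj b * a) * y)"
proof -
  have "(norm (a * x - b * y))\<^sup>2 = (norm (a * x))\<^sup>2 + (norm (b * y))\<^sup>2 - 2 * inner (a * x) (b * y)"
    using norm_sum_sq[of "a * x" "- (b * y)"] by simp
  moreover have "(norm (a * y + b * x))\<^sup>2 = (norm (a * y))\<^sup>2 + (norm (b * x))\<^sup>2 + 2 * inner (b * x) (a * y)"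
    using norm_sum_sq[of "a * y" "b * x"] by (simp add: inner_commute)
  ultimately show ?thesis unfolding inner_mult_left
    by (simp add: norm_mult power_mult_distrib inner_diff_right algebra_simps)
qed

lemma same_mod_mult:
  assumes "same_mod x y x' y'"
  shows "(norm (a * x - b * y))\<^sup>2 + (norm (a * y + b * x))\<^sup>2 = (norm (a * x' - b * y'))\<^sup>2 + (norm (a * y' + b * x'))\<^sup>2"
proof -
  have "qre (qcnj a * b - qcnj b * a) = 0" by simp
  with assms show ?thesis unfolding stem_mult_norm same_mod_def by auto
qed

text \<open>With u = x + I y the new value is u g + I u d. The two summands are orthogonal because
  \<open>qcnj u * (I * u)\<close> is imaginary, so the modulus is |u| for every I.\<close>

lemma inner_stem_mult:
  assumes I: "I \<in> \<S>" and g: "(norm g)\<^sup>2 + (norm d)\<^sup>2 = 1" "\<And>V. qre V = 0 \<Longrightarrow> inner g (V * d) = 0"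
  shows "norm ((x * g - y * d) + I * (x * d + y * g)) = norm (x + I * y)"
proof -
  define u where "u = x + I * y"
  have II: "I * (I * z) = - z" for z using imag_unit_sq[OF I] by (simp flip: mult.assoc)
  have e: "(x * g - y * d) + I * (x * d + y * g) = u * g + I * u * d"
    by (simp add: u_def distrib_left distrib_right left_diff_distrib right_diff_distrib mult.assoc II)
  have I0: "qre I = 0" using I by (simp add: imag_units_iff)
  have "qre (qcnj u * (I * u)) = 0" using I0 by (simp add: algebra_simps)
  hence "inner (u * g) (I * u * d) = 0" unfolding inner_mult_left using g(2)[of "qcnj u * (I * u)"] by (simp add: mult.assoc)
  hence "(norm (u * g + I * u * d))\<^sup>2 = (norm u)\<^sup>2 * ((norm g)\<^sup>2 + (norm d)\<^sup>2)"
    by (simp add: norm_sum_sq norm_mult norm_imag_unit[OF I] power_mult_distrib algebra_simps)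
  hence "(norm (u * g + I * u * d))\<^sup>2 = (norm u)\<^sup>2" unfolding g(1) by simp
  thus ?thesis unfolding e u_def[symmetric] by simp
qed

section \<open>The boundary measure\<close>

lemma qcis_norm: "I \<in> \<S> \<Longrightarrow> norm (qcis I t) = 1"
  by (simp flip: emb_cis add: norm_emb)

lemma radial_limit_eq:
  assumes f: "has_expansion_on f a \<B>" and I: "I \<in> \<S>"
    and l: "((\<lambda>r. sA a (of_real r * cis t)) \<longlongrightarrow> bA a t) (at_left 1) \<and> ((\<lambda>r. sB a (of_real r * cis t)) \<longlongrightarrow> bB a t) (at_left 1)"
  shows "radial_limit f (qcis I t) = bA a t + I * bB a t"
  unfolding radial_limit_def
proof (rule tendsto_Lim)
  have "((\<lambda>r. sA a (of_real r * cis t) + I * sB a (of_real r * cis t)) \<longlongrightarrow> bA a t + I * bB a t) (at_left 1)"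
    using l by (intro tendsto_intros) auto
  moreover have "\<forall>\<^sub>F r in at_left 1. sA a (of_real r * cis t) + I * sB a (of_real r * cis t) = f (r *\<^sub>R qcis I t)"
    using at_left_1_ge
  proof eventually_elim
    case (elim r)
    have q: "r *\<^sub>R qcis I t = emb I (of_real r * cis t)" by (simp add: scaleR_emb flip: emb_cis)
    have z: "cmod (of_real r * cis t) < 1" using elim by (simp add: norm_mult)
    show ?case unfolding q
      using has_expansion_eq[OF f, of "emb I (of_real r * cis t)"] qeval_emb[OF has_expansion_qds[OF f] z I] z
      by (simp add: norm_emb[OF I])
  qed
  ultimately show "((\<lambda>r. f (r *\<^sub>R qcis I t)) \<longlongrightarrow> bA a t + I * bB a t) (at_left 1)"
    by (rule Lim_transform_eventually)
qed simp

definition tmeas :: "real measure" where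
  "tmeas = density lborel (indicator {0..<2*pi})"

lemma sets_tmeas [simp, measurable_cong]: "sets tmeas = sets borel" and space_tmeas [simp]: "space tmeas = UNIV"
  by (simp_all add: tmeas_def)

lemma finite_tmeas: "finite_measure tmeas"
  by (rule finite_measureI) (simp add: tmeas_def emeasure_density)

lemma sets_sphere_area [simp, measurable_cong]: "sets sphere_area = sets borel" and space_sphere_area [simp]: "space sphere_area = UNIV"
  by (simp_all add: sphere_area_def)

lemma finite_sphere_area: "finite_measure sphere_area"
  by (rule finite_measureI) (simp add: emeasure_sphere_area)

lemma pair_sphere: "pair_sigma_finite sphere_area tmeas"
  using finite_measure.axioms(1)[OF finite_sphere_area] finite_measure.axioms(1)[OF finite_tmeas]
  by (simp add: pair_sigma_finite_def)

lemma AE_tmeas: "(AE t in tmeas. P t) \<longleftrightarrow> (AE t in lborel. t \<in> {0..<2*pi} \<longrightarrow> P t)"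
  unfolding tmeas_def by (subst AE_density) (auto intro!: AE_cong simp: indicator_def)

text \<open>The two measures differ by a constant factor and the endpoint 2 pi.\<close>

lemma AE_tmeas_circ: "(AE t in tmeas. P t) \<longleftrightarrow> (AE t in circ. P t)"
proof
  assume "AE t in tmeas. P t"
  thus "AE t in circ. P t" unfolding AE_tmeas AE_circ using AE_lborel_singleton[of "2*pi"]
    by eventually_elim auto
next
  assume "AE t in circ. P t"
  thus "AE t in tmeas. P t" unfolding AE_tmeas AE_circ by eventually_elim auto
qed

lemma AE_boundary: "(AE q in boundary_measure. P q) \<longleftrightarrow> (AE q in distr (sphere_area \<Otimes>\<^sub>M tmeas) borel (\<lambda>(I, t). qcis I t). P q)"
proof -
  have "ennreal (1 / (8 * pi\<^sup>2)) \<noteq> 0" by (simp add: ennreal_eq_0_iff not_le)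
  thus ?thesis unfolding boundary_measure_def tmeas_def[symmetric] eventually_ae_filter null_sets_def
    by (simp add: space_scale_measure)
qed

lemma qcis_measurable: "(\<lambda>(I, t). qcis I t) \<in> borel_measurable (sphere_area \<Otimes>\<^sub>M tmeas)"
proof -
  have "(\<lambda>(I, t). qcis I t) \<in> borel_measurable (borel \<Otimes>\<^sub>M borel)" unfolding borel_prod
    by (rule borel_measurable_continuous_onI) (auto simp: qcis_def case_prod_beta of_real_def intro!: continuous_intros)
  thus ?thesis by (simp cong: measurable_cong_sets)
qed

definition sph :: "real \<times> real \<Rightarrow> quat" where
  "sph = (\<lambda>(\<phi>, \<theta>). Quat 0 (sin \<phi> * cos \<theta>) (sin \<phi> * sin \<theta>) (cos \<phi>))"

lemma sph_continuous: "continuous_on UNIV sph"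
proof -
  have "sph = (\<lambda>x. (sin (fst x) * cos (snd x)) *\<^sub>R Quat 0 1 0 0 + (sin (fst x) * sin (snd x)) *\<^sub>R Quat 0 0 1 0 + cos (fst x) *\<^sub>R Quat 0 0 0 1)"
    by (rule ext) (simp add: sph_def case_prod_beta quat_eq_iff)
  moreover have "continuous_on UNIV \<dots>" by (intro continuous_intros)
  ultimately show ?thesis by (simp only:)
qed

lemma sph_imag: "sph x \<in> \<S>"
proof -
  have "(sin (fst x))\<^sup>2 * (cos (snd x))\<^sup>2 + (sin (fst x))\<^sup>2 * (sin (snd x))\<^sup>2 = (sin (fst x))\<^sup>2"
    by (simp flip: distrib_left)
  thus ?thesis by (simp add: imag_units_iff sph_def case_prod_beta power_mult_distrib)
qed

definition smeas :: "(real \<times> real) measure" where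
  "smeas = density lborel (\<lambda>(\<phi>, \<theta>). ennreal (sin \<phi>) * indicator ({0..pi} \<times> {0..<2*pi}) (\<phi>, \<theta>))"

lemma sets_smeas [simp, measurable_cong]: "sets smeas = sets borel" and space_smeas [simp]: "space smeas = UNIV"
  by (simp_all add: smeas_def)

lemma sphere_area_smeas: "sphere_area = distr smeas borel sph"
  by (simp add: sphere_area_def smeas_def sph_def)

lemma sph_measurable [measurable]: "sph \<in> borel_measurable smeas"
  using borel_measurable_continuous_onI[OF sph_continuous] by (simp cong: measurable_cong_sets)

lemma finite_smeas: "finite_measure smeas"
proof (rule finite_measureI)
  have "emeasure sphere_area UNIV = emeasure smeas UNIV" unfolding sphere_area_smeas
    by (subst emeasure_distr) auto
  thus "emeasure smeas (space smeas) \<noteq> \<infinity>" unfolding emeasure_sphere_area space_smeas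
    by (metis ennreal_neq_top infinity_ennreal_def)
qed

text \<open>\<open>same_mod\<close> encodes equality of the moduli for all I, whereas the measure
  sees only almost all pairs (I, t). Fubini and continuity in I lead from almost all to all;
  conversely one null set of angles serves every I.\<close>

lemma AE_boundary_iff:
  assumes f: "has_expansion_on f a \<B>" "l2 a" and g: "has_expansion_on g b \<B>" "l2 b"
  shows "(AE q in boundary_measure. norm (radial_limit f q) = norm (radial_limit g q)) \<longleftrightarrow>
    (AE t in circ. same_mod (bA a t) (bB a t) (bA b t) (bB b t))"
proof
  interpret P: pair_sigma_finite sphere_area tmeas by (rule pair_sphere)
  note [measurable] = bA_bB_measurable[OF f(2)] bA_bB_measurable[OF g(2)]
  {
    assume "AE q in boundary_measure. norm (radial_limit f q) = norm (radial_limit g q)"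
    hence "AE q in distr (sphere_area \<Otimes>\<^sub>M tmeas) borel (\<lambda>(I, t). qcis I t). norm (radial_limit f q) = norm (radial_limit g q)"
      unfolding AE_boundary .
    from AE_distrD[OF qcis_measurable this]
    have "AE p in sphere_area \<Otimes>\<^sub>M tmeas. norm (radial_limit f (qcis (fst p) (snd p))) = norm (radial_limit g (qcis (fst p) (snd p)))"
      by (simp add: case_prod_beta)
    from P.AE_pair[OF this] have "AE I in sphere_area. AE t in tmeas. norm (radial_limit f (qcis I t)) = norm (radial_limit g (qcis I t))"
      by simp
    hence "AE x in smeas. AE t in tmeas. norm (radial_limit f (qcis (sph x) t)) = norm (radial_limit g (qcis (sph x) t))"
      unfolding sphere_area_smeas using AE_distrD[OF sph_measurable] by auto
    \<comment> \<open>Replacing the radial limits by the Borel functions \<open>bA\<close> and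
      \<open>bB\<close> makes the set of pairs measurable, as needed to exchange the two
      almost-everywhere quantifiers.\<close>
    hence ae: "AE x in smeas. AE t in tmeas. norm (bA a t + sph x * bB a t) = norm (bA b t + sph x * bB b t)"
    proof (rule eventually_mono)
      fix x assume "AE t in tmeas. norm (radial_limit f (qcis (sph x) t)) = norm (radial_limit g (qcis (sph x) t))"
      thus "AE t in tmeas. norm (bA a t + sph x * bB a t) = norm (bA b t + sph x * bB b t)"
        using stem_radial[OF f(2)] stem_radial[OF g(2)] unfolding AE_tmeas_circ
        by eventually_elim (simp add: radial_limit_eq[OF f(1) sph_imag] radial_limit_eq[OF g(1) sph_imag])
    qed
    interpret Q: pair_sigma_finite smeas tmeas
      using finite_measure.axioms(1)[OF finite_smeas] finite_measure.axioms(1)[OF finite_tmeas]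
      by (simp add: pair_sigma_finite_def)
    have "{x \<in> space (smeas \<Otimes>\<^sub>M tmeas). norm (bA a (snd x) + sph (fst x) * bB a (snd x)) = norm (bA b (snd x) + sph (fst x) * bB b (snd x))} \<in> sets (smeas \<Otimes>\<^sub>M tmeas)"
      by measurable
    from Q.AE_commute[of "\<lambda>x t. norm (bA a t + sph x * bB a t) = norm (bA b t + sph x * bB b t)"] this ae
    have "AE t in tmeas. AE x in smeas. norm (bA a t + sph x * bB a t) = norm (bA b t + sph x * bB b t)"
      by simp
    hence "AE t in tmeas. same_mod (bA a t) (bB a t) (bA b t) (bB b t)"
    proof (rule eventually_mono)
      fix t assume "AE x in smeas. norm (bA a t + sph x * bB a t) = norm (bA b t + sph x * bB b t)"
      hence "AE x in lborel. 0 < (case x of (\<phi>, \<theta>) \<Rightarrow> ennreal (sin \<phi>) * indicator ({0..pi} \<times> {0..<2*pi}) (\<phi>, \<theta>)) \<longrightarrow>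
         norm (bA a t + sph x * bB a t) = norm (bA b t + sph x * bB b t)"
        unfolding smeas_def by (subst (asm) AE_density) (auto simp: borel_prod[symmetric])
      hence "AE x in lebesgue. 0 < (case x of (\<phi>, \<theta>) \<Rightarrow> ennreal (sin \<phi>) * indicator ({0..pi} \<times> {0..<2*pi}) (\<phi>, \<theta>)) \<longrightarrow>
         norm (bA a t + sph x * bB a t) = norm (bA b t + sph x * bB b t)"
        by (rule AE_completion)
      hence ae: "AE x\<in>{0<..<pi} \<times> {0<..<2*pi} in lebesgue. x \<in> {x. norm (bA a t + sph x * bB a t) = norm (bA b t + sph x * bB b t)}"
        by eventually_elim (auto simp: sin_gt_zero)
      have cl: "closed {x. norm (bA a t + sph x * bB a t) = norm (bA b t + sph x * bB b t)}"
        by (intro closed_Collect_eq continuous_intros sph_continuous)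
      have pt: "norm (bA a t + sph x * bB a t) = norm (bA b t + sph x * bB b t)" if "x \<in> {0<..<pi} \<times> {0<..<2*pi}" for x
        using mem_closed_if_AE_lebesgue_open[OF _ cl ae that] by (simp add: open_Times)
      show "same_mod (bA a t) (bB a t) (bA b t) (bB b t)"
      proof (rule same_modI)
        fix I assume I: "I \<in> {Quat 0 (-1) 0 0, Quat 0 0 1 0, Quat 0 0 (-1) 0, Quat 0 0 (sqrt (1/2)) (sqrt (1/2))}"
        have s3: "sin (3 * pi / 2) = -1" "cos (3 * pi / 2) = 0"
          using sin_add[of pi "pi/2"] cos_add[of pi "pi/2"] by (simp_all add: field_simps)
        have s4: "sqrt (1/2) = sqrt 2 / 2" by (rule real_sqrt_unique) (auto simp: power_divide)
        have "sph (pi/2, pi) = Quat 0 (-1) 0 0" "sph (pi/2, pi/2) = Quat 0 0 1 0" "sph (pi/2, 3*pi/2) = Quat 0 0 (-1) 0"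
          "sph (pi/4, pi/2) = Quat 0 0 (sqrt (1/2)) (sqrt (1/2))"
          by (simp_all add: sph_def s3 s4 sin_45 cos_45)
        thus "norm (bA a t + I * bB a t) = norm (bA b t + I * bB b t)"
          using I pt[of "(pi/2, pi)"] pt[of "(pi/2, pi/2)"] pt[of "(pi/2, 3*pi/2)"] pt[of "(pi/4, pi/2)"] by auto
      qed
    qed
    thus "AE t in circ. same_mod (bA a t) (bB a t) (bA b t) (bB b t)" unfolding AE_tmeas_circ .
  }
  assume "AE t in circ. same_mod (bA a t) (bB a t) (bA b t) (bB b t)"
  hence "AE t in circ. \<forall>I\<in>\<S>. norm (radial_limit f (qcis I t)) = norm (radial_limit g (qcis I t))"
    using stem_radial[OF f(2)] stem_radial[OF g(2)]
    by eventually_elim (auto simp: radial_limit_eq[OF f(1)] radial_limit_eq[OF g(1)] same_modD)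
  hence "AE t in lborel. t \<in> {0..2*pi} \<longrightarrow> (\<forall>I\<in>\<S>. norm (radial_limit f (qcis I t)) = norm (radial_limit g (qcis I t)))"
    unfolding AE_circ .
  then obtain Z where Z: "Z \<in> null_sets lborel" "\<And>t. t \<notin> Z \<Longrightarrow> t \<in> {0..2*pi} \<Longrightarrow> \<forall>I\<in>\<S>. norm (radial_limit f (qcis I t)) = norm (radial_limit g (qcis I t))"
    unfolding eventually_ae_filter by auto
  have Zb [measurable]: "Z \<in> sets borel" using Z(1) by auto
  \<comment> \<open>The angle in [0, pi] of a boundary point; clamping makes it continuous, hence
    Borel, on all quaternions.\<close>
  define ac where "ac q = arccos (max (-1) (min 1 (qre q)))" for q
  have "bounded_linear qre" by (rule bounded_linear_intro[where K=1]) (use abs_comp_le[of qre] in auto)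
  hence acm [measurable]: "ac \<in> borel_measurable borel" unfolding ac_def
    by (intro borel_measurable_continuous_onI continuous_intros bounded_linear.continuous_on[of qre]) auto
  \<comment> \<open>A Borel set on which equality holds; the full set of equality involves radial
    limits and is not known to be Borel.\<close>
  define G where "G = {q. norm q = 1 \<and> ac q \<notin> Z}"
  have Gm [measurable]: "G \<in> sets borel" unfolding G_def by measurable
  have good: "norm (radial_limit f q) = norm (radial_limit g q)" if q: "q \<in> G" for q
  proof -
    obtain I z where Iz: "I \<in> \<S>" "q = emb I z" by (rule quat_emb_cases)
    have z1: "cmod z = 1" using q Iz by (simp add: G_def norm_emb)
    have rez: "qre q = Re z" using Iz by (simp add: emb_def imag_units_iff)
    have rb: "-1 \<le> Re z" "Re z \<le> 1" using abs_Re_le_cmod[of z] z1 by auto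
    define t where "t = arccos (Re z)"
    have t: "0 \<le> t" "t \<le> pi" "cos t = Re z" using rb by (auto simp: t_def arccos_lbound arccos_ubound)
    have tZ: "t \<notin> Z" using q rb by (simp add: G_def ac_def rez t_def)
    have st: "sin t = \<bar>Im z\<bar>"
    proof -
      have "(sin t)\<^sup>2 = (Im z)\<^sup>2" using sin_squared_eq[of t] z1 cmod_power2[of z] by (simp add: t)
      thus ?thesis using sin_ge_zero[OF t(1,2)] by (metis abs_of_nonneg power2_eq_iff_nonneg abs_ge_zero power2_abs)
    qed
    define J where "J = (if Im z \<ge> 0 then I else - I)"
    have J: "J \<in> \<S>" using Iz(1) by (simp add: J_def imag_units_iff)
    have "q = qcis J t" unfolding Iz(2) emb_def qcis_def t(3) st J_def by simp
    thus ?thesis using Z(2)[OF tZ] J t pi_ge_zero by auto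
  qed
  \<comment> \<open>An angle t above pi is read by \<open>ac\<close> as 2 pi - t, so the reflected
    null set must be avoided as well.\<close>
  have refl: "AE t in lborel. 2*pi - t \<notin> Z"
  proof -
    have "Measurable.pred borel (\<lambda>t. t \<notin> Z)" by measurable
    from AE_borel_affine[of "-1" "\<lambda>t. t \<notin> Z" "2*pi", OF _ this AE_not_in[OF Z(1)]] show ?thesis by simp
  qed
  have "AE t in tmeas. arccos (cos t) \<notin> Z"
    unfolding AE_tmeas using refl AE_not_in[OF Z(1)]
  proof eventually_elim
    case (elim t)
    show ?case
    proof
      assume t: "t \<in> {0..<2*pi}"
      show "arccos (cos t) \<notin> Z"
      proof (cases "t \<le> pi")
        case True thus ?thesis using elim t by (simp add: arccos_cos)
      next
        case False
        hence "arccos (cos (2*pi - t)) = 2*pi - t" using t by (intro arccos_cos) auto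
        thus ?thesis using elim by simp
      qed
    qed
  qed
  hence tG: "AE t in tmeas. qcis I t \<in> G" if "I \<in> \<S>" for I
  proof (rule eventually_mono)
    fix t assume "arccos (cos t) \<notin> Z"
    moreover have "qre (qcis I t) = cos t" using that by (simp add: qcis_def imag_units_iff)
    ultimately show "qcis I t \<in> G" unfolding G_def ac_def by (simp add: qcis_norm[OF that])
  qed
  have "AE I in sphere_area. I \<in> \<S>"
  proof -
    have "closed \<S>" unfolding imag_units_def by (intro closed_Collect_eq continuous_intros)
    hence "\<S> \<in> sets borel" by simp
    thus ?thesis unfolding sphere_area_smeas by (subst AE_distr_iff) (auto simp: sph_imag)
  qed
  hence aeI: "AE I in sphere_area. AE t in tmeas. qcis I t \<in> G" by (rule eventually_mono) (rule tG)
  have "AE p in sphere_area \<Otimes>\<^sub>M tmeas. (case p of (I, t) \<Rightarrow> qcis I t) \<in> G"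
  proof (rule P.AE_pair_measure)
    note [measurable] = qcis_measurable
    show "{p \<in> space (sphere_area \<Otimes>\<^sub>M tmeas). (case p of (I, t) \<Rightarrow> qcis I t) \<in> G} \<in> sets (sphere_area \<Otimes>\<^sub>M tmeas)"
      by measurable
  qed (use aeI in simp)
  hence "AE q in distr (sphere_area \<Otimes>\<^sub>M tmeas) borel (\<lambda>(I, t). qcis I t). q \<in> G"
    by (subst AE_distr_iff[OF qcis_measurable]) auto
  hence "AE q in boundary_measure. q \<in> G" unfolding AE_boundary .
  thus "AE q in boundary_measure. norm (radial_limit f q) = norm (radial_limit g q)"
    by (rule eventually_mono) (rule good)
qed

section \<open>Outer sequences and left multiples\<close>

definition out :: "(nat \<Rightarrow> quat) \<Rightarrow> bool" where
  "out a \<longleftrightarrow> (\<forall>h. l2 h \<longrightarrow> (AE t in circ. same_mod (bA a t) (bB a t) (bA h t) (bB h t)) \<longrightarrow>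
     (\<forall>q\<in>\<B>. norm (qeval h q) \<le> norm (qeval a q)))"

lemma outer_H2_iff:
  assumes g: "has_expansion_on g a \<B>" "l2 a"
  shows "outer_H2 g \<longleftrightarrow> out a"
proof -
  have gH: "g \<in> H2" unfolding H2_iff using g by blast
  show ?thesis
  proof
    assume o: "outer_H2 g"
    show "out a" unfolding out_def
    proof (intro allI impI ballI)
      fix h q assume h: "l2 h" "AE t in circ. same_mod (bA a t) (bB a t) (bA h t) (bB h t)" and q: "q \<in> \<B>"
      have e: "has_expansion_on (qeval h) h \<B>" by (rule qds_has_expansion[OF l2_qds[OF h(1)]])
      have "AE q in boundary_measure. norm (radial_limit g q) = norm (radial_limit (qeval h) q)"
        unfolding AE_boundary_iff[OF g e h(1)] by (rule h(2))
      hence "norm (g q) \<ge> norm (qeval h q)" using o qeval_H2[OF h(1)] q unfolding outer_H2_def by blast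
      thus "norm (qeval h q) \<le> norm (qeval a q)" using has_expansion_eq[OF g(1) q] by simp
    qed
  next
    assume o: "out a"
    show "outer_H2 g" unfolding outer_H2_def
    proof (intro conjI gH ballI impI)
      fix h q assume h: "h \<in> H2" "AE q in boundary_measure. norm (radial_limit g q) = norm (radial_limit h q)" and q: "q \<in> \<B>"
      obtain b where b: "has_expansion_on h b \<B>" "l2 b" using h(1) unfolding H2_iff by blast
      have "AE t in circ. same_mod (bA a t) (bB a t) (bA b t) (bB b t)" using h(2) unfolding AE_boundary_iff[OF g b] .
      hence "norm (qeval b q) \<le> norm (qeval a q)" using o b(2) q unfolding out_def by blast
      thus "norm (g q) \<ge> norm (h q)" using has_expansion_eq[OF g(1) q] has_expansion_eq[OF b(1) q] by simp
    qed
  qed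
qed

lemma conv_scale_left: "conv (\<lambda>n. c * p n) a n = c * conv p (a :: nat \<Rightarrow> 'a::ring_1) n"
  by (simp add: conv_def sum_distrib_left mult.assoc)

lemma cyc_cnjs_iff: "cyc (cnjs a) \<longleftrightarrow> (\<forall>e>0. \<exists>p. fins p \<and> l2 (\<lambda>n. conv p a n - delta0 n) \<and> l2n (\<lambda>n. conv p a n - delta0 n) < e)"
proof -
  have f: "fins (cnjs p) \<longleftrightarrow> fins p" for p
    unfolding fins_def cnjs_def by (metis qcnj_simps(1,2))
  have e: "(\<lambda>n. conv (cnjs a) (cnjs p) n - delta0 n) = cnjs (\<lambda>n. conv p a n - delta0 n)" for p
    unfolding cnjs_conv[symmetric] by (auto simp: cnjs_def delta0_def)
  have l: "l2 (cnjs c) \<longleftrightarrow> l2 c" for c by (metis cnjs_cnjs l2_cnjs(1))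
  have "cyc (cnjs a) \<longleftrightarrow> (\<forall>e>0. \<exists>p. fins (cnjs p) \<and> l2 (\<lambda>n. conv (cnjs a) (cnjs p) n - delta0 n) \<and> l2n (\<lambda>n. conv (cnjs a) (cnjs p) n - delta0 n) < e)"
    unfolding cyc_def by (metis cnjs_cnjs)
  thus ?thesis unfolding f e l l2_cnjs(2) .
qed

lemma left_cyc_dense:
  assumes a: "cyc (cnjs a)" and c: "l2 c" and e: "e > 0"
  shows "\<exists>p. fins p \<and> l2 (\<lambda>n. conv p a n - c n) \<and> l2n (\<lambda>n. conv p a n - c n) < e"
proof -
  obtain p where p: "fins p" "l2 (\<lambda>n. conv (cnjs a) p n - cnjs c n)" "l2n (\<lambda>n. conv (cnjs a) p n - cnjs c n) < e"
    using cyc_dense[OF a l2_cnjs(1)[OF c] e] by blast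
  have e: "(\<lambda>n. conv (cnjs p) a n - c n) = cnjs (\<lambda>n. conv (cnjs a) p n - cnjs c n)"
  proof
    fix n
    have "cnjs (conv (cnjs a) p) = conv (cnjs p) a" by (simp add: cnjs_conv)
    hence "qcnj (conv (cnjs a) p n) = conv (cnjs p) a n" by (metis cnjs_def)
    thus "conv (cnjs p) a n - c n = cnjs (\<lambda>n. conv (cnjs a) p n - cnjs c n) n" by (simp add: cnjs_def)
  qed
  have "fins (cnjs p)" using p(1) unfolding fins_def cnjs_def by (metis qcnj_simps(2))
  thus ?thesis using l2_cnjs(1)[OF p(2)] p(3) unfolding e[symmetric] l2_cnjs(2)[of "\<lambda>n. conv (cnjs a) p n - cnjs c n", folded e, symmetric]
    by blast
qed

lemma qeval_bound:
  assumes c: "l2 c" and q: "norm q < 1"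
  shows "norm (qeval c q) \<le> l2n c / sqrt (1 - (norm q)\<^sup>2)"
proof -
  have s: "(\<lambda>n. q ^ n * c n) sums qeval c q"
    using qds_has_expansion[OF l2_qds[OF c]] q by (auto simp: has_expansion_on_def)
  have q2: "(norm q)\<^sup>2 < 1" using q by (simp add: abs_square_less_1)
  have g: "(\<Sum>n<N. (norm q ^ n)\<^sup>2) \<le> 1 / (1 - (norm q)\<^sup>2)" for N
  proof -
    have "(\<Sum>n<N. ((norm q)\<^sup>2) ^ n) \<le> (\<Sum>n. ((norm q)\<^sup>2) ^ n)"
      by (rule sum_le_suminf) (use q2 in \<open>auto intro!: summable_geometric\<close>)
    also have "\<dots> = 1 / (1 - (norm q)\<^sup>2)" using q2 by (intro suminf_geometric) simp
    finally show ?thesis by (simp flip: power_mult add: mult.commute)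
  qed
  have b: "norm (\<Sum>n<N. q ^ n * c n) \<le> l2n c / sqrt (1 - (norm q)\<^sup>2)" for N
  proof -
    have "norm (\<Sum>n<N. q ^ n * c n) \<le> (\<Sum>n<N. \<bar>norm q ^ n\<bar> * \<bar>norm (c n)\<bar>)"
      by (rule order_trans[OF norm_sum]) (simp add: norm_mult norm_power)
    also have "\<dots> \<le> L2_set (\<lambda>n. norm q ^ n) {..<N} * L2_set (\<lambda>n. norm (c n)) {..<N}" by (rule L2_set_mult_ineq)
    also have "\<dots> \<le> sqrt (1 / (1 - (norm q)\<^sup>2)) * l2n c"
      unfolding L2_set_def using g[of N] q2 by (intro mult_mono sqrt_sum_le_l2n c) (auto simp: sum_nonneg)
    finally show ?thesis by (simp add: real_sqrt_divide)
  qed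
  show ?thesis
    by (rule LIMSEQ_le_const2[OF tendsto_norm[OF s[unfolded sums_def]]]) (use b in auto)
qed

text \<open>Although the star product is not pointwise, the value of p * a at a point of the slice
  depends on p only through its value u there: it is u A + I u B.\<close>

lemma qeval_conv:
  assumes "qds p" "qds a" "cmod z < 1" "I \<in> \<S>"
  shows "qeval (conv p a) (emb I z) = qeval p (emb I z) * sA a z + I * qeval p (emb I z) * sB a z"
proof -
  have II: "I * (I * y) = - y" for y using imag_unit_sq[OF assms(4)] by (simp flip: mult.assoc)
  show ?thesis
    unfolding qeval_emb[OF pser_pc_conv(1)[OF assms(1,2)] assms(3,4)] qeval_emb[OF assms(1,3,4)]
      pser_pc_conv(2,3)[OF assms(1,2,3)]
    by (simp add: distrib_left distrib_right left_diff_distrib right_diff_distrib mult.assoc II)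
qed

lemma qeval_add: "qds a \<Longrightarrow> qds b \<Longrightarrow> norm q < 1 \<Longrightarrow> qeval (\<lambda>n. a n + b n) q = qeval a q + qeval b q"
  using sums_add[of "\<lambda>n. q ^ n * a n" "qeval a q" "\<lambda>n. q ^ n * b n" "qeval b q"]
    qds_has_expansion[of a] qds_has_expansion[of b]
  by (auto simp: has_expansion_on_def sums_iff qeval_def distrib_left)

lemma qeval_diff: "qds a \<Longrightarrow> qds b \<Longrightarrow> norm q < 1 \<Longrightarrow> qeval (\<lambda>n. a n - b n) q = qeval a q - qeval b q"
  using sums_diff[of "\<lambda>n. q ^ n * a n" "qeval a q" "\<lambda>n. q ^ n * b n" "qeval b q"]
    qds_has_expansion[of a] qds_has_expansion[of b]
  by (auto simp: has_expansion_on_def sums_iff qeval_def right_diff_distrib)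

lemma qeval_const: "qeval (\<lambda>n. delta0 n * c) q = c"
proof -
  have "(\<lambda>n. q ^ n * (delta0 n * c)) = (\<lambda>n. if n = 0 then c else 0)" by (auto simp: delta0_def)
  thus ?thesis unfolding qeval_def using sums_single[of 0 "\<lambda>n. c"] by (simp add: sums_iff)
qed

lemma same_mod_norm_conv:
  assumes a: "l2 a" and h: "l2 h" and s: "AE t in circ. same_mod (bA a t) (bB a t) (bA h t) (bB h t)" and p: "fins p"
  shows "l2n (conv p a) = l2n (conv p h)"
proof -
  have pl: "l2 p" by (rule fins_l2[OF p])
  have l: "l2 (conv p a)" "l2 (conv p h)" using p l2_conv_fins(3)[OF a] l2_conv_fins(3)[OF h] by (auto simp: fins_def)
  have "l2sq (conv p a) = l2sq (conv p h)"
    unfolding stem_parseval(2)[OF l(1), symmetric] stem_parseval(2)[OF l(2), symmetric]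
  proof (rule integral_cong_AE)
    show "AE t in circ. (norm (bA (conv p a) t))\<^sup>2 + (norm (bB (conv p a) t))\<^sup>2 = (norm (bA (conv p h) t))\<^sup>2 + (norm (bB (conv p h) t))\<^sup>2"
      using s boundary_conv[OF pl a l(1)] boundary_conv[OF pl h l(2)]
      by eventually_elim (simp add: same_mod_mult)
  qed (use bA_bB_measurable[OF l(1)] bA_bB_measurable[OF l(2)] in measurable)
  thus ?thesis by (simp add: l2n_def)
qed

text \<open>The point evaluation at \<open>q\<close> has norm \<open>1 / sqrt (1 - |q|\<^sup>2)\<close>, attained at the kernel function
  \<open>\<kappa>\<close>. If \<open>p * a\<close> is close to the multiple of \<open>\<kappa>\<close> with the value of \<open>a\<close> at \<open>q\<close>, then \<open>p\<close> is close to
  \<open>1\<close> at \<open>q\<close>, and \<open>|h| \<le> |p * h| / sqrt (1 - |q|\<^sup>2)\<close> at \<open>q\<close> where \<open>|p * h| = |p * a|\<close> in norm.\<close>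

theorem left_cyc_imp_out:
  assumes a: "l2 a" and cyc: "cyc (cnjs a)"
  shows "out a"
  unfolding out_def
proof (intro allI impI ballI)
  fix h q assume h: "l2 h" and sm: "AE t in circ. same_mod (bA a t) (bB a t) (bA h t) (bB h t)" and qB: "q \<in> \<B>"
  obtain I z where Iz: "I \<in> \<S>" "q = emb I z" by (rule quat_emb_cases)
  have q1: "norm q < 1" using qB by simp
  have z: "cmod z < 1" using q1 Iz by (simp add: norm_emb)
  define R where "R = 1 - (norm q)\<^sup>2"
  have R: "R > 0" using q1 by (simp add: R_def abs_square_less_1)
  define L where "L u = u * sA a z + I * u * sB a z" for u
  have lin: "linear L" unfolding L_def by (rule linearI) (simp_all add: distrib_left distrib_right algebra_simps)
  have ev: "qeval (conv p a) q = L (qeval p q)" if "fins p" for p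
    unfolding Iz(2) L_def by (rule qeval_conv[OF l2_qds[OF fins_l2[OF that]] l2_qds[OF a] z Iz(1)])
  have L1: "L 1 = qeval a q" unfolding Iz(2) L_def by (simp add: qeval_emb[OF l2_qds[OF a] z Iz(1)])
  \<comment> \<open>Density of the products p * a makes the values of L dense, and a subspace of a
    finite-dimensional space is closed, so L is onto and therefore bounded below. This turns
    closeness of p * a to L 1 at q into closeness of p to 1 at q.\<close>
  have "w \<in> range L" for w
  proof -
    define c where "c n = delta0 n * w" for n
    have c: "l2 c" using l2_mult(3)[OF fins_l2[OF fins_delta0], of w] by (simp add: c_def[abs_def])
    have "w \<in> closure (range L)" unfolding closure_approachable
    proof (intro allI impI)
      fix e :: real assume e: "e > 0"
      obtain p where p: "fins p" "l2 (\<lambda>n. conv p a n - c n)" "l2n (\<lambda>n. conv p a n - c n) < e * sqrt R"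
        using left_cyc_dense[OF cyc c, of "e * sqrt R"] e R by auto
      have pa: "l2 (conv p a)" by (rule l2n_triangle_sub(1)[OF c p(2)])
      have "norm (L (qeval p q) - w) = norm (qeval (\<lambda>n. conv p a n - c n) q)"
        unfolding ev[OF p(1), symmetric] using qeval_diff[OF l2_qds[OF pa] l2_qds[OF c] q1] by (simp add: c_def[abs_def] qeval_const)
      also have "\<dots> \<le> l2n (\<lambda>n. conv p a n - c n) / sqrt R" unfolding R_def by (rule qeval_bound[OF p(2) q1])
      also have "\<dots> < e" using p(3) R by (simp add: divide_less_eq)
      finally show "\<exists>y\<in>range L. dist y w < e" by (auto simp: dist_norm)
    qed
    moreover have "closed (range L)" by (rule closed_subspace[OF linear_subspace_image[OF lin subspace_UNIV]])
    ultimately show ?thesis by simp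
  qed
  hence "surj L" by blast
  hence "inj L" by (intro linear_surjective_imp_injective[OF lin]) auto
  then obtain B where B: "B > 0" "\<And>x. B * norm x \<le> norm (L x)" using linear_inj_bounded_below_pos[OF lin] by blast
  \<comment> \<open>With R = 1 - |q|^2, the kernel sequence \<open>qcnj q ^ n * c\<close> sums at q
    to c / R, which is the value of a there.\<close>
  define c where "c = R *\<^sub>R qeval a q"
  define \<kappa> where "\<kappa> n = qcnj q ^ n * c" for n
  have \<kappa>n: "(norm (\<kappa> n))\<^sup>2 = ((norm q)\<^sup>2) ^ n * (norm c)\<^sup>2" for n
    by (simp add: \<kappa>_def norm_mult norm_power power_mult_distrib flip: power_mult) (simp add: mult.commute)
  have "(\<lambda>n. ((norm q)\<^sup>2) ^ n * (norm c)\<^sup>2) sums (1 / (1 - (norm q)\<^sup>2) * (norm c)\<^sup>2)"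
    by (intro sums_mult2 geometric_sums) (use q1 in \<open>simp add: abs_square_less_1\<close>)
  hence \<kappa>: "l2 \<kappa>" "l2sq \<kappa> = (norm c)\<^sup>2 / R" by (simp_all add: l2_def l2sq_def \<kappa>n sums_iff R_def)
  have "l2sq \<kappa> = R * (norm (qeval a q))\<^sup>2" unfolding \<kappa>(2) c_def using R by (simp add: power_mult_distrib power2_eq_square)
  hence \<kappa>2: "l2n \<kappa> = sqrt R * norm (qeval a q)" by (simp add: l2n_def real_sqrt_mult)
  have ev\<kappa>: "qeval \<kappa> q = qeval a q"
  proof -
    have qq: "q * qcnj q = of_real ((norm q)\<^sup>2)" unfolding norm_quat_sq by (simp add: quat_eq_iff power2_eq_square)
    have "q ^ n * qcnj q ^ n = of_real (((norm q)\<^sup>2) ^ n)" for n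
    proof (induction n)
      case (Suc n)
      have "q ^ Suc n * qcnj q ^ Suc n = q * (q ^ n * qcnj q ^ n) * qcnj q"
        by (simp only: power_Suc power_Suc2 mult.assoc)
          (simp only: power_commutes mult.assoc[symmetric])
      also have "\<dots> = of_real (((norm q)\<^sup>2) ^ n) * (q * qcnj q)" unfolding Suc by (simp add: of_real_def)
      finally show ?case unfolding qq by (metis of_real_mult mult.commute power_Suc)
    qed simp
    hence "(\<lambda>n. q ^ n * \<kappa> n) = (\<lambda>n. ((norm q)\<^sup>2) ^ n *\<^sub>R c)"
      by (simp add: \<kappa>_def scaleR_conv_of_real flip: mult.assoc)
    moreover have "(\<lambda>n. ((norm q)\<^sup>2) ^ n *\<^sub>R c) sums ((1 / (1 - (norm q)\<^sup>2)) *\<^sub>R c)"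
      by (intro sums_scaleR_left geometric_sums) (use q1 in \<open>simp add: abs_square_less_1\<close>)
    ultimately show ?thesis unfolding qeval_def[of \<kappa>] using R by (simp add: sums_iff c_def flip: R_def)
  qed
  define K where "K = 1 + l2n a / (sqrt R * B)"
  have main: "norm (qeval h q) \<le> norm (qeval a q) + e * K / sqrt R" if e: "e > 0" for e
  proof -
    obtain p where p: "fins p" "l2 (\<lambda>n. conv p a n - \<kappa> n)" "l2n (\<lambda>n. conv p a n - \<kappa> n) < e"
      using left_cyc_dense[OF cyc \<kappa>(1) e] by blast
    note pa = l2n_triangle_sub[OF \<kappa>(1) p(2)]
    define u where "u = qeval p q"
    have "L (u - 1) = qeval (\<lambda>n. conv p a n - \<kappa> n) q"
      unfolding linear_diff[OF lin] L1 u_def ev[OF p(1), symmetric]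
      using qeval_diff[OF l2_qds[OF pa(1)] l2_qds[OF \<kappa>(1)] q1] ev\<kappa> by simp
    hence "B * norm (u - 1) \<le> l2n (\<lambda>n. conv p a n - \<kappa> n) / sqrt R"
      using B(2)[of "u - 1"] qeval_bound[OF p(2) q1] unfolding R_def by simp
    also have "\<dots> \<le> e / sqrt R" using p(3) R by (intro divide_right_mono) auto
    finally have u1: "norm (u - 1) \<le> e / (sqrt R * B)" using B(1) R by (simp add: field_simps)
    \<comment> \<open>Shifting p by a constant makes its value at q exactly 1, so that p' * h and h
      agree at q; the cost is |1 - u| times the norm of a.\<close>
    define p' where "p' n = p n + delta0 n * (1 - u)" for n
    have f2: "fins (\<lambda>n. delta0 n * (1 - u))" by (auto simp: fins_def delta0_def intro!: exI[of _ 1])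
    have p'f: "fins p'" unfolding p'_def using p(1) f2 by (rule fins_add)
    have p'1: "qeval p' q = 1" unfolding p'_def
      using qeval_add[OF l2_qds[OF fins_l2[OF p(1)]] l2_qds[OF fins_l2[OF f2]] q1] by (simp add: qeval_const u_def)
    have "conv p' a = (\<lambda>n. conv p a n + (1 - u) * a n)"
    proof
      fix n
      have "(\<lambda>n. delta0 n * (1 - u)) = (\<lambda>n. (1 - u) * delta0 n)" by (auto simp: delta0_def)
      hence "conv (\<lambda>n. delta0 n * (1 - u)) a n = (1 - u) * conv delta0 a n"
        by (simp add: conv_scale_left)
      thus "conv p' a n = conv p a n + (1 - u) * a n" unfolding p'_def conv_add_left by simp
    qed
    hence "l2n (conv p' a) \<le> l2n (conv p a) + norm (1 - u) * l2n a"
      using l2_add(2)[OF pa(1) l2_mult(1)[OF a, of "1 - u"]] by (simp add: l2_mult(2)[OF a])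
    also have "\<dots> \<le> (e + l2n \<kappa>) + e / (sqrt R * B) * l2n a"
      using pa(2) p(3) u1 l2n_nonneg[OF a] by (intro add_mono mult_right_mono) (auto simp: norm_minus_commute)
    also have "\<dots> = l2n \<kappa> + e * K" by (simp add: K_def algebra_simps)
    finally have na: "l2n (conv p' a) \<le> l2n \<kappa> + e * K" .
    have hl: "l2 (conv p' h)" using p'f l2_conv_fins(3)[OF h] by (auto simp: fins_def)
    have "qeval (conv p' h) q = 1 * sA h z + I * 1 * sB h z"
      using qeval_conv[OF l2_qds[OF fins_l2[OF p'f]] l2_qds[OF h] z Iz(1)] p'1 unfolding Iz(2) by simp
    also have "\<dots> = qeval h q" unfolding Iz(2) by (simp add: qeval_emb[OF l2_qds[OF h] z Iz(1)])
    finally have "norm (qeval h q) \<le> l2n (conv p' h) / sqrt R" using qeval_bound[OF hl q1] by (simp add: R_def)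
    also have "l2n (conv p' h) = l2n (conv p' a)" by (rule same_mod_norm_conv[OF a h sm p'f, symmetric])
    also have "\<dots> / sqrt R \<le> (l2n \<kappa> + e * K) / sqrt R" using na R by (intro divide_right_mono) auto
    also have "\<dots> = norm (qeval a q) + e * K / sqrt R" unfolding \<kappa>2 using R by (simp add: field_simps)
    finally show ?thesis .
  qed
  have "((\<lambda>e. norm (qeval a q) + e * K / sqrt R) \<longlongrightarrow> norm (qeval a q) + 0 * K / sqrt R) (at_right 0)"
    by (intro tendsto_intros) (use R in auto)
  thus "norm (qeval h q) \<le> norm (qeval a q)"
    by (intro tendsto_lowerbound[of "\<lambda>e. norm (qeval a q) + e * K / sqrt R" _ "at_right 0"])
      (auto intro!: eventually_mono[OF eventually_at_right_real[of 0 1]] main)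
qed

section \<open>Minimal elements\<close>

definition ip :: "(nat \<Rightarrow> 'a::real_inner) \<Rightarrow> (nat \<Rightarrow> 'a) \<Rightarrow> real" where
  "ip x y = (\<Sum>n. inner (x n) (y n))"

lemma ip_summable:
  assumes "l2 x" "l2 y" shows "summable (\<lambda>n. inner (x n) (y n))"
proof (rule summable_comparison_test'[where N=0])
  show "summable (\<lambda>n. (norm (x n))\<^sup>2 + (norm (y n))\<^sup>2)" using assms unfolding l2_def by (rule summable_add)
  show "norm (inner (x n) (y n)) \<le> (norm (x n))\<^sup>2 + (norm (y n))\<^sup>2" for n
  proof -
    have "2 * (norm (x n) * norm (y n)) \<le> (norm (x n))\<^sup>2 + (norm (y n))\<^sup>2" using sum_squares_bound[of "norm (x n)" "norm (y n)"] by simp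
    moreover have "0 \<le> norm (x n) * norm (y n)" by simp
    ultimately show ?thesis using Cauchy_Schwarz_ineq2[of "x n" "y n"] unfolding real_norm_def by linarith
  qed
qed

lemma l2sq_add_scaled:
  assumes x: "l2 x" and y: "l2 y"
  shows "l2sq (\<lambda>n. x n + c *\<^sub>R y n) = l2sq x + 2 * c * ip x y + c\<^sup>2 * l2sq y"
proof -
  have "(\<lambda>n. (norm (x n))\<^sup>2 + 2 * c * inner (x n) (y n) + c\<^sup>2 * (norm (y n))\<^sup>2) sums (l2sq x + 2 * c * ip x y + c\<^sup>2 * l2sq y)"
    unfolding l2sq_def ip_def using ip_summable[OF x y] x y unfolding l2_def by (intro sums_add sums_mult summable_sums)
  moreover have "(norm (x n + c *\<^sub>R y n))\<^sup>2 = (norm (x n))\<^sup>2 + 2 * c * inner (x n) (y n) + c\<^sup>2 * (norm (y n))\<^sup>2" for n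
    unfolding power2_norm_eq_inner by (simp add: inner_add_left inner_add_right inner_commute power2_eq_square algebra_simps)
  ultimately show ?thesis unfolding l2sq_def by (simp add: sums_iff)
qed

lemma ip_le:
  assumes x: "l2 x" and y: "l2 y"
  shows "\<bar>ip x y\<bar> \<le> l2n x * l2n y"
proof -
  have lim: "(\<lambda>N. \<Sum>n<N. inner (x n) (y n)) \<longlonglongrightarrow> ip x y"
    unfolding ip_def by (rule summable_LIMSEQ[OF ip_summable[OF x y]])
  have b: "\<bar>\<Sum>n<N. inner (x n) (y n)\<bar> \<le> l2n x * l2n y" for N
  proof -
    have "\<bar>\<Sum>n<N. inner (x n) (y n)\<bar> \<le> (\<Sum>n<N. \<bar>norm (x n)\<bar> * \<bar>norm (y n)\<bar>)"
      by (rule order_trans[OF sum_abs sum_mono]) (simp add: Cauchy_Schwarz_ineq2)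
    also have "\<dots> \<le> L2_set (\<lambda>n. norm (x n)) {..<N} * L2_set (\<lambda>n. norm (y n)) {..<N}" by (rule L2_set_mult_ineq)
    also have "\<dots> \<le> l2n x * l2n y" unfolding L2_set_def
      by (intro mult_mono sqrt_sum_le_l2n x y l2n_nonneg) (auto simp: sum_nonneg)
    finally show ?thesis .
  qed
  show ?thesis by (rule LIMSEQ_le_const2[OF tendsto_rabs[OF lim]]) (use b in auto)
qed

lemma ip_diff_right: "l2 x \<Longrightarrow> l2 y \<Longrightarrow> l2 z \<Longrightarrow> ip x (\<lambda>n. y n - z n) = ip x y - ip x z"
  unfolding ip_def by (simp add: inner_diff_right suminf_diff ip_summable)

lemma ip_mult_left: "ip (\<lambda>n. c * x n) y = ip x (\<lambda>n. qcnj c * y n)"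
  unfolding ip_def by (simp add: inner_mult_left)

lemma l2_complete:
  fixes w :: "nat \<Rightarrow> nat \<Rightarrow> 'a::banach"
  assumes l: "\<And>j. l2 (w j)" and C: "\<And>e. e > 0 \<Longrightarrow> \<exists>M. \<forall>i\<ge>M. \<forall>j\<ge>M. l2n (\<lambda>n. w i n - w j n) < e"
  shows "\<exists>v. l2 v \<and> (\<lambda>j. l2n (\<lambda>n. w j n - v n)) \<longlonglongrightarrow> 0"
proof -
  have ld: "l2 (\<lambda>n. w i n - w j n)" for i j by (rule l2_diff(1)[OF l l])
  have "Cauchy (\<lambda>j. w j n)" for n
  proof (rule metric_CauchyI)
    fix e :: real assume "e > 0"
    then obtain M where M: "\<And>i j. i \<ge> M \<Longrightarrow> j \<ge> M \<Longrightarrow> l2n (\<lambda>n. w i n - w j n) < e" using C by blast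
    have "dist (w i n) (w j n) < e" if "i \<ge> M" "j \<ge> M" for i j
      using l2n_ge_0th[OF ld[of i j], of n] M[OF that] by (simp add: dist_norm)
    thus "\<exists>M. \<forall>m\<ge>M. \<forall>k\<ge>M. dist (w m n) (w k n) < e" by blast
  qed
  hence "\<forall>n. \<exists>x. (\<lambda>j. w j n) \<longlonglongrightarrow> x" using Cauchy_convergent convergent_def by blast
  then obtain v where v: "\<And>n. (\<lambda>j. w j n) \<longlonglongrightarrow> v n" by metis
  have le: "l2 (\<lambda>n. w j n - v n) \<and> l2n (\<lambda>n. w j n - v n) \<le> e" if M: "\<And>i j. i \<ge> M \<Longrightarrow> j \<ge> M \<Longrightarrow> l2n (\<lambda>n. w i n - w j n) < e" and j: "j \<ge> M" for M j e
  proof -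
    have "sqrt (\<Sum>n<N. (norm (w j n - v n))\<^sup>2) \<le> e" for N
    proof (rule LIMSEQ_le_const2)
      show "(\<lambda>i. sqrt (\<Sum>n<N. (norm (w j n - w i n))\<^sup>2)) \<longlonglongrightarrow> sqrt (\<Sum>n<N. (norm (w j n - v n))\<^sup>2)"
        by (intro tendsto_intros v)
      show "\<exists>K. \<forall>i\<ge>K. sqrt (\<Sum>n<N. (norm (w j n - w i n))\<^sup>2) \<le> e"
      proof (intro exI allI impI)
        fix i assume "M \<le> i"
        show "sqrt (\<Sum>n<N. (norm (w j n - w i n))\<^sup>2) \<le> e"
          using sqrt_sum_le_l2n[OF ld[of j i], of N] M[OF j \<open>M \<le> i\<close>] by linarith
      qed
    qed
    from l2n_bound[OF this] show ?thesis by blast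
  qed
  obtain M where "\<And>i j. i \<ge> M \<Longrightarrow> j \<ge> M \<Longrightarrow> l2n (\<lambda>n. w i n - w j n) < 1" using C[of 1] by auto
  from le[OF this order_refl] have "l2 (\<lambda>n. w M n - v n)" by blast
  from l2_diff(1)[OF l[of M] this] have vl: "l2 v" by simp
  have "(\<lambda>j. l2n (\<lambda>n. w j n - v n)) \<longlonglongrightarrow> 0"
  proof (rule LIMSEQ_I)
    fix e :: real assume "e > 0"
    then obtain M where M: "\<And>i j. i \<ge> M \<Longrightarrow> j \<ge> M \<Longrightarrow> l2n (\<lambda>n. w i n - w j n) < e / 2" using C[of "e/2"] by auto
    have "norm (l2n (\<lambda>n. w j n - v n) - 0) < e" if "j \<ge> M" for j
      using le[OF M that] l2n_nonneg[of "\<lambda>n. w j n - v n"] \<open>e > 0\<close> by auto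
    thus "\<exists>no. \<forall>n\<ge>no. norm (l2n (\<lambda>na. w n na - v na) - 0) < e" by blast
  qed
  with vl show ?thesis by blast
qed

lemma shiftr_fps: "shiftr k a = fps_nth (fps_X ^ k * Abs_fps (a :: nat \<Rightarrow> 'a::ring_1))"
  by (rule ext) (auto simp: shiftr_def fps_X_power_mult_nth)

lemma conv_shiftr_left: "conv (shiftr k p) a = shiftr k (conv p (a :: nat \<Rightarrow> 'a::ring_1))"
proof -
  have "Abs_fps (shiftr k p) = fps_X ^ k * Abs_fps p" by (simp add: shiftr_fps fps_nth_inverse)
  thus ?thesis by (simp add: conv_fps shiftr_fps mult.assoc fps_nth_inverse)
qed

lemma fins_scale: "fins p \<Longrightarrow> fins (\<lambda>n. c * p n :: 'a::ring_1)"
  unfolding fins_def by fastforce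

lemma fins_diff: "fins p \<Longrightarrow> fins q \<Longrightarrow> fins (\<lambda>n. p n - q n :: 'a::ring_1)"
  using fins_add[of p "\<lambda>n. (-1) * q n"] fins_scale[of q "-1"] by simp

lemma fins_Suc: "fins p \<Longrightarrow> fins (\<lambda>n. p (Suc n))"
  unfolding fins_def by (meson le_Suc_eq)

lemma fins_shiftr: "fins p \<Longrightarrow> fins (shiftr k p)"
proof -
  assume "fins p"
  then obtain N where "\<forall>n\<ge>N. p n = 0" by (auto simp: fins_def)
  hence "\<forall>n\<ge>N + k. shiftr k p n = 0" by (auto simp: shiftr_def)
  thus ?thesis unfolding fins_def by blast
qed

lemma l2_conv_fins_left: "l2 a \<Longrightarrow> fins p \<Longrightarrow> l2 (conv p (a :: nat \<Rightarrow> 'a::real_normed_div_algebra))"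
  using l2_conv_fins(3) by (auto simp: fins_def)

lemma shiftr_1_Suc: "p 0 = 0 \<Longrightarrow> p = shiftr 1 (\<lambda>n. p (Suc n))"
  by (auto simp: shiftr_def fun_eq_iff not_less_eq_eq split: nat.splits)

lemma l2sq_mult: "l2 a \<Longrightarrow> l2sq (\<lambda>n. c * a n) = (norm c)\<^sup>2 * l2sq (a :: nat \<Rightarrow> 'a::real_normed_div_algebra)"
  unfolding l2sq_def l2_def norm_mult power_mult_distrib by (rule suminf_mult)

lemma l2sq_shiftr: "l2 a \<Longrightarrow> l2sq (shiftr k a) = l2sq a"
  using l2_shiftr[of a k] l2n_sq[of a] l2n_sq[of "shiftr k a"] by simp

text \<open>The element \<open>w\<close> of least norm among the limits of \<open>p * a\<close> with \<open>p\<close> a polynomial and \<open>p(0) = 1\<close> is a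
  wandering vector of the left shift-invariant space \<open>Cl\<close> generated by \<open>a\<close>: a Wold decomposition
  writes every element of that space as \<open>c * w\<close> with norm \<open>\<parallel>c\<parallel> \<parallel>w\<parallel>\<close>.\<close>

locale left_span =
  fixes a :: "nat \<Rightarrow> quat"
  assumes al: "l2 a" and a0: "a 0 \<noteq> 0"
begin

definition Cl :: "(nat \<Rightarrow> quat) \<Rightarrow> bool" where
  "Cl y \<longleftrightarrow> l2 y \<and> (\<forall>e>0. \<exists>r. fins r \<and> l2n (\<lambda>n. conv r a n - y n) < e)"

definition Cl1 :: "(nat \<Rightarrow> quat) \<Rightarrow> bool" where
  "Cl1 y \<longleftrightarrow> l2 y \<and> (\<forall>e>0. \<exists>r. fins r \<and> r 0 = 1 \<and> l2n (\<lambda>n. conv r a n - y n) < e)"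

definition minsq :: real where
  "minsq = Inf {l2sq (conv p a) | p. fins p \<and> p 0 = 1}"

lemma pl: "fins p \<Longrightarrow> l2 (conv p a)" by (rule l2_conv_fins_left[OF al])

lemma minsq_le:
  assumes "fins p" "p 0 = 1"
  shows "minsq \<le> l2sq (conv p a)"
  unfolding minsq_def using assms pl by (intro cInf_lower bdd_belowI[of _ 0]) (auto intro: l2sq_nonneg)

lemma minsq_pos: "minsq > 0"
proof -
  have "(norm (a 0))\<^sup>2 \<le> minsq" unfolding minsq_def
  proof (rule cInf_greatest)
    show "{l2sq (conv p a) | p. fins p \<and> p 0 = 1} \<noteq> {}" using fins_delta0 by (auto simp: delta0_def)
    fix x assume "x \<in> {l2sq (conv p a) | p. fins p \<and> p 0 = 1}"
    then obtain p where p: "fins p" "p 0 = 1" "x = l2sq (conv p a)" by blast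
    thus "(norm (a 0))\<^sup>2 \<le> x" using l2_norm_le[OF pl[OF p(1)], of 0] by (simp add: conv_0)
  qed
  moreover have "(norm (a 0))\<^sup>2 > 0" using a0 by simp
  ultimately show ?thesis by linarith
qed

lemma Cl1_ge:
  assumes "Cl1 y" shows "minsq \<le> l2sq y"
proof -
  have y: "l2 y" using assms by (simp add: Cl1_def)
  have "sqrt minsq \<le> l2n y + e" if e: "e > 0" for e
  proof -
    obtain r where r: "fins r" "r 0 = 1" "l2n (\<lambda>n. conv r a n - y n) < e" using assms e unfolding Cl1_def by blast
    have "sqrt minsq \<le> l2n (conv r a)" unfolding l2n_def by (intro real_sqrt_le_mono minsq_le r)
    also have "\<dots> \<le> l2n (\<lambda>n. conv r a n - y n) + l2n y" by (rule l2n_triangle_sub(2)[OF y l2_diff(1)[OF pl[OF r(1)] y]])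
    finally show ?thesis using r(3) by simp
  qed
  hence "sqrt minsq \<le> l2n y" by (rule field_le_epsilon)
  thus ?thesis by (simp add: l2n_def)
qed

lemma minimizer: "\<exists>w. Cl1 w \<and> l2sq w = minsq"
proof -
  have "\<exists>p. fins p \<and> p 0 = 1 \<and> l2sq (conv p a) < minsq + e" if "e > 0" for e
  proof -
    have ne: "{l2sq (conv p a) | p. fins p \<and> p 0 = 1} \<noteq> {}" using fins_delta0 by (auto simp: delta0_def)
    have "\<exists>x\<in>{l2sq (conv p a) | p. fins p \<and> p 0 = 1}. x < minsq + e"
      using cInf_lessD[OF ne, of "minsq + e"] that unfolding minsq_def by auto
    thus ?thesis by blast
  qed
  hence "\<forall>j. \<exists>p. fins p \<and> p 0 = 1 \<and> l2sq (conv p a) < minsq + 1 / real (Suc j)" by simp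
  then obtain p where p: "\<And>j. fins (p j)" "\<And>j. p j 0 = 1" "\<And>j. l2sq (conv (p j) a) < minsq + 1 / real (Suc j)" by metis
  have par: "l2sq (\<lambda>n. conv (p i) a n - conv (p j) a n) \<le> 2 / real (Suc i) + 2 / real (Suc j)" for i j
  proof -
    note l = pl[OF p(1)[of i]] pl[OF p(1)[of j]]
    \<comment> \<open>The midpoint of two competitors is a competitor, so the parallelogram law
      makes the minimizing sequence Cauchy.\<close>
    define q where "q n = of_real (1/2) * p i n + of_real (1/2) * p j n" for n
    have half: "of_real (1/2) + of_real (1/2) = (1::quat)" by (simp only: of_real_add[symmetric]) simp
    have q: "fins q" "q 0 = 1" unfolding q_def using p(1,2) by (auto intro!: fins_add fins_scale simp only: half mult_1_right)
    have "conv q a = (\<lambda>n. (1/2) *\<^sub>R (conv (p i) a n + 1 *\<^sub>R conv (p j) a n))"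
      unfolding q_def by (auto simp: conv_add_left conv_scale_left scaleR_conv_of_real distrib_left)
    hence "l2n (conv q a) = 1/2 * l2n (\<lambda>n. conv (p i) a n + 1 *\<^sub>R conv (p j) a n)"
      using l2_scaleR(2)[of "\<lambda>n. conv (p i) a n + 1 *\<^sub>R conv (p j) a n" "1/2"] l2_add(1)[OF l] by simp
    hence "(l2n (conv q a))\<^sup>2 = 1/4 * (l2n (\<lambda>n. conv (p i) a n + 1 *\<^sub>R conv (p j) a n))\<^sup>2" by (simp only: power_mult_distrib) (simp add: power2_eq_square)
    hence "4 * l2sq (conv q a) = l2sq (\<lambda>n. conv (p i) a n + 1 *\<^sub>R conv (p j) a n)"
      using l2n_sq[OF pl[OF q(1)]] l2n_sq[of "\<lambda>n. conv (p i) a n + 1 *\<^sub>R conv (p j) a n"] l2_add(1)[OF l] by simp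
    hence "4 * minsq \<le> l2sq (conv (p i) a) + 2 * ip (conv (p i) a) (conv (p j) a) + l2sq (conv (p j) a)"
      using minsq_le[OF q] l2sq_add_scaled[OF l, of 1] by simp
    moreover have "l2sq (\<lambda>n. conv (p i) a n - conv (p j) a n) = l2sq (conv (p i) a) - 2 * ip (conv (p i) a) (conv (p j) a) + l2sq (conv (p j) a)"
      using l2sq_add_scaled[OF l, of "-1"] by simp
    ultimately show ?thesis using p(3)[of i] p(3)[of j] by simp
  qed
  obtain w where w: "l2 w" "(\<lambda>j. l2n (\<lambda>n. conv (p j) a n - w n)) \<longlonglongrightarrow> 0"
  proof -
    have "\<exists>M. \<forall>i\<ge>M. \<forall>j\<ge>M. l2n (\<lambda>n. conv (p i) a n - conv (p j) a n) < e" if e: "e > 0" for e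
    proof -
      obtain M :: nat where M: "4 / e\<^sup>2 < real M" using reals_Archimedean2 by blast
      have "l2n (\<lambda>n. conv (p i) a n - conv (p j) a n) < e" if "i \<ge> M" "j \<ge> M" for i j
      proof -
        have s: "2 / real (Suc k) < e\<^sup>2 / 2" if "k \<ge> M" for k
        proof -
          have "4 / e\<^sup>2 < real (Suc k)" using M that by linarith
          thus ?thesis using e by (simp add: field_simps)
        qed
        have "l2sq (\<lambda>n. conv (p i) a n - conv (p j) a n) < e\<^sup>2" using par[of i j] s[OF that(1)] s[OF that(2)] by linarith
        thus ?thesis unfolding l2n_def using e by (simp add: real_less_lsqrt)
      qed
      thus ?thesis by blast
    qed
    with l2_complete[of "\<lambda>j. conv (p j) a"] pl[OF p(1)] that show thesis by blast
  qed
  have c: "Cl1 w" unfolding Cl1_def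
  proof (intro conjI w(1) allI impI)
    fix e :: real assume "e > 0"
    from LIMSEQ_D[OF w(2) this] obtain j where "\<forall>n\<ge>j. norm (l2n (\<lambda>k. conv (p n) a k - w k) - 0) < e" by blast
    hence "l2n (\<lambda>k. conv (p j) a k - w k) < e" by (auto dest: spec[of _ j])
    thus "\<exists>r. fins r \<and> r 0 = 1 \<and> l2n (\<lambda>n. conv r a n - w n) < e" using p by blast
  qed
  have "l2n w \<le> sqrt minsq"
  proof (rule LIMSEQ_le_const)
    have "(\<lambda>j. 1 / real (Suc j)) \<longlonglongrightarrow> 0" by (rule LIMSEQ_Suc[OF lim_1_over_n])
    hence "(\<lambda>j. l2n (\<lambda>n. conv (p j) a n - w n) + sqrt (minsq + 1 / real (Suc j))) \<longlonglongrightarrow> 0 + sqrt (minsq + 0)"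
      by (intro tendsto_intros w(2))
    thus "(\<lambda>j. l2n (\<lambda>n. conv (p j) a n - w n) + sqrt (minsq + 1 / real (Suc j))) \<longlonglongrightarrow> sqrt minsq" by simp
    have "l2n w \<le> l2n (\<lambda>n. conv (p j) a n - w n) + sqrt (minsq + 1 / real (Suc j))" for j
    proof -
      have "l2n w \<le> l2n (\<lambda>n. w n - conv (p j) a n) + l2n (conv (p j) a)"
        by (rule l2n_triangle_sub(2)[OF pl[OF p(1)] l2_diff(1)[OF w(1) pl[OF p(1)]]])
      also have "l2n (\<lambda>n. w n - conv (p j) a n) = l2n (\<lambda>n. conv (p j) a n - w n)" by (rule l2n_minus_commute)
      also have "l2n (conv (p j) a) \<le> sqrt (minsq + 1 / real (Suc j))"
        unfolding l2n_def using p(3)[of j] by (intro real_sqrt_le_mono) simp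
      finally show ?thesis by simp
    qed
    thus "\<exists>N. \<forall>n\<ge>N. l2n w \<le> l2n (\<lambda>na. conv (p n) a na - w na) + sqrt (minsq + 1 / real (Suc n))" by blast
  qed
  hence "l2sq w \<le> minsq" by (simp add: l2n_def)
  with Cl1_ge[OF c] c show ?thesis by force
qed

definition w :: "nat \<Rightarrow> quat" where
  "w = (SOME w. Cl1 w \<and> l2sq w = minsq)"

lemma w: "Cl1 w" "l2sq w = minsq"
  using someI_ex[OF minimizer] unfolding w_def by blast+

lemma wl: "l2 w" using w(1) by (simp add: Cl1_def)

lemma w_0: "w 0 = a 0"
proof -
  have "norm (a 0 - w 0) \<le> 0 + e" if e: "e > 0" for e
  proof -
    obtain r where r: "fins r" "r 0 = 1" "l2n (\<lambda>n. conv r a n - w n) < e" using w(1) e unfolding Cl1_def by blast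
    have "norm (conv r a 0 - w 0) \<le> l2n (\<lambda>n. conv r a n - w n)"
      by (rule l2n_ge_0th[OF l2_diff(1)[OF pl[OF r(1)] wl], where n = 0])
    thus ?thesis using r by (simp add: conv_0)
  qed
  from field_le_epsilon[OF this] show ?thesis by simp
qed

text \<open>Adding a real multiple of the shifted r * a to w leaves the constant coefficient of the
  approximating multipliers equal to 1, so w is minimal along this line and the first variation
  vanishes.\<close>

lemma w_orth_fins:
  assumes r: "fins r"
  shows "ip w (shiftr 1 (conv r a)) = 0"
proof -
  let ?x = "shiftr 1 (conv r a)"
  have x: "?x = conv (shiftr 1 r) a" by (simp add: conv_shiftr_left)
  have xl: "l2 ?x" by (rule l2_shiftr(1)[OF pl[OF r]])
  have ge: "0 \<le> 2 * e * ip w ?x + e\<^sup>2 * l2sq ?x" for e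
  proof -
    have "Cl1 (\<lambda>n. w n + e *\<^sub>R ?x n)" unfolding Cl1_def
    proof (intro conjI allI impI)
      show "l2 (\<lambda>n. w n + e *\<^sub>R ?x n)" by (intro l2_add(1) l2_scaleR(1) wl xl)
      fix d :: real assume "d > 0"
      then obtain p where p: "fins p" "p 0 = 1" "l2n (\<lambda>n. conv p a n - w n) < d" using w(1) unfolding Cl1_def by blast
      define q where "q n = p n + of_real e * shiftr 1 r n" for n
      have "fins q" unfolding q_def by (intro fins_add fins_scale fins_shiftr p r)
      moreover have "q 0 = 1" using p(2) by (simp add: q_def shiftr_def)
      moreover have "conv q a n = conv p a n + e *\<^sub>R ?x n" for n
        unfolding q_def x by (simp add: conv_add_left conv_scale_left scaleR_conv_of_real)
      ultimately show "\<exists>r'. fins r' \<and> r' 0 = 1 \<and> l2n (\<lambda>n. conv r' a n - (w n + e *\<^sub>R ?x n)) < d"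
        using p(3) by (intro exI[of _ q]) simp
    qed
    from Cl1_ge[OF this] show ?thesis unfolding l2sq_add_scaled[OF wl xl] w(2) by simp
  qed
  show ?thesis
  proof (rule ccontr)
    assume nz: "ip w ?x \<noteq> 0"
    \<comment> \<open>Taking e as minus the inner product divided by s would make the quadratic
      negative; adding 1 keeps s positive.\<close>
    define s where "s = l2sq ?x + 1"
    have s: "s > 0" "l2sq ?x < s" using l2sq_nonneg[OF xl] by (auto simp: s_def)
    have "0 \<le> 2 * (- (ip w ?x / s)) * ip w ?x + (- (ip w ?x / s))\<^sup>2 * l2sq ?x" by (rule ge)
    also have "\<dots> < 2 * (- (ip w ?x / s)) * ip w ?x + (- (ip w ?x / s))\<^sup>2 * s"
      using s nz by (intro add_strict_left_mono mult_strict_left_mono) auto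
    also have "\<dots> = - ((ip w ?x)\<^sup>2 / s)" using s by (simp add: field_simps power2_eq_square)
    also have "\<dots> \<le> 0" using s by simp
    finally show False by simp
  qed
qed

lemma Cl_mult: 
  assumes "Cl y" shows "Cl (\<lambda>n. c * y n)"
  unfolding Cl_def
proof (intro conjI allI impI)
  have y: "l2 y" using assms by (simp add: Cl_def)
  show "l2 (\<lambda>n. c * y n)" by (rule l2_mult(1)[OF y])
  fix e :: real assume e: "e > 0"
  hence "e / (norm c + 1) > 0" by (simp add: add_nonneg_pos)
  then obtain r where r: "fins r" "l2n (\<lambda>n. conv r a n - y n) < e / (norm c + 1)" using assms unfolding Cl_def by blast
  have "l2n (\<lambda>n. conv (\<lambda>n. c * r n) a n - c * y n) = norm c * l2n (\<lambda>n. conv r a n - y n)"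
    unfolding conv_scale_left right_diff_distrib[symmetric] by (rule l2_mult(2)[OF l2_diff(1)[OF pl[OF r(1)] y]])
  also have "\<dots> \<le> norm c * (e / (norm c + 1))" using r(2) by (intro mult_left_mono) auto
  also have "\<dots> < e" using e by (simp add: field_simps add_pos_nonneg)
  finally show "\<exists>r. fins r \<and> l2n (\<lambda>n. conv r a n - c * y n) < e" using fins_scale[OF r(1)] by blast
qed

text \<open>The inner product \<open>ip\<close> is real-valued, so orthogonality of all c w with
  quaternion c is recovered by moving c to the other side, where \<open>Cl\<close> is stable under
  left scalars.\<close>

lemma w_orth:
  assumes y: "Cl y"
  shows "ip (\<lambda>n. c * w n) (shiftr 1 y) = 0"
proof -
  have o: "ip w (shiftr 1 z) = 0" if z: "Cl z" for z
  proof -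
    have zl: "l2 z" using z by (simp add: Cl_def)
    have "\<bar>ip w (shiftr 1 z)\<bar> \<le> 0 + e" if e: "e > 0" for e
    proof -
      have "e / (l2n w + 1) > 0" using e l2n_nonneg[OF wl] by simp
      then obtain r where r: "fins r" "l2n (\<lambda>n. conv r a n - z n) < e / (l2n w + 1)" using z unfolding Cl_def by blast
      note dl = l2_diff(1)[OF pl[OF r(1)] zl]
      have "(\<lambda>n. shiftr 1 (conv r a) n - shiftr 1 z n) = shiftr 1 (\<lambda>n. conv r a n - z n)" by (auto simp: shiftr_def)
      hence "- ip w (shiftr 1 z) = ip w (shiftr 1 (\<lambda>n. conv r a n - z n))"
        using ip_diff_right[OF wl l2_shiftr(1)[OF pl[OF r(1)], of 1] l2_shiftr(1)[OF zl, of 1]] w_orth_fins[OF r(1)] by simp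
      hence "\<bar>ip w (shiftr 1 z)\<bar> \<le> l2n w * l2n (\<lambda>n. conv r a n - z n)"
        using ip_le[OF wl l2_shiftr(1)[OF dl, of 1]] l2_shiftr(2)[OF dl, of 1] by simp
      also have "\<dots> \<le> l2n w * (e / (l2n w + 1))" using r(2) l2n_nonneg[OF wl] by (intro mult_left_mono) auto
      also have "\<dots> \<le> e" using e l2n_nonneg[OF wl] by (simp add: field_simps)
      finally show ?thesis by simp
    qed
    from field_le_epsilon[OF this] show ?thesis by simp
  qed
  have "ip (\<lambda>n. c * w n) (shiftr 1 y) = ip w (\<lambda>n. qcnj c * shiftr 1 y n)" by (rule ip_mult_left)
  also have "(\<lambda>n. qcnj c * shiftr 1 y n) = shiftr 1 (\<lambda>n. qcnj c * y n)" by (auto simp: shiftr_def)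
  finally show ?thesis using o[OF Cl_mult[OF y]] by simp
qed

lemma Cl_a: "Cl a"
  unfolding Cl_def using al fins_delta0 by (auto intro!: exI[of _ delta0] simp: l2n_def l2sq_def)

lemma Cl_conv_w:
  assumes p: "fins p" shows "Cl (conv p w)"
  unfolding Cl_def
proof (intro conjI allI impI)
  show l: "l2 (conv p w)" by (rule l2_conv_fins_left[OF wl p])
  fix e :: real assume e: "e > 0"
  obtain N where N: "\<forall>n\<ge>N. p n = 0" using p by (auto simp: fins_def)
  define C where "C = (\<Sum>k<N. norm (p k))"
  have C: "C \<ge> 0" by (simp add: C_def sum_nonneg)
  have "e / (C + 1) > 0" using e C by simp
  then obtain r where r: "fins r" "l2n (\<lambda>n. conv r a n - w n) < e / (C + 1)" using w(1) unfolding Cl1_def by blast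
  have "l2n (\<lambda>n. conv (conv p r) a n - conv p w n) = l2n (conv p (\<lambda>n. conv r a n - w n))"
    by (simp add: conv_assoc conv_diff_right fun_eq_iff[symmetric] flip: conv_diff_right)
  also have "\<dots> \<le> C * l2n (\<lambda>n. conv r a n - w n)" unfolding C_def
    by (rule l2_conv_fins(4)[OF l2_diff(1)[OF pl[OF r(1)] wl] N])
  also have "\<dots> \<le> C * (e / (C + 1))" using r(2) C by (intro mult_left_mono) auto
  also have "\<dots> < e" using e C by (simp add: field_simps)
  finally show "\<exists>r. fins r \<and> l2n (\<lambda>n. conv r a n - conv p w n) < e" using fins_conv[OF p r(1)] by blast
qed

text \<open>One step of the Wold decomposition: subtracting c w kills the constant coefficient of y,
  and the quotient by the variable stays in \<open>Cl\<close>. Orthogonality of the multiples of w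
  to the shifts makes the squared norms add.\<close>

lemma Cl_step:
  assumes y: "Cl y"
  defines "c \<equiv> y 0 * inverse (a 0)"
  defines "y' \<equiv> (\<lambda>n. y (Suc n) - c * w (Suc n))"
  shows "Cl y'" "l2sq y = (norm c)\<^sup>2 * minsq + l2sq y'"
proof -
  have yl: "l2 y" using y by (simp add: Cl_def)
  have c: "c * w 0 = y 0" using a0 by (simp add: c_def w_0 mult.assoc)
  note cw = l2_mult(1)[OF wl, of c]
  note dl = l2_diff(1)[OF yl cw]
  have sh: "(\<lambda>n. y n - c * w n) = shiftr 1 y'" unfolding y'_def using shiftr_1_Suc[of "\<lambda>n. y n - c * w n"] c by simp
  have y'l: "l2 y'" using dl unfolding y'_def l2_def by (subst (asm) summable_Suc_iff[symmetric])
  show Cy': "Cl y'" unfolding Cl_def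
  proof (intro conjI y'l allI impI)
    fix e :: real assume e: "e > 0"
    \<comment> \<open>Budget for three errors: d for approximating y, d for r 0 times the error at
      w, and d / |a 0| times the norm of w for replacing c by r 0.\<close>
    define K where "K = 2 + l2n w / norm (a 0)"
    have K: "K > 0" unfolding K_def using l2n_nonneg[OF wl] by (intro add_pos_nonneg) auto
    define d where "d = e / K"
    have d: "d > 0" using e K by (simp add: d_def)
    obtain r where r: "fins r" "l2n (\<lambda>n. conv r a n - y n) < d" using y d unfolding Cl_def by blast
    have "d / (1 + norm (r 0)) > 0" using d by (simp add: add_pos_nonneg)
    then obtain p where p: "fins p" "p 0 = 1" "l2n (\<lambda>n. conv p a n - w n) < d / (1 + norm (r 0))"
      using w(1) unfolding Cl1_def by blast
    \<comment> \<open>p 0 = 1 makes the constant term of s vanish, so s can be divided by the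
      variable within the polynomials.\<close>
    define s where "s n = r n - r 0 * p n" for n
    have sf: "fins s" unfolding s_def by (intro fins_diff fins_scale r p)
    have ss: "s = shiftr 1 (\<lambda>n. s (Suc n))" by (rule shiftr_1_Suc) (simp add: s_def p)
    note l1 = l2_diff(1)[OF pl[OF r(1)] yl] and l2' = l2_diff(1)[OF pl[OF p(1)] wl]
    have "norm (conv r a 0 - y 0) \<le> l2n (\<lambda>n. conv r a n - y n)" by (rule l2n_ge_0th[OF l1, where n = 0])
    also have "conv r a 0 - y 0 = (r 0 - c) * a 0" using c by (simp add: conv_0 w_0 left_diff_distrib)
    finally have rc: "norm (r 0 - c) \<le> d / norm (a 0)" using r(2) a0 by (simp add: norm_mult pos_le_divide_eq)
    have "l2n (\<lambda>n. conv (\<lambda>n. s (Suc n)) a n - y' n) = l2n (shiftr 1 (\<lambda>n. conv (\<lambda>n. s (Suc n)) a n - y' n))"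
      using l2_shiftr(2)[OF l2_diff(1)[OF pl[OF fins_Suc[OF sf]] y'l], of 1] by simp
    also have "shiftr 1 (\<lambda>n. conv (\<lambda>n. s (Suc n)) a n - y' n) = (\<lambda>n. conv s a n - (y n - c * w n))"
    proof
      fix n
      have "conv s a n = shiftr 1 (conv (\<lambda>n. s (Suc n)) a) n" by (subst ss) (simp add: conv_shiftr_left)
      moreover have "y n - c * w n = shiftr 1 y' n" by (metis sh)
      ultimately show "shiftr 1 (\<lambda>n. conv (\<lambda>n. s (Suc n)) a n - y' n) n = conv s a n - (y n - c * w n)" by (simp add: shiftr_def)
    qed
    also have "\<dots> = (\<lambda>n. ((conv r a n - y n) - r 0 * (conv p a n - w n)) - (r 0 - c) * w n)"
      unfolding s_def by (auto simp: conv_diff_left conv_scale_left algebra_simps)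
    also have "l2n \<dots> \<le> (l2n (\<lambda>n. conv r a n - y n) + norm (r 0) * l2n (\<lambda>n. conv p a n - w n)) + norm (r 0 - c) * l2n w"
      using l2_diff(2)[OF l2_diff(1)[OF l1 l2_mult(1)[OF l2', of "r 0"]] l2_mult(1)[OF wl, of "r 0 - c"]]
        l2_diff(2)[OF l1 l2_mult(1)[OF l2', of "r 0"]]
      by (simp add: l2_mult(2)[OF l2'] l2_mult(2)[OF wl])
    also have "\<dots> < (d + d) + d / norm (a 0) * l2n w"
    proof (intro add_less_le_mono add_less_le_mono r(2) mult_right_mono rc l2n_nonneg[OF wl])
      have "norm (r 0) * l2n (\<lambda>n. conv p a n - w n) \<le> norm (r 0) * (d / (1 + norm (r 0)))"
        using p(3) by (intro mult_left_mono) auto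
      also have "\<dots> \<le> d" using d by (simp add: field_simps add_pos_nonneg)
      finally show "norm (r 0) * l2n (\<lambda>n. conv p a n - w n) \<le> d" .
    qed
    also have "\<dots> = d * K" by (simp add: K_def algebra_simps)
    also have "\<dots> = e" using K by (simp add: d_def)
    finally show "\<exists>r. fins r \<and> l2n (\<lambda>n. conv r a n - y' n) < e" using fins_Suc[OF sf] by blast
  qed
  have "y n = c * w n + 1 *\<^sub>R shiftr 1 y' n" for n unfolding sh[symmetric] by simp
  hence "l2sq y = l2sq (\<lambda>n. c * w n + 1 *\<^sub>R shiftr 1 y' n)" by (intro arg_cong[of _ _ l2sq] ext)
  also have "\<dots> = l2sq (\<lambda>n. c * w n) + l2sq (shiftr 1 y')"
    using l2sq_add_scaled[OF cw l2_shiftr(1)[OF y'l, of 1], of 1] w_orth[OF Cy', of c] by simp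
  also have "l2sq (\<lambda>n. c * w n) = (norm c)\<^sup>2 * minsq"
    unfolding l2sq_mult[OF wl] w(2) ..
  also have "l2sq (shiftr 1 y') = l2sq y'" by (rule l2sq_shiftr[OF y'l])
  finally show "l2sq y = (norm c)\<^sup>2 * minsq + l2sq y'" .
qed

text \<open>Peeling off the constant coefficient writes p * w as p 0 times w plus the shift of a
  multiple of lower degree, and these two are orthogonal.\<close>

lemma w_iso:
  assumes "fins p" shows "l2sq (conv p w) = minsq * l2sq p"
proof -
  have "l2sq (conv p w) = minsq * l2sq p" if "\<forall>n\<ge>N. p n = 0" for N p
    using that
  proof (induction N arbitrary: p)
    case 0
    hence "p = (\<lambda>_. 0)" by auto
    thus ?case by (simp add: conv_def l2sq_def)
  next
    case (Suc N)
    have pf: "fins p" "fins (\<lambda>n. p (Suc n))" using Suc.prems fins_Suc unfolding fins_def by blast+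
    have IH: "l2sq (conv (\<lambda>n. p (Suc n)) w) = minsq * l2sq (\<lambda>n. p (Suc n))" using Suc.prems by (intro Suc.IH) auto
    note yl = l2_conv_fins_left[OF wl pf(2)]
    have "(\<lambda>n. p n - p 0 * delta0 n) = shiftr 1 (\<lambda>n. p (Suc n))"
      using shiftr_1_Suc[of "\<lambda>n. p n - p 0 * delta0 n"] by (simp add: delta0_def)
    hence d: "p n - p 0 * delta0 n = shiftr 1 (\<lambda>n. p (Suc n)) n" for n by (rule fun_cong)
    have "p n = p 0 * delta0 n + shiftr 1 (\<lambda>n. p (Suc n)) n" for n unfolding d[symmetric] by simp
    hence "conv p w = (\<lambda>n. conv (\<lambda>n. p 0 * delta0 n + shiftr 1 (\<lambda>n. p (Suc n)) n) w n)"
      by (intro ext arg_cong[of _ _ "\<lambda>p. conv p w _"])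
    also have "\<dots> = (\<lambda>n. p 0 * w n + 1 *\<^sub>R shiftr 1 (conv (\<lambda>n. p (Suc n)) w) n)"
      by (simp add: conv_add_left conv_scale_left conv_shiftr_left)
    finally have "l2sq (conv p w) = l2sq (\<lambda>n. p 0 * w n) + l2sq (shiftr 1 (conv (\<lambda>n. p (Suc n)) w))"
      using l2sq_add_scaled[OF l2_mult(1)[OF wl, of "p 0"] l2_shiftr(1)[OF yl, of 1], of 1] w_orth[OF Cl_conv_w[OF pf(2)], of "p 0"] by simp
    also have "l2sq (\<lambda>n. p 0 * w n) = (norm (p 0))\<^sup>2 * minsq"
      unfolding l2sq_mult[OF wl] w(2) ..
    also have "l2sq (shiftr 1 (conv (\<lambda>n. p (Suc n)) w)) = minsq * l2sq (\<lambda>n. p (Suc n))"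
      unfolding l2sq_shiftr[OF yl] by (rule IH)
    also have "(norm (p 0))\<^sup>2 * minsq + minsq * l2sq (\<lambda>n. p (Suc n)) = minsq * l2sq p"
      using suminf_split_head[OF fins_l2[OF pf(1), unfolded l2_def]] by (simp add: l2sq_def mult.commute[of minsq] flip: distrib_right)
    finally show ?case .
  qed
  thus ?thesis using assms unfolding fins_def by blast
qed

text \<open>Remainders of a after k steps of \<open>Cl_step\<close>.\<close>

primrec Y :: "nat \<Rightarrow> nat \<Rightarrow> quat" where
  "Y 0 = a"
| "Y (Suc k) = (\<lambda>n. Y k (Suc n) - Y k 0 * inverse (a 0) * w (Suc n))"

text \<open>Adding up the norm identities of the steps bounds the partial sums of |c k|^2. The
  equality a = c * w is exact in every coefficient, because coefficient n of \<open>Y k\<close>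
  involves only c k, ..., c (k + n); no limit of the remainders is taken.\<close>

lemma factorization: "\<exists>c. l2 c \<and> c 0 = 1 \<and> conv c w = a"
proof (intro exI conjI)
  define c where "c k = Y k 0 * inverse (a 0)" for k
  have Cl: "Cl (Y k)" for k by (induction k) (auto simp: Cl_a Cl_step(1))
  have st: "l2sq (Y k) = (norm (c k))\<^sup>2 * minsq + l2sq (Y (Suc k))" for k
    using Cl_step(2)[OF Cl[of k]] by (simp add: c_def)
  have tot: "l2sq a = (\<Sum>k<K. (norm (c k))\<^sup>2) * minsq + l2sq (Y K)" for K
    by (induction K) (auto simp: st algebra_simps)
  have "(\<Sum>k<K. (norm (c k))\<^sup>2) \<le> l2sq a / minsq" for K
    using tot[of K] l2sq_nonneg[of "Y K"] Cl[of K] minsq_pos by (simp add: Cl_def field_simps)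
  thus "l2 c" unfolding l2_def by (intro summableI_nonneg_bounded[where x = "l2sq a / minsq"]) auto
  show "c 0 = 1" using a0 by (simp add: c_def)
  have "Y k n = (\<Sum>i\<le>n. c (k + i) * w (n - i))" for k n
  proof (induction n arbitrary: k)
    case 0 show ?case using a0 by (simp add: c_def w_0 mult.assoc)
  next
    case (Suc n)
    have "Y k (Suc n) = c k * w (Suc n) + Y (Suc k) n" by (simp add: c_def)
    also have "\<dots> = (\<Sum>i\<le>Suc n. c (k + i) * w (Suc n - i))" unfolding Suc.IH by (subst sum.atMost_Suc_shift) simp
    finally show ?case .
  qed
  from this[of 0] show "conv c w = a" by (auto simp: conv_def)
qed

end

section \<open>Isometric multiplications\<close>

lemma fourier_unique:
  assumes u [measurable]: "u \<in> borel_measurable borel" and ui: "integrable circ u"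
    and c: "\<And>k::nat. integral\<^sup>L circ (\<lambda>t. u t * cos (real k * t)) = 0"
    and s: "\<And>k::nat. integral\<^sup>L circ (\<lambda>t. u t * sin (real k * t)) = 0"
  shows "AE t in circ. u t = 0"
proof -
  have bi: "integrable circ (\<lambda>t. u t * g t)" if [measurable]: "g \<in> borel_measurable borel" and g: "\<And>t. \<bar>g t\<bar> \<le> K" for g K
  proof (rule Bochner_Integration.integrable_bound[OF integrable_mult_right[OF ui, of K]])
    show "AE t in circ. norm (u t * g t) \<le> norm (K * u t)"
      using g by (intro AE_I2) (auto simp: abs_mult mult.commute intro!: mult_mono order_trans[OF g abs_ge_self])
  qed simp
  have z: "integral\<^sup>L circ (\<lambda>t. u t * Re (poly P (cis t))) = 0" for P
  proof -
    have eq: "u t * Re (poly P (cis t)) = (\<Sum>i\<le>degree P. Re (coeff P i) * (u t * cos (real i * t)) - Im (coeff P i) * (u t * sin (real i * t)))" for t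
      by (simp add: poly_altdef Complex.DeMoivre sum_distrib_left algebra_simps)
    have "integrable circ (\<lambda>t. u t * cos (real i * t))" "integrable circ (\<lambda>t. u t * sin (real i * t))" for i :: nat
      by (rule bi[where K=1]; simp)+
    thus ?thesis unfolding eq by (simp add: c s)
  qed
  obtain G :: "nat \<Rightarrow> complex poly" where G: "\<And>n t. \<bar>Re (poly (G n) (cis t))\<bar> \<le> 1 + 1"
    "AE t in circ. (\<lambda>n. Re (poly (G n) (cis t))) \<longlonglongrightarrow> sgn (u t)"
    using bounded_approx_repoly[of "\<lambda>t. sgn (u t)" 1] by (auto simp: abs_sgn_eq)
  have "(\<lambda>n. integral\<^sup>L circ (\<lambda>t. u t * Re (poly (G n) (cis t)))) \<longlonglongrightarrow> integral\<^sup>L circ (\<lambda>t. u t * sgn (u t))"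
  proof (rule integral_dominated_convergence[where w = "\<lambda>t. 2 * \<bar>u t\<bar>"])
    show "AE t in circ. (\<lambda>n. u t * Re (poly (G n) (cis t))) \<longlonglongrightarrow> u t * sgn (u t)"
      using G(2) by eventually_elim (rule tendsto_mult_left)
    show "AE t in circ. norm (u t * Re (poly (G n) (cis t))) \<le> 2 * \<bar>u t\<bar>" for n
      using G(1)[of n] by (intro AE_I2) (simp add: abs_mult mult.commute mult_left_mono)
  qed (use ui in auto)
  hence "integral\<^sup>L circ (\<lambda>t. u t * sgn (u t)) = 0" unfolding z using LIMSEQ_unique tendsto_const by blast
  hence "integral\<^sup>L circ (\<lambda>t. norm (u t)) = 0" by (simp add: abs_sgn)
  hence "AE t in circ. norm (u t) = 0"
    using integral_nonneg_eq_0_iff_AE[OF integrable_norm[OF ui]] by simp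
  thus ?thesis by simp
qed

lemma circ_reflect:
  fixes f :: "real \<Rightarrow> real"
  assumes [measurable]: "f \<in> borel_measurable borel"
  shows "integral\<^sup>L circ (\<lambda>t. f (2*pi - t)) = integral\<^sup>L circ f"
proof -
  have "integral\<^sup>L lborel (\<lambda>t. indicator {0..2*pi} t *\<^sub>R f t) = integral\<^sup>L lborel (\<lambda>t. indicator {0..2*pi} (2*pi - t) *\<^sub>R f (2*pi - t))"
    using lborel_integral_real_affine[of "-1" "\<lambda>t. indicator {0..2*pi} t *\<^sub>R f t" "2*pi"] by simp
  also have "(\<lambda>t. indicator {0..2*pi} (2*pi - t) *\<^sub>R f (2*pi - t)) = (\<lambda>t. indicator {0..2*pi} t *\<^sub>R f (2*pi - t))"
    by (auto simp: indicator_def)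
  finally show ?thesis by (simp add: integral_circ set_lebesgue_integral_def)
qed

text \<open>The component series have real coefficients and so commute with complex
  conjugation.\<close>

lemma boundary_reflect:
  assumes a: "l2 a"
  shows "AE t in circ. bA a (2*pi - t) = bA a t \<and> bB a (2*pi - t) = - bB a t"
proof -
  have m: "AE t in circ. bd (pc m a) (2*pi - t) = cnj (bd (pc m a) t)" if "m \<in> {qre, qi, qj, qk}" for m
    using bd_AE[OF l2_pc(1)[OF a that]]
  proof eventually_elim
    case (elim t)
    have "cis (2*pi - t) = cnj (cis t)" by (simp add: complex_eq_iff)
    hence z: "of_real r * cis (2*pi - t) = cnj (of_real r * cis t)" for r by simp
    have "\<forall>\<^sub>F r in at_left 1. cnj (pser (pc m a) (of_real r * cis t)) = pser (pc m a) (of_real r * cis (2*pi - t))"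
      using at_left_1_ge
    proof eventually_elim
      case (elim r)
      hence "cmod (of_real r * cis t) < 1" by (simp add: norm_mult)
      from pser_sums[OF l2_pc(1)[OF a that] this]
      have "(\<lambda>n. cnj (pc m a n * (of_real r * cis t) ^ n)) sums cnj (pser (pc m a) (of_real r * cis t))" unfolding sums_cnj .
      thus ?case unfolding z pser_def[of _ "cnj _"] by (simp add: sums_iff pc_def)
    qed
    with tendsto_cnj[OF elim] have "((\<lambda>r. pser (pc m a) (of_real r * cis (2*pi - t))) \<longlongrightarrow> cnj (bd (pc m a) t)) (at_left 1)"
      by (rule Lim_transform_eventually)
    thus ?case by (rule bd_eqI)
  qed
  show ?thesis using m[of qre, simplified] m[of qi, simplified] m[of qj, simplified] m[of qk, simplified]
    by eventually_elim (simp add: bA_def bB_def reQ_def imQ_def quat_eq_iff)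
qed

lemma boundary_binomial:
  fixes c :: quat and k :: nat
  defines "p \<equiv> \<lambda>n. (if n = 0 then 1 else 0) + (if n = k then c else 0)"
  shows "bA p t = 1 + cos (real k * t) *\<^sub>R c" "bB p t = sin (real k * t) *\<^sub>R c"
proof -
  have "bd (pc m p) t = of_real (m 1) + of_real (m c) * cis (real k * t)" if m: "m \<in> {qre, qi, qj, qk}" for m
  proof -
    have "pc m p = coeff (monom (of_real (m 1)) 0 + monom (of_real (m c)) k)"
      using m by (auto simp: pc_def p_def fun_eq_iff)
    thus ?thesis by (simp add: bd_coeff poly_monom Complex.DeMoivre)
  qed
  thus "bA p t = 1 + cos (real k * t) *\<^sub>R c" "bB p t = sin (real k * t) *\<^sub>R c"
    by (simp_all add: bA_def bB_def reQ_def imQ_def quat_eq_iff mult.commute)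
qed

text \<open>Parseval's identity for \<open>p * \<theta>\<close> with \<open>p = 1 + q\<^sup>k c\<close> gives the Fourier coefficients of
  \<open>|A|\<^sup>2 + |B|\<^sup>2\<close> and of \<open>\<langle>A, V B\<rangle>\<close>, where \<open>A + I B\<close> are the boundary values of \<open>\<theta>\<close>; those that are
  missing vanish by the symmetry \<open>t \<mapsto> 2\<pi> - t\<close>.\<close>

theorem isometric_imp_unimodular:
  assumes th: "l2 \<theta>" and iso: "\<And>p. fins p \<Longrightarrow> l2sq (conv p \<theta>) = l2sq p"
  shows "AE t in circ. (norm (bA \<theta> t))\<^sup>2 + (norm (bB \<theta> t))\<^sup>2 = 1 \<and> (\<forall>V. qre V = 0 \<longrightarrow> inner (bA \<theta> t) (V * bB \<theta> t) = 0)"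
proof -
  note [measurable] = bA_bB_measurable[OF th]
  define N where "N t = (norm (bA \<theta> t))\<^sup>2 + (norm (bB \<theta> t))\<^sup>2" for t
  define X where "X V t = inner (bA \<theta> t) (V * bB \<theta> t)" for V t
  have [measurable]: "N \<in> borel_measurable borel" "X V \<in> borel_measurable borel" for V
    unfolding N_def[abs_def] X_def[abs_def] by measurable
  have Ni: "integrable circ N" unfolding N_def[abs_def] by (rule stem_parseval(1)[OF th])
  have N1: "integral\<^sup>L circ N = 1"
    using stem_parseval(2)[OF th] iso[OF fins_delta0] l2n_sq[of "delta0 :: nat \<Rightarrow> quat"]
    by (simp add: N_def[abs_def] l2n_delta0 fins_l2 fins_delta0)
  have XN: "\<bar>X V t\<bar> \<le> norm V * N t" for V t
  proof -
    have "\<bar>X V t\<bar> \<le> norm (bA \<theta> t) * (norm V * norm (bB \<theta> t))"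
      unfolding X_def using Cauchy_Schwarz_ineq2[of "bA \<theta> t" "V * bB \<theta> t"] by (simp add: norm_mult)
    also have "\<dots> = norm V * (norm (bA \<theta> t) * norm (bB \<theta> t))" by simp
    also have "\<dots> \<le> norm V * N t" unfolding N_def
    proof (rule mult_left_mono)
      have "2 * (norm (bA \<theta> t) * norm (bB \<theta> t)) \<le> (norm (bA \<theta> t))\<^sup>2 + (norm (bB \<theta> t))\<^sup>2"
        using sum_squares_bound[of "norm (bA \<theta> t)" "norm (bB \<theta> t)"] by simp
      moreover have "0 \<le> norm (bA \<theta> t) * norm (bB \<theta> t)" by simp
      ultimately show "norm (bA \<theta> t) * norm (bB \<theta> t) \<le> (norm (bA \<theta> t))\<^sup>2 + (norm (bB \<theta> t))\<^sup>2" by linarith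
    qed simp
    finally show ?thesis .
  qed
  have Xi: "integrable circ (X V)" for V
  proof (rule Bochner_Integration.integrable_bound[OF integrable_mult_right[OF Ni, of "norm V"]])
    show "AE t in circ. norm (X V t) \<le> norm (norm V * N t)" by (intro AE_I2, unfold real_norm_def) (rule order_trans[OF XN abs_ge_self])
  qed simp
  have trig: "integrable circ (\<lambda>t. f t * g t)" if f: "integrable circ f" and [measurable]: "f \<in> borel_measurable borel" "g \<in> borel_measurable borel"
    and g: "\<And>t. \<bar>g t\<bar> \<le> 1" for f g :: "real \<Rightarrow> real"
  proof (rule Bochner_Integration.integrable_bound[OF f])
    show "AE t in circ. norm (f t * g t) \<le> norm (f t)"
      using g by (intro AE_I2) (simp add: abs_mult mult_left_le)
  qed simp
  have par: "integral\<^sup>L circ (\<lambda>t. ((norm (1 + cos (real k * t) *\<^sub>R c))\<^sup>2 + (norm (sin (real k * t) *\<^sub>R c))\<^sup>2) * N t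
      - 2 * inner (bA \<theta> t) ((qcnj (1 + cos (real k * t) *\<^sub>R c) * (sin (real k * t) *\<^sub>R c) - qcnj (sin (real k * t) *\<^sub>R c) * (1 + cos (real k * t) *\<^sub>R c)) * bB \<theta> t))
      = 1 + (norm c)\<^sup>2" if k: "k > 0" for k c
  proof -
    define p where "p = (\<lambda>n. (if n = 0 then 1 else 0) + (if n = k then c else 0))"
    have pf: "fins p" unfolding p_def fins_def by (intro exI[of _ "Suc k"]) auto
    have ps: "l2sq p = 1 + (norm c)\<^sup>2"
      unfolding l2sq_def using k by (subst suminf_finite[of "{0, k}"]) (auto simp: p_def)
    note cl = l2_conv_fins_left[OF th pf]
    have "1 + (norm c)\<^sup>2 = l2sq (conv p \<theta>)" using iso[OF pf] ps by simp
    also have "\<dots> = integral\<^sup>L circ (\<lambda>t. (norm (bA (conv p \<theta>) t))\<^sup>2 + (norm (bB (conv p \<theta>) t))\<^sup>2)" by (rule stem_parseval(2)[OF cl, symmetric])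
    also have "\<dots> = integral\<^sup>L circ (\<lambda>t. ((norm (1 + cos (real k * t) *\<^sub>R c))\<^sup>2 + (norm (sin (real k * t) *\<^sub>R c))\<^sup>2) * N t
      - 2 * inner (bA \<theta> t) ((qcnj (1 + cos (real k * t) *\<^sub>R c) * (sin (real k * t) *\<^sub>R c) - qcnj (sin (real k * t) *\<^sub>R c) * (1 + cos (real k * t) *\<^sub>R c)) * bB \<theta> t))"
    proof (rule integral_cong_AE)
      show "AE t in circ. (norm (bA (conv p \<theta>) t))\<^sup>2 + (norm (bB (conv p \<theta>) t))\<^sup>2 = ((norm (1 + cos (real k * t) *\<^sub>R c))\<^sup>2 + (norm (sin (real k * t) *\<^sub>R c))\<^sup>2) * N t
      - 2 * inner (bA \<theta> t) ((qcnj (1 + cos (real k * t) *\<^sub>R c) * (sin (real k * t) *\<^sub>R c) - qcnj (sin (real k * t) *\<^sub>R c) * (1 + cos (real k * t) *\<^sub>R c)) * bB \<theta> t)"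
        using boundary_conv[OF fins_l2[OF pf] th cl]
      proof eventually_elim
        case (elim t)
        have b: "bA p t = 1 + cos (real k * t) *\<^sub>R c" "bB p t = sin (real k * t) *\<^sub>R c"
          unfolding p_def by (rule boundary_binomial)+
        show ?case unfolding elim[THEN conjunct1] elim[THEN conjunct2] stem_mult_norm b N_def ..
      qed
      have "continuous_on UNIV qcnj" by (rule linear_continuous_on, rule bounded_linear_intro[where K=1]) (auto simp: quat_eq_iff)
      hence [measurable]: "qcnj \<in> borel_measurable borel" by (rule borel_measurable_continuous_onI)
      show "(\<lambda>t. ((norm (1 + cos (real k * t) *\<^sub>R c))\<^sup>2 + (norm (sin (real k * t) *\<^sub>R c))\<^sup>2) * N t
      - 2 * inner (bA \<theta> t) ((qcnj (1 + cos (real k * t) *\<^sub>R c) * (sin (real k * t) *\<^sub>R c) - qcnj (sin (real k * t) *\<^sub>R c) * (1 + cos (real k * t) *\<^sub>R c)) * bB \<theta> t)) \<in> borel_measurable circ"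
        by measurable
    qed (use bA_bB_measurable[OF cl] in measurable)
    finally show ?thesis by simp
  qed
  have refl: "AE t in circ. N (2*pi - t) = N t \<and> (\<forall>V. X V (2*pi - t) = - X V t)"
    using boundary_reflect[OF th] by eventually_elim (simp add: N_def X_def)
  have sr: "sin (real k * (2*pi - t)) = - sin (real k * t)" "cos (real k * (2*pi - t)) = cos (real k * t)" for k t
  proof -
    have "real k * (2*pi - t) = 2 * real k * pi - real k * t" by (simp add: algebra_simps)
    thus "sin (real k * (2*pi - t)) = - sin (real k * t)" "cos (real k * (2*pi - t)) = cos (real k * t)"
      by (simp_all only: sin_diff cos_diff sin_2npi cos_2npi mult_zero_left mult_1_left diff_0 add_0_right)
  qed
  have odd: "integral\<^sup>L circ f = 0" if [measurable]: "f \<in> borel_measurable borel" and f: "AE t in circ. f (2*pi - t) = - f t" for f :: "real \<Rightarrow> real"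
  proof -
    have "integral\<^sup>L circ f = integral\<^sup>L circ (\<lambda>t. f (2*pi - t))" by (simp add: circ_reflect)
    also have "\<dots> = integral\<^sup>L circ (\<lambda>t. - f t)" using f by (intro integral_cong_AE) auto
    finally show ?thesis by simp
  qed
  have Nz: "AE t in circ. N t - 1 = 0"
  proof (rule fourier_unique)
    have one: "integrable circ (\<lambda>t. 1::real)" by (rule circ_continuous(1)) simp
    show "integrable circ (\<lambda>t. N t - 1)" by (intro Bochner_Integration.integrable_diff Ni one)
    have c1: "integral\<^sup>L circ (\<lambda>t. 1::real) = 1" using measure_circ by simp
    fix k :: nat
    have "integral\<^sup>L circ (\<lambda>t. (N t - 1) * cos (real k * t)) = integral\<^sup>L circ (\<lambda>t. N t * cos (real k * t)) - integral\<^sup>L circ (\<lambda>t. cos (real k * t))"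
      unfolding left_diff_distrib mult_1_left
      by (intro Bochner_Integration.integral_diff trig Ni circ_continuous(1) continuous_intros) auto
    also have "\<dots> = 0"
    proof (cases "k = 0")
      case True thus ?thesis using N1 c1 by simp
    next
      case False
      hence k: "k > 0" by simp
      have "integral\<^sup>L circ (\<lambda>t. 2 * N t + 2 * (N t * cos (real k * t))) = 2"
      proof -
        \<comment> \<open>For c = 1 the commutator term vanishes and the cosine coefficient of N is
          left.\<close>
        have e: "((norm (1 + cos (real k * t) *\<^sub>R (1::quat)))\<^sup>2 + (norm (sin (real k * t) *\<^sub>R (1::quat)))\<^sup>2) * N t
      - 2 * inner (bA \<theta> t) ((qcnj (1 + cos (real k * t) *\<^sub>R 1) * (sin (real k * t) *\<^sub>R 1) - qcnj (sin (real k * t) *\<^sub>R 1) * (1 + cos (real k * t) *\<^sub>R 1)) * bB \<theta> t)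
          = 2 * N t + 2 * (N t * cos (real k * t))" for t
        proof -
          have "qcnj (1 + cos (real k * t) *\<^sub>R 1) * (sin (real k * t) *\<^sub>R 1) - qcnj (sin (real k * t) *\<^sub>R 1) * (1 + cos (real k * t) *\<^sub>R 1) = 0"
            by (simp add: quat_eq_iff)
          moreover have "(norm (1 + cos (real k * t) *\<^sub>R (1::quat)))\<^sup>2 + (norm (sin (real k * t) *\<^sub>R (1::quat)))\<^sup>2 = 2 + 2 * cos (real k * t)"
            unfolding norm_quat_sq using sin_cos_squared_add[of "real k * t"] by (simp add: power2_sum)
          ultimately show ?thesis by (simp add: algebra_simps)
        qed
        show ?thesis using par[OF k, of 1] unfolding e by simp
      qed
      moreover have "integral\<^sup>L circ (\<lambda>t. 2 * N t + 2 * (N t * cos (real k * t))) = 2 * integral\<^sup>L circ N + 2 * integral\<^sup>L circ (\<lambda>t. N t * cos (real k * t))"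
        by (subst Bochner_Integration.integral_add) (auto intro!: Ni trig integrable_mult_right)
      moreover have "integral\<^sup>L circ (\<lambda>t. cos (real k * t)) = 0"
      proof -
        have "((\<lambda>t. cos (real k * t)) has_integral (sin (real k * (2*pi)) / real k - sin (real k * 0) / real k)) {0..2*pi}"
          using k by (intro fundamental_theorem_of_calculus) (auto intro!: derivative_eq_intros simp flip: has_real_derivative_iff_has_vector_derivative)
        moreover have "sin (real k * (2*pi)) = 0" using sin_2npi[of k] by (simp add: mult.commute mult.left_commute)
        ultimately have "integral {0..2*pi} (\<lambda>t. cos (real k * t)) = 0" by (simp add: integral_unique)
        thus ?thesis by (subst circ_continuous(2)) (auto intro!: continuous_intros)
      qed
      ultimately show ?thesis using N1 by simp
    qed
    finally show "integral\<^sup>L circ (\<lambda>t. (N t - 1) * cos (real k * t)) = 0" .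
    show "integral\<^sup>L circ (\<lambda>t. (N t - 1) * sin (real k * t)) = 0"
    proof (rule odd)
      show "AE t in circ. (N (2*pi - t) - 1) * sin (real k * (2*pi - t)) = - ((N t - 1) * sin (real k * t))"
        unfolding sr using refl by eventually_elim simp
    qed simp
  qed simp
  have Xz: "AE t in circ. X V t = 0" if V: "qre V = 0" for V
  proof (rule fourier_unique[OF _ Xi])
    fix k :: nat
    show "integral\<^sup>L circ (\<lambda>t. X V t * cos (real k * t)) = 0"
    proof (rule odd)
      show "AE t in circ. X V (2*pi - t) * cos (real k * (2*pi - t)) = - (X V t * cos (real k * t))"
        unfolding sr using refl by eventually_elim simp
    qed simp
    show "integral\<^sup>L circ (\<lambda>t. X V t * sin (real k * t)) = 0"
    proof (cases "k = 0")
      case False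
      hence k: "k > 0" by simp
      \<comment> \<open>For imaginary c = V the norm factor is constant in t, since 1 and V are
        orthogonal, and the commutator term carries the sine coefficient of X V.\<close>
      have e: "((norm (1 + cos (real k * t) *\<^sub>R V))\<^sup>2 + (norm (sin (real k * t) *\<^sub>R V))\<^sup>2) * N t
      - 2 * inner (bA \<theta> t) ((qcnj (1 + cos (real k * t) *\<^sub>R V) * (sin (real k * t) *\<^sub>R V) - qcnj (sin (real k * t) *\<^sub>R V) * (1 + cos (real k * t) *\<^sub>R V)) * bB \<theta> t)
          = (1 + (norm V)\<^sup>2) * N t - 4 * (X V t * sin (real k * t))" for t
      proof -
        have "qcnj (1 + cos (real k * t) *\<^sub>R V) * (sin (real k * t) *\<^sub>R V) - qcnj (sin (real k * t) *\<^sub>R V) * (1 + cos (real k * t) *\<^sub>R V) = (2 * sin (real k * t)) *\<^sub>R V"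
          using V by (simp add: quat_eq_iff algebra_simps)
        moreover have "(norm (1 + cos (real k * t) *\<^sub>R V))\<^sup>2 + (norm (sin (real k * t) *\<^sub>R V))\<^sup>2 = 1 + (norm V)\<^sup>2 * ((sin (real k * t))\<^sup>2 + (cos (real k * t))\<^sup>2)"
        proof -
          have "(norm (1 + x *\<^sub>R V))\<^sup>2 + (norm (y *\<^sub>R V))\<^sup>2 = 1 + (norm V)\<^sup>2 * (y\<^sup>2 + x\<^sup>2)" for x y
            unfolding norm_quat_sq using V by (simp add: power2_eq_square algebra_simps)
          thus ?thesis .
        qed
        ultimately show ?thesis by (simp add: X_def mult.commute)
      qed
      have "(1 + (norm V)\<^sup>2) * integral\<^sup>L circ N - 4 * integral\<^sup>L circ (\<lambda>t. X V t * sin (real k * t)) = 1 + (norm V)\<^sup>2"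
        using par[OF k, of V] unfolding e
        by (subst (asm) Bochner_Integration.integral_diff) (auto intro!: Ni Xi trig integrable_mult_right)
      thus ?thesis using N1 by simp
    qed simp
  qed simp
  have "AE t in circ. X (Quat 0 1 0 0) t = 0 \<and> X (Quat 0 0 1 0) t = 0 \<and> X (Quat 0 0 0 1) t = 0"
    by (intro AE_conjI Xz) auto
  with Nz show ?thesis
  proof eventually_elim
    case (elim t)
    show ?case
    proof (intro conjI allI impI)
      show "(norm (bA \<theta> t))\<^sup>2 + (norm (bB \<theta> t))\<^sup>2 = 1" using elim by (simp add: N_def)
      fix V assume "qre V = 0"
      from inner_imag[OF this, of "bA \<theta> t" "bB \<theta> t"] show "inner (bA \<theta> t) (V * bB \<theta> t) = 0" using elim unfolding X_def by simp
    qed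
  qed
qed

lemma isometric_same_mod:
  assumes th: "l2 \<theta>" and iso: "\<And>p. fins p \<Longrightarrow> l2sq (conv p \<theta>) = l2sq p" and h: "l2 h" and c: "l2 (conv h \<theta>)"
  shows "AE t in circ. same_mod (bA (conv h \<theta>) t) (bB (conv h \<theta>) t) (bA h t) (bB h t)"
proof -
  have "AE t in circ. (norm (bA \<theta> t))\<^sup>2 + (norm (bB \<theta> t))\<^sup>2 = 1 \<and> (\<forall>V. qre V = 0 \<longrightarrow> inner (bA \<theta> t) (V * bB \<theta> t) = 0)"
    by (rule isometric_imp_unimodular[OF th]) (rule iso)
  thus ?thesis using boundary_conv[OF h th c]
  proof eventually_elim
    case (elim t)
    show ?case
    proof (rule same_modI)
      fix I assume "I \<in> {Quat 0 (-1) 0 0, Quat 0 0 1 0, Quat 0 0 (-1) 0, Quat 0 0 (sqrt (1/2)) (sqrt (1/2))}"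
      hence I: "I \<in> \<S>" by (auto simp: imag_units_iff)
      show "norm (bA (conv h \<theta>) t + I * bB (conv h \<theta>) t) = norm (bA h t + I * bB h t)"
        unfolding elim(2)[THEN conjunct1] elim(2)[THEN conjunct2]
        by (rule inner_stem_mult[OF I]) (use elim(1) in auto)
    qed
  qed
qed

theorem out_imp_left_cyc:
  assumes al: "l2 a" and nz: "a \<noteq> (\<lambda>_. 0)" and o: "out a"
  shows "cyc (cnjs a)"
proof -
  \<comment> \<open>Any factorization of a as h * \<theta> with isometric \<theta> gives a
    competitor h with the boundary modulus of a; outerness is then evaluated at 0.\<close>
  have o0: "norm (h 0) \<le> norm (a 0)" if "l2 \<theta>" "\<And>p. fins p \<Longrightarrow> l2sq (conv p \<theta>) = l2sq p" "l2 h" "conv h \<theta> = a" for h \<theta>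
  proof -
    have q0: "qeval x 0 = x 0" for x unfolding qeval_def by (subst suminf_finite[of "{0}"]) (auto simp: power_0_left)
    have "norm (qeval h 0) \<le> norm (qeval a 0)"
      using o isometric_same_mod[OF that(1-3)] that(3) al unfolding out_def that(4) by (simp add: mem_ball)
    thus ?thesis by (simp add: q0)
  qed
  have a0: "a 0 \<noteq> 0"
  proof
    assume z: "a 0 = 0"
    \<comment> \<open>If a vanished at 0 to order k, dividing by the k-th power of the variable
      would give a competitor that does not vanish at 0.\<close>
    define k where "k = (LEAST k. a k \<noteq> 0)"
    obtain n where "a n \<noteq> 0" using nz by auto
    hence k: "a k \<noteq> 0" unfolding k_def by (rule LeastI)
    have lt: "a n = 0" if "n < k" for n using not_less_Least[of n "\<lambda>k. a k \<noteq> 0"] that unfolding k_def by blast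
    define h where "h n = a (n + k)" for n
    have h: "l2 h" using al unfolding l2_def h_def by (rule summable_ignore_initial_segment)
    have ks: "conv p (shiftr k delta0) = shiftr k p" for p :: "nat \<Rightarrow> quat"
    proof
      fix n
      have "conv p (shiftr k delta0) n = (\<Sum>i\<le>n. if i = n - k \<and> k \<le> n then p i else 0)"
        unfolding conv_def by (intro sum.cong) (auto simp: shiftr_def delta0_def)
      also have "\<dots> = shiftr k p n" by (auto simp: shiftr_def)
      finally show "conv p (shiftr k delta0) n = shiftr k p n" .
    qed
    have "norm (h 0) \<le> norm (a 0)"
    proof (rule o0)
      show "l2 (shiftr k (delta0 :: nat \<Rightarrow> quat))" by (intro l2_shiftr(1) fins_l2 fins_delta0)
      show "l2sq (conv p (shiftr k delta0)) = l2sq p" if "fins p" for p :: "nat \<Rightarrow> quat"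
        unfolding ks by (rule l2sq_shiftr[OF fins_l2[OF that]])
      show "conv h (shiftr k delta0) = a" unfolding ks by (auto simp: shiftr_def h_def lt)
    qed (rule h)
    thus False using k z by (simp add: h_def)
  qed
  interpret left_span a by unfold_locales (use al a0 in auto)
  define s where "s = sqrt minsq"
  have s: "s > 0" "s\<^sup>2 = minsq" using minsq_pos by (auto simp: s_def)
  obtain c where c: "l2 c" "c 0 = 1" "conv c w = a" using factorization by blast
  \<comment> \<open>w / s acts isometrically by \<open>w_iso\<close>, and a is the product of s c
    and w / s. The resulting bound s <= |a 0| = |w 0| for the norm s of w leaves nothing for the
    other coefficients, so w is the constant a 0.\<close>
  have "norm (s *\<^sub>R c 0) \<le> norm (a 0)"
  proof (rule o0[where \<theta> = "\<lambda>n. (1 / s) *\<^sub>R w n"])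
    have cs: "conv p (\<lambda>n. (1 / s) *\<^sub>R w n) = (\<lambda>n. of_real (1 / s) * conv p w n)" for p
      unfolding scaleR_conv_of_real[symmetric] conv_def by (simp add: scaleR_right.sum)
    have ns: "norm (of_real (1 / s) :: quat) = 1 / s" unfolding norm_of_real using s by simp
    show "l2sq (conv p (\<lambda>n. (1 / s) *\<^sub>R w n)) = l2sq p" if "fins p" for p
      unfolding cs l2sq_mult[OF l2_conv_fins_left[OF wl that]] w_iso[OF that] ns s(2)[symmetric] using s(1)
      by (simp add: power_divide)
    have "conv (\<lambda>n. s *\<^sub>R c n) (\<lambda>n. (1 / s) *\<^sub>R w n) = conv c w"
      unfolding conv_def using s by simp
    thus "conv (\<lambda>n. s *\<^sub>R c n) (\<lambda>n. (1 / s) *\<^sub>R w n) = a" using c(3) by simp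
  qed (use l2_scaleR(1)[OF wl] l2_scaleR(1)[OF c(1)] in auto)
  hence "s \<le> norm (a 0)" using s c(2) by simp
  hence "minsq \<le> (norm (w 0))\<^sup>2" unfolding s(2)[symmetric] w_0 using s by (intro power_mono) auto
  hence "l2sq (\<lambda>n. w n - w 0 * delta0 n) \<le> 0" using l2sq_remove_0(2)[OF wl] w(2) by simp
  hence d0: "l2n (\<lambda>n. w n - a 0 * delta0 n) = 0" using l2sq_nonneg[OF l2sq_remove_0(1)[OF wl]] by (simp add: l2n_def w_0)
  show ?thesis unfolding cyc_cnjs_iff
  proof (intro allI impI)
    fix e :: real assume e: "e > 0"
    hence "e * norm (a 0) > 0" using a0 by simp
    then obtain p where p: "fins p" "l2n (\<lambda>n. conv p a n - w n) < e * norm (a 0)" using w(1) unfolding Cl1_def by blast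
    note l1 = l2_diff(1)[OF pl[OF p(1)] wl] and l2' = l2sq_remove_0(1)[OF wl, unfolded w_0]
    have "(\<lambda>n. conv (\<lambda>n. inverse (a 0) * p n) a n - delta0 n) = (\<lambda>n. inverse (a 0) * ((conv p a n - w n) + (w n - a 0 * delta0 n)))"
      unfolding conv_scale_left using a0 by (auto simp: right_diff_distrib mult.assoc[symmetric])
    moreover have "l2n (\<lambda>n. inverse (a 0) * ((conv p a n - w n) + (w n - a 0 * delta0 n))) < e"
    proof -
      have "l2n (\<lambda>n. inverse (a 0) * ((conv p a n - w n) + (w n - a 0 * delta0 n))) = inverse (norm (a 0)) * l2n (\<lambda>n. (conv p a n - w n) + (w n - a 0 * delta0 n))"
        unfolding l2_mult(2)[OF l2_add(1)[OF l1 l2']] by (simp add: norm_inverse)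
      also have "\<dots> \<le> inverse (norm (a 0)) * l2n (\<lambda>n. conv p a n - w n)"
        using l2_add(2)[OF l1 l2'] d0 by (intro mult_left_mono) auto
      also have "\<dots> < e" using p(2) a0 by (simp add: field_simps)
      finally show ?thesis .
    qed
    ultimately show "\<exists>p. fins p \<and> l2 (\<lambda>n. conv p a n - delta0 n) \<and> l2n (\<lambda>n. conv p a n - delta0 n) < e"
      using fins_scale[OF p(1), of "inverse (a 0)"] l2_mult(1)[OF l2_add(1)[OF l1 l2'], of "inverse (a 0)"]
      by (intro exI[of _ "\<lambda>n. inverse (a 0) * p n"]) simp
  qed
qed

section \<open>Outer functions on a slice\<close>

text \<open>At z = 0 the modulus of the defining formula is equality in Jensen's inequality;
  conversely \<open>outer_formula\<close> recovers the whole formula from that equality.\<close>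

theorem outer_H2_slice_iff:
  assumes I: "I \<in> \<S>" and h: "has_expansion_on h (\<lambda>n. of_real (s n)) (slice_ball I)"
    and b: "bser (\<lambda>n. complex_of_real (s n)) M"
  shows "outer_H2_slice I h \<longleftrightarrow> cyc s"
proof -
  define \<phi> where "\<phi> n = complex_of_real (s n)" for n
  define u where "u t = ln (cmod (bd \<phi> t))" for t
  have b: "bser \<phi> M" using b by (simp add: \<phi>_def[abs_def])
  have l: "l2 \<phi>" by (rule bser_l2[OF b])
  have sl: "l2 s" using l by (subst l2_norm_cong(1)[of s \<phi>]) (auto simp: \<phi>_def)
  note [measurable] = bd_measurable[OF l]
  have um [measurable]: "u \<in> borel_measurable borel" unfolding u_def[abs_def] by measurable
  have hv: "h (emb I z) = emb I (pser \<phi> z)" if z: "cmod z < 1" for z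
  proof -
    have "(\<lambda>n. emb I (\<phi> n * z ^ n)) sums emb I (pser \<phi> z)"
      by (rule bounded_linear.sums[OF bounded_linear_emb[OF I] pser_sums[OF l z]])
    moreover have "emb I (\<phi> n * z ^ n) = emb I z ^ n * of_real (s n)" for n
      by (simp add: \<phi>_def mult.commute[of "complex_of_real _"] emb_mult[OF I] emb_power[OF I])
    moreover have "emb I z \<in> slice_ball I" using z by (simp add: slice_ball_emb[OF I])
    ultimately show ?thesis using h unfolding has_expansion_on_def by (metis (no_types, lifting) sums_cong sums_unique2)
  qed
  have rl: "AE t in circ. radial_limit h (qcis I t) = emb I (bd \<phi> t)"
    using bd_AE[OF l]
  proof eventually_elim
    case (elim t)
    have "((\<lambda>r. emb I (pser \<phi> (of_real r * cis t))) \<longlongrightarrow> emb I (bd \<phi> t)) (at_left 1)"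
      by (rule bounded_linear.tendsto[OF bounded_linear_emb[OF I] elim])
    moreover have "\<forall>\<^sub>F r in at_left 1. emb I (pser \<phi> (of_real r * cis t)) = h (r *\<^sub>R qcis I t)"
      using at_left_1_ge by eventually_elim (simp add: hv[symmetric] norm_mult scaleR_emb flip: emb_cis)
    ultimately have "((\<lambda>r. h (r *\<^sub>R qcis I t)) \<longlongrightarrow> emb I (bd \<phi> t)) (at_left 1)"
      by (rule Lim_transform_eventually)
    thus ?case unfolding radial_limit_def by (intro tendsto_Lim) auto
  qed
  define E where "E z = (1 / (2 * pi)) *\<^sub>R (LINT \<theta>:{0..2*pi}|lebesgue. ln (norm (radial_limit h (qcis I \<theta>))) *\<^sub>R
      ((qcis I \<theta> + z) / (qcis I \<theta> - z)))" for z
  have Ev: "E (emb I z) = emb I (herglotz u z)" if ui: "integrable circ u" and z: "cmod z < 1" for z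
  proof -
    have "continuous_on UNIV (emb I)" by (rule linear_continuous_on[OF bounded_linear_emb[OF I]])
    hence [measurable]: "emb I \<in> borel_measurable borel" by (rule borel_measurable_continuous_onI)
    have [measurable]: "(\<lambda>t. (cis t + z) / (cis t - z)) \<in> borel_measurable borel"
      by (rule borel_measurable_continuous_onI[OF herglotz_kernel_cont[OF z]])
    have "E (emb I z) = integral\<^sup>L circ (\<lambda>t. emb I (u t *\<^sub>R ((cis t + z) / (cis t - z))))"
      unfolding E_def
    proof (rule lebesgue_integral_circ)
      show "AE t in circ. ln (norm (radial_limit h (qcis I t))) *\<^sub>R ((qcis I t + emb I z) / (qcis I t - emb I z)) = emb I (u t *\<^sub>R ((cis t + z) / (cis t - z)))"
        using rl by eventually_elim (simp add: norm_emb[OF I] u_def emb_scaleR emb_divide[OF I] emb_add emb_diff emb_cis)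
    qed measurable
    also have "\<dots> = emb I (herglotz u z)" unfolding herglotz_def
      by (rule integral_bounded_linear[OF bounded_linear_emb[OF I] herglotz_integrable[OF ui z]])
    finally show ?thesis .
  qed
  have H: "h \<in> H2_slice I" unfolding H2_slice_def
  proof (intro CollectI exI conjI allI)
    show "of_real (s n) \<in> slice_plane I" for n by (rule slice_plane_closed(2)[OF I])
  qed (use h sl in \<open>auto simp: l2_def\<close>)
  have "outer_H2_slice I h \<longleftrightarrow> \<phi> 0 \<noteq> 0 \<and> integral\<^sup>L circ u = ln (cmod (\<phi> 0))"
  proof
    assume "outer_H2_slice I h"
    then obtain \<alpha> where \<alpha>: "norm \<alpha> = 1" "\<And>z. z \<in> slice_ball I \<Longrightarrow> h z = \<alpha> * exp (E z)"
      unfolding outer_H2_slice_def E_def by blast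
    have eq: "emb I (\<phi> 0) = \<alpha> * exp (E (emb I 0))"
      using \<alpha>(2)[of "emb I 0"] hv[of 0] real_in_slice_ball[of 0 I] by simp
    \<comment> \<open>Whatever value the integral has, an exponential does not vanish. Only after
      this is the logarithm known to be integrable, so that the integral is more than a default
      value.\<close>
    have nz: "\<phi> 0 \<noteq> 0"
    proof
      assume "\<phi> 0 = 0"
      hence "\<alpha> * exp (E (emb I 0)) = 0" using eq by simp
      thus False using \<alpha>(1) by auto
    qed
    have ui: "integrable circ u" unfolding u_def using poisson_log_jensen(2)[OF b, of 0] nz by simp
    have "emb I (\<phi> 0) = \<alpha> * emb I (exp (herglotz u 0))" using eq Ev[OF ui, of 0] by (simp add: emb_exp[OF I])
    hence "cmod (\<phi> 0) = exp (Re (herglotz u 0))" using \<alpha>(1) by (metis norm_mult norm_emb[OF I] mult_1 norm_exp_eq_Re)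
    thus "\<phi> 0 \<noteq> 0 \<and> integral\<^sup>L circ u = ln (cmod (\<phi> 0))" using nz herglotz_Re[OF ui, of 0] by simp
  next
    assume a: "\<phi> 0 \<noteq> 0 \<and> integral\<^sup>L circ u = ln (cmod (\<phi> 0))"
    then obtain \<alpha> where \<alpha>: "cmod \<alpha> = 1" "\<And>z. cmod z < 1 \<Longrightarrow> pser \<phi> z = \<alpha> * exp (herglotz u z)"
      using outer_formula[OF b] unfolding u_def[abs_def] by blast
    have ui: "integrable circ u" unfolding u_def using poisson_log_jensen(2)[OF b, of 0] a by simp
    have "emb I (\<phi> 0) \<noteq> 0" using a norm_emb[OF I, of "\<phi> 0"] by auto
    hence "h 0 \<noteq> 0" using hv[of 0] by simp
    hence "\<exists>z\<in>slice_ball I. h z \<noteq> 0" using real_in_slice_ball[of 0 I] by auto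
    moreover have "\<forall>z\<in>slice_ball I. h z = emb I \<alpha> * exp (E z)"
      by (auto simp: slice_ball_emb[OF I] hv Ev[OF ui] \<alpha>(2) emb_mult[OF I] emb_exp[OF I])
    moreover have "emb I \<alpha> \<in> slice_plane I" "norm (emb I \<alpha>) = 1" by (auto simp: slice_plane_emb norm_emb[OF I] \<alpha>(1))
    ultimately show "outer_H2_slice I h" unfolding outer_H2_slice_def E_def[symmetric] using H by blast
  qed
  also have "\<dots> \<longleftrightarrow> cyc \<phi>" unfolding u_def by (rule cyc_iff_log_mean[OF b, symmetric])
  also have "\<dots> \<longleftrightarrow> cyc s" unfolding \<phi>_def by (rule cyc_of_real_complex)
  finally show ?thesis .
qed

text \<open>All eight properties reduce to \<open>cyc (symc a)\<close>. Outerness of f gets there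
  through \<open>cnjs a\<close>, whose real sequence \<open>symc (cnjs a)\<close> is that of
  a.\<close>

theorem theorem4p6:
  fixes f :: "quat \<Rightarrow> quat"
  assumes "f \<in> Hinf"
    and "\<exists>q\<in>\<B>. f q \<noteq> 0"
  shows "(cyclic_H2 f \<longleftrightarrow> outer_H2 f) \<and>
    (outer_H2 f \<longleftrightarrow> cyclic_H2 (symmetrization f)) \<and>
    (cyclic_H2 (symmetrization f) \<longleftrightarrow> outer_H2 (symmetrization f)) \<and>
    (outer_H2 (symmetrization f) \<longleftrightarrow>
      (\<forall>I\<in>\<S>. cyclic_H2_slice I (slice_restrict (symmetrization f) I))) \<and>
    ((\<forall>I\<in>\<S>. cyclic_H2_slice I (slice_restrict (symmetrization f) I)) \<longleftrightarrow>
      (\<exists>I\<in>\<S>. cyclic_H2_slice I (slice_restrict (symmetrization f) I))) \<and>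
    ((\<exists>I\<in>\<S>. cyclic_H2_slice I (slice_restrict (symmetrization f) I)) \<longleftrightarrow>
      (\<forall>I\<in>\<S>. outer_H2_slice I (slice_restrict (symmetrization f) I))) \<and>
    ((\<forall>I\<in>\<S>. outer_H2_slice I (slice_restrict (symmetrization f) I)) \<longleftrightarrow>
      (\<exists>I\<in>\<S>. outer_H2_slice I (slice_restrict (symmetrization f) I)))"
proof -
  obtain a M where f: "has_expansion_on f a \<B>" and qb: "qbser a M" using Hinf_expansion[OF assms(1)] by blast
  have al: "l2 a" by (rule qbser_l2[OF qb])
  obtain M' where M': "bser (\<lambda>n. complex_of_real (symc a n)) M'" using sym_bser[OF qb] by blast
  have "(l2 (symc a)) = l2 (\<lambda>n. complex_of_real (symc a n))" by (rule l2_norm_cong(1)) simp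
  hence sl: "l2 (symc a)" using bser_l2[OF M'] by simp
  define S where "S = conv a (cnjs a)"
  have S: "S = (\<lambda>n. of_real (symc a n))" unfolding S_def by (rule sym_of_real)
  have F: "has_expansion_on (symmetrization f) S \<B>" unfolding S_def by (rule symmetrization_expansion[OF f])
  have "l2 S = l2 (symc a)" unfolding S by (rule l2_norm_cong(1)) simp
  hence Sl: "l2 S" using sl by simp
  have nz: "a \<noteq> (\<lambda>_. 0)"
  proof
    assume "a = (\<lambda>_. 0)"
    hence "f q = 0" if "q \<in> \<B>" for q using has_expansion_eq[OF f that] by (simp add: qeval_def)
    thus False using assms(2) by blast
  qed
  \<comment> \<open>Formal power series over a division ring have no zero divisors.\<close>
  have Snz: "S \<noteq> (\<lambda>_. 0)"
  proof
    assume "S = (\<lambda>_. 0)"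
    hence "Abs_fps a * Abs_fps (cnjs a) = 0" unfolding S_def conv_fps by (simp add: fps_eq_iff fun_eq_iff)
    hence "Abs_fps a = 0 \<or> Abs_fps (cnjs a) = 0" by simp
    hence "a n = 0" for n by (auto simp: fps_eq_iff cnjs_def quat_eq_iff)
    thus False using nz by blast
  qed
  \<comment> \<open>Real coefficients are self-conjugate, so for f^s the passage to the conjugate
    disappears and outerness is cyclicity of \<open>S\<close> itself.\<close>
  have cS: "cnjs S = S" unfolding S by (auto simp: cnjs_def quat_eq_iff)
  have "symc (cnjs a) = symc a"
    using sym_cnjs[OF l2_qds[OF al]] by (simp add: symc_def[abs_def])
  hence "cyc (cnjs a) \<longleftrightarrow> cyc (symc a)"
    using cyc_imp_cyc_sym[OF qbser_cnjs[OF qb]] cyc_sym_imp(2)[OF qb] by auto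
  hence 2: "outer_H2 f \<longleftrightarrow> cyc (symc a)"
    using outer_H2_iff[OF f al] left_cyc_imp_out[OF al] out_imp_left_cyc[OF al nz] by blast
  have 1: "cyclic_H2 f \<longleftrightarrow> cyc (symc a)"
    using cyclic_H2_iff[OF f al] cyc_imp_cyc_sym[OF qb] cyc_sym_imp(1)[OF qb] by blast
  have cy: "cyc S \<longleftrightarrow> cyc (symc a)" unfolding S by (rule cyc_of_real_quat)
  have 3: "cyclic_H2 (symmetrization f) \<longleftrightarrow> cyc (symc a)" using cyclic_H2_iff[OF F Sl] cy by simp
  have 4: "outer_H2 (symmetrization f) \<longleftrightarrow> cyc (symc a)"
    using outer_H2_iff[OF F Sl] left_cyc_imp_out[OF Sl] out_imp_left_cyc[OF Sl Snz] cy unfolding cS by blast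
  have h: "has_expansion_on (slice_restrict (symmetrization f) I) (\<lambda>n. of_real (symc a n)) (slice_ball I)" for I
    using F unfolding S has_expansion_on_def slice_restrict_def slice_ball_def by auto
  have 5: "cyclic_H2_slice I (slice_restrict (symmetrization f) I) \<longleftrightarrow> cyc (symc a)" if "I \<in> \<S>" for I
    by (rule cyclic_H2_slice_iff[OF that h sl])
  have 6: "outer_H2_slice I (slice_restrict (symmetrization f) I) \<longleftrightarrow> cyc (symc a)" if "I \<in> \<S>" for I
    by (rule outer_H2_slice_iff[OF that h M'])
  have "\<exists>I. I \<in> \<S>" using qim_unit_imag by blast
  thus ?thesis unfolding 1 2 3 4 using 5 6 by blast
qed

end
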